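(* Let $(\Omega,\mathcal F,\mathbb P)$ be a probability space and let $$a:\Omega\to\mathcal S^d_{\varrho,\delta}(X,Y,\Xi),\quad \omega\mapsto\big((x,y,\xi)\mapsto a(x,y,\xi,\omega)\big),\qquad \Phi:\Omega\to\mathcal M_\alpha(X,Y,\Xi),\quad \omega\mapsto\big((x,y,\xi)\mapsto\Phi(x,y,\xi,\omega)\big)$$ be measurable mappings, where the target spaces are equipped with their Borel $\sigma$-algebras. Then for fixed $\psi\in\mathcal D(Y)$, respectively fixed $u\in\mathcal E'(Y)$, the mappings $$\Omega\to\mathcal C^\infty(X),\ \ \omega\mapsto A_{\Phi(\omega),a(\omega)}[\psi],\qquad\text{respectively}\qquad \Omega\to\mathcal D'(X),\ \ \omega\mapsto A_{\Phi(\omega),a(\omega)}[u],$$ are measurable with respect to the Borel $\sigma$-algebra induced by the corresponding topology: the topology of the seminorms $(\pi_{X,m})_m$ on $\mathcal C^\infty(X)$, respectively the weak-$*$ topology on $\mathcal D'(X)$.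
   Context: Let $n_X,n_Y,n_\Xi\ge 1$ be integers, $X\subset\mathbb R^{n_X}$ and $Y\subset\mathbb R^{n_Y}$ open, $\Xi=\mathbb R^{n_\Xi}\setminus\{0\}$, $\alpha>0$, $d\in\mathbb R$, $0\le\delta<1$, $0<\varrho\le 1$. Write $\langle\xi\rangle=(1+\|\xi\|^2)^{1/2}$. $\mathcal D$ denotes smooth compactly supported functions, $\mathcal D'$ distributions, $\mathcal E'$ compactly supported distributions. For $Z\subset\mathbb R^{k}$ open and $m\in\{1,2,\dots\}$ put $K_{Z,m}=\{x\in Z:\|x\|\le m,\ \mathrm{dist}(x,\mathbb R^{k}\setminus Z)\ge 1/m\}$. Phase functions. $\mathcal M_{hg}(X,Y,\Xi)$ is the space of smooth functions $\Phi:X\times Y\times\Xi\to\mathbb R$ that are positively homogeneous of degree $1$ in $\xi$, with the topology given by the seminorms $$p_m(\Phi)=\sup\{\|\xi\|^{|l|-1}|\partial_x^j\partial_y^k\partial_\xi^l\Phi(x,y,\xi)|: x\in K_{X,m},\,y\in K_{Y,m},\,\xi\in\Xi,\ |j|+|k|+|l|\le m\}$$ ($j,k,l$ multi-indices). $\mathcal M_\alpha(X,Y,\Xi)$ is the subset (with subspace topology) of those $\Phi\in\mathcal M_{hg}(X,Y,\Xi)$ such that for all $(x,y,\xi)\in X\times Y\times\Xi$ $$\|\xi\|^{-2}\|\nabla_x\Phi\|^2+\|\nabla_\xi\Phi\|^2\ge\alpha\quad\text{and}\quad \|\xi\|^{-2}\|\nabla_y\Phi\|^2+\|\nabla_\xi\Phi\|^2\ge\alpha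 .$$ Amplitudes. $S^d_{\varrho,\delta}(X\times Y\times\mathbb R^{n_\Xi})$ is the Hörmander class of smooth functions $a$ such that for all multi-indices $j,k,l$ and all compact $K\subset X\times Y$ there is $C$ with $|\partial_x^j\partial_y^k\partial_\xi^l a(x,y,\xi)|\le C\langle\xi\rangle^{d-\varrho|l|+\delta(|j|+|k|)}$ for $(x,y)\in K$, $\xi\in\mathbb R^{n_\Xi}$. $\mathcal S^d_{\varrho,\delta}(X,Y,\Xi)$ is the space of restrictions to $X\times Y\times\Xi$ of elements of $S^d_{\varrho,\delta}(X\times Y\times\mathbb R^{n_\Xi})$, topologized by the seminorms $$q_m(a)=\sup\{\langle\xi\rangle^{-d+\varrho|l|-\delta(|j|+|k|)}|\partial_x^j\partial_y^k\partial_\xi^l a(x,y,\xi)|: x\in K_{X,m},\,y\in K_{Y,m},\,\xi\in\Xi,\ |j|+|k|+|l|\le m\}.$$ $\mathcal C^\infty(X)$ carries the seminorms $\pi_{X,m}(v)=\sup\{|\partial_x^jv(x)|:x\in K_{X,m},|j|\le m\}$. Fourier integral operators. Fix $\chi\in\mathcal D(\mathbb R^{n_\Xi})$ with $\chi=1$ for $\|\xi\|<1$ and $\chi=0$ for $\|\xi\|>2$. For $\Phi\in\mathcal M_\alpha(X,Y,\Xi)$ let $r=\|\xi\|^2\|\nabla_\xi\Phi\|^2+\|\nabla_y\Phi\|^2$, $\underline\alpha_l=\frac{-i}{r}(1-\chi)\|\xi\|^2\partial_{\xi_l}\Phi$, $\underline\beta_k=\frac{-i}{r}(1-\chi)\partial_{y_k}\Phi$,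 $\underline\gamma=\chi$, and $Lf=-\sum_{l=1}^{n_\Xi}\partial_{\xi_l}(\underline\alpha_lf)-\sum_{k=1}^{n_Y}\partial_{y_k}(\underline\beta_kf)+\underline\gamma f$ (its formal transpose fixes $e^{i\Phi}$). For $\psi\in\mathcal D(Y)$, the oscillatory integral $A_{\Phi,a}[\psi](x)=(2\pi)^{-n_\Xi}\int_\Xi\int_Y e^{i\Phi(x,y,\xi)}a(x,y,\xi)\psi(y)\,dy\,d\xi$ is defined as $$A_{\Phi,a}[\psi](x)=\frac1{(2\pi)^{n_\Xi}}\int_\Xi\int_Y e^{i\Phi(x,y,\xi)}L^\kappa\big(a(x,y,\xi)\psi(y)\big)\,dy\,d\xi$$ for $\kappa\in\mathbb N$ large enough that the integral converges absolutely (e.g. $d-\kappa\min(\varrho,1-\delta)<-n_\Xi$); $A_{\Phi,a}[\psi]\in\mathcal C^\infty(X)$. For $u\in\mathcal E'(Y)$, $A_{\Phi,a}[u]\in\mathcal D'(X)$ is defined by $\langle A_{\Phi,a}[u],\phi\rangle=\langle u,{}^{\mathsf t}\!A_{\Phi,a}[\phi]\rangle$ for $\phi\in\mathcal D(X)$, where ${}^{\mathsf t}\!A_{\Phi,a}[\phi](y)=(2\pi)^{-n_\Xi}\int_\Xi\int_X e^{i\Phi(x,y,\xi)}a(x,y,\xi)\phi(x)\,dx\,d\xi\in\mathcal C^\infty(Y)$ is the oscillatory integral defined in the same way with the roles of $x$ and $y$ (and $X$ and $Y$) interchanged. *)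

theory Defs
  imports "HOL-Probability.Probability"
begin

text \<open>
  Spaces of functions on a set are carriers of total functions that are \<^const>\<open>undefined\<close> outside that
  set (\<^const>\<open>extensional\<close>), so that equality in the carrier is equality on the set. All derivatives
  are evaluated at points of open sets only, hence never see the values outside. Test functions are
  the exception: they are extended by zero to the whole space.
\<close>

section \<open>Partial derivatives and smoothness\<close>

definition ddir :: "'v::real_normed_vector \<Rightarrow> ('v \<Rightarrow> 'b::real_normed_vector) \<Rightarrow> 'v \<Rightarrow> 'b" where
  "ddir v f p = vector_derivative (\<lambda>t::real. f (p + t *\<^sub>R v)) (at 0)"

definition smooth_on :: "'v::euclidean_space set \<Rightarrow> ('v \<Rightarrow> 'b::real_normed_vector) \<Rightarrow> bool" where
  "smooth_on S f \<longleftrightarrow> (\<forall>vs. set vs \<subseteq> Basis \<longrightarrow> foldr ddir vs f differentiable_on S)"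

type_synonym 'n multi_index = "'n \<Rightarrow> nat"

definition order_of :: "'n::finite multi_index \<Rightarrow> nat" where
  "order_of j = (\<Sum>i\<in>UNIV. j i)"

text \<open>
  Some enumeration of the coordinates, fixing the order of differentiation in \<open>mderiv\<close>.
  The order is immaterial for smooth functions.
\<close>

definition coords :: "'n::finite list" where
  "coords = (SOME is. distinct is \<and> set is = UNIV)"

definition mderiv :: "('n::finite \<Rightarrow> 'v::real_normed_vector) \<Rightarrow> 'n multi_index
    \<Rightarrow> ('v \<Rightarrow> 'b::real_normed_vector) \<Rightarrow> 'v \<Rightarrow> 'b" where
  "mderiv e j f = foldr (\<lambda>i. ddir (e i) ^^ j i) coords f"

definition unit_vec :: "'n::finite \<Rightarrow> real ^ 'n" where
  "unit_vec i = axis i 1"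

definition unit_x :: "'x::finite \<Rightarrow> (real ^ 'x) \<times> (real ^ 'y) \<times> (real ^ 'z)" where
  "unit_x i = (axis i 1, 0, 0)"

definition unit_y :: "'y::finite \<Rightarrow> (real ^ 'x) \<times> (real ^ 'y) \<times> (real ^ 'z)" where
  "unit_y i = (0, axis i 1, 0)"

definition unit_xi :: "'z::finite \<Rightarrow> (real ^ 'x) \<times> (real ^ 'y) \<times> (real ^ 'z)" where
  "unit_xi i = (0, 0, axis i 1)"

definition mderiv3 :: "'x::finite multi_index \<Rightarrow> 'y::finite multi_index \<Rightarrow> 'z::finite multi_index
    \<Rightarrow> ((real ^ 'x) \<times> (real ^ 'y) \<times> (real ^ 'z) \<Rightarrow> 'b::real_normed_vector)
    \<Rightarrow> (real ^ 'x) \<times> (real ^ 'y) \<times> (real ^ 'z) \<Rightarrow> 'b" where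
  "mderiv3 j k l f = mderiv unit_x j (mderiv unit_y k (mderiv unit_xi l f))"

definition grad :: "('n::finite \<Rightarrow> 'v::real_normed_vector) \<Rightarrow> ('v \<Rightarrow> real) \<Rightarrow> 'v \<Rightarrow> real ^ 'n" where
  "grad e f p = (\<chi> i. ddir (e i) f p)"


section \<open>Topologies and their Borel sets\<close>

definition borel_of :: "'a topology \<Rightarrow> 'a measure" where
  "borel_of T = sigma (topspace T) {U. openin T U}"

definition seminorm_topology :: "('a \<Rightarrow> 'b::real_vector) set \<Rightarrow> (nat \<Rightarrow> ('a \<Rightarrow> 'b) \<Rightarrow> ennreal)
    \<Rightarrow> ('a \<Rightarrow> 'b) topology" where
  "seminorm_topology V p = topology_generated_by
     {{g \<in> V. p m (\<lambda>z. g z - f z) < ennreal \<epsilon>} | f m \<epsilon>. f \<in> V \<and> 1 \<le> m \<and> 0 < \<epsilon>}"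

text \<open>
  The distance to the complement is spelled out because \<^const>\<open>infdist\<close> to the empty set is \<open>0\<close>,
  whereas the condition has to be void for \<open>Z = UNIV\<close>.
\<close>

definition exhaust :: "(real ^ 'n::finite) set \<Rightarrow> nat \<Rightarrow> (real ^ 'n) set" where
  "exhaust Z m = {x \<in> Z. norm x \<le> real m \<and> (\<forall>y. y \<notin> Z \<longrightarrow> 1 / real m \<le> dist x y)}"


section \<open>Phase functions\<close>

definition \<Xi> :: "(real ^ 'z::finite) set" where
  "\<Xi> = - {0}"

definition phases :: "(real ^ 'x::finite) set \<Rightarrow> (real ^ 'y::finite) set
    \<Rightarrow> ((real ^ 'x) \<times> (real ^ 'y) \<times> (real ^ 'z::finite) \<Rightarrow> real) set" where
  "phases X Y = {\<Phi> \<in> extensional (X \<times> Y \<times> \<Xi>). smooth_on (X \<times> Y \<times> \<Xi>) \<Phi> \<and>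
     (\<forall>x\<in>X. \<forall>y\<in>Y. \<forall>\<xi>\<in>\<Xi>. \<forall>t>0. \<Phi> (x, y, t *\<^sub>R \<xi>) = t * \<Phi> (x, y, \<xi>))}"

definition phase_seminorm :: "(real ^ 'x::finite) set \<Rightarrow> (real ^ 'y::finite) set \<Rightarrow> nat
    \<Rightarrow> ((real ^ 'x) \<times> (real ^ 'y) \<times> (real ^ 'z::finite) \<Rightarrow> real) \<Rightarrow> ennreal" where
  "phase_seminorm X Y m \<Phi> = Sup
     {ennreal (norm \<xi> powi (int (order_of l) - 1) * \<bar>mderiv3 j k l \<Phi> (x, y, \<xi>)\<bar>) | x y \<xi> j k l.
        x \<in> exhaust X m \<and> y \<in> exhaust Y m \<and> \<xi> \<in> \<Xi> \<and> order_of j + order_of k + order_of l \<le> m}"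

definition nondeg_phases :: "real \<Rightarrow> (real ^ 'x::finite) set \<Rightarrow> (real ^ 'y::finite) set
    \<Rightarrow> ((real ^ 'x) \<times> (real ^ 'y) \<times> (real ^ 'z::finite) \<Rightarrow> real) set" where
  "nondeg_phases \<alpha> X Y = {\<Phi> \<in> phases X Y. \<forall>x\<in>X. \<forall>y\<in>Y. \<forall>\<xi>\<in>\<Xi>.
     (norm (grad unit_x \<Phi> (x, y, \<xi>)))\<^sup>2 / (norm \<xi>)\<^sup>2 + (norm (grad unit_xi \<Phi> (x, y, \<xi>)))\<^sup>2 \<ge> \<alpha> \<and>
     (norm (grad unit_y \<Phi> (x, y, \<xi>)))\<^sup>2 / (norm \<xi>)\<^sup>2 + (norm (grad unit_xi \<Phi> (x, y, \<xi>)))\<^sup>2 \<ge> \<alpha>}"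

definition nondeg_phase_topology :: "real \<Rightarrow> (real ^ 'x::finite) set \<Rightarrow> (real ^ 'y::finite) set
    \<Rightarrow> ((real ^ 'x) \<times> (real ^ 'y) \<times> (real ^ 'z::finite) \<Rightarrow> real) topology" where
  "nondeg_phase_topology \<alpha> X Y =
     subtopology (seminorm_topology (phases X Y) (phase_seminorm X Y)) (nondeg_phases \<alpha> X Y)"


section \<open>Amplitudes\<close>

definition japanese :: "'v::real_normed_vector \<Rightarrow> real" where
  "japanese \<xi> = sqrt (1 + (norm \<xi>)\<^sup>2)"

definition hoermander_class :: "real \<Rightarrow> real \<Rightarrow> real \<Rightarrow> (real ^ 'x::finite) set \<Rightarrow> (real ^ 'y::finite) set
    \<Rightarrow> ((real ^ 'x) \<times> (real ^ 'y) \<times> (real ^ 'z::finite) \<Rightarrow> complex) set" where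
  "hoermander_class d \<rho> \<delta> X Y = {a \<in> extensional (X \<times> Y \<times> UNIV). smooth_on (X \<times> Y \<times> UNIV) a \<and>
     (\<forall>j k l K. compact K \<longrightarrow> K \<subseteq> X \<times> Y \<longrightarrow>
       (\<exists>C. \<forall>(x, y)\<in>K. \<forall>\<xi>. norm (mderiv3 j k l a (x, y, \<xi>)) \<le>
          C * japanese \<xi> powr (d - \<rho> * order_of l + \<delta> * (order_of j + order_of k))))}"

definition amplitudes :: "real \<Rightarrow> real \<Rightarrow> real \<Rightarrow> (real ^ 'x::finite) set \<Rightarrow> (real ^ 'y::finite) set
    \<Rightarrow> ((real ^ 'x) \<times> (real ^ 'y) \<times> (real ^ 'z::finite) \<Rightarrow> complex) set" where
  "amplitudes d \<rho> \<delta> X Y = (\<lambda>b. restrict b (X \<times> Y \<times> \<Xi>)) ` hoermander_class d \<rho> \<delta> X Y"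

definition amplitude_seminorm :: "real \<Rightarrow> real \<Rightarrow> real \<Rightarrow> (real ^ 'x::finite) set \<Rightarrow> (real ^ 'y::finite) set
    \<Rightarrow> nat \<Rightarrow> ((real ^ 'x) \<times> (real ^ 'y) \<times> (real ^ 'z::finite) \<Rightarrow> complex) \<Rightarrow> ennreal" where
  "amplitude_seminorm d \<rho> \<delta> X Y m a = Sup
     {ennreal (japanese \<xi> powr (- d + \<rho> * order_of l - \<delta> * (order_of j + order_of k))
        * norm (mderiv3 j k l a (x, y, \<xi>))) | x y \<xi> j k l.
        x \<in> exhaust X m \<and> y \<in> exhaust Y m \<and> \<xi> \<in> \<Xi> \<and> order_of j + order_of k + order_of l \<le> m}"

definition amplitude_topology :: "real \<Rightarrow> real \<Rightarrow> real \<Rightarrow> (real ^ 'x::finite) set \<Rightarrow> (real ^ 'y::finite) set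
    \<Rightarrow> ((real ^ 'x) \<times> (real ^ 'y) \<times> (real ^ 'z::finite) \<Rightarrow> complex) topology" where
  "amplitude_topology d \<rho> \<delta> X Y =
     seminorm_topology (amplitudes d \<rho> \<delta> X Y) (amplitude_seminorm d \<rho> \<delta> X Y)"


section \<open>Smooth functions, test functions and distributions\<close>

definition smooth_functions :: "(real ^ 'x::finite) set \<Rightarrow> (real ^ 'x \<Rightarrow> complex) set" where
  "smooth_functions X = {v \<in> extensional X. smooth_on X v}"

definition smooth_seminorm :: "(real ^ 'x::finite) set \<Rightarrow> nat \<Rightarrow> (real ^ 'x \<Rightarrow> complex) \<Rightarrow> ennreal" where
  "smooth_seminorm X m v = Sup {ennreal (norm (mderiv unit_vec j v x)) | x j. x \<in> exhaust X m \<and> order_of j \<le> m}"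

definition smooth_topology :: "(real ^ 'x::finite) set \<Rightarrow> (real ^ 'x \<Rightarrow> complex) topology" where
  "smooth_topology X = seminorm_topology (smooth_functions X) (smooth_seminorm X)"

definition fun_support :: "('v::topological_space \<Rightarrow> complex) \<Rightarrow> 'v set" where
  "fun_support \<phi> = closure {x. \<phi> x \<noteq> 0}"

definition test_functions :: "(real ^ 'x::finite) set \<Rightarrow> (real ^ 'x \<Rightarrow> complex) set" where
  "test_functions X = {\<phi>. smooth_on UNIV \<phi> \<and> compact (fun_support \<phi>) \<and> fun_support \<phi> \<subseteq> X}"

text \<open>
  Continuity of a linear functional on the test functions is expressed by the usual estimate on
  each compact subset.
\<close>

definition distributions :: "(real ^ 'x::finite) set \<Rightarrow> ((real ^ 'x \<Rightarrow> complex) \<Rightarrow> complex) set" where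
  "distributions X = {u \<in> extensional (test_functions X).
     (\<forall>\<phi>\<in>test_functions X. \<forall>\<psi>\<in>test_functions X. u (\<lambda>x. \<phi> x + \<psi> x) = u \<phi> + u \<psi>) \<and>
     (\<forall>c. \<forall>\<phi>\<in>test_functions X. u (\<lambda>x. c * \<phi> x) = c * u \<phi>) \<and>
     (\<forall>K. compact K \<longrightarrow> K \<subseteq> X \<longrightarrow> (\<exists>C N. \<forall>\<phi>\<in>test_functions X. fun_support \<phi> \<subseteq> K \<longrightarrow>
        norm (u \<phi>) \<le> C * (\<Sum>j\<in>{j. order_of j \<le> N}. SUP x. norm (mderiv unit_vec j \<phi> x))))}"

text \<open>
  The product topology indexed by the test functions is the topology of pointwise convergence; its
  points are the functionals that are \<^const>\<open>undefined\<close> outside the test functions.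
\<close>

definition weak_star_topology :: "(real ^ 'x::finite) set \<Rightarrow> ((real ^ 'x \<Rightarrow> complex) \<Rightarrow> complex) topology" where
  "weak_star_topology X =
     subtopology (product_topology (\<lambda>_. euclidean) (test_functions X)) (distributions X)"

definition dist_support :: "(real ^ 'y::finite) set \<Rightarrow> ((real ^ 'y \<Rightarrow> complex) \<Rightarrow> complex) \<Rightarrow> (real ^ 'y) set" where
  "dist_support Y u = Y - \<Union>{U. open U \<and> U \<subseteq> Y \<and> (\<forall>\<phi>\<in>test_functions Y. fun_support \<phi> \<subseteq> U \<longrightarrow> u \<phi> = 0)}"

definition compact_distributions :: "(real ^ 'y::finite) set \<Rightarrow> ((real ^ 'y \<Rightarrow> complex) \<Rightarrow> complex) set" where
  "compact_distributions Y = {u \<in> distributions Y. compact (dist_support Y u)}"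

text \<open>
  The pairing of a compactly supported distribution with a smooth function is \<open>u (\<eta> v)\<close> for any
  test function \<open>\<eta>\<close> equal to \<open>1\<close> near the support of \<open>u\<close>; the value does not depend on \<open>\<eta>\<close>.
\<close>

definition cutoff :: "(real ^ 'y::finite) set \<Rightarrow> (real ^ 'y) set \<Rightarrow> real ^ 'y \<Rightarrow> complex" where
  "cutoff Y K = (SOME \<eta>. \<eta> \<in> test_functions Y \<and> (\<exists>U. open U \<and> K \<subseteq> U \<and> (\<forall>y\<in>U. \<eta> y = 1)))"

definition pairing :: "(real ^ 'y::finite) set \<Rightarrow> ((real ^ 'y \<Rightarrow> complex) \<Rightarrow> complex)
    \<Rightarrow> (real ^ 'y \<Rightarrow> complex) \<Rightarrow> complex" where
  "pairing Y u v = u (\<lambda>y. cutoff Y (dist_support Y u) y * v y)"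


section \<open>Fourier integral operators\<close>

text \<open>
  Below, \<open>\<theta>\<close> is the excision function, equal to \<open>1\<close> near the origin of the frequency space and
  compactly supported; the letter chi is taken by the binder syntax for vectors.
\<close>

definition L_denom :: "((real ^ 'x::finite) \<times> (real ^ 'y::finite) \<times> (real ^ 'z::finite) \<Rightarrow> real)
    \<Rightarrow> (real ^ 'x) \<times> (real ^ 'y) \<times> (real ^ 'z) \<Rightarrow> real" where
  "L_denom \<Phi> = (\<lambda>(x, y, \<xi>). (norm \<xi>)\<^sup>2 * (norm (grad unit_xi \<Phi> (x, y, \<xi>)))\<^sup>2
                              + (norm (grad unit_y \<Phi> (x, y, \<xi>)))\<^sup>2)"

definition L_alpha :: "(real ^ 'z \<Rightarrow> complex)
    \<Rightarrow> ((real ^ 'x::finite) \<times> (real ^ 'y::finite) \<times> (real ^ 'z::finite) \<Rightarrow> real)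
    \<Rightarrow> 'z \<Rightarrow> (real ^ 'x) \<times> (real ^ 'y) \<times> (real ^ 'z) \<Rightarrow> complex" where
  "L_alpha \<theta> \<Phi> l = (\<lambda>(x, y, \<xi>). - \<i> / of_real (L_denom \<Phi> (x, y, \<xi>)) * (1 - \<theta> \<xi>)
      * of_real ((norm \<xi>)\<^sup>2 * ddir (unit_xi l) \<Phi> (x, y, \<xi>)))"

definition L_beta :: "(real ^ 'z \<Rightarrow> complex)
    \<Rightarrow> ((real ^ 'x::finite) \<times> (real ^ 'y::finite) \<times> (real ^ 'z::finite) \<Rightarrow> real)
    \<Rightarrow> 'y \<Rightarrow> (real ^ 'x) \<times> (real ^ 'y) \<times> (real ^ 'z) \<Rightarrow> complex" where
  "L_beta \<theta> \<Phi> k = (\<lambda>(x, y, \<xi>). - \<i> / of_real (L_denom \<Phi> (x, y, \<xi>)) * (1 - \<theta> \<xi>)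
      * of_real (ddir (unit_y k) \<Phi> (x, y, \<xi>)))"

definition L_op :: "(real ^ 'z \<Rightarrow> complex)
    \<Rightarrow> ((real ^ 'x::finite) \<times> (real ^ 'y::finite) \<times> (real ^ 'z::finite) \<Rightarrow> real)
    \<Rightarrow> ((real ^ 'x) \<times> (real ^ 'y) \<times> (real ^ 'z) \<Rightarrow> complex)
    \<Rightarrow> (real ^ 'x) \<times> (real ^ 'y) \<times> (real ^ 'z) \<Rightarrow> complex" where
  "L_op \<theta> \<Phi> f = (\<lambda>(x, y, \<xi>).
     - (\<Sum>l\<in>UNIV. ddir (unit_xi l) (\<lambda>z. L_alpha \<theta> \<Phi> l z * f z) (x, y, \<xi>))
     - (\<Sum>k\<in>UNIV. ddir (unit_y k) (\<lambda>z. L_beta \<theta> \<Phi> k z * f z) (x, y, \<xi>))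
     + \<theta> \<xi> * f (x, y, \<xi>))"

text \<open>
  The number \<open>\<kappa>\<close> of integrations by parts is an explicit parameter; the value is the same
  for all sufficiently large \<open>\<kappa>\<close>.
\<close>

definition fio :: "nat \<Rightarrow> (real ^ 'z \<Rightarrow> complex) \<Rightarrow> (real ^ 'x) set \<Rightarrow> (real ^ 'y) set
    \<Rightarrow> ((real ^ 'x::finite) \<times> (real ^ 'y::finite) \<times> (real ^ 'z::finite) \<Rightarrow> real)
    \<Rightarrow> ((real ^ 'x) \<times> (real ^ 'y) \<times> (real ^ 'z) \<Rightarrow> complex)
    \<Rightarrow> (real ^ 'y \<Rightarrow> complex) \<Rightarrow> real ^ 'x \<Rightarrow> complex" where
  "fio \<kappa> \<theta> X Y \<Phi> a \<psi> = (\<lambda>x\<in>X. 1 / of_real ((2 * pi) ^ CARD('z)) *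
     (LINT \<xi>:\<Xi>|lborel. LINT y:Y|lborel.
        exp (\<i> * of_real (\<Phi> (x, y, \<xi>))) *
        (L_op \<theta> \<Phi> ^^ \<kappa>) (\<lambda>(x, y, \<xi>). a (x, y, \<xi>) * \<psi> y) (x, y, \<xi>)))"

definition interchange :: "('x \<times> 'y \<times> 'z \<Rightarrow> 'b) \<Rightarrow> 'y \<times> 'x \<times> 'z \<Rightarrow> 'b" where
  "interchange f = (\<lambda>(y, x, \<xi>). f (x, y, \<xi>))"

definition fio_transpose :: "nat \<Rightarrow> (real ^ 'z \<Rightarrow> complex) \<Rightarrow> (real ^ 'x) set \<Rightarrow> (real ^ 'y) set
    \<Rightarrow> ((real ^ 'x::finite) \<times> (real ^ 'y::finite) \<times> (real ^ 'z::finite) \<Rightarrow> real)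
    \<Rightarrow> ((real ^ 'x) \<times> (real ^ 'y) \<times> (real ^ 'z) \<Rightarrow> complex)
    \<Rightarrow> (real ^ 'x \<Rightarrow> complex) \<Rightarrow> real ^ 'y \<Rightarrow> complex" where
  "fio_transpose \<kappa> \<theta> X Y \<Phi> a \<phi> = fio \<kappa> \<theta> Y X (interchange \<Phi>) (interchange a) \<phi>"

definition fio_dist :: "nat \<Rightarrow> (real ^ 'z \<Rightarrow> complex) \<Rightarrow> (real ^ 'x) set \<Rightarrow> (real ^ 'y) set
    \<Rightarrow> ((real ^ 'x::finite) \<times> (real ^ 'y::finite) \<times> (real ^ 'z::finite) \<Rightarrow> real)
    \<Rightarrow> ((real ^ 'x) \<times> (real ^ 'y) \<times> (real ^ 'z) \<Rightarrow> complex)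
    \<Rightarrow> ((real ^ 'y \<Rightarrow> complex) \<Rightarrow> complex) \<Rightarrow> (real ^ 'x \<Rightarrow> complex) \<Rightarrow> complex" where
  "fio_dist \<kappa> \<theta> X Y \<Phi> a u =
     (\<lambda>\<phi>\<in>test_functions X. pairing Y u (fio_transpose \<kappa> \<theta> X Y \<Phi> a \<phi>))"

end

theory Submission
  imports Defs
begin

text \<open>
  Both target spaces are reduced to scalar functions of \<open>\<omega>\<close>. The space \<open>C\<^sup>\<infinity>(X)\<close> is separable metrizable and its
  seminorms are countable suprema of limits of difference quotients, so a map into it is measurable as soon as
  all point evaluations are. In \<open>D'(X)\<close> the same holds for the evaluations at test functions, because
  \<open>D'(X)\<close> is a countable union of equicontinuous sets, each with a countable network.

  The value \<open>A[\<psi>](x)\<close> is an absolutely convergent integral whose integrand is measurable in \<open>\<omega>\<close>, being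
  built from the evaluations of \<open>a\<close> and \<open>\<Phi>\<close> by limits of difference quotients and algebra, and
  continuous in \<open>(y, \<xi>)\<close> away from \<open>\<xi> = 0\<close>; so it is jointly measurable and Fubini applies. Smoothness in \<open>x\<close>
  follows by raising \<open>\<kappa>\<close>, which by integration by parts does not change the integral, and the symbol estimates,
  uniform over bounded sets of \<open>\<psi>\<close>, make \<open>\<psi> \<mapsto> A[\<psi>]\<close> continuous. By transposition \<open>A[u]\<close> is a distribution,
  and \<open>\<langle>A[u], \<phi>\<rangle>\<close> is a continuous functional of the measurable \<open>C\<^sup>\<infinity>(Y)\<close>-valued map given by the transposed operator on \<open>\<phi>\<close>.
\<close>

text \<open>Three obstacles shape the estimates. A homogeneous phase is in general not smooth at
  \<xi> = 0, so frequencies with \<open>norm \<xi> < 1\<close> are treated apart, with derivatives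
  in x and y only; this suffices because the excision makes L the identity there. Every x-derivative
  that falls on the oscillating factor costs one power of |\<xi>|, so the given
  \<open>\<kappa>\<close>, which only guarantees convergence, does not dominate the derivatives; the
  number of integrations by parts has to grow with the number of derivatives. Finally, a
  distribution needs bounds by seminorms of the test function and not merely finiteness for each
  one, so the symbol estimates are stated for indexed families with one constant per region.\<close>

section \<open>Directional derivatives, iterated derivatives and their local nature\<close>

lemma ddir_has_derivative:
  assumes "(f has_derivative D) (at p)"
  shows "ddir v f p = D v"
proof -
  have 1: "((\<lambda>t::real. p + t *\<^sub>R v) has_derivative (\<lambda>t. t *\<^sub>R v)) (at 0)"
    by (auto intro!: derivative_eq_intros)
  have "((\<lambda>t. f (p + t *\<^sub>R v)) has_derivative (\<lambda>t. D (t *\<^sub>R v))) (at 0)"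
    using has_derivative_compose[OF 1, of f D] assms by simp
  moreover have "D (t *\<^sub>R v) = t *\<^sub>R D v" for t
    using assms has_derivative_linear linear_cmul by blast
  ultimately show ?thesis
    unfolding ddir_def by (simp add: has_vector_derivative_def vector_derivative_at)
qed

lemma has_derivative_ddir:
  assumes "f differentiable (at p)"
  shows "(f has_derivative (\<lambda>v. ddir v f p)) (at p)"
proof -
  obtain D where D: "(f has_derivative D) (at p)" using assms by (auto simp: differentiable_def)
  have "D = (\<lambda>v. ddir v f p)" using ddir_has_derivative[OF D] by auto
  then show ?thesis using D by simp
qed

lemma has_vector_derivative_line:
  assumes "f differentiable (at (p + t *\<^sub>R v))"
  shows "((\<lambda>t. f (p + t *\<^sub>R v)) has_vector_derivative ddir v f (p + t *\<^sub>R v)) (at t)"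
proof -
  note D = has_derivative_ddir[OF assms]
  have 1: "((\<lambda>t::real. p + t *\<^sub>R v) has_derivative (\<lambda>t. t *\<^sub>R v)) (at t)"
    by (auto intro!: derivative_eq_intros)
  have "((\<lambda>t. f (p + t *\<^sub>R v)) has_derivative (\<lambda>s. ddir (s *\<^sub>R v) f (p + t *\<^sub>R v))) (at t)"
    by (rule has_derivative_compose[OF 1 D])
  moreover have "ddir (s *\<^sub>R v) f (p + t *\<^sub>R v) = s *\<^sub>R ddir v f (p + t *\<^sub>R v)" for s
    using D has_derivative_linear linear_cmul by blast
  ultimately show ?thesis
    by (simp add: has_vector_derivative_def)
qed

lemma ddir_cong:
  assumes "open S" "p \<in> S" "\<And>q. q \<in> S \<Longrightarrow> f q = g q"
  shows "ddir v f p = ddir v g p"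
proof -
  have "((\<lambda>t::real. p + t *\<^sub>R v) \<longlongrightarrow> p) (nhds 0)"
    using filterlim_ident by (auto intro!: tendsto_eq_intros)
  then have "eventually (\<lambda>t::real. p + t *\<^sub>R v \<in> S) (nhds 0)"
    using assms(1,2) topological_tendstoD by blast
  then show ?thesis
    unfolding ddir_def by (intro vector_derivative_cong_eq) (auto elim!: eventually_mono intro: assms)
qed

lemma derivs_cong:
  assumes "open S" "p \<in> S" "\<And>q. q \<in> S \<Longrightarrow> f q = g q"
  shows "foldr ddir vs f p = foldr ddir vs g p"
  using assms(2)
proof (induction vs arbitrary: p)
  case (Cons v vs)
  then show ?case using ddir_cong[OF assms(1), of p "foldr ddir vs f" "foldr ddir vs g"] by simp
qed (simp add: assms)

lemma differentiable_on_cong: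
  assumes "open S" "\<And>q. q \<in> S \<Longrightarrow> f q = g q" "f differentiable_on S"
  shows "g differentiable_on S"
  unfolding differentiable_on_def differentiable_def
proof
  fix x assume x: "x \<in> S"
  then obtain D where "(f has_derivative D) (at x within S)"
    using assms(3) unfolding differentiable_on_def differentiable_def by blast
  then have "(g has_derivative D) (at x within S)"
    by (rule has_derivative_transform[OF x, rotated]) (simp add: assms(2))
  then show "\<exists>D. (g has_derivative D) (at x within S)" by blast
qed

lemma smooth_on_cong:
  assumes "open S" "\<And>q. q \<in> S \<Longrightarrow> f q = g q" "smooth_on S f"
  shows "smooth_on S g"
  unfolding smooth_on_def
proof (intro allI impI)
  fix vs :: "'a list" assume "set vs \<subseteq> Basis"
  then have "foldr ddir vs f differentiable_on S" using assms(3) unfolding smooth_on_def by blast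
  then show "foldr ddir vs g differentiable_on S"
    by (rule differentiable_on_cong[OF assms(1), rotated]) (rule derivs_cong[OF assms(1) _ assms(2)])
qed

lemma smooth_on_subset: "smooth_on S f \<Longrightarrow> T \<subseteq> S \<Longrightarrow> smooth_on T f"
  unfolding smooth_on_def using differentiable_on_subset by blast

lemma smooth_on_differentiable_on: "smooth_on S f \<Longrightarrow> f differentiable_on S"
  unfolding smooth_on_def by (metis empty_subsetI foldr.simps(1) id_apply list.set(1))

lemma smooth_on_differentiable_at:
  "smooth_on S f \<Longrightarrow> open S \<Longrightarrow> p \<in> S \<Longrightarrow> f differentiable (at p)"
  using smooth_on_differentiable_on[of S f] at_within_open[of p S] by (auto simp: differentiable_on_def)

lemma smooth_on_continuous_on: "smooth_on S f \<Longrightarrow> continuous_on S f"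
  by (simp add: differentiable_imp_continuous_on smooth_on_differentiable_on)

lemma smooth_on_derivs:
  assumes "smooth_on S f" "set vs \<subseteq> Basis"
  shows "smooth_on S (foldr ddir vs f)"
  unfolding smooth_on_def
proof (intro allI impI)
  fix us :: "'a list" assume "set us \<subseteq> Basis"
  then have "set (us @ vs) \<subseteq> Basis" using assms by auto
  then have "foldr ddir (us @ vs) f differentiable_on S" using assms unfolding smooth_on_def by blast
  then show "foldr ddir us (foldr ddir vs f) differentiable_on S" by simp
qed

lemma smooth_on_ddir: "smooth_on S f \<Longrightarrow> v \<in> Basis \<Longrightarrow> smooth_on S (ddir v f)"
  using smooth_on_derivs[of S f "[v]"] by simp

text \<open>A finite-order stand-in for \<open>smooth_on\<close> that removes the derivative applied
  first. A closure property then reduces to one differentiation rule per step, with the order as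
  induction variable, whereas iterated derivatives of products and composites have no simple closed
  form.\<close>

primrec diff_order :: "nat \<Rightarrow> 'v::euclidean_space set \<Rightarrow> ('v \<Rightarrow> 'b::real_normed_vector) \<Rightarrow> bool" where
  "diff_order 0 S f \<longleftrightarrow> f differentiable_on S"
| "diff_order (Suc n) S f \<longleftrightarrow> f differentiable_on S \<and> (\<forall>v\<in>Basis. diff_order n S (ddir v f))"

lemma smooth_on_diff_order: "smooth_on S f \<longleftrightarrow> (\<forall>n. diff_order n S f)"
proof
  assume "smooth_on S f"
  then have "diff_order n S f" for n
    by (induction n arbitrary: f) (auto simp: smooth_on_differentiable_on smooth_on_ddir)
  then show "\<forall>n. diff_order n S f" by blast
next
  assume *: "\<forall>n. diff_order n S f"
  have "foldr ddir vs f differentiable_on S" if "set vs \<subseteq> Basis" "diff_order (length vs) S f" for vs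
    using that
  \<comment> \<open>\<open>foldr\<close> applies the last direction of the list first, and this is
    the derivative that \<open>diff_order\<close> removes; hence the induction from the end.\<close>
  proof (induction vs arbitrary: f rule: rev_induct)
    case (snoc v vs)
    then show ?case by simp
  qed simp
  then show "smooth_on S f" unfolding smooth_on_def using * by blast
qed

lemma diff_order_Suc_imp: "diff_order (Suc n) S f \<Longrightarrow> diff_order n S f"
  by (induction n arbitrary: f) auto

lemma diff_order_cong:
  assumes "open S" "\<And>q. q \<in> S \<Longrightarrow> f q = g q" "diff_order n S f"
  shows "diff_order n S g"
  using assms(2,3)
proof (induction n arbitrary: f g)
  case 0
  then show ?case using differentiable_on_cong[OF assms(1), of f g] by simp
next
  case (Suc n)
  have "diff_order n S (ddir v g)" if "v \<in> Basis" for v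
    using Suc.IH[of "ddir v f" "ddir v g"] ddir_cong[OF assms(1), of _ f g] Suc.prems that by auto
  then show ?case using Suc.prems differentiable_on_cong[OF assms(1), of f g] by auto
qed

section \<open>Differentiation rules and closure properties of smooth functions\<close>

lemma ddir_const: "ddir v (\<lambda>_. c) p = 0"
  by (subst ddir_has_derivative[of _ "\<lambda>_. 0"]) auto

lemma ddir_add:
  assumes "f differentiable (at p)" "g differentiable (at p)"
  shows "ddir v (\<lambda>q. f q + g q) p = ddir v f p + ddir v g p"
  using has_derivative_add[OF has_derivative_ddir[OF assms(1)] has_derivative_ddir[OF assms(2)]]
  by (rule ddir_has_derivative)

lemma ddir_bounded_linear:
  assumes "bounded_linear h" "f differentiable (at p)"
  shows "ddir v (\<lambda>q. h (f q)) p = h (ddir v f p)"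
  using bounded_linear.has_derivative[OF assms(1) has_derivative_ddir[OF assms(2)]]
  by (rule ddir_has_derivative)

lemma ddir_bounded_bilinear:
  assumes "bounded_bilinear h" "f differentiable (at p)" "g differentiable (at p)"
  shows "ddir v (\<lambda>q. h (f q) (g q)) p = h (f p) (ddir v g p) + h (ddir v f p) (g p)"
  using bounded_bilinear.FDERIV[OF assms(1) has_derivative_ddir[OF assms(2)] has_derivative_ddir[OF assms(3)]]
  by (rule ddir_has_derivative)

lemma ddir_mult:
  fixes f g :: "'v::real_normed_vector \<Rightarrow> 'a::real_normed_algebra"
  assumes "f differentiable (at p)" "g differentiable (at p)"
  shows "ddir v (\<lambda>q. f q * g q) p = f p * ddir v g p + ddir v f p * g p"
  using ddir_bounded_bilinear[OF bounded_bilinear_mult assms] .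

lemma ddir_exp:
  fixes f :: "'v::real_normed_vector \<Rightarrow> complex"
  assumes "f differentiable (at p)"
  shows "ddir v (\<lambda>q. exp (f q)) p = exp (f p) * ddir v f p"
proof -
  have "((\<lambda>q. exp (f q)) has_derivative (\<lambda>v. exp (f p) * ddir v f p)) (at p)"
    using has_derivative_compose[OF has_derivative_ddir[OF assms], of exp "\<lambda>x. exp (f p) * x"] DERIV_exp[of "f p"]
    unfolding has_field_derivative_def by simp
  then show ?thesis by (rule ddir_has_derivative)
qed

lemma ddir_inverse:
  fixes f :: "'v::real_normed_vector \<Rightarrow> complex"
  assumes "f differentiable (at p)" "f p \<noteq> 0"
  shows "ddir v (\<lambda>q. inverse (f q)) p = - (inverse (f p) * (inverse (f p) * ddir v f p))"
proof -
  have "((\<lambda>q. inverse (f q)) has_derivative (\<lambda>v. - (inverse (f p) * (inverse (f p) * ddir v f p)))) (at p)"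
    using Deriv.has_derivative_inverse[OF assms(2) has_derivative_ddir[OF assms(1)]] by (simp add: algebra_simps)
  then show ?thesis by (rule ddir_has_derivative)
qed

lemma diff_order_const: "diff_order n S (\<lambda>_. c)"
proof (induction n arbitrary: c)
  case 0
  show ?case by (simp add: differentiable_on_def)
next
  case (Suc n)
  have *: "ddir v (\<lambda>_. c) = (\<lambda>_. 0)" for v :: 'a by (rule ext) (rule ddir_const)
  show ?case unfolding diff_order.simps * using Suc.IH[of 0] by (auto simp: differentiable_on_def)
qed

context
  fixes S :: "'v::euclidean_space set"
  assumes S: "open S"
begin

lemma differentiable_on_at: "f differentiable_on S \<Longrightarrow> p \<in> S \<Longrightarrow> f differentiable (at p)"
  using S at_within_open[of p S] by (auto simp: differentiable_on_def)

lemma differentiable_onI: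
  assumes "\<And>p. p \<in> S \<Longrightarrow> f differentiable (at p)"
  shows "f differentiable_on S"
  unfolding differentiable_on_def
proof
  fix p assume "p \<in> S"
  then show "f differentiable (at p within S)"
    by (rule differentiable_at_withinI[OF assms])
qed

lemma diff_order_add:
  assumes "diff_order n S f" "diff_order n S g"
  shows "diff_order n S (\<lambda>q. f q + g q)"
  using assms
proof (induction n arbitrary: f g)
  case (Suc n)
  have "diff_order n S (ddir v (\<lambda>q. f q + g q))" if "v \<in> Basis" for v
    by (rule diff_order_cong[OF S _ Suc.IH[of "ddir v f" "ddir v g"]])
      (use Suc that in \<open>auto simp: ddir_add differentiable_on_at\<close>)
  then show ?case using Suc by simp
qed simp

lemma diff_order_bounded_linear:
  assumes "bounded_linear h" "diff_order n S f"
  shows "diff_order n S (\<lambda>q. h (f q))"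
proof -
  have d: "(\<lambda>q. h (f q)) differentiable_on S" if "f differentiable_on S" for f
    using bounded_linear.has_derivative[OF assms(1) has_derivative_ddir[OF differentiable_on_at[OF that]]]
    by (intro differentiable_onI) (auto simp: differentiable_def)
  show ?thesis using assms(2)
proof (induction n arbitrary: f)
  case 0
  then show ?case using d by simp
next
  case (Suc n)
  have "diff_order n S (ddir v (\<lambda>q. h (f q)))" if "v \<in> Basis" for v
    by (rule diff_order_cong[OF S _ Suc.IH[of "ddir v f"]])
      (use Suc that in \<open>auto simp: ddir_bounded_linear[OF assms(1)] differentiable_on_at\<close>)
  then show ?case using Suc.prems d by simp
qed
qed

lemma diff_order_bounded_bilinear:
  assumes h: "bounded_bilinear h" and "diff_order n S f" "diff_order n S g"
  shows "diff_order n S (\<lambda>q. h (f q) (g q))"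
proof -
  have d: "(\<lambda>q. h (f q) (g q)) differentiable_on S" if "f differentiable_on S" "g differentiable_on S" for f g
  proof (rule differentiable_onI)
    fix p assume "p \<in> S"
    then show "(\<lambda>q. h (f q) (g q)) differentiable (at p)"
      using bounded_bilinear.FDERIV[OF h has_derivative_ddir[OF differentiable_on_at]
        has_derivative_ddir[OF differentiable_on_at]] that
      unfolding differentiable_def by blast
  qed
  show ?thesis using assms(2,3)
  proof (induction n arbitrary: f g)
    case (Suc n)
    have "diff_order n S (ddir v (\<lambda>q. h (f q) (g q)))" if "v \<in> Basis" for v
    proof (rule diff_order_cong[OF S])
      show "diff_order n S (\<lambda>p. h (f p) (ddir v g p) + h (ddir v f p) (g p))"
        using Suc that diff_order_Suc_imp by (intro diff_order_add Suc.IH) (auto intro: diff_order_Suc_imp)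
    qed (use Suc in \<open>auto simp: ddir_bounded_bilinear[OF h] differentiable_on_at\<close>)
    then show ?case using Suc d by simp
  qed (simp add: d)
qed

lemmas diff_order_mult = diff_order_bounded_bilinear[OF bounded_bilinear_mult]

lemma diff_order_exp:
  fixes f :: "'v \<Rightarrow> complex"
  assumes "diff_order n S f"
  shows "diff_order n S (\<lambda>q. exp (f q))"
proof -
  have d: "(\<lambda>q. exp (f q)) differentiable_on S" if "f differentiable_on S"
    using has_derivative_compose[OF has_derivative_ddir[OF differentiable_on_at[OF that]] DERIV_exp[unfolded has_field_derivative_def]]
    by (intro differentiable_onI) (auto simp: differentiable_def)
  show ?thesis using assms
  proof (induction n)
    case (Suc n)
    have "diff_order n S (ddir v (\<lambda>q. exp (f q)))" if "v \<in> Basis" for v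
      by (rule diff_order_cong[OF S _ diff_order_mult[OF Suc.IH, of "ddir v f"]])
        (use Suc that diff_order_Suc_imp in \<open>auto simp: ddir_exp differentiable_on_at\<close>)
    then show ?case using Suc d by simp
  qed (simp add: d)
qed

lemma diff_order_inverse:
  fixes f :: "'v \<Rightarrow> complex"
  assumes "diff_order n S f" "\<And>p. p \<in> S \<Longrightarrow> f p \<noteq> 0"
  shows "diff_order n S (\<lambda>q. inverse (f q))"
proof -
  have d: "(\<lambda>q. inverse (f q)) differentiable_on S" if "f differentiable_on S"
    using Deriv.has_derivative_inverse[OF assms(2) has_derivative_ddir[OF differentiable_on_at[OF that]]]
    by (intro differentiable_onI) (auto simp: differentiable_def)
  show ?thesis using assms(1)
  proof (induction n)
    case (Suc n)
    have 1: "diff_order n S (\<lambda>q. inverse (f q))" using Suc diff_order_Suc_imp by blast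
    have "diff_order n S (ddir v (\<lambda>q. inverse (f q)))" if "v \<in> Basis" for v
      by (rule diff_order_cong[OF S _ diff_order_bounded_linear[OF bounded_linear_minus[OF bounded_linear_ident]
         diff_order_mult[OF 1 diff_order_mult[OF 1, of "ddir v f"]]]])
        (use Suc that assms(2) in \<open>auto simp: ddir_inverse differentiable_on_at\<close>)
    then show ?case using Suc d by simp
  qed (simp add: d)
qed

lemma smooth_on_add: "smooth_on S f \<Longrightarrow> smooth_on S g \<Longrightarrow> smooth_on S (\<lambda>q. f q + g q)"
  by (simp add: smooth_on_diff_order diff_order_add)

lemma smooth_on_mult:
  fixes f :: "'v \<Rightarrow> 'a::real_normed_algebra"
  shows "smooth_on S f \<Longrightarrow> smooth_on S g \<Longrightarrow> smooth_on S (\<lambda>q. f q * g q)"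
  by (simp add: smooth_on_diff_order diff_order_mult)

lemma smooth_on_bounded_linear:
  "bounded_linear h \<Longrightarrow> smooth_on S f \<Longrightarrow> smooth_on S (\<lambda>q. h (f q))"
  by (simp add: smooth_on_diff_order diff_order_bounded_linear)

lemma smooth_on_uminus: "smooth_on S f \<Longrightarrow> smooth_on S (\<lambda>q. - f q)"
  by (rule smooth_on_bounded_linear) (auto intro: bounded_linear_minus bounded_linear_ident)

lemma smooth_on_diff:
  "smooth_on S f \<Longrightarrow> smooth_on S g \<Longrightarrow> smooth_on S (\<lambda>q. f q - g q)"
  using smooth_on_add[OF _ smooth_on_uminus, of f g] by simp

lemma smooth_on_of_real:
  "smooth_on S f \<Longrightarrow> smooth_on S (\<lambda>q. of_real (f q) :: 'a::{real_normed_algebra_1})"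
  by (rule smooth_on_bounded_linear[OF bounded_linear_of_real])

lemma smooth_on_exp:
  fixes f :: "'v \<Rightarrow> complex"
  shows "smooth_on S f \<Longrightarrow> smooth_on S (\<lambda>q. exp (f q))"
  by (simp add: smooth_on_diff_order diff_order_exp)

lemma smooth_on_inverse:
  fixes f :: "'v \<Rightarrow> complex"
  shows "smooth_on S f \<Longrightarrow> (\<And>p. p \<in> S \<Longrightarrow> f p \<noteq> 0) \<Longrightarrow> smooth_on S (\<lambda>q. inverse (f q))"
  by (simp add: smooth_on_diff_order diff_order_inverse)

end

lemma smooth_on_const: "smooth_on S (\<lambda>_. c)"
  by (simp add: smooth_on_diff_order diff_order_const)

lemma smooth_on_sum:
  assumes "open S" "\<And>i. i \<in> I \<Longrightarrow> smooth_on S (f i)"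
  shows "smooth_on S (\<lambda>q. \<Sum>i\<in>I. f i q)"
  using assms(2) by (induction I rule: infinite_finite_induct) (auto simp: smooth_on_const smooth_on_add[OF assms(1)])

lemma smooth_on_prod:
  fixes f :: "'i \<Rightarrow> 'v::euclidean_space \<Rightarrow> 'a::{real_normed_algebra_1, comm_monoid_mult}"
  assumes "open S" "\<And>i. i \<in> I \<Longrightarrow> smooth_on S (f i)"
  shows "smooth_on S (\<lambda>q. \<Prod>i\<in>I. f i q)"
  using assms(2) by (induction I rule: infinite_finite_induct) (auto simp: smooth_on_const smooth_on_mult[OF assms(1)])

lemma smooth_on_linear:
  fixes h :: "'v::euclidean_space \<Rightarrow> 'b::real_normed_vector"
  assumes "bounded_linear h"
  shows "smooth_on S h"
proof -
  have "diff_order n S h" for n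
  proof (cases n)
    case 0
    then show ?thesis using bounded_linear_imp_differentiable_on[OF assms] by simp
  next
    case (Suc k)
    have "ddir v h = (\<lambda>_. h v)" for v
      using ddir_has_derivative[OF bounded_linear_imp_has_derivative[OF assms]] by auto
    then show ?thesis using Suc bounded_linear_imp_differentiable_on[OF assms] by (simp add: diff_order_const)
  qed
  then show ?thesis by (simp add: smooth_on_diff_order)
qed

lemma differentiable_affine_compose:
  fixes A :: "'v::euclidean_space \<Rightarrow> 'u::euclidean_space"
  assumes "bounded_linear A" "f differentiable (at (c + A p))"
  shows "(\<lambda>p. f (c + A p)) differentiable (at p)"
    and "ddir v (\<lambda>p. f (c + A p)) p = ddir (A v) f (c + A p)"
proof -
  have "((\<lambda>p. c + A p) has_derivative A) (at p)"
    using bounded_linear_imp_has_derivative[OF assms(1)] by (auto intro!: derivative_eq_intros)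
  from has_derivative_compose[OF this has_derivative_ddir[OF assms(2)]]
  have *: "((\<lambda>p. f (c + A p)) has_derivative (\<lambda>v. ddir (A v) f (c + A p))) (at p)" .
  then show "(\<lambda>p. f (c + A p)) differentiable (at p)" by (auto simp: differentiable_def)
  from * show "ddir v (\<lambda>p. f (c + A p)) p = ddir (A v) f (c + A p)"
    by (rule ddir_has_derivative)
qed

text \<open>\<open>smooth_on\<close> controls basis directions only. If the linear part sends every
  basis vector to a multiple of a basis vector, a derivative of the composite is again a multiple of
  such a composite and the induction closes. Coordinate projections, the interchange of x and y, and
  a coordinate placed on a coordinate axis are all of this kind.\<close>

lemma smooth_on_affine_compose:
  fixes A :: "'v::euclidean_space \<Rightarrow> 'u::euclidean_space" and f :: "'u \<Rightarrow> 'b::real_normed_vector"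
  assumes A: "bounded_linear A" and AB: "\<And>v. v \<in> Basis \<Longrightarrow> \<exists>r. \<exists>b\<in>Basis. A v = r *\<^sub>R b"
    and f: "smooth_on T f" and T: "open T" and S: "open S" "\<And>p. p \<in> S \<Longrightarrow> c + A p \<in> T"
  shows "smooth_on S (\<lambda>p. f (c + A p))"
proof -
  have d: "(\<lambda>p. f (c + A p)) differentiable_on S" if "smooth_on T f" for f :: "'u \<Rightarrow> 'b"
  proof (rule differentiable_onI[OF S(1)])
    fix p assume "p \<in> S"
    then show "(\<lambda>p. f (c + A p)) differentiable (at p)"
      by (rule differentiable_affine_compose(1)[OF A smooth_on_differentiable_at[OF that T S(2)]])
  qed
  have "diff_order n S (\<lambda>p. f (c + A p))" if "smooth_on T f" for n and f :: "'u \<Rightarrow> 'b"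
    using that
  proof (induction n arbitrary: f)
    case 0
    then show ?case using d by simp
  next
    case (Suc n)
    have "diff_order n S (ddir v (\<lambda>p. f (c + A p)))" if v: "v \<in> Basis" for v
    proof -
      obtain r b where b: "b \<in> Basis" "A v = r *\<^sub>R b" using AB[OF v] by blast
      have "diff_order n S (\<lambda>p. r *\<^sub>R ddir b f (c + A p))"
        using diff_order_bounded_linear[OF S(1) bounded_linear_scaleR_right[of r] Suc.IH[OF smooth_on_ddir[OF Suc.prems b(1)]]] .
      then show ?thesis
      proof (rule diff_order_cong[OF S(1), rotated])
        fix q assume q: "q \<in> S"
        have d: "f differentiable at (c + A q)" by (rule smooth_on_differentiable_at[OF Suc.prems T S(2)[OF q]])
        have "r *\<^sub>R ddir b f (c + A q) = ddir (r *\<^sub>R b) f (c + A q)"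
          using linear_cmul[OF has_derivative_linear[OF has_derivative_ddir[OF d]], of r b] by simp
        then show "r *\<^sub>R ddir b f (c + A q) = ddir v (\<lambda>p. f (c + A p)) q"
          using differentiable_affine_compose(2)[OF A d] b by simp
      qed
    qed
    then show ?case using d[OF Suc.prems] by simp
  qed
  then show ?thesis using f by (simp add: smooth_on_diff_order)
qed

section \<open>Symmetry of mixed partial derivatives\<close>

text \<open>Young's version of the symmetry theorem, by the mean value inequality. The second
  difference does not change when u and v are exchanged, so two uses of this limit give
  \<open>ddir_commute\<close>.\<close>

lemma second_difference_tendsto:
  fixes f :: "'v::euclidean_space \<Rightarrow> 'b::real_normed_vector"
  assumes S: "open S" "p \<in> S" and f: "\<And>q. q \<in> S \<Longrightarrow> f differentiable (at q)"
    and g: "ddir u f differentiable (at p)"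
  shows "((\<lambda>s. (f (p + s *\<^sub>R u + s *\<^sub>R v) - f (p + s *\<^sub>R u) - f (p + s *\<^sub>R v) + f p) /\<^sub>R s\<^sup>2)
    \<longlongrightarrow> ddir v (ddir u f) p) (at_right 0)"
proof (rule tendstoI)
  fix e0 :: real assume e0: "0 < e0"
  define N where "N = norm u + norm v + 1"
  \<comment> \<open>The mean value estimate below produces \<open>2 * e * N * s\<^sup>2\<close>,
    which by this choice is \<open>e0 / 2 * s\<^sup>2\<close>.\<close>
  define e where "e = e0 / (4 * N)"
  have N: "N > 0" unfolding N_def by (simp add: add_nonneg_pos)
  have e: "e > 0" using e0 N by (simp add: e_def)
  define A where "A = (\<lambda>h. ddir h (ddir u f) p)"
  have A: "(ddir u f has_derivative A) (at p)" unfolding A_def by (rule has_derivative_ddir[OF g])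
  have lin: "linear A" using A has_derivative_linear by blast
  obtain d1 where d1: "d1 > 0" "\<And>q. norm (q - p) < d1 \<Longrightarrow>
      norm (ddir u f q - ddir u f p - A (q - p)) \<le> e * norm (q - p)"
    using A e unfolding has_derivative_at_alt by blast
  obtain d2 where d2: "d2 > 0" "ball p d2 \<subseteq> S" using S openE by blast
  define d where "d = min d1 d2"
  have "dist ((f (p + s *\<^sub>R u + s *\<^sub>R v) - f (p + s *\<^sub>R u) - f (p + s *\<^sub>R v) + f p) /\<^sub>R s\<^sup>2)
      (ddir v (ddir u f) p) < e0" if s: "s > 0" "s < d / N" for s
  proof -
    have sN: "s * N < d" using s N by (simp add: field_simps)
    have nb: "norm (t *\<^sub>R u + r *\<^sub>R v) \<le> s * N" if "0 \<le> t" "t \<le> s" "0 \<le> r" "r \<le> s" for t r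
    proof -
      have "norm (t *\<^sub>R u + r *\<^sub>R v) \<le> t * norm u + r * norm v"
        using that norm_triangle_ineq[of "t *\<^sub>R u" "r *\<^sub>R v"] by simp
      also have "\<dots> \<le> s * norm u + s * norm v" using that by (intro add_mono mult_right_mono) auto
      also have "\<dots> \<le> s * N" using s by (simp add: N_def algebra_simps)
      finally show ?thesis .
    qed
    have inS: "p + (t *\<^sub>R u + r *\<^sub>R v) \<in> S" if "0 \<le> t" "t \<le> s" "0 \<le> r" "r \<le> s" for t r
    proof -
      have "dist p (p + h) = norm h" for h by (simp add: dist_norm)
      then have "p + (t *\<^sub>R u + r *\<^sub>R v) \<in> ball p d2" using nb[OF that] sN unfolding mem_ball by (simp add: d_def)
      then show ?thesis using d2 by blast
    qed
    \<comment> \<open>The first difference in direction v as a function of the step in direction u,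
      with its expected linear part removed; \<open>G s - G 0\<close> is the second difference minus
      \<open>s\<^sup>2 *\<^sub>R A v\<close>.\<close>
    define G where "G = (\<lambda>t. f ((p + s *\<^sub>R v) + t *\<^sub>R u) - f (p + t *\<^sub>R u) - (t * s) *\<^sub>R A v)"
    define G' where "G' = (\<lambda>t. ddir u f ((p + s *\<^sub>R v) + t *\<^sub>R u) - ddir u f (p + t *\<^sub>R u) - s *\<^sub>R A v)"
    have dG: "(G has_vector_derivative G' t) (at t within {0..s})" if t: "t \<in> {0..s}" for t
    proof -
      have "f differentiable at ((p + s *\<^sub>R v) + t *\<^sub>R u)"
        using f[OF inS[of t s]] t s by (simp add: algebra_simps)
      moreover have "f differentiable at (p + t *\<^sub>R u)"
        using f[OF inS[of t 0]] t s by (simp add: algebra_simps)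
      moreover have "((\<lambda>t. (t * s) *\<^sub>R A v) has_vector_derivative s *\<^sub>R A v) (at t)"
        by (auto intro!: derivative_eq_intros simp: has_vector_derivative_def)
      ultimately have "(G has_vector_derivative G' t) (at t)" unfolding G_def G'_def
        by (intro has_vector_derivative_diff has_vector_derivative_line)
      then show ?thesis by (rule has_vector_derivative_at_within)
    qed
    have bG: "norm (G' t) \<le> 2 * e * (s * N)" if t: "t \<in> {0..s}" for t
    proof -
      have eq: "G' t = (ddir u f (p + (t *\<^sub>R u + s *\<^sub>R v)) - ddir u f p - A (t *\<^sub>R u + s *\<^sub>R v))
          - (ddir u f (p + (t *\<^sub>R u + 0 *\<^sub>R v)) - ddir u f p - A (t *\<^sub>R u + 0 *\<^sub>R v))"
        unfolding G'_def using lin by (simp add: linear_add linear_cmul algebra_simps)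
      have b: "norm (ddir u f (p + (t *\<^sub>R u + r *\<^sub>R v)) - ddir u f p - A (t *\<^sub>R u + r *\<^sub>R v)) \<le> e * (s * N)"
        if r: "0 \<le> r" "r \<le> s" for r
      proof -
        have n: "norm (t *\<^sub>R u + r *\<^sub>R v) \<le> s * N" using nb r t by simp
        then have "norm (ddir u f (p + (t *\<^sub>R u + r *\<^sub>R v)) - ddir u f p - A (t *\<^sub>R u + r *\<^sub>R v))
          \<le> e * norm (t *\<^sub>R u + r *\<^sub>R v)" using d1(2)[of "p + (t *\<^sub>R u + r *\<^sub>R v)"] sN by (simp add: d_def)
        also have "\<dots> \<le> e * (s * N)" using n e by simp
        finally show ?thesis .
      qed
      show ?thesis unfolding eq using b[of s] b[of 0] s
        by (intro order_trans[OF norm_triangle_ineq4]) simp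
    qed
    have "norm (G s - G 0) \<le> 2 * e * (s * N) * norm (s - 0)"
    proof (rule differentiable_bound[of "{0..s}" G "\<lambda>t h. h *\<^sub>R G' t"])
      show "(G has_derivative (\<lambda>h. h *\<^sub>R G' x)) (at x within {0..s})" if "x \<in> {0..s}" for x
        using dG[OF that] unfolding has_vector_derivative_def .
      show "onorm (\<lambda>h. h *\<^sub>R G' x) \<le> 2 * e * (s * N)" if "x \<in> {0..s}" for x
        using bG[OF that] by (intro onorm_le) (simp add: mult.commute mult_left_mono)
    qed (use s in auto)
    also have "\<dots> = 2 * e * N * s\<^sup>2" using s by (simp add: power2_eq_square)
    also have "\<dots> = e0 / 2 * s\<^sup>2" using N by (simp add: e_def field_simps)
    also have "\<dots> < e0 * s\<^sup>2" using e0 s by simp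
    finally have 1: "norm (G s - G 0) < e0 * s\<^sup>2" .
    have "(f (p + s *\<^sub>R u + s *\<^sub>R v) - f (p + s *\<^sub>R u) - f (p + s *\<^sub>R v) + f p) /\<^sub>R s\<^sup>2 - A v
        = (G s - G 0) /\<^sub>R s\<^sup>2"
      using s unfolding G_def by (simp add: algebra_simps power2_eq_square)
    then have "norm ((f (p + s *\<^sub>R u + s *\<^sub>R v) - f (p + s *\<^sub>R u) - f (p + s *\<^sub>R v) + f p) /\<^sub>R s\<^sup>2 - A v)
        = norm (G s - G 0) / s\<^sup>2" by (simp add: divide_inverse mult.commute)
    also have "\<dots> < e0" using 1 s by (simp add: field_simps)
    finally show ?thesis by (simp add: dist_norm A_def)
  qed
  moreover have "d / N > 0" using d1 d2 N by (simp add: d_def)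
  ultimately show "\<forall>\<^sub>F s in at_right 0. dist ((f (p + s *\<^sub>R u + s *\<^sub>R v) - f (p + s *\<^sub>R u) - f (p + s *\<^sub>R v) + f p) /\<^sub>R s\<^sup>2)
      (ddir v (ddir u f) p) < e0"
    unfolding eventually_at_right_field by (intro exI[of _ "d / N"]) auto
qed

lemma ddir_commute:
  assumes f: "smooth_on S f" and S: "open S" "p \<in> S" and uv: "u \<in> Basis" "v \<in> Basis"
  shows "ddir u (ddir v f) p = ddir v (ddir u f) p"
proof -
  have d: "f differentiable at q" if "q \<in> S" for q using smooth_on_differentiable_at[OF f S(1) that] .
  have dd: "ddir w f differentiable at p" if "w \<in> Basis" for w
    using smooth_on_differentiable_at[OF smooth_on_ddir[OF f that] S] .
  let ?g = "\<lambda>u v s. (f (p + s *\<^sub>R u + s *\<^sub>R v) - f (p + s *\<^sub>R u) - f (p + s *\<^sub>R v) + f p) /\<^sub>R s\<^sup>2"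
  have 1: "(?g u v \<longlongrightarrow> ddir v (ddir u f) p) (at_right 0)"
    by (rule second_difference_tendsto[OF S d dd[OF uv(1)]])
  have 2: "(?g v u \<longlongrightarrow> ddir u (ddir v f) p) (at_right 0)"
    by (rule second_difference_tendsto[OF S d dd[OF uv(2)]])
  have eq: "?g v u = ?g u v" by (rule ext) (simp add: algebra_simps)
  show ?thesis by (rule tendsto_unique[OF trivial_limit_at_right_real 2[unfolded eq] 1])
qed

lemma derivs_perm:
  assumes f: "smooth_on S f" and S: "open S" "p \<in> S" and "mset us = mset vs" "set us \<subseteq> Basis"
  shows "foldr ddir us f p = foldr ddir vs f p"
  using S(2) assms(4,5)
proof (induction us arbitrary: vs p)
  case (Cons u us)
  have "u \<in> set vs" using Cons.prems(2) by (metis list.set_intros(1) set_mset_mset)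
  then obtain ws ws' where vs: "vs = ws @ u # ws'" by (meson split_list)
  have m: "mset us = mset (ws @ ws')" using Cons.prems(2) vs by simp
  have wB: "set ws \<subseteq> Basis" "set ws' \<subseteq> Basis" and uB: "u \<in> Basis"
    using Cons.prems(3) mset_eq_setD[OF m] by auto
  have h: "smooth_on S (foldr ddir ws' f)" by (rule smooth_on_derivs[OF f wB(2)])
  \<comment> \<open>Commuting \<open>u\<close> with the entries of \<open>ws\<close> one after the
    other brings it to the front of \<open>vs\<close>.\<close>
  have move: "foldr ddir ws (ddir u h) q = ddir u (foldr ddir ws h) q"
    if "smooth_on S h" "q \<in> S" for h q
    using wB(1) that(2)
  proof (induction ws arbitrary: q)
    case (Cons w ws)
    have "ddir w (foldr ddir ws (ddir u h)) q = ddir w (ddir u (foldr ddir ws h)) q"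
      using Cons by (intro ddir_cong[OF S(1)]) auto
    also have "\<dots> = ddir u (ddir w (foldr ddir ws h)) q"
      using Cons.prems uB by (intro ddir_commute[OF smooth_on_derivs[OF that(1)] S(1)]) auto
    finally show ?case by simp
  qed simp
  have "foldr ddir (u # us) f p = ddir u (foldr ddir (ws @ ws') f) p"
    using Cons.IH[OF _ m] Cons.prems by (auto intro!: ddir_cong[OF S(1)])
  also have "\<dots> = foldr ddir vs f p"
    using move[OF h Cons.prems(1)] vs by simp
  finally show ?case .
qed simp

section \<open>Multi-index derivatives as lists of directions\<close>

text \<open>The directions that \<open>mderiv\<close> applies, collected in one list. Derivatives by
  multi-indices are reordered and estimated through such lists, because \<open>derivs_perm\<close>
  applies to them.\<close>

definition mlist :: "('n::finite \<Rightarrow> 'v) \<Rightarrow> 'n multi_index \<Rightarrow> 'v list" where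
  "mlist e j = concat (map (\<lambda>i. replicate (j i) (e i)) coords)"

lemma coords: "distinct (coords :: 'n::finite list)" "set (coords :: 'n list) = UNIV"
proof -
  have "\<exists>is :: 'n list. distinct is \<and> set is = UNIV"
    using finite_distinct_list[of "UNIV :: 'n set"] by auto
  from someI_ex[OF this] show "distinct (coords :: 'n list)" "set (coords :: 'n list) = UNIV"
    unfolding coords_def by auto
qed

lemma mderiv_eq_derivs:
  fixes e :: "'n::finite \<Rightarrow> 'v::real_normed_vector" and f :: "'v \<Rightarrow> 'b::real_normed_vector"
  shows "mderiv e j f = foldr ddir (mlist e j) f"
proof -
  have "foldr (\<lambda>i. ddir (e i) ^^ j i) is f = foldr ddir (concat (map (\<lambda>i. replicate (j i) (e i)) is)) f" for "is"
  proof (induction "is")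
    case (Cons i "is")
    have "foldr ddir (replicate n (e i)) g = (ddir (e i) ^^ n) g" for n and g :: "'v \<Rightarrow> 'b"
      by (induction n) auto
    then show ?case using Cons by simp
  qed simp
  then show ?thesis unfolding mderiv_def mlist_def .
qed

lemma set_mlist: "set (mlist e j) \<subseteq> range e"
  unfolding mlist_def by auto

lemma length_mlist:
  fixes j :: "'n::finite multi_index"
  shows "length (mlist e j) = order_of j"
  unfolding mlist_def order_of_def
  using coords[where 'n='n] sum_list_distinct_conv_sum_set[of "coords :: 'n list" j]
  by (simp add: length_concat comp_def)

lemma count_mlist:
  assumes "inj e"
  shows "count (mset (mlist e j)) (e i) = j i"
proof -
  have "count (mset (concat (map (\<lambda>i. replicate (j i) (e i)) is))) (e i) = (if i \<in> set is then j i else 0)"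
    if "distinct is" for "is"
    using that by (induction "is") (use assms in \<open>auto simp: inj_eq\<close>)
  then show ?thesis unfolding mlist_def using coords by (metis UNIV_I)
qed

lemma mset_mlist:
  assumes "inj e" "set vs \<subseteq> range e"
  shows "mset vs = mset (mlist e (\<lambda>i. count (mset vs) (e i)))"
proof (rule multiset_eqI)
  fix x
  show "count (mset vs) x = count (mset (mlist e (\<lambda>i. count (mset vs) (e i)))) x"
  proof (cases "x \<in> range e")
    case True
    then show ?thesis using count_mlist[OF assms(1)] by auto
  next
    case False
    then show ?thesis using assms(2) set_mlist[of e] by (metis count_eq_zero_iff set_mset_mset subsetD)
  qed
qed

lemma range_unit_vec: "range unit_vec = (Basis :: (real ^ 'n::finite) set)"
  unfolding unit_vec_def Basis_vec_def by auto

lemma inj_units: "inj (unit_vec :: 'n::finite \<Rightarrow> _)" "inj unit_x" "inj unit_y" "inj unit_xi"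
  by (auto simp: inj_def unit_vec_def unit_x_def unit_y_def unit_xi_def axis_eq_axis)

lemma Basis_triple:
  "(Basis :: ((real ^ 'x::finite) \<times> (real ^ 'y::finite) \<times> (real ^ 'z::finite)) set)
    = range unit_x \<union> range unit_y \<union> range unit_xi"
proof -
  have B: "(Basis :: (real ^ 'n::finite) set) = range (\<lambda>i. axis i 1)"
    by (auto simp: Basis_vec_def)
  show ?thesis
    unfolding unit_x_def unit_y_def unit_xi_def Basis_prod_def B image_Un image_image zero_prod_def
    by (simp add: Un_assoc)
qed

lemma unit_Basis [simp]: "unit_vec i \<in> Basis" "unit_x i \<in> Basis" "unit_y i \<in> Basis" "unit_xi i \<in> Basis"
  using Basis_triple range_unit_vec by auto

lemma derivs_eq_mderiv:
  assumes "smooth_on S f" "open S" "p \<in> S" "set vs \<subseteq> Basis"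
  shows "foldr ddir vs f p = mderiv unit_vec (\<lambda>i. count (mset vs) (unit_vec i)) f p"
  unfolding mderiv_eq_derivs using assms mset_mlist[OF inj_units(1), of vs]
  by (intro derivs_perm[OF assms(1-3)]) (auto simp: range_unit_vec)

lemma mderiv3_eq_derivs:
  "mderiv3 j k l f = foldr ddir (mlist unit_x j @ mlist unit_y k @ mlist unit_xi l) f"
  unfolding mderiv3_def mderiv_eq_derivs by simp

lemma units_disjoint:
  "range unit_x \<inter> range unit_y = {}" "range unit_x \<inter> range unit_xi = {}" "range unit_y \<inter> range unit_xi = {}"
  by (auto simp: unit_x_def unit_y_def unit_xi_def axis_eq_0_iff)

lemma mset_filter_split3:
  assumes "set vs \<subseteq> A \<union> B \<union> C" "A \<inter> B = {}" "A \<inter> C = {}" "B \<inter> C = {}"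
  shows "mset vs = mset (filter (\<lambda>v. v \<in> A) vs) + mset (filter (\<lambda>v. v \<in> B) vs) + mset (filter (\<lambda>v. v \<in> C) vs)"
  using assms by (induction vs) auto

text \<open>Sorting the directions into the groups x, y and \<xi>, allowed by
  \<open>derivs_perm\<close>, brings an arbitrary iterated derivative into the order in which the
  seminorms take it.\<close>

lemma derivs_eq_mderiv3:
  assumes "smooth_on S f" "open S" "p \<in> S" "set vs \<subseteq> Basis"
  shows "foldr ddir vs f p = mderiv3 (\<lambda>i. count (mset vs) (unit_x i)) (\<lambda>i. count (mset vs) (unit_y i))
    (\<lambda>i. count (mset vs) (unit_xi i)) f p"
proof -
  let ?x = "filter (\<lambda>v. v \<in> range unit_x) vs" and ?y = "filter (\<lambda>v. v \<in> range unit_y) vs"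
    and ?z = "filter (\<lambda>v. v \<in> range unit_xi) vs"
  have "mset vs = mset ?x + mset ?y + mset ?z"
    by (rule mset_filter_split3[OF assms(4)[unfolded Basis_triple] units_disjoint])
  moreover have "mset ?x = mset (mlist unit_x (\<lambda>i. count (mset ?x) (unit_x i)))"
    by (rule mset_mlist[OF inj_units(2)]) auto
  moreover have "mset ?y = mset (mlist unit_y (\<lambda>i. count (mset ?y) (unit_y i)))"
    by (rule mset_mlist[OF inj_units(3)]) auto
  moreover have "mset ?z = mset (mlist unit_xi (\<lambda>i. count (mset ?z) (unit_xi i)))"
    by (rule mset_mlist[OF inj_units(4)]) auto
  ultimately show ?thesis
    unfolding mderiv3_eq_derivs by (intro derivs_perm[OF assms(1-3) _ assms(4)]) (simp add: add.assoc)
qed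

lemma derivs_add:
  assumes "open S" "smooth_on S f" "smooth_on S g" "set vs \<subseteq> Basis" "p \<in> S"
  shows "foldr ddir vs (\<lambda>z. f z + g z) p = foldr ddir vs f p + foldr ddir vs g p"
  using assms(4,5)
proof (induction vs arbitrary: p)
  case (Cons v vs)
  have "ddir v (foldr ddir vs (\<lambda>z. f z + g z)) p = ddir v (\<lambda>p. foldr ddir vs f p + foldr ddir vs g p) p"
    using Cons by (intro ddir_cong[OF assms(1)]) auto
  also have "\<dots> = ddir v (foldr ddir vs f) p + ddir v (foldr ddir vs g) p"
    using Cons.prems assms
    by (intro ddir_add smooth_on_differentiable_at[OF smooth_on_derivs]) auto
  finally show ?case by simp
qed simp

lemma derivs_bounded_linear:
  assumes "bounded_linear h" "open S" "smooth_on S f" "set vs \<subseteq> Basis" "p \<in> S"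
  shows "foldr ddir vs (\<lambda>z. h (f z)) p = h (foldr ddir vs f p)"
  using assms(4,5)
proof (induction vs arbitrary: p)
  case (Cons v vs)
  have "ddir v (foldr ddir vs (\<lambda>z. h (f z))) p = ddir v (\<lambda>p. h (foldr ddir vs f p)) p"
    using Cons by (intro ddir_cong[OF assms(2)]) auto
  also have "\<dots> = h (ddir v (foldr ddir vs f) p)"
    using Cons.prems assms
    by (intro ddir_bounded_linear smooth_on_differentiable_at[OF smooth_on_derivs]) auto
  finally show ?case by simp
qed simp

lemma derivs_diff:
  assumes "open S" "smooth_on S f" "smooth_on S g" "set vs \<subseteq> Basis" "p \<in> S"
  shows "foldr ddir vs (\<lambda>z. f z - g z) p = foldr ddir vs f p - foldr ddir vs g p"
  using derivs_add[OF assms(1,2) smooth_on_uminus[OF assms(1,3)] assms(4,5)]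
    derivs_bounded_linear[OF bounded_linear_minus[OF bounded_linear_ident] assms(1,3,4,5)] by simp

lemma set_mlist_Basis:
  "set (mlist unit_vec j) \<subseteq> Basis" "set (mlist unit_x j) \<subseteq> Basis"
  "set (mlist unit_y j) \<subseteq> Basis" "set (mlist unit_xi j) \<subseteq> Basis"
  using set_mlist[of unit_vec] set_mlist[of unit_x] set_mlist[of unit_y] set_mlist[of unit_xi]
    range_unit_vec Basis_triple by fastforce+

lemma mderiv_diff:
  fixes f g :: "real ^ 'n::finite \<Rightarrow> complex"
  assumes "open S" "smooth_on S f" "smooth_on S g" "p \<in> S"
  shows "mderiv unit_vec j (\<lambda>z. f z - g z) p = mderiv unit_vec j f p - mderiv unit_vec j g p"
  unfolding mderiv_eq_derivs by (rule derivs_diff[OF assms(1-3) set_mlist_Basis(1) assms(4)])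

lemma continuous_on_mderiv:
  fixes f :: "real ^ 'n::finite \<Rightarrow> complex"
  assumes "smooth_on S f"
  shows "continuous_on S (mderiv unit_vec j f)"
  unfolding mderiv_eq_derivs by (rule smooth_on_continuous_on[OF smooth_on_derivs[OF assms set_mlist_Basis(1)]])

lemma derivs_zero: "foldr ddir vs (\<lambda>_. 0) = (\<lambda>_. 0)"
  by (induction vs) (auto simp: ddir_const)

lemma finite_multi_index: "finite {j :: 'n::finite multi_index. order_of j \<le> N}"
proof (rule finite_subset)
  show "{j :: 'n multi_index. order_of j \<le> N} \<subseteq> (UNIV \<rightarrow>\<^sub>E {..N})"
  proof
    fix j :: "'n multi_index" assume "j \<in> {j. order_of j \<le> N}"
    then have "j i \<le> N" for i
      using member_le_sum[of i UNIV j] by (simp add: order_of_def)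
    then show "j \<in> (UNIV \<rightarrow>\<^sub>E {..N})" by auto
  qed
  show "finite ((UNIV :: 'n set) \<rightarrow>\<^sub>E {..N})" by (intro finite_PiE) auto
qed

section \<open>Exhaustion\<close>

lemma compact_exhaust: "compact (exhaust X m)"
proof (cases "m = 0")
  \<comment> \<open>Here \<open>1 / real m\<close> is 0, so the distance condition is void and the
    norm bound leaves at most the origin.\<close>
  case True
  then have "exhaust X m \<subseteq> {0}" by (auto simp: exhaust_def)
  then show ?thesis by (metis compact_empty compact_sing subset_singleton_iff)
next
  case False
  then have m: "1 / real m > 0" by simp
  \<comment> \<open>For positive \<open>m\<close> membership in \<open>X\<close> is implied by the
    distance condition, since a point outside \<open>X\<close> has distance 0 to itself. What
    remains is an intersection of closed sets.\<close>
  have eq: "exhaust X m = cball 0 (real m) \<inter> (\<Inter>y\<in>-X. {x. 1 / real m \<le> dist x y})"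
  proof safe
    fix x assume "x \<in> cball 0 (real m)" and *: "x \<in> (\<Inter>y\<in>-X. {x. 1 / real m \<le> dist x y})"
    then have "x \<in> X" using m by (cases "x \<in> X") (fastforce dest!: INT_D[of _ _ _ x])+
    with * \<open>x \<in> cball 0 (real m)\<close> show "x \<in> exhaust X m" by (auto simp: exhaust_def)
  qed (auto simp: exhaust_def)
  have "closed {x. 1 / real m \<le> dist x y}" for y :: "real ^ 'a"
    by (intro closed_Collect_le continuous_intros)
  then show ?thesis unfolding eq by (intro compact_Int_closed closed_INT) auto
qed

lemma exhaust_subset: "exhaust X m \<subseteq> X"
  by (auto simp: exhaust_def)

text \<open>Index 0 has to be excluded: \<open>1 / real 0 = 0\<close> voids the distance condition,
  and \<open>exhaust X 0\<close> may contain the origin when \<open>exhaust X 1\<close> does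
  not.\<close>

lemma exhaust_mono:
  assumes "1 \<le> m" "m \<le> n"
  shows "exhaust X m \<subseteq> exhaust X n"
proof -
  have "1 / real n \<le> 1 / real m" using assms by (intro divide_left_mono) auto
  then show ?thesis using assms by (auto simp: exhaust_def intro: order_trans)
qed

lemma compact_subset_exhaust:
  assumes "open X" "compact K" "K \<subseteq> X"
  shows "\<exists>m\<ge>N. 1 \<le> m \<and> K \<subseteq> exhaust X m"
proof -
  obtain R where R: "\<And>x. x \<in> K \<Longrightarrow> norm x \<le> R"
    using compact_imp_bounded[OF assms(2)] bounded_iff by blast
  obtain e where e: "e > 0" "\<And>x y. x \<in> K \<Longrightarrow> y \<notin> X \<Longrightarrow> e \<le> dist x y"
  proof -
    have "closed (- X)" "K \<inter> - X = {}" using assms by auto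
    from separate_compact_closed[OF assms(2) this] show thesis using that by auto
  qed
  obtain k where k: "1 / real (Suc k) < e" using e(1) nat_approx_posE by metis
  define m where "m = Suc k + N + nat \<lceil>R\<rceil>"
  have "1 / real m \<le> 1 / real (Suc k)" unfolding m_def by (intro divide_left_mono) auto
  then have "1 / real m \<le> e" using k by simp
  moreover have "R \<le> real m" unfolding m_def by linarith
  moreover have "1 / real m \<le> dist x y" if "x \<in> K" "y \<notin> X" for x y
    using e(2)[OF that] calculation(1) by linarith
  ultimately have "K \<subseteq> exhaust X m"
    unfolding exhaust_def using R assms(3) by (auto intro: order_trans)
  then show ?thesis by (intro exI[of _ m]) (auto simp: m_def)
qed

lemma finite_subset_exhaust:
  assumes "open X" "x \<in> X"
  shows "\<exists>m\<ge>1. x \<in> exhaust X m"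
  using compact_subset_exhaust[OF assms(1), of "{x}" 1] assms(2) by auto


section \<open>Measurability with respect to seminorm topologies\<close>

lemma space_borel_of [simp]: "space (borel_of T) = topspace T"
  unfolding borel_of_def by (simp add: space_measure_of_conv)

lemma sets_borel_of: "sets (borel_of T) = sigma_sets (topspace T) {U. openin T U}"
  unfolding borel_of_def using openin_subset by (intro sets_measure_of) auto

lemma measurable_borel_ofI:
  assumes "\<And>\<omega>. \<omega> \<in> space P \<Longrightarrow> F \<omega> \<in> topspace T"
    and "\<And>U. openin T U \<Longrightarrow> F -` U \<inter> space P \<in> sets P"
  shows "F \<in> measurable P (borel_of T)"
  unfolding borel_of_def
  by (rule measurable_measure_of) (use assms in \<open>auto dest: openin_subset\<close>)

lemma measurable_borel_of_open:
  assumes "F \<in> measurable P (borel_of T)" "openin T U"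
  shows "F -` U \<inter> space P \<in> sets P"
  using assms by (intro measurable_sets[OF assms(1)]) (auto simp: sets_borel_of)

lemma measurable_borel_of_subtopology:
  assumes F: "F \<in> measurable P (borel_of (subtopology T W))"
  shows "F \<in> measurable P (borel_of T)"
proof (rule measurable_borel_ofI)
  have sp: "F \<omega> \<in> topspace T \<inter> W" if "\<omega> \<in> space P" for \<omega>
    using measurable_space[OF F that] by simp
  then show "F \<omega> \<in> topspace T" if "\<omega> \<in> space P" for \<omega> using that by blast
  fix U assume "openin T U"
  then have "F -` (U \<inter> W) \<inter> space P \<in> sets P"
    by (intro measurable_borel_of_open[OF F]) (auto simp: openin_subtopology)
  moreover have "F -` (U \<inter> W) \<inter> space P = F -` U \<inter> space P" using sp by auto
  ultimately show "F -` U \<inter> space P \<in> sets P" by simp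
qed

lemma topspace_seminorm_topology:
  assumes "\<And>m. p m (\<lambda>_. 0) = 0"
  shows "topspace (seminorm_topology V p) = V"
  unfolding seminorm_topology_def topology_generated_by_topspace
proof (intro equalityI subsetI)
  fix f assume "f \<in> V"
  then have "f \<in> {g \<in> V. p (1::nat) (\<lambda>z. g z - f z) < ennreal 1}" using assms by simp
  moreover have "{g \<in> V. p (1::nat) (\<lambda>z. g z - f z) < ennreal 1}
      \<in> {{g \<in> V. p m (\<lambda>z. g z - f z) < ennreal \<epsilon>} | f m \<epsilon>. f \<in> V \<and> 1 \<le> m \<and> 0 < \<epsilon>}"
    using \<open>f \<in> V\<close> by (intro CollectI exI[of _ f] exI[of _ "1::nat"] exI[of _ "1::real"]) auto
  ultimately show "f \<in> \<Union>{{g \<in> V. p m (\<lambda>z. g z - f z) < ennreal \<epsilon>} | f m \<epsilon>. f \<in> V \<and> 1 \<le> m \<and> 0 < \<epsilon>}"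
    by (rule UnionI[rotated])
qed auto

text \<open>Serves the point evaluations of amplitudes and phases and also the pairing with a
  distribution. Continuity is tested with a single seminorm at each member of \<open>V\<close>, and
  linearity of \<open>l\<close> is not involved.\<close>

lemma measurable_seminorm_functional:
  fixes l :: "('a \<Rightarrow> 'b::real_vector) \<Rightarrow> 'c::metric_space"
  assumes F: "F \<in> measurable P (borel_of (seminorm_topology V p))"
    and p0: "\<And>m. p m (\<lambda>_. 0) = 0"
    and cont: "\<And>f e. f \<in> V \<Longrightarrow> 0 < e \<Longrightarrow> \<exists>m\<ge>1. \<exists>\<delta>>0. \<forall>g\<in>V. p m (\<lambda>z. g z - f z) < ennreal \<delta> \<longrightarrow> dist (l g) (l f) < e"
  shows "(\<lambda>\<omega>. l (F \<omega>)) \<in> borel_measurable P"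
proof (rule borel_measurableI)
  let ?T = "seminorm_topology V p"
  fix S :: "'c set" assume S: "open S"
  have "openin ?T {g \<in> V. l g \<in> S}"
  proof (subst openin_subopen, safe)
    fix f assume f: "f \<in> V" "l f \<in> S"
    then obtain e where e: "e > 0" "ball (l f) e \<subseteq> S" using S openE by blast
    then obtain m \<delta> where *: "1 \<le> m" "0 < \<delta>" "\<And>g. g \<in> V \<Longrightarrow> p m (\<lambda>z. g z - f z) < ennreal \<delta> \<Longrightarrow> dist (l g) (l f) < e"
      using cont[OF f(1), of e] by blast
    have "openin ?T {g \<in> V. p m (\<lambda>z. g z - f z) < ennreal \<delta>}"
      unfolding seminorm_topology_def using f(1) * by (intro topology_generated_by_Basis) blast
    moreover have "{g \<in> V. p m (\<lambda>z. g z - f z) < ennreal \<delta>} \<subseteq> {g \<in> V. l g \<in> S}"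
      using *(3) e(2) by (force simp: dist_commute subset_iff)
    ultimately show "\<exists>T. openin ?T T \<and> f \<in> T \<and> T \<subseteq> {g \<in> V. l g \<in> S}"
      using f(1) *(2) p0 by (intro exI[of _ "{g \<in> V. p m (\<lambda>z. g z - f z) < ennreal \<delta>}"]) auto
  qed
  then have "F -` {g \<in> V. l g \<in> S} \<inter> space P \<in> sets P" by (rule measurable_borel_of_open[OF F])
  moreover have "F \<omega> \<in> V" if "\<omega> \<in> space P" for \<omega>
    using measurable_space[OF F that] topspace_seminorm_topology[of p V] p0 by simp
  then have "F -` {g \<in> V. l g \<in> S} \<inter> space P = (\<lambda>\<omega>. l (F \<omega>)) -` S \<inter> space P" by auto
  ultimately show "(\<lambda>\<omega>. l (F \<omega>)) -` S \<inter> space P \<in> sets P" by simp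
qed

text \<open>Separability and pseudometrizability in a form that can be checked for suprema of
  derivatives, which may be infinite. The triangle inequality and symmetry are asked for differences
  of members only, since derivatives are additive only on smooth functions; monotonicity starts at
  index 1, as in \<open>exhaust_mono\<close>.\<close>

locale separable_seminorms =
  fixes V :: "('a \<Rightarrow> 'b::real_vector) set" and p :: "nat \<Rightarrow> ('a \<Rightarrow> 'b) \<Rightarrow> ennreal" and D :: "('a \<Rightarrow> 'b) set"
  assumes zero: "\<And>m. p m (\<lambda>_. 0) = 0"
    and triangle: "\<And>m f g h. f \<in> V \<Longrightarrow> g \<in> V \<Longrightarrow> h \<in> V \<Longrightarrow>
      p m (\<lambda>z. h z - f z) \<le> p m (\<lambda>z. h z - g z) + p m (\<lambda>z. g z - f z)"
    and commute: "\<And>m f g. f \<in> V \<Longrightarrow> g \<in> V \<Longrightarrow> p m (\<lambda>z. f z - g z) = p m (\<lambda>z. g z - f z)"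
    and mono: "\<And>m n f. 1 \<le> m \<Longrightarrow> m \<le> n \<Longrightarrow> p m f \<le> p n f"
    and countable: "countable D" and D: "D \<subseteq> V"
    and dense: "\<And>f m e. f \<in> V \<Longrightarrow> 0 < e \<Longrightarrow> \<exists>d\<in>D. p m (\<lambda>z. f z - d z) < ennreal e"
begin

text \<open>The generating balls form a subbasis with arbitrary centres and indices. Monotonicity in
  the index takes care of intersections, and the triangle inequality recentres a ball at
  \<open>g\<close> with the radius that is left.\<close>

lemma open_contains_ball:
  assumes "openin (seminorm_topology V p) U" "g \<in> U"
  shows "\<exists>m\<ge>1. \<exists>\<epsilon>>0. {h \<in> V. p m (\<lambda>z. h z - g z) < ennreal \<epsilon>} \<subseteq> U"
proof -
  let ?S = "{{g \<in> V. p m (\<lambda>z. g z - f z) < ennreal \<epsilon>} | f m \<epsilon>. f \<in> V \<and> 1 \<le> m \<and> 0 < \<epsilon>}"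
  have "generate_topology_on ?S U"
    using assms(1) unfolding seminorm_topology_def openin_topology_generated_by_iff .
  then show ?thesis using assms(2)
  proof (induction arbitrary: g)
    case (Int a b)
    obtain m e where 1: "1 \<le> m" "0 < e" "{h \<in> V. p m (\<lambda>z. h z - g z) < ennreal e} \<subseteq> a" using Int by blast
    obtain n d where 2: "1 \<le> n" "0 < d" "{h \<in> V. p n (\<lambda>z. h z - g z) < ennreal d} \<subseteq> b" using Int by blast
    have "{h \<in> V. p (max m n) (\<lambda>z. h z - g z) < ennreal (min e d)} \<subseteq> a \<inter> b"
    proof safe
      fix h assume h: "h \<in> V" "p (max m n) (\<lambda>z. h z - g z) < ennreal (min e d)"
      have "p m (\<lambda>z. h z - g z) < ennreal e"
        using le_less_trans[OF mono[of m "max m n"] less_le_trans[OF h(2), of "ennreal e"]] 1 by (simp add: ennreal_leI)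
      then show "h \<in> a" using 1 h by blast
      have "p n (\<lambda>z. h z - g z) < ennreal d"
        using le_less_trans[OF mono[of n "max m n"] less_le_trans[OF h(2), of "ennreal d"]] 2 by (simp add: ennreal_leI)
      then show "h \<in> b" using 2 h by blast
    qed
    then show ?case using 1 2 by (intro exI[of _ "max m n"] conjI exI[of _ "min e d"]) auto
  next
    case (UN K)
    then obtain k where "k \<in> K" "g \<in> k" by blast
    then show ?case using UN.IH[of k g] by (meson Union_upper subset_trans)
  next
    case (Basis s)
    then obtain f m e where s: "s = {g \<in> V. p m (\<lambda>z. g z - f z) < ennreal e}" "f \<in> V" "1 \<le> m" "0 < e" by blast
    have g: "g \<in> V" "p m (\<lambda>z. g z - f z) < ennreal e" using Basis s by auto
    obtain r where r: "p m (\<lambda>z. g z - f z) = ennreal r" "0 \<le> r" "r < e"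
      using g(2) by (cases "p m (\<lambda>z. g z - f z)") (auto simp: ennreal_less_iff)
    have "{h \<in> V. p m (\<lambda>z. h z - g z) < ennreal (e - r)} \<subseteq> s"
    proof
      fix h assume h: "h \<in> {h \<in> V. p m (\<lambda>z. h z - g z) < ennreal (e - r)}"
      have "p m (\<lambda>z. h z - f z) \<le> p m (\<lambda>z. h z - g z) + ennreal r"
        using triangle[OF s(2) g(1), of h m] h r by simp
      also have "\<dots> < ennreal (e - r) + ennreal r"
        using h by (simp add: ennreal_add_eq_top ennreal_add_left_cancel_less add.commute[of _ "ennreal r"])
      also have "\<dots> = ennreal e" using r by (simp flip: ennreal_plus)
      finally show "h \<in> s" using h s by simp
    qed
    then show ?case using s(3) r(3) by (intro exI[of _ m] conjI exI[of _ "e - r"]) auto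
  qed simp
qed

text \<open>Every open set is a countable union of balls with centres in \<open>D\<close> and radii
  \<open>1 / real (Suc k)\<close>, and membership of \<open>F \<omega>\<close> in one of these is a
  condition on one measurable seminorm. Taking the radius below \<open>e / 2\<close> keeps the ball
  around \<open>d\<close> inside the given ball around \<open>g\<close>.\<close>

lemma measurable_into:
  assumes F: "\<And>\<omega>. \<omega> \<in> space P \<Longrightarrow> F \<omega> \<in> V"
    and meas: "\<And>m d. d \<in> D \<Longrightarrow> (\<lambda>\<omega>. p m (\<lambda>z. F \<omega> z - d z)) \<in> borel_measurable P"
  shows "F \<in> measurable P (borel_of (seminorm_topology V p))"
proof (rule measurable_borel_ofI)
  show "F \<omega> \<in> topspace (seminorm_topology V p)" if "\<omega> \<in> space P" for \<omega>
    using F[OF that] by (simp add: topspace_seminorm_topology zero)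
  fix U assume U: "openin (seminorm_topology V p) U"
  define B where "B = (\<lambda>(d, m, k). {h \<in> V. p m (\<lambda>z. h z - d z) < ennreal (1 / real (Suc k))})"
  define I where "I = {i \<in> D \<times> (UNIV :: nat set) \<times> (UNIV :: nat set). B i \<subseteq> U}"
  have "U = (\<Union>i\<in>I. B i)"
  proof (rule equalityI)
    show "U \<subseteq> (\<Union>i\<in>I. B i)"
    proof
      fix g assume g: "g \<in> U"
      obtain m e where me: "1 \<le> m" "0 < e" "{h \<in> V. p m (\<lambda>z. h z - g z) < ennreal e} \<subseteq> U"
        using open_contains_ball[OF U g] by blast
      have gV: "g \<in> V" using openin_subset[OF U] g by (auto simp: topspace_seminorm_topology zero)
      obtain k where k: "1 / real (Suc k) < e / 2" using me(2) nat_approx_posE half_gt_zero by metis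
      obtain d where d: "d \<in> D" "p m (\<lambda>z. g z - d z) < ennreal (1 / real (Suc k))"
        using dense[OF gV, of "1 / real (Suc k)" m] by auto
      have "B (d, m, k) \<subseteq> U"
      proof
        fix h assume h: "h \<in> B (d, m, k)"
        then have hV: "h \<in> V" by (simp add: B_def)
        have "p m (\<lambda>z. h z - g z) \<le> p m (\<lambda>z. h z - d z) + p m (\<lambda>z. d z - g z)"
          using triangle[OF gV _ hV] d D by blast
        also have "\<dots> \<le> ennreal (1 / real (Suc k)) + ennreal (1 / real (Suc k))"
          using h d gV D commute[of g d m] by (intro add_mono) (auto simp: B_def less_imp_le subset_iff)
        also have "\<dots> < ennreal e" using k by (simp add: ennreal_less_iff flip: ennreal_plus)
        finally show "h \<in> U" using me(3) hV by blast
      qed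
      then have "(d, m, k) \<in> I" unfolding I_def using d(1) by blast
      moreover have "g \<in> B (d, m, k)" using gV d by (simp add: B_def)
      ultimately show "g \<in> (\<Union>i\<in>I. B i)" by (rule UN_I)
    qed
    show "(\<Union>i\<in>I. B i) \<subseteq> U" unfolding I_def by blast
  qed
  then have eq: "F -` U \<inter> space P = (\<Union>i\<in>I. F -` B i \<inter> space P)" by blast
  have "countable I" unfolding I_def using countable by (intro countable_Collect countable_SIGMA) auto
  moreover have "F -` B i \<inter> space P \<in> sets P" if "i \<in> I" for i
  proof -
    obtain d m k where i0: "i = (d, m, k)" using prod_cases3 by blast
    then have i: "i = (d, m, k)" "d \<in> D" using that unfolding I_def by blast+
    have "F -` B i \<inter> space P = {\<omega> \<in> space P. p m (\<lambda>z. F \<omega> z - d z) < ennreal (1 / real (Suc k))}"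
      using F i by (auto simp: B_def)
    also have "\<dots> \<in> sets P" using meas[OF i(2)] by measurable
    finally show ?thesis .
  qed
  ultimately show "F -` U \<inter> space P \<in> sets P" unfolding eq by (rule sets.countable_UN'')
qed

end

text \<open>
  A function is recorded, up to a small error, by finitely many rational values on a net that is fine
  compared with its modulus of continuity; picking one function per record gives a dense set.
\<close>

lemma countable_dense_selection:
  fixes V :: "'f set" and D :: "'j \<Rightarrow> 'f \<Rightarrow> 'a::metric_space \<Rightarrow> complex"
  assumes J: "\<And>m::nat. finite (J m)" and K: "\<And>m. compact (K m)"
    and cont: "\<And>f m j. f \<in> V \<Longrightarrow> j \<in> J m \<Longrightarrow> continuous_on (K m) (D j f)"
  shows "\<exists>C\<subseteq>V. countable C \<and> (\<forall>f\<in>V. \<forall>m. \<forall>e>0. \<exists>c\<in>C. \<forall>j\<in>J m. \<forall>x\<in>K m. dist (D j f x) (D j c x) < e)"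
proof -
  have "\<exists>N. finite N \<and> N \<subseteq> K m \<and> K m \<subseteq> (\<Union>x\<in>N. ball x (1 / real (Suc n)))" for m n
    using seq_compact_imp_totally_bounded[OF compact_imp_seq_compact[OF K[of m]]]
    by (elim allE[of _ "1 / real (Suc n)"]) simp
  then obtain N where N: "\<And>m n. finite (N m n)" "\<And>m n. N m n \<subseteq> K m"
    "\<And>m n. K m \<subseteq> (\<Union>x\<in>N m n. ball x (1 / real (Suc n)))" by metis
  obtain Q :: "complex set" where Q: "countable Q" "\<And>U. open U \<Longrightarrow> U \<noteq> {} \<Longrightarrow> \<exists>q\<in>Q. q \<in> U"
    using countable_dense_setE by metis
  define R where "R = (\<lambda>(m, n, k, q) f. f \<in> V
      \<and> (\<forall>j\<in>J m. \<forall>x\<in>N m n. dist (D j f x) (q (j, x)) < 1 / real (Suc k))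
      \<and> (\<forall>j\<in>J m. \<forall>x\<in>K m. \<forall>y\<in>K m. dist x y < 1 / real (Suc n) \<longrightarrow> dist (D j f x) (D j f y) < 1 / real (Suc k)))"
  define I where "I = (\<Union>m n. {m} \<times> {n} \<times> (UNIV :: nat set) \<times> (\<Pi>\<^sub>E p\<in>J m \<times> N m n. Q))"
  define C where "C = (\<lambda>i. SOME f. R i f) ` {i \<in> I. \<exists>f. R i f}"
  have "countable (\<Pi>\<^sub>E p\<in>J m \<times> N m n. Q)" for m n
    using J N Q by (intro countable_PiE) auto
  then have "countable I" unfolding I_def by (intro countable_UN countable_SIGMA) auto
  then have "countable C" unfolding C_def by (intro countable_image countable_Collect)
  moreover have RS: "R i (SOME f. R i f)" if "\<exists>f. R i f" for i using someI_ex[OF that] .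
  then have "C \<subseteq> V" unfolding C_def by (fastforce simp: R_def)
  moreover have "\<exists>c\<in>C. \<forall>j\<in>J m. \<forall>x\<in>K m. dist (D j f x) (D j c x) < e" if f: "f \<in> V" and e: "e > 0" for f m e
  proof -
    \<comment> \<open>Four errors are added at the end: a move to the net and back, for
      \<open>f\<close> and for \<open>c\<close>, and the distance of either one to the recorded
      value.\<close>
    obtain k where k: "1 / real (Suc k) < e / 4" using e nat_approx_posE[of "e / 4"] by (metis divide_pos_pos zero_less_numeral)
    have "\<forall>j\<in>J m. \<exists>d>0. \<forall>y\<in>K m. \<forall>x\<in>K m. dist x y < d \<longrightarrow> dist (D j f x) (D j f y) < 1 / real (Suc k)"
    proof
      fix j assume j: "j \<in> J m"
      have "uniformly_continuous_on (K m) (D j f)" using compact_uniformly_continuous[OF cont[OF f j] K] .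
      then show "\<exists>d>0. \<forall>y\<in>K m. \<forall>x\<in>K m. dist x y < d \<longrightarrow> dist (D j f x) (D j f y) < 1 / real (Suc k)"
        unfolding uniformly_continuous_on_def by (elim allE[of _ "1 / real (Suc k)"]) simp
    qed
    then obtain d where d: "\<And>j. j \<in> J m \<Longrightarrow> d j > 0"
      "\<And>j x y. j \<in> J m \<Longrightarrow> x \<in> K m \<Longrightarrow> y \<in> K m \<Longrightarrow> dist x y < d j \<Longrightarrow> dist (D j f x) (D j f y) < 1 / real (Suc k)"
      by metis
    have "\<exists>d0>0. \<forall>j\<in>J m. d0 \<le> d j"
      using J[of m] d(1) by (intro exI[of _ "Min (insert 1 (d ` J m))"]) auto
    then obtain d0 where d0: "d0 > 0" "\<And>j. j \<in> J m \<Longrightarrow> d0 \<le> d j" by blast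
    obtain n where n: "1 / real (Suc n) < d0" using d0(1) nat_approx_posE by metis
    have "\<exists>q\<in>Q. q \<in> ball (D (fst p) f (snd p)) (1 / real (Suc k))" for p
      by (rule Q(2)) (auto simp: ball_eq_empty)
    then obtain q0 where q0: "\<And>p. q0 p \<in> Q" "\<And>p. dist (D (fst p) f (snd p)) (q0 p) < 1 / real (Suc k)"
      unfolding mem_ball by metis
    define q where "q = restrict q0 (J m \<times> N m n)"
    define i where "i = (m, n, k, q)"
    have iI: "i \<in> I" unfolding I_def i_def q_def using q0(1) by auto
    have "dist (D j f x) (q (j, x)) < 1 / real (Suc k)" if "j \<in> J m" "x \<in> N m n" for j x
      using q0(2)[of "(j, x)"] that by (simp add: q_def)
    moreover have "dist (D j f x) (D j f y) < 1 / real (Suc k)"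
      if "j \<in> J m" "x \<in> K m" "y \<in> K m" "dist x y < 1 / real (Suc n)" for j x y
      using d(2)[OF that(1-3)] d0(2)[OF that(1)] n that(4) by linarith
    ultimately have "R i f" unfolding R_def i_def prod.case using f by blast
    then have ex: "\<exists>f. R i f" by blast
    define c where "c = (SOME f. R i f)"
    have Rc: "R i c" unfolding c_def by (rule RS[OF ex])
    have cC: "c \<in> C" unfolding C_def c_def using iI ex by blast
    have "dist (D j f x) (D j c x) < e" if j: "j \<in> J m" and x: "x \<in> K m" for j x
    proof -
      obtain y where y: "y \<in> N m n" "dist y x < 1 / real (Suc n)" using N(3)[of m n] x by force
      have yK: "y \<in> K m" using N(2) y by blast
      have "dist (D j f x) (D j f y) < 1 / real (Suc k)" "dist (D j c y) (D j c x) < 1 / real (Suc k)"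
        using \<open>R i f\<close> Rc j x yK y(2) unfolding R_def i_def by (auto simp: dist_commute)
      moreover have "dist (D j f y) (q (j, y)) < 1 / real (Suc k)" "dist (D j c y) (q (j, y)) < 1 / real (Suc k)"
        using \<open>R i f\<close> Rc j y unfolding R_def i_def by auto
      moreover have "dist (D j f x) (D j c x) \<le> dist (D j f x) (D j f y) + dist (D j f y) (q (j, y))
          + dist (D j c y) (q (j, y)) + dist (D j c y) (D j c x)"
        using dist_triangle[of "D j f x" "D j c x" "D j f y"] dist_triangle[of "D j f y" "D j c x" "q (j, y)"]
          dist_triangle[of "q (j, y)" "D j c x" "D j c y"] by (simp add: dist_commute)
      ultimately show ?thesis using k by linarith
    qed
    then show ?thesis using cC by blast
  qed
  ultimately show ?thesis by blast
qed

section \<open>Measurable derivatives and maps into the space of smooth functions\<close>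

lemma Sup_ennreal_dense:
  fixes g :: "'a::metric_space \<Rightarrow> ennreal"
  assumes "E \<subseteq> A" "A \<subseteq> closure E" "continuous_on A g"
  shows "Sup (g ` A) = Sup (g ` E)"
proof (rule antisym)
  show "Sup (g ` E) \<le> Sup (g ` A)" using assms(1) by (intro Sup_subset_mono image_mono)
  show "Sup (g ` A) \<le> Sup (g ` E)"
  proof (rule SUP_least)
    fix x assume x: "x \<in> A"
    then obtain s where s: "\<And>n. s n \<in> E" "s \<longlonglongrightarrow> x" using assms(2) closure_sequential by (metis subsetD)
    have "(\<lambda>n. g (s n)) \<longlonglongrightarrow> g x"
      using assms(3) s x subsetD[OF assms(1) s(1)] unfolding continuous_on_sequentially comp_def by blast
    then show "g x \<le> Sup (g ` E)" by (rule LIMSEQ_le_const2) (auto intro!: Sup_upper s)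
  qed
qed

lemma ddir_tendsto:
  assumes "f differentiable (at p)"
  shows "((\<lambda>h. (f (p + h *\<^sub>R v) - f p) /\<^sub>R h) \<longlongrightarrow> ddir v f p) (at 0)"
proof -
  have "((\<lambda>t. f (p + t *\<^sub>R v)) has_derivative (\<lambda>h. h *\<^sub>R ddir v f p)) (at 0)"
    using has_vector_derivative_line[of f p 0 v] assms by (simp add: has_vector_derivative_def)
  then have "((\<lambda>h. norm (f (p + h *\<^sub>R v) - f p - h *\<^sub>R ddir v f p) / norm h) \<longlongrightarrow> 0) (at 0)"
    unfolding has_derivative_at by simp
  moreover have "eventually (\<lambda>h. norm (f (p + h *\<^sub>R v) - f p - h *\<^sub>R ddir v f p) / norm h
      = norm ((f (p + h *\<^sub>R v) - f p) /\<^sub>R h - ddir v f p)) (at 0)"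
    unfolding eventually_at_filter
  proof (intro always_eventually allI impI)
    fix h :: real assume "h \<noteq> 0"
    then have "(f (p + h *\<^sub>R v) - f p) /\<^sub>R h - ddir v f p = (f (p + h *\<^sub>R v) - f p - h *\<^sub>R ddir v f p) /\<^sub>R h"
      by (simp add: scaleR_right_diff_distrib)
    then show "norm (f (p + h *\<^sub>R v) - f p - h *\<^sub>R ddir v f p) / norm h
      = norm ((f (p + h *\<^sub>R v) - f p) /\<^sub>R h - ddir v f p)" by (simp add: divide_inverse mult.commute)
  qed
  ultimately have "((\<lambda>h. norm ((f (p + h *\<^sub>R v) - f p) /\<^sub>R h - ddir v f p)) \<longlongrightarrow> 0) (at 0)"
    by (rule Lim_transform_eventually)
  then show ?thesis by (rule LIM_zero_cancel[OF tendsto_norm_zero_cancel])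
qed

lemma measurable_ddir:
  fixes f :: "'w \<Rightarrow> 'v::euclidean_space \<Rightarrow> 'b::{real_normed_vector, second_countable_topology}"
  assumes S: "open S" "p \<in> S" and meas: "\<And>q. q \<in> S \<Longrightarrow> (\<lambda>\<omega>. f \<omega> q) \<in> borel_measurable P"
    and d: "\<And>\<omega>. \<omega> \<in> space P \<Longrightarrow> f \<omega> differentiable (at p)"
  shows "(\<lambda>\<omega>. ddir v (f \<omega>) p) \<in> borel_measurable P"
proof -
  have lim: "(\<lambda>n. 1 / real (Suc n)) \<longlonglongrightarrow> 0" by (rule LIMSEQ_Suc[OF lim_1_over_n])
  then have "(\<lambda>n. p + (1 / real (Suc n)) *\<^sub>R v) \<longlonglongrightarrow> p"
    using tendsto_add[OF tendsto_const[of p] tendsto_scaleR[OF lim tendsto_const[of v]]] by simp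
  then have "eventually (\<lambda>n. p + (1 / real (Suc n)) *\<^sub>R v \<in> S) sequentially"
    by (rule topological_tendstoD[OF _ S])
  then obtain N where N: "\<And>n. n \<ge> N \<Longrightarrow> p + (1 / real (Suc n)) *\<^sub>R v \<in> S"
    by (auto simp: eventually_sequentially)
  \<comment> \<open>The shift by \<open>N\<close> keeps every evaluation point inside
    \<open>S\<close>, the only place where measurability is known.\<close>
  define h where "h n = 1 / real (Suc (n + N))" for n
  have h: "h \<longlonglongrightarrow> 0" "\<And>n. h n \<noteq> 0" unfolding h_def using LIMSEQ_ignore_initial_segment[OF lim] by auto
  show ?thesis
  proof (rule borel_measurable_LIMSEQ_metric)
    show "(\<lambda>\<omega>. (f \<omega> (p + h n *\<^sub>R v) - f \<omega> p) /\<^sub>R h n) \<in> borel_measurable P" for n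
      using meas[OF N[of "n + N"]] meas[OF S(2)] unfolding h_def by measurable
    show "(\<lambda>n. (f \<omega> (p + h n *\<^sub>R v) - f \<omega> p) /\<^sub>R h n) \<longlonglongrightarrow> ddir v (f \<omega>) p" if "\<omega> \<in> space P" for \<omega>
      by (rule filterlim_compose[OF ddir_tendsto[OF d[OF that]]]) (use h in \<open>simp add: filterlim_at\<close>)
  qed
qed

lemma measurable_derivs:
  fixes f :: "'w \<Rightarrow> 'v::euclidean_space \<Rightarrow> 'b::{real_normed_vector, second_countable_topology}"
  assumes "open S" "p \<in> S" "\<And>q. q \<in> S \<Longrightarrow> (\<lambda>\<omega>. f \<omega> q) \<in> borel_measurable P"
    and "\<And>\<omega>. \<omega> \<in> space P \<Longrightarrow> smooth_on S (f \<omega>)" "set vs \<subseteq> Basis"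
  shows "(\<lambda>\<omega>. foldr ddir vs (f \<omega>) p) \<in> borel_measurable P"
  using assms(5,2)
proof (induction vs arbitrary: p)
  case (Cons v vs)
  have "(\<lambda>\<omega>. ddir v (foldr ddir vs (f \<omega>)) p) \<in> borel_measurable P"
    using Cons assms(1,4)
    by (intro measurable_ddir[OF assms(1)] smooth_on_differentiable_at[OF smooth_on_derivs]) auto
  then show ?case by simp
qed (simp add: assms(3))

lemma smooth_seminorm_zero: "smooth_seminorm X m (\<lambda>_. 0) = 0"
proof -
  have "mderiv unit_vec j (\<lambda>_. 0 :: complex) x = 0" for j :: "'a multi_index" and x
    by (simp add: mderiv_eq_derivs derivs_zero)
  then show ?thesis unfolding smooth_seminorm_def by (auto intro!: antisym Sup_least)
qed

lemma smooth_seminorm_upper: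
  "x \<in> exhaust X m \<Longrightarrow> order_of j \<le> m \<Longrightarrow> ennreal (norm (mderiv unit_vec j v x)) \<le> smooth_seminorm X m v"
  unfolding smooth_seminorm_def by (intro Sup_upper) blast

lemma smooth_seminorm_least:
  "(\<And>x j. x \<in> exhaust X m \<Longrightarrow> order_of j \<le> m \<Longrightarrow> ennreal (norm (mderiv unit_vec j v x)) \<le> B)
    \<Longrightarrow> smooth_seminorm X m v \<le> B"
  unfolding smooth_seminorm_def by (intro Sup_least) blast

lemma smooth_seminorm_less:
  assumes "smooth_seminorm X m v < ennreal e" "x \<in> exhaust X m" "order_of j \<le> m"
  shows "norm (mderiv unit_vec j v x) < e"
  using le_less_trans[OF smooth_seminorm_upper[OF assms(2,3)] assms(1)] by (simp add: ennreal_less_iff)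

lemma countable_dense_smooth:
  fixes V :: "(real ^ 'x::finite \<Rightarrow> complex) set"
  assumes "\<And>v. v \<in> V \<Longrightarrow> smooth_on S v" "\<And>m::nat. compact (K m)" "\<And>m. K m \<subseteq> S"
  shows "\<exists>D\<subseteq>V. countable D \<and> (\<forall>f\<in>V. \<forall>m. \<forall>e>0. \<exists>d\<in>D. \<forall>j\<in>{j. order_of j \<le> m}. \<forall>x\<in>K m.
      dist (mderiv unit_vec j f x) (mderiv unit_vec j d x) < e)"
proof (rule countable_dense_selection)
  fix f :: "real ^ 'x \<Rightarrow> complex" and m :: nat and j :: "'x multi_index" assume "f \<in> V" "j \<in> {j. order_of j \<le> m}"
  then show "continuous_on (K m) (mderiv unit_vec j f)"
    using continuous_on_subset[OF continuous_on_mderiv assms(3)] assms(1) by blast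
qed (use assms finite_multi_index in auto)

lemma measurable_smooth_topology:
  fixes X :: "(real ^ 'x::finite) set"
  assumes X: "open X" and F: "\<And>\<omega>. \<omega> \<in> space P \<Longrightarrow> F \<omega> \<in> smooth_functions X"
    and meas: "\<And>x. x \<in> X \<Longrightarrow> (\<lambda>\<omega>. F \<omega> x) \<in> borel_measurable P"
  shows "F \<in> measurable P (borel_of (smooth_topology X))"
proof -
  let ?V = "smooth_functions X"
  have V: "smooth_on X v" if "v \<in> ?V" for v using that by (simp add: smooth_functions_def)
  have "\<exists>D\<subseteq>?V. countable D \<and> (\<forall>f\<in>?V. \<forall>m. \<forall>e>0. \<exists>d\<in>D. \<forall>j\<in>{j. order_of j \<le> m}. \<forall>x\<in>exhaust X m.
      dist (mderiv unit_vec j f x) (mderiv unit_vec j d x) < e)"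
    by (rule countable_dense_smooth[OF V compact_exhaust exhaust_subset])
  then obtain D where D: "D \<subseteq> ?V" "countable D" and
    dense0: "\<forall>f\<in>?V. \<forall>m. \<forall>e>0. \<exists>d\<in>D. \<forall>j\<in>{j. order_of j \<le> m}. \<forall>x\<in>exhaust X m.
      dist (mderiv unit_vec j f x) (mderiv unit_vec j d x) < e"
    by (elim exE conjE) (rule that)
  note dense = dense0[rule_format]
  have md: "mderiv unit_vec j (\<lambda>z. f z - g z) x = mderiv unit_vec j f x - mderiv unit_vec j g x"
    if "f \<in> ?V" "g \<in> ?V" "x \<in> exhaust X m" for f g x j m
    using mderiv_diff[OF X V V] that exhaust_subset[of X m] by blast
  interpret separable_seminorms ?V "smooth_seminorm X" D
  proof
    show "smooth_seminorm X m (\<lambda>_. 0) = 0" for m by (rule smooth_seminorm_zero)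
    show "smooth_seminorm X m (\<lambda>z. h z - f z) \<le> smooth_seminorm X m (\<lambda>z. h z - g z) + smooth_seminorm X m (\<lambda>z. g z - f z)"
      if "f \<in> ?V" "g \<in> ?V" "h \<in> ?V" for m f g h
    proof (rule smooth_seminorm_least)
      fix x and j :: "'x multi_index" assume x: "x \<in> exhaust X m" "order_of j \<le> m"
      have "norm (mderiv unit_vec j (\<lambda>z. h z - f z) x)
          \<le> norm (mderiv unit_vec j (\<lambda>z. h z - g z) x) + norm (mderiv unit_vec j (\<lambda>z. g z - f z) x)"
        using md that x norm_triangle_ineq[of "mderiv unit_vec j h x - mderiv unit_vec j g x" "mderiv unit_vec j g x - mderiv unit_vec j f x"]
        by simp
      then have "ennreal (norm (mderiv unit_vec j (\<lambda>z. h z - f z) x))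
          \<le> ennreal (norm (mderiv unit_vec j (\<lambda>z. h z - g z) x)) + ennreal (norm (mderiv unit_vec j (\<lambda>z. g z - f z) x))"
        by (simp add: ennreal_leI flip: ennreal_plus)
      also have "\<dots> \<le> smooth_seminorm X m (\<lambda>z. h z - g z) + smooth_seminorm X m (\<lambda>z. g z - f z)"
        by (intro add_mono smooth_seminorm_upper x)
      finally show "ennreal (norm (mderiv unit_vec j (\<lambda>z. h z - f z) x))
          \<le> smooth_seminorm X m (\<lambda>z. h z - g z) + smooth_seminorm X m (\<lambda>z. g z - f z)" .
    qed
    have le: "smooth_seminorm X m (\<lambda>z. f z - g z) \<le> smooth_seminorm X m (\<lambda>z. g z - f z)"
      if "f \<in> ?V" "g \<in> ?V" for m f g
    proof (rule smooth_seminorm_least)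
      fix x and j :: "'x multi_index" assume x: "x \<in> exhaust X m" "order_of j \<le> m"
      then show "ennreal (norm (mderiv unit_vec j (\<lambda>z. f z - g z) x)) \<le> smooth_seminorm X m (\<lambda>z. g z - f z)"
        using smooth_seminorm_upper[OF x, of "\<lambda>z. g z - f z"] md[OF that x(1)] md[OF that(2,1) x(1)]
        by (simp add: norm_minus_commute)
    qed
    then show "smooth_seminorm X m (\<lambda>z. f z - g z) = smooth_seminorm X m (\<lambda>z. g z - f z)"
      if "f \<in> ?V" "g \<in> ?V" for m f g using that by (intro antisym) auto
    show "smooth_seminorm X m f \<le> smooth_seminorm X n f" if "1 \<le> m" "m \<le> n" for m n f
      using exhaust_mono[OF that, of X] that by (intro smooth_seminorm_least smooth_seminorm_upper) auto
    show "\<exists>d\<in>D. smooth_seminorm X m (\<lambda>z. f z - d z) < ennreal e" if f: "f \<in> ?V" and e: "0 < e" for f m e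
    proof -
      have "\<exists>d\<in>D. \<forall>j\<in>{j. order_of j \<le> m}. \<forall>x\<in>exhaust X m.
          dist (mderiv unit_vec j f x) (mderiv unit_vec j d x) < e / 2"
        by (rule dense[OF f]) (use e in simp)
      then obtain d where d: "d \<in> D" "\<And>j x. order_of j \<le> m \<Longrightarrow> x \<in> exhaust X m \<Longrightarrow>
          dist (mderiv unit_vec j f x) (mderiv unit_vec j d x) < e / 2" by blast
      have "smooth_seminorm X m (\<lambda>z. f z - d z) \<le> ennreal (e / 2)"
      proof (rule smooth_seminorm_least)
        fix x and j :: "'x multi_index" assume x: "x \<in> exhaust X m" "order_of j \<le> m"
        then show "ennreal (norm (mderiv unit_vec j (\<lambda>z. f z - d z) x)) \<le> ennreal (e / 2)"
          using md[OF f subsetD[OF D(1) d(1)] x(1)] d(2)[OF x(2,1)] by (intro ennreal_leI) (simp add: dist_norm)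
      qed
      also have "\<dots> < ennreal e" using e by (simp add: ennreal_less_iff)
      finally show ?thesis using d(1) by blast
    qed
  qed (use D in auto)
  show ?thesis unfolding smooth_topology_def
  proof (rule measurable_into[OF F])
    fix m d assume d: "d \<in> D"
    \<comment> \<open>Derivatives are continuous on the compact set, so a countable dense part of it
      carries the whole supremum; together with the finitely many multi-indices this leaves a
      countable supremum of measurable functions.\<close>
    obtain E where E: "countable E" "E \<subseteq> exhaust X m" "exhaust X m \<subseteq> closure E"
      using separable[of "exhaust X m"] by blast
    have sm: "smooth_on X (\<lambda>z. F \<omega> z - d z)" if "\<omega> \<in> space P" for \<omega>
      using smooth_on_diff[OF X V[OF F[OF that]] V[OF subsetD[OF D(1) d]]] .
    have "smooth_seminorm X m (\<lambda>z. F \<omega> z - d z)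
        = (SUP j\<in>{j. order_of j \<le> m}. SUP x\<in>E. ennreal (norm (mderiv unit_vec j (\<lambda>z. F \<omega> z - d z) x)))"
      if \<omega>: "\<omega> \<in> space P" for \<omega>
    proof -
      have "smooth_seminorm X m (\<lambda>z. F \<omega> z - d z)
        = (SUP j\<in>{j. order_of j \<le> m}. SUP x\<in>exhaust X m. ennreal (norm (mderiv unit_vec j (\<lambda>z. F \<omega> z - d z) x)))"
      proof (rule antisym)
        show "smooth_seminorm X m (\<lambda>z. F \<omega> z - d z)
            \<le> (SUP j\<in>{j. order_of j \<le> m}. SUP x\<in>exhaust X m. ennreal (norm (mderiv unit_vec j (\<lambda>z. F \<omega> z - d z) x)))"
        proof (rule smooth_seminorm_least)
          fix x and j :: "'x multi_index" assume x: "x \<in> exhaust X m" and j: "order_of j \<le> m"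
          show "ennreal (norm (mderiv unit_vec j (\<lambda>z. F \<omega> z - d z) x))
            \<le> (SUP j\<in>{j. order_of j \<le> m}. SUP x\<in>exhaust X m. ennreal (norm (mderiv unit_vec j (\<lambda>z. F \<omega> z - d z) x)))"
            by (rule SUP_upper2[of j], simp add: j, rule SUP_upper[OF x])
        qed
      qed (auto intro!: SUP_least smooth_seminorm_upper)
      also have "\<dots> = (SUP j\<in>{j. order_of j \<le> m}. SUP x\<in>E. ennreal (norm (mderiv unit_vec j (\<lambda>z. F \<omega> z - d z) x)))"
        by (intro SUP_cong refl Sup_ennreal_dense E continuous_on_ennreal continuous_on_norm
            continuous_on_subset[OF continuous_on_mderiv[OF sm[OF \<omega>]] exhaust_subset])
      finally show ?thesis .
    qed
    moreover have "(\<lambda>\<omega>. SUP j\<in>{j. order_of j \<le> m}. SUP x\<in>E. ennreal (norm (mderiv unit_vec j (\<lambda>z. F \<omega> z - d z) x)))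
        \<in> borel_measurable P"
    proof (rule borel_measurable_SUP[OF countable_finite[OF finite_multi_index]], rule borel_measurable_SUP[OF E(1)])
      fix j :: "'x multi_index" and x assume "x \<in> E"
      then have x: "x \<in> X" using E exhaust_subset[of X m] by blast
      have "(\<lambda>\<omega>. mderiv unit_vec j (\<lambda>z. F \<omega> z - d z) x) \<in> borel_measurable P"
        unfolding mderiv_eq_derivs
        by (rule measurable_derivs[OF X x _ sm set_mlist_Basis(1)]) (auto intro: borel_measurable_diff meas)
      then show "(\<lambda>\<omega>. ennreal (norm (mderiv unit_vec j (\<lambda>z. F \<omega> z - d z) x))) \<in> borel_measurable P"
        by measurable
    qed
    ultimately show "(\<lambda>\<omega>. smooth_seminorm X m (\<lambda>z. F \<omega> z - d z)) \<in> borel_measurable P"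
      by (simp cong: measurable_cong)
  qed
qed


section \<open>Test functions and distributions\<close>

definition test_functions_on :: "(real ^ 'x::finite) set \<Rightarrow> (real ^ 'x) set \<Rightarrow> (real ^ 'x \<Rightarrow> complex) set" where
  "test_functions_on X K = {\<phi> \<in> test_functions X. fun_support \<phi> \<subseteq> K}"

text \<open>The seminorm in the continuity estimate of \<open>distributions\<close>, under a name,
  so that bounds of different orders can be compared.\<close>

definition cnorm :: "nat \<Rightarrow> (real ^ 'x::finite \<Rightarrow> complex) \<Rightarrow> real" where
  "cnorm N \<phi> = (\<Sum>j\<in>{j. order_of j \<le> N}. SUP x. norm (mderiv unit_vec j \<phi> x))"

lemma test_functions_smooth: "\<phi> \<in> test_functions X \<Longrightarrow> smooth_on UNIV \<phi>"
  by (simp add: test_functions_def)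

lemma outside_fun_support: "x \<notin> fun_support \<phi> \<Longrightarrow> \<phi> x = 0"
  unfolding fun_support_def using closure_subset[of "{x. \<phi> x \<noteq> 0}"] by blast

lemma derivs_outside_fun_support:
  assumes "x \<notin> fun_support \<phi>"
  shows "foldr ddir vs \<phi> x = 0"
proof -
  have "foldr ddir vs \<phi> x = foldr ddir vs (\<lambda>_. 0) x"
    by (rule derivs_cong[of "- fun_support \<phi>"])
      (use assms outside_fun_support in \<open>auto simp: fun_support_def\<close>)
  then show ?thesis by (simp add: derivs_zero)
qed

lemma fun_support_subset: "closed K \<Longrightarrow> (\<And>x. x \<notin> K \<Longrightarrow> \<phi> x = 0) \<Longrightarrow> fun_support \<phi> \<subseteq> K"
  unfolding fun_support_def by (rule closure_minimal) auto

lemma test_functionsI: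
  assumes "smooth_on UNIV \<phi>" "compact K" "K \<subseteq> X" "\<And>x. x \<notin> K \<Longrightarrow> \<phi> x = 0"
  shows "\<phi> \<in> test_functions_on X K"
proof -
  have s: "fun_support \<phi> \<subseteq> K" using fun_support_subset[of K \<phi>] assms compact_imp_closed by blast
  moreover have "compact (fun_support \<phi>)"
    using compact_Int_closed[OF assms(2), of "fun_support \<phi>"] s by (simp add: fun_support_def Int_absorb1)
  ultimately show ?thesis using assms by (auto simp: test_functions_on_def test_functions_def)
qed

lemma test_functions_diff:
  assumes "\<phi> \<in> test_functions X" "\<psi> \<in> test_functions X"
  shows "(\<lambda>x. \<phi> x - \<psi> x) \<in> test_functions X"
proof -
  have "(\<lambda>x. \<phi> x - \<psi> x) \<in> test_functions_on X (fun_support \<phi> \<union> fun_support \<psi>)"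
    by (rule test_functionsI)
      (use assms in \<open>auto simp: test_functions_def smooth_on_diff outside_fun_support\<close>)
  then show ?thesis by (simp add: test_functions_on_def)
qed

lemma test_functions_on_diff:
  assumes "\<phi> \<in> test_functions_on X K" "\<psi> \<in> test_functions_on X K" "closed K"
  shows "(\<lambda>x. \<phi> x - \<psi> x) \<in> test_functions_on X K"
proof -
  have "fun_support (\<lambda>x. \<phi> x - \<psi> x) \<subseteq> K"
  proof (rule fun_support_subset[OF assms(3)])
    fix x assume "x \<notin> K"
    then have "\<phi> x = 0" "\<psi> x = 0" using assms outside_fun_support unfolding test_functions_on_def by blast+
    then show "\<phi> x - \<psi> x = 0" by simp
  qed
  then show ?thesis using assms(1,2) test_functions_diff[of \<phi> X \<psi>] by (simp add: test_functions_on_def)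
qed

lemma distribution_diff:
  assumes u: "u \<in> distributions X" and "\<phi> \<in> test_functions X" "\<psi> \<in> test_functions X"
  shows "u (\<lambda>x. \<phi> x - \<psi> x) = u \<phi> - u \<psi>"
proof -
  have "\<forall>\<phi>\<in>test_functions X. \<forall>\<psi>\<in>test_functions X. u (\<lambda>x. \<phi> x + \<psi> x) = u \<phi> + u \<psi>"
    using u by (simp add: distributions_def)
  from bspec[OF bspec[OF this test_functions_diff[OF assms(2,3)]] assms(3)]
  show ?thesis by simp
qed

text \<open>The suprema in \<open>cnorm\<close> are real ones and bound the values only once
  boundedness is known. It comes from continuity on the compact support and vanishing
  outside.\<close>

lemma bdd_above_mderiv:
  assumes "\<phi> \<in> test_functions X"
  shows "bdd_above (range (\<lambda>x. norm (mderiv unit_vec j \<phi> x)))"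
proof -
  let ?g = "\<lambda>x. norm (mderiv unit_vec j \<phi> x)"
  have "continuous_on (fun_support \<phi>) ?g"
    using continuous_on_mderiv[OF test_functions_smooth[OF assms]] continuous_on_subset
    by (intro continuous_on_norm) blast
  then have "bounded (?g ` fun_support \<phi>)"
    using assms by (intro compact_imp_bounded compact_continuous_image) (auto simp: test_functions_def)
  then obtain B where B: "\<And>x. x \<in> fun_support \<phi> \<Longrightarrow> ?g x \<le> B" by (auto simp: bounded_iff)
  have "?g x \<le> max B 0" for x
    using B[of x] derivs_outside_fun_support[of x \<phi>]
    by (cases "x \<in> fun_support \<phi>") (auto simp: mderiv_eq_derivs)
  then show ?thesis by (intro bdd_aboveI[of _ "max B 0"]) auto
qed

lemma norm_mderiv_le_cnorm:
  assumes "\<phi> \<in> test_functions X" "order_of j \<le> N"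
  shows "norm (mderiv unit_vec j \<phi> x) \<le> cnorm N \<phi>"
proof -
  have le: "norm (mderiv unit_vec i \<phi> x) \<le> (SUP x. norm (mderiv unit_vec i \<phi> x))" for i x
    by (rule cSUP_upper[OF UNIV_I bdd_above_mderiv[OF assms(1)]])
  have "0 \<le> (SUP x. norm (mderiv unit_vec i \<phi> x))" for i
    using order_trans[OF norm_ge_zero le[of i 0]] .
  then have "(SUP x. norm (mderiv unit_vec j \<phi> x)) \<le> cnorm N \<phi>"
    unfolding cnorm_def using assms(2) by (intro member_le_sum finite_multi_index) auto
  with le show ?thesis by (rule order_trans)
qed

lemma SUP_mderiv_nonneg:
  assumes "\<phi> \<in> test_functions X"
  shows "0 \<le> (SUP x. norm (mderiv unit_vec j \<phi> x))"
  by (rule order_trans[OF norm_ge_zero cSUP_upper[OF UNIV_I bdd_above_mderiv[OF assms]]])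

lemma cnorm_nonneg: "\<phi> \<in> test_functions X \<Longrightarrow> 0 \<le> cnorm N \<phi>"
  unfolding cnorm_def by (intro sum_nonneg SUP_mderiv_nonneg)

lemma cnorm_mono: "\<phi> \<in> test_functions X \<Longrightarrow> M \<le> N \<Longrightarrow> cnorm M \<phi> \<le> cnorm N \<phi>"
  unfolding cnorm_def by (intro sum_mono2 finite_multi_index SUP_mderiv_nonneg) auto

lemma cnorm_triangle:
  assumes "\<phi> \<in> test_functions X" "\<psi> \<in> test_functions X"
  shows "cnorm N \<psi> \<le> cnorm N \<phi> + cnorm N (\<lambda>x. \<phi> x - \<psi> x)"
proof -
  note bdd = bdd_above_mderiv[OF assms(1)] bdd_above_mderiv[OF assms(2)] bdd_above_mderiv[OF test_functions_diff[OF assms]]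
  have "(SUP x. norm (mderiv unit_vec j \<psi> x))
      \<le> (SUP x. norm (mderiv unit_vec j \<phi> x)) + (SUP x. norm (mderiv unit_vec j (\<lambda>x. \<phi> x - \<psi> x) x))" for j
  proof (rule cSUP_least)
    fix x
    have "norm (mderiv unit_vec j \<psi> x) \<le> norm (mderiv unit_vec j \<phi> x) + norm (mderiv unit_vec j (\<lambda>x. \<phi> x - \<psi> x) x)"
      using norm_triangle_sub[of "mderiv unit_vec j \<psi> x" "mderiv unit_vec j \<phi> x"] assms
      by (simp add: mderiv_diff[OF open_UNIV] test_functions_smooth norm_minus_commute)
    also have "\<dots> \<le> (SUP x. norm (mderiv unit_vec j \<phi> x)) + (SUP x. norm (mderiv unit_vec j (\<lambda>x. \<phi> x - \<psi> x) x))"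
      by (intro add_mono cSUP_upper bdd UNIV_I)
    finally show "norm (mderiv unit_vec j \<psi> x)
      \<le> (SUP x. norm (mderiv unit_vec j \<phi> x)) + (SUP x. norm (mderiv unit_vec j (\<lambda>x. \<phi> x - \<psi> x) x))" .
  qed simp
  then show ?thesis unfolding cnorm_def sum.distrib[symmetric] by (rule sum_mono)
qed

lemma cnorm_le:
  assumes "\<And>j x. order_of j \<le> N \<Longrightarrow> norm (mderiv unit_vec j \<phi> x) \<le> e"
  shows "cnorm N (\<phi> :: real ^ 'x::finite \<Rightarrow> complex) \<le> real (card {j :: 'x multi_index. order_of j \<le> N}) * e"
proof -
  have "cnorm N \<phi> \<le> (\<Sum>j\<in>{j :: 'x multi_index. order_of j \<le> N}. e)"
    unfolding cnorm_def by (intro sum_mono cSUP_least) (auto intro: assms)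
  then show ?thesis by simp
qed

text \<open>The selection is made among functions supported in \<open>K\<close> itself. Off
  \<open>K\<close> all derivatives then vanish for both functions, so closeness on the compact set
  is closeness everywhere.\<close>

lemma countable_dense_test_functions:
  fixes X :: "(real ^ 'x::finite) set"
  assumes K: "compact K"
  shows "\<exists>D\<subseteq>test_functions_on X K. countable D \<and>
    (\<forall>\<phi>\<in>test_functions_on X K. \<forall>N. \<forall>e>0. \<exists>d\<in>D. cnorm N (\<lambda>x. \<phi> x - d x) < e)"
proof -
  let ?V = "test_functions_on X K"
  have V: "smooth_on UNIV v" "\<And>x. x \<notin> K \<Longrightarrow> mderiv unit_vec j v x = 0" if "v \<in> ?V" for v j
    using that derivs_outside_fun_support[of _ v "mlist unit_vec j"]
    by (auto simp: test_functions_on_def test_functions_def mderiv_eq_derivs)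
  have "\<exists>D\<subseteq>?V. countable D \<and> (\<forall>f\<in>?V. \<forall>m. \<forall>e>0. \<exists>d\<in>D. \<forall>j\<in>{j. order_of j \<le> m}. \<forall>x\<in>K.
      dist (mderiv unit_vec j f x) (mderiv unit_vec j d x) < e)"
    by (rule countable_dense_smooth[of ?V UNIV "\<lambda>_. K", OF V(1) K subset_UNIV])
  then obtain D where D: "D \<subseteq> ?V" "countable D" and
    dense0: "\<forall>f\<in>?V. \<forall>m. \<forall>e>0. \<exists>d\<in>D. \<forall>j\<in>{j. order_of j \<le> m}. \<forall>x\<in>K.
      dist (mderiv unit_vec j f x) (mderiv unit_vec j d x) < e"
    by (elim exE conjE) (rule that)
  note dense = dense0[rule_format]
  have "\<exists>d\<in>D. cnorm N (\<lambda>x. \<phi> x - d x) < e" if \<phi>: "\<phi> \<in> ?V" and e: "e > 0" for \<phi> N e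
  proof -
    let ?c = "real (card {j :: 'x multi_index. order_of j \<le> N})"
    have c: "?c + 1 > 0" by (simp add: add_nonneg_pos)
    have "\<exists>d\<in>D. \<forall>j\<in>{j. order_of j \<le> N}. \<forall>x\<in>K.
        dist (mderiv unit_vec j \<phi> x) (mderiv unit_vec j d x) < e / (?c + 1)"
      by (rule dense[OF \<phi>]) (use e c in simp)
    then obtain d where d: "d \<in> D" "\<And>j x. order_of j \<le> N \<Longrightarrow> x \<in> K \<Longrightarrow>
        dist (mderiv unit_vec j \<phi> x) (mderiv unit_vec j d x) < e / (?c + 1)" by blast
    have dV: "d \<in> ?V" using D d by blast
    have "norm (mderiv unit_vec j (\<lambda>x. \<phi> x - d x) x) \<le> e / (?c + 1)" if j: "order_of j \<le> N" for j x
    proof (cases "x \<in> K")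
      case True
      then show ?thesis using d(2)[OF j True] by (simp add: mderiv_diff[OF open_UNIV V(1)[OF \<phi>] V(1)[OF dV]] dist_norm)
    next
      case False
      then show ?thesis using e c
        by (simp add: mderiv_diff[OF open_UNIV V(1)[OF \<phi>] V(1)[OF dV]] V(2)[OF \<phi>] V(2)[OF dV])
    qed
    then have "cnorm N (\<lambda>x. \<phi> x - d x) \<le> ?c * (e / (?c + 1))" by (rule cnorm_le)
    also have "\<dots> < e" using e c by (simp add: field_simps)
    finally show ?thesis using d(1) by blast
  qed
  then show ?thesis using D by blast
qed

text \<open>
  The distributions are covered by countably many equicontinuous pieces, on which the weak-*
  topology is determined by a countable set of test functions; hence \<open>D'(X)\<close> has a countable network
  and its weak-* Borel sets are generated by the evaluations.
\<close>

lemma measurable_weak_star_topology: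
  fixes X :: "(real ^ 'x::finite) set"
  assumes X: "open X" and w: "\<And>\<omega>. \<omega> \<in> space P \<Longrightarrow> w \<omega> \<in> distributions X"
    and meas: "\<And>\<phi>. \<phi> \<in> test_functions X \<Longrightarrow> (\<lambda>\<omega>. w \<omega> \<phi>) \<in> borel_measurable P"
  shows "w \<in> measurable P (borel_of (weak_star_topology X))"
proof (rule measurable_borel_ofI)
  let ?T = "\<lambda>m. test_functions_on X (exhaust X m)"
  have ext: "u \<in> extensional (test_functions X)" if "u \<in> distributions X" for u
    using that by (simp add: distributions_def)
  show "w \<omega> \<in> topspace (weak_star_topology X)" if "\<omega> \<in> space P" for \<omega>
    using w[OF that] ext[OF w[OF that]] by (simp add: weak_star_topology_def PiE_def)
  fix U assume U: "openin (weak_star_topology X) U"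
  have "\<exists>D\<subseteq>?T m. countable D \<and> (\<forall>\<phi>\<in>?T m. \<forall>N. \<forall>e>0. \<exists>d\<in>D. cnorm N (\<lambda>x. \<phi> x - d x) < e)" for m
    by (rule countable_dense_test_functions[OF compact_exhaust])
  then have "\<forall>m. \<exists>D. D \<subseteq> ?T m \<and> countable D \<and> (\<forall>\<phi>\<in>?T m. \<forall>N. \<forall>e>0. \<exists>d\<in>D. cnorm N (\<lambda>x. \<phi> x - d x) < e)"
    by (rule allI)
  from choice[OF this] obtain D where
    "\<forall>m. D m \<subseteq> ?T m \<and> countable (D m) \<and> (\<forall>\<phi>\<in>?T m. \<forall>N. \<forall>e>0. \<exists>d\<in>D m. cnorm N (\<lambda>x. \<phi> x - d x) < e)" ..
  then have D: "\<And>m. D m \<subseteq> ?T m" "\<And>m. countable (D m)"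
    and dense: "\<And>m \<phi> N e. \<phi> \<in> ?T m \<Longrightarrow> e > 0 \<Longrightarrow> \<exists>d\<in>D m. cnorm N (\<lambda>x. \<phi> x - d x) < e"
    by blast+
  have T: "\<phi> \<in> test_functions X" if "\<phi> \<in> ?T m" for \<phi> m using that by (simp add: test_functions_on_def)
  have Tdiff: "(\<lambda>x. \<phi> x - \<psi> x) \<in> ?T m" if "\<phi> \<in> ?T m" "\<psi> \<in> ?T m" for \<phi> \<psi> m
    using test_functions_on_diff[OF that] compact_exhaust compact_imp_closed by blast
  obtain Q :: "complex set" where Q: "countable Q" "\<And>U. open U \<Longrightarrow> U \<noteq> {} \<Longrightarrow> \<exists>q\<in>Q. q \<in> U"
    using countable_dense_setE by metis
  \<comment> \<open>The equicontinuous pieces. One number \<open>N\<close> serves both as constant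
    and as order of the seminorm, so for each \<open>m\<close> countably many pieces exhaust the
    distributions.\<close>
  define B where "B = (\<lambda>m N. {u \<in> distributions X. \<forall>\<phi>\<in>?T m. norm (u \<phi>) \<le> real N * cnorm N \<phi>})"
  have B_ex: "\<exists>N. u \<in> B m N" if u: "u \<in> distributions X" for u m
  proof -
    have "\<forall>K. compact K \<longrightarrow> K \<subseteq> X \<longrightarrow> (\<exists>C N. \<forall>\<phi>\<in>test_functions X. fun_support \<phi> \<subseteq> K \<longrightarrow> norm (u \<phi>) \<le> C * cnorm N \<phi>)"
      using u unfolding distributions_def cnorm_def by simp
    from this[rule_format, OF compact_exhaust exhaust_subset]
    obtain C N0 where C: "\<And>\<phi>. \<phi> \<in> ?T m \<Longrightarrow> norm (u \<phi>) \<le> C * cnorm N0 \<phi>"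
      unfolding test_functions_on_def by blast
    define N where "N = max N0 (nat \<lceil>C\<rceil>)"
    have "norm (u \<phi>) \<le> real N * cnorm N \<phi>" if \<phi>: "\<phi> \<in> ?T m" for \<phi>
    proof -
      have "norm (u \<phi>) \<le> C * cnorm N0 \<phi>" by (rule C[OF \<phi>])
      also have "\<dots> \<le> real N * cnorm N0 \<phi>"
      proof (rule mult_right_mono[OF _ cnorm_nonneg[OF T[OF \<phi>]]])
        have "C \<le> real (nat \<lceil>C\<rceil>)" by linarith
        then show "C \<le> real N" unfolding N_def by simp
      qed
      also have "\<dots> \<le> real N * cnorm N \<phi>"
        using cnorm_mono[OF T[OF \<phi>], of N0 N] by (intro mult_left_mono) (auto simp: N_def)
      finally show ?thesis .
    qed
    then show ?thesis using u by (auto simp: B_def)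
  qed
  \<comment> \<open>Membership in a piece can be tested on the countable set \<open>D m\<close>,
    which makes it a measurable condition. The distribution satisfies some estimate with
    \<open>N1\<close> anyway; this controls the error of approximating by \<open>D m\<close>, and
    the error tends to 0, so only the constant \<open>N\<close> survives.\<close>
  have B_dense: "u \<in> B m N" if u: "u \<in> distributions X" and bd: "\<And>d. d \<in> D m \<Longrightarrow> norm (u d) \<le> real N * cnorm N d" for u m N
  proof -
    obtain N1 where N1: "u \<in> B m N1" using B_ex[OF u] by blast
    have "norm (u \<phi>) \<le> real N * cnorm N \<phi>" if \<phi>: "\<phi> \<in> ?T m" for \<phi>
    proof (rule field_le_epsilon)
      fix e :: real assume e: "e > 0"
      define c where "c = real N1 + real N + 1"
      have c: "c > 0" by (simp add: c_def add_nonneg_pos)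
      obtain d where d: "d \<in> D m" "cnorm (max N N1) (\<lambda>x. \<phi> x - d x) < e / c"
        using dense[OF \<phi>, of "e / c" "max N N1"] e c by auto
      have dT: "d \<in> ?T m" using D d by blast
      let ?r = "\<lambda>x. \<phi> x - d x"
      have rT: "?r \<in> ?T m" by (rule Tdiff[OF \<phi> dT])
      have small: "cnorm N ?r \<le> e / c" "cnorm N1 ?r \<le> e / c"
        using cnorm_mono[OF T[OF rT], of N "max N N1"] cnorm_mono[OF T[OF rT], of N1 "max N N1"] d(2) by auto
      have "norm (u \<phi>) \<le> norm (u d) + norm (u ?r)"
        using norm_triangle_ineq[of "u d" "u \<phi> - u d"] distribution_diff[OF u T[OF \<phi>] T[OF dT]] by simp
      also have "\<dots> \<le> real N * cnorm N d + real N1 * cnorm N1 ?r"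
        using bd[OF d(1)] N1 rT unfolding B_def by (intro add_mono) auto
      also have "\<dots> \<le> real N * (cnorm N \<phi> + e / c) + real N1 * (e / c)"
        using cnorm_triangle[OF T[OF \<phi>] T[OF dT], of N] small by (intro add_mono mult_left_mono) auto
      also have "\<dots> = real N * cnorm N \<phi> + (real N + real N1) * (e / c)" by (simp add: algebra_simps)
      also have "\<dots> \<le> real N * cnorm N \<phi> + c * (e / c)" using e c by (intro add_left_mono mult_right_mono) (auto simp: c_def)
      finally show "norm (u \<phi>) \<le> real N * cnorm N \<phi> + e" using c by simp
    qed
    then show ?thesis using u by (simp add: B_def)
  qed
  \<comment> \<open>The members of the network: finitely many approximate values, prescribed inside
    one equicontinuous piece. They need not be weak-* open; it is enough that countably many of them
    cover each open set from inside.\<close>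
  define Z where "Z = (\<lambda>(m, N, k, R). {u \<in> B m N. \<forall>(d, q)\<in>R. norm (u d - q) < 1 / real (Suc k)})"
  define I where "I = {i \<in> (\<Union>m. {m} \<times> (UNIV :: nat set) \<times> (UNIV :: nat set) \<times> {R. finite R \<and> R \<subseteq> D m \<times> Q}). Z i \<subseteq> U}"
  have cI: "countable I" unfolding I_def
    using D(2) Q(1) by (intro countable_Collect countable_UN countable_SIGMA countable_Collect_finite_subset) simp_all
  have UZ: "U = (\<Union>i\<in>I. Z i)"
  proof (rule equalityI)
    show "(\<Union>i\<in>I. Z i) \<subseteq> U" unfolding I_def by blast
    show "U \<subseteq> (\<Union>i\<in>I. Z i)"
    proof
      fix u assume uU: "u \<in> U"
      have u: "u \<in> distributions X"
        using openin_subset[OF U] uU by (auto simp: weak_star_topology_def)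
      obtain W where W: "openin (product_topology (\<lambda>_. euclidean) (test_functions X)) W" "U = W \<inter> distributions X"
        using U unfolding weak_star_topology_def openin_subtopology by blast
      obtain O' where O': "u \<in> Pi\<^sub>E (test_functions X) O'" "\<And>\<phi>. open (O' \<phi>)"
          "finite {\<phi>. O' \<phi> \<noteq> UNIV}" "Pi\<^sub>E (test_functions X) O' \<subseteq> W"
        using product_topology_open_contains_basis[OF W(1), of u] uU W(2) by auto
      \<comment> \<open>A basic neighbourhood in the product topology constrains only these
        coordinates. Being finitely many, their supports fit into one set of the exhaustion.\<close>
      define F where "F = {\<phi> \<in> test_functions X. O' \<phi> \<noteq> UNIV}"
      have F: "finite F" "F \<subseteq> test_functions X" using O'(3) by (auto simp: F_def)
      have "\<exists>e>0. \<forall>\<phi>\<in>F. ball (u \<phi>) e \<subseteq> O' \<phi>"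
      proof -
        have "\<exists>e>0. ball (u \<phi>) e \<subseteq> O' \<phi>" if "\<phi> \<in> F" for \<phi>
        proof -
          have "u \<phi> \<in> O' \<phi>" using O'(1) that F(2) by (blast dest: PiE_mem)
          then show ?thesis using O'(2)[of \<phi>] by (simp add: open_contains_ball)
        qed
        then obtain e where e: "\<And>\<phi>. \<phi> \<in> F \<Longrightarrow> e \<phi> > 0" "\<And>\<phi>. \<phi> \<in> F \<Longrightarrow> ball (u \<phi>) (e \<phi>) \<subseteq> O' \<phi>" by metis
        have "ball (u \<phi>) (Min (insert 1 (e ` F))) \<subseteq> O' \<phi>" if "\<phi> \<in> F" for \<phi>
          using e(2)[OF that] F(1) that by (intro order_trans[OF subset_ball e(2)[OF that]]) auto
        then show ?thesis using e(1) F(1) by (intro exI[of _ "Min (insert 1 (e ` F))"]) auto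
      qed
      then obtain e where e: "e > 0" "\<And>\<phi>. \<phi> \<in> F \<Longrightarrow> ball (u \<phi>) e \<subseteq> O' \<phi>" by blast
      have "\<exists>m. F \<subseteq> ?T m"
      proof -
        have "compact (\<Union>\<phi>\<in>F. fun_support \<phi>)" "(\<Union>\<phi>\<in>F. fun_support \<phi>) \<subseteq> X"
          using F by (auto intro!: compact_UN simp: test_functions_def)
        then obtain m where "(\<Union>\<phi>\<in>F. fun_support \<phi>) \<subseteq> exhaust X m" using compact_subset_exhaust[OF X] by blast
        then show ?thesis using F by (intro exI[of _ m]) (auto simp: test_functions_on_def)
      qed
      then obtain m where m: "F \<subseteq> ?T m" by blast
      obtain N where N: "u \<in> B m N" using B_ex[OF u] by blast
      \<comment> \<open>Again four errors of at most \<open>e / 4\<close>: two from replacing a test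
        function by a member of \<open>D m\<close>, controlled by the bound of the piece, and two
        from the recorded values.\<close>
      obtain k where k: "1 / real (Suc k) < e / 4" using e nat_approx_posE[of "e / 4"] by (metis divide_pos_pos zero_less_numeral)
      have N1: "real N + 1 > 0" by (simp add: add_nonneg_pos)
      have "\<exists>d\<in>D m. cnorm N (\<lambda>x. \<phi> x - d x) < e / (4 * (real N + 1))" if "\<phi> \<in> F" for \<phi>
        by (rule dense[OF subsetD[OF m that]]) (use e N1 in simp)
      then obtain d where d: "\<And>\<phi>. \<phi> \<in> F \<Longrightarrow> d \<phi> \<in> D m" "\<And>\<phi>. \<phi> \<in> F \<Longrightarrow> cnorm N (\<lambda>x. \<phi> x - d \<phi> x) < e / (4 * (real N + 1))"
        by metis
      have "\<exists>q\<in>Q. q \<in> ball (u (d \<phi>)) (1 / real (Suc k))" for \<phi> by (rule Q(2)) auto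
      then obtain q where q: "\<And>\<phi>. q \<phi> \<in> Q" "\<And>\<phi>. norm (u (d \<phi>) - q \<phi>) < 1 / real (Suc k)"
        unfolding mem_ball dist_norm by metis
      define R where "R = (\<lambda>\<phi>. (d \<phi>, q \<phi>)) ` F"
      have "Z (m, N, k, R) \<subseteq> U"
      proof
        fix v assume v: "v \<in> Z (m, N, k, R)"
        then have vB: "v \<in> B m N" by (simp add: Z_def)
        then have vD: "v \<in> distributions X" by (simp add: B_def)
        have "v \<phi> \<in> O' \<phi>" if \<phi>: "\<phi> \<in> F" for \<phi>
        proof -
          have dT: "d \<phi> \<in> ?T m" and \<phi>T: "\<phi> \<in> ?T m" using d(1)[OF \<phi>] D m \<phi> by blast+
          let ?r = "\<lambda>x. \<phi> x - d \<phi> x"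
          have rT: "?r \<in> ?T m" by (rule Tdiff[OF \<phi>T dT])
          have small: "norm (z ?r) \<le> e / 4" if "z \<in> B m N" for z
          proof -
            have "norm (z ?r) \<le> real N * cnorm N ?r" using that rT by (simp add: B_def)
            also have "\<dots> \<le> (real N + 1) * cnorm N ?r"
              using cnorm_nonneg[OF T[OF rT], of N] by (intro mult_right_mono) auto
            also have "\<dots> \<le> (real N + 1) * (e / (4 * (real N + 1)))"
              using d(2)[OF \<phi>] by (intro mult_left_mono) auto
            also have "\<dots> = e / 4" using N1 by (simp add: field_simps)
            finally show ?thesis .
          qed
          have "norm (v (d \<phi>) - q \<phi>) < 1 / real (Suc k)" using v \<phi> unfolding Z_def R_def by auto
          moreover have "norm (v \<phi> - v (d \<phi>)) \<le> e / 4" "norm (u \<phi> - u (d \<phi>)) \<le> e / 4"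
            using small[OF vB] small[OF N] distribution_diff[OF vD T[OF \<phi>T] T[OF dT]] distribution_diff[OF u T[OF \<phi>T] T[OF dT]] by auto
          moreover have "norm (v \<phi> - u \<phi>) \<le> norm (v \<phi> - v (d \<phi>)) + norm (v (d \<phi>) - q \<phi>) + norm (u (d \<phi>) - q \<phi>) + norm (u \<phi> - u (d \<phi>))"
            using dist_triangle[of "v \<phi>" "u \<phi>" "v (d \<phi>)"] dist_triangle[of "v (d \<phi>)" "u \<phi>" "q \<phi>"]
              dist_triangle[of "q \<phi>" "u \<phi>" "u (d \<phi>)"] by (simp add: dist_norm norm_minus_commute)
          ultimately have "norm (v \<phi> - u \<phi>) < e" using q(2)[of \<phi>] k by linarith
          then show ?thesis using e(2)[OF \<phi>] by (auto simp: dist_norm norm_minus_commute)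
        qed
        then have "v \<in> Pi\<^sub>E (test_functions X) O'"
          using ext[OF vD] by (auto simp: PiE_iff F_def)
        then show "v \<in> U" using O'(4) W(2) vD by blast
      qed
      moreover have "R \<subseteq> D m \<times> Q" "finite R" using d(1) q(1) F(1) by (auto simp: R_def)
      ultimately have "(m, N, k, R) \<in> I" unfolding I_def by blast
      moreover have "u \<in> Z (m, N, k, R)" using N q(2) by (auto simp: Z_def R_def)
      ultimately show "u \<in> (\<Union>i\<in>I. Z i)" by (rule UN_I)
    qed
  qed
  have eq: "w -` U \<inter> space P = (\<Union>i\<in>I. w -` Z i \<inter> space P)" using UZ by blast
  show "w -` U \<inter> space P \<in> sets P" unfolding eq
  proof (rule sets.countable_UN''[OF cI])
    fix i assume "i \<in> I"
    obtain m N k R where i0: "i = (m, N, k, R)" using prod_cases4 by blast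
    have R: "finite R" "R \<subseteq> D m \<times> Q" using \<open>i \<in> I\<close> unfolding I_def i0 by blast+
    have DT: "d \<in> test_functions X" if "d \<in> D m" for d using that D T by blast
    have eq: "w -` Z i \<inter> space P = {\<omega> \<in> space P. (\<forall>d\<in>D m. norm (w \<omega> d) \<le> real N * cnorm N d) \<and>
        (\<forall>p\<in>R. norm (w \<omega> (fst p) - snd p) < 1 / real (Suc k))}"
    proof safe
      fix \<omega> assume *: "\<omega> \<in> space P" "\<forall>d\<in>D m. norm (w \<omega> d) \<le> real N * cnorm N d"
        "\<forall>p\<in>R. norm (w \<omega> (fst p) - snd p) < 1 / real (Suc k)"
      then have "w \<omega> \<in> B m N" using B_dense[OF w] by blast
      then show "\<omega> \<in> w -` Z i" using * by (auto simp: Z_def i0)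
    next
      fix \<omega> d assume "\<omega> \<in> space P" "w \<omega> \<in> Z i" "d \<in> D m"
      then show "norm (w \<omega> d) \<le> real N * cnorm N d" using D(1)[of m] by (auto simp: Z_def i0 B_def)
    next
      fix \<omega> d q assume "\<omega> \<in> space P" "w \<omega> \<in> Z i" "(d, q) \<in> R"
      then show "norm (w \<omega> (fst (d, q)) - snd (d, q)) < 1 / real (Suc k)" by (auto simp: Z_def i0)
    qed
    have "{\<omega> \<in> space P. \<forall>d\<in>D m. norm (w \<omega> d) \<le> real N * cnorm N d} \<in> sets P"
    proof (rule sets.sets_Collect_countable_All'[OF _ D(2)])
      fix d assume "d \<in> D m"
      from meas[OF DT[OF this]] show "{\<omega> \<in> space P. norm (w \<omega> d) \<le> real N * cnorm N d} \<in> sets P" by measurable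
    qed
    moreover have "{\<omega> \<in> space P. \<forall>p\<in>R. norm (w \<omega> (fst p) - snd p) < 1 / real (Suc k)} \<in> sets P"
    proof (rule sets.sets_Collect_countable_All'[OF _ countable_finite[OF R(1)]])
      fix p assume "p \<in> R"
      then have "fst p \<in> D m" using R by auto
      from meas[OF DT[OF this]] show "{\<omega> \<in> space P. norm (w \<omega> (fst p) - snd p) < 1 / real (Suc k)} \<in> sets P" by measurable
    qed
    ultimately have "{\<omega> \<in> space P. \<forall>d\<in>D m. norm (w \<omega> d) \<le> real N * cnorm N d}
        \<inter> {\<omega> \<in> space P. \<forall>p\<in>R. norm (w \<omega> (fst p) - snd p) < 1 / real (Suc k)} \<in> sets P" by (rule sets.Int)
    then show "w -` Z i \<inter> space P \<in> sets P" unfolding eq by (rule back_subst[where P="\<lambda>A. A \<in> sets P"]) auto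
  qed
qed

section \<open>Symbol estimates\<close>

text \<open>
  Estimates \<open>|\<partial>\<^sub>v\<^sub>1 \<dots> \<partial>\<^sub>v\<^sub>k f\<^sub>i| \<le> C r\<^bsup>m + w v\<^sub>1 + \<dots> + w v\<^sub>k\<^esup>\<close> for at most \<open>n\<close> directions from \<open>B\<close>, on each
  of the regions in \<open>KK\<close>, with constants that do not depend on \<open>i \<in> I\<close>.
\<close>

definition bnd :: "'v set set \<Rightarrow> ('v \<Rightarrow> real) \<Rightarrow> 'i set \<Rightarrow> real \<Rightarrow> ('i \<Rightarrow> 'v \<Rightarrow> complex) \<Rightarrow> bool" where
  "bnd KK r I m f \<longleftrightarrow> (\<forall>K\<in>KK. \<exists>C. \<forall>i\<in>I. \<forall>p\<in>K. norm (f i p) \<le> C * r p powr m)"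

primrec symb :: "'v::real_normed_vector set set \<Rightarrow> ('v \<Rightarrow> real) \<Rightarrow> 'v set \<Rightarrow> ('v \<Rightarrow> real) \<Rightarrow> 'i set
    \<Rightarrow> nat \<Rightarrow> real \<Rightarrow> ('i \<Rightarrow> 'v \<Rightarrow> complex) \<Rightarrow> bool" where
  "symb KK r B w I 0 m f \<longleftrightarrow> bnd KK r I m f"
| "symb KK r B w I (Suc n) m f \<longleftrightarrow> bnd KK r I m f
      \<and> (\<forall>v\<in>B. symb KK r B w I n (m + w v) (\<lambda>i. ddir v (f i)))"

lemma bndI:
  assumes "\<And>K. K \<in> KK \<Longrightarrow> \<exists>C. \<forall>i\<in>I. \<forall>p\<in>K. norm (f i p) \<le> C * r p powr m"
  shows "bnd KK r I m f"
  using assms unfolding bnd_def by blast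

lemma bndE:
  assumes "bnd KK r I m f" "K \<in> KK"
  obtains C where "C \<ge> 0" "\<And>i p. i \<in> I \<Longrightarrow> p \<in> K \<Longrightarrow> norm (f i p) \<le> C * r p powr m"
proof -
  obtain C where C: "\<forall>i\<in>I. \<forall>p\<in>K. norm (f i p) \<le> C * r p powr m" using assms unfolding bnd_def by blast
  have "norm (f i p) \<le> \<bar>C\<bar> * r p powr m" if "i \<in> I" "p \<in> K" for i p
    using C that by (intro order_trans[OF _ mult_right_mono[OF abs_ge_self]]) auto
  then show thesis using that[of "\<bar>C\<bar>"] by simp
qed

lemma symb_bnd: "symb KK r B w I n m f \<Longrightarrow> bnd KK r I m f"
  by (cases n) auto

lemma symb_Suc_imp: "symb KK r B w I (Suc n) m f \<Longrightarrow> symb KK r B w I n m f"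
  by (induction n arbitrary: m f) auto

lemma symb_ddir: "symb KK r B w I (Suc n) m f \<Longrightarrow> v \<in> B \<Longrightarrow> symb KK r B w I n (m + w v) (\<lambda>i. ddir v (f i))"
  by simp

lemma symb_derivs:
  assumes "symb KK r B w I n m f" "set vs \<subseteq> B" "length vs \<le> n" "K \<in> KK"
  shows "\<exists>C. \<forall>i\<in>I. \<forall>p\<in>K. norm (foldr ddir vs (f i) p) \<le> C * r p powr (m + sum_list (map w vs))"
  using assms(1-3)
proof (induction vs arbitrary: n m f rule: rev_induct)
  case Nil
  then show ?case using symb_bnd[OF Nil(1)] assms(4) by (simp add: bnd_def)
next
  case (snoc v vs)
  then obtain k where k: "n = Suc k" by (cases n) auto
  have "symb KK r B w I k (m + w v) (\<lambda>i. ddir v (f i))" using snoc.prems k by auto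
  from snoc.IH[OF this] show ?case using snoc.prems k by (simp add: algebra_simps)
qed

lemma symb_from_derivs:
  assumes "\<And>vs K. set vs \<subseteq> B \<Longrightarrow> length vs \<le> n \<Longrightarrow> K \<in> KK \<Longrightarrow>
    \<exists>C. \<forall>i\<in>I. \<forall>p\<in>K. norm (foldr ddir vs (f i) p) \<le> C * r p powr (m + sum_list (map w vs))"
  shows "symb KK r B w I n m f"
  using assms
proof (induction n arbitrary: m f)
  case 0
  show ?case using 0[of "[]"] by (simp add: bnd_def)
next
  case (Suc n)
  have "symb KK r B w I n (m + w v) (\<lambda>i. ddir v (f i))" if "v \<in> B" for v
  proof (rule Suc.IH)
    fix vs K assume "set vs \<subseteq> B" "length vs \<le> n" "K \<in> KK"
    then show "\<exists>C. \<forall>i\<in>I. \<forall>p\<in>K. norm (foldr ddir vs (ddir v (f i)) p) \<le> C * r p powr (m + w v + sum_list (map w vs))"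
      using Suc.prems[of "vs @ [v]" K] that by (simp add: algebra_simps)
  qed
  then show ?case using Suc.prems[of "[]"] by (simp add: bnd_def)
qed

text \<open>The assumption \<open>1 \<le> r p\<close> makes the estimates monotone in the exponent,
  and \<open>B \<subseteq> Basis\<close> keeps derivatives of smooth functions smooth. The locale is
  used with \<open>freq\<close> and all directions for large frequencies, with the constant 1 and
  the x- and y-directions near the origin, and with the constant 1 on a compact set for products
  with a cutoff.\<close>

locale symbol_class =
  fixes S :: "'v::euclidean_space set" and KK :: "'v set set" and r :: "'v \<Rightarrow> real"
    and B :: "'v set" and w :: "'v \<Rightarrow> real" and I :: "'i set"
  assumes open_S: "open S" and KK_subset: "\<And>K. K \<in> KK \<Longrightarrow> K \<subseteq> S"
    and r_ge: "\<And>K p. K \<in> KK \<Longrightarrow> p \<in> K \<Longrightarrow> 1 \<le> r p" and B: "B \<subseteq> Basis"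
begin

abbreviation "sy \<equiv> symb KK r B w I"

lemma bnd_cong:
  assumes "\<And>i p. i \<in> I \<Longrightarrow> p \<in> S \<Longrightarrow> f i p = g i p" "bnd KK r I m f"
  shows "bnd KK r I m g"
proof (rule bndI)
  fix K assume K: "K \<in> KK"
  from assms(2) K obtain C where C: "C \<ge> 0" "\<And>i p. i \<in> I \<Longrightarrow> p \<in> K \<Longrightarrow> norm (f i p) \<le> C * r p powr m"
    by (rule bndE) blast
  have "norm (g i p) \<le> C * r p powr m" if "i \<in> I" "p \<in> K" for i p
    using C(2)[OF that] assms(1)[OF that(1) subsetD[OF KK_subset[OF K] that(2)]] by simp
  then show "\<exists>C. \<forall>i\<in>I. \<forall>p\<in>K. norm (g i p) \<le> C * r p powr m" by blast
qed

lemma symb_cong: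
  assumes "\<And>i p. i \<in> I \<Longrightarrow> p \<in> S \<Longrightarrow> f i p = g i p" "sy n m f"
  shows "sy n m g"
  using assms
proof (induction n arbitrary: m f g)
  case 0
  then show ?case using bnd_cong[of f g m] by simp
next
  case (Suc n)
  have "sy n (m + w v) (\<lambda>i. ddir v (g i))" if "v \<in> B" for v
  proof (rule Suc.IH)
    show "sy n (m + w v) (\<lambda>i. ddir v (f i))" using Suc.prems(2) that by simp
    show "ddir v (f i) p = ddir v (g i) p" if "i \<in> I" "p \<in> S" for i p
      using ddir_cong[OF open_S that(2), of "f i" "g i"] Suc.prems(1) that by blast
  qed
  then show ?case using bnd_cong[of f g m] Suc.prems by simp
qed

lemma bnd_mono:
  assumes "bnd KK r I m f" "m \<le> m'"
  shows "bnd KK r I m' f"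
proof (rule bndI)
  fix K assume K: "K \<in> KK"
  from assms(1) K obtain C where C: "C \<ge> 0" "\<And>i p. i \<in> I \<Longrightarrow> p \<in> K \<Longrightarrow> norm (f i p) \<le> C * r p powr m"
    by (rule bndE) blast
  have "norm (f i p) \<le> C * r p powr m'" if "i \<in> I" "p \<in> K" for i p
    by (rule order_trans[OF C(2)[OF that] mult_left_mono[OF powr_mono[OF assms(2) r_ge[OF K that(2)]] C(1)]])
  then show "\<exists>C. \<forall>i\<in>I. \<forall>p\<in>K. norm (f i p) \<le> C * r p powr m'" by blast
qed

lemma symb_mono: "sy n m f \<Longrightarrow> m \<le> m' \<Longrightarrow> sy n m' f"
proof (induction n arbitrary: m m' f)
  case 0
  then show ?case using bnd_mono by simp
next
  case (Suc n)
  have "sy n (m' + w v) (\<lambda>i. ddir v (f i))" if "v \<in> B" for v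
    by (rule Suc.IH[of "m + w v"]) (use Suc.prems that in auto)
  then show ?case using bnd_mono[OF symb_bnd[OF Suc.prems(1)] Suc.prems(2)] by simp
qed

lemma symb_zero: "sy n m (\<lambda>i _. 0)"
proof (induction n arbitrary: m)
  case 0
  show ?case by (auto intro!: bndI exI[of _ 0])
next
  case (Suc n)
  have "ddir v (\<lambda>_. 0 :: complex) = (\<lambda>_. 0)" for v :: 'v by (rule ext) (rule ddir_const)
  then show ?case using Suc by (auto intro!: bndI exI[of _ 0])
qed

lemma symb_const: "sy n 0 (\<lambda>i _. c)"
proof -
  have 1: "bnd KK r I 0 (\<lambda>i _. c)"
  proof (intro bndI exI[of _ "norm c"] ballI)
    fix K p assume "K \<in> KK" "p \<in> K"
    then have "r p \<noteq> 0" using r_ge by fastforce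
    then show "norm c \<le> norm c * r p powr 0" by simp
  qed
  show ?thesis
  proof (cases n)
    case (Suc k)
    have "ddir v (\<lambda>_. c) = (\<lambda>_. 0)" for v :: 'v by (rule ext) (rule ddir_const)
    then show ?thesis using 1 Suc symb_zero by simp
  qed (use 1 in simp)
qed

lemma bnd_add:
  assumes "bnd KK r I m f" "bnd KK r I m g"
  shows "bnd KK r I m (\<lambda>i p. f i p + g i p)"
proof (rule bndI)
  fix K assume K: "K \<in> KK"
  from assms(1) K obtain C where C: "\<And>i p. i \<in> I \<Longrightarrow> p \<in> K \<Longrightarrow> norm (f i p) \<le> C * r p powr m" by (rule bndE) blast
  from assms(2) K obtain D where D: "\<And>i p. i \<in> I \<Longrightarrow> p \<in> K \<Longrightarrow> norm (g i p) \<le> D * r p powr m" by (rule bndE) blast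
  have "norm (f i p + g i p) \<le> (C + D) * r p powr m" if "i \<in> I" "p \<in> K" for i p
    unfolding distrib_right by (rule order_trans[OF norm_triangle_ineq add_mono[OF C[OF that] D[OF that]]])
  then show "\<exists>C. \<forall>i\<in>I. \<forall>p\<in>K. norm (f i p + g i p) \<le> C * r p powr m" by blast
qed

lemma symb_add:
  assumes "\<And>i. i \<in> I \<Longrightarrow> smooth_on S (f i)" "\<And>i. i \<in> I \<Longrightarrow> smooth_on S (g i)" "sy n m f" "sy n m g"
  shows "sy n m (\<lambda>i p. f i p + g i p)"
  using assms
proof (induction n arbitrary: m f g)
  case 0
  then show ?case using bnd_add by simp
next
  case (Suc n)
  have "sy n (m + w v) (\<lambda>i. ddir v (\<lambda>p. f i p + g i p))" if v: "v \<in> B" for v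
  proof (rule symb_cong)
    have vB: "v \<in> Basis" using v B by blast
    have smd: "smooth_on S (ddir v (f i))" "smooth_on S (ddir v (g i))" if "i \<in> I" for i
      using smooth_on_ddir[OF Suc.prems(1) vB] smooth_on_ddir[OF Suc.prems(2) vB] that by blast+
    show "sy n (m + w v) (\<lambda>i p. ddir v (f i) p + ddir v (g i) p)"
      by (rule Suc.IH) (use Suc.prems v smd in auto)
    show "ddir v (f i) p + ddir v (g i) p = ddir v (\<lambda>p. f i p + g i p) p" if "i \<in> I" "p \<in> S" for i p
      using ddir_add[OF smooth_on_differentiable_at[OF Suc.prems(1) open_S] smooth_on_differentiable_at[OF Suc.prems(2) open_S]] that
      by simp
  qed
  then show ?case using bnd_add[OF symb_bnd[OF Suc.prems(3)] symb_bnd[OF Suc.prems(4)]] by simp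
qed

lemma bnd_mult:
  assumes "bnd KK r I a f" "bnd KK r I b g"
  shows "bnd KK r I (a + b) (\<lambda>i p. f i p * g i p)"
proof (rule bndI)
  fix K assume K: "K \<in> KK"
  from assms(1) K obtain C where C: "C \<ge> 0" "\<And>i p. i \<in> I \<Longrightarrow> p \<in> K \<Longrightarrow> norm (f i p) \<le> C * r p powr a" by (rule bndE) blast
  from assms(2) K obtain D where D: "D \<ge> 0" "\<And>i p. i \<in> I \<Longrightarrow> p \<in> K \<Longrightarrow> norm (g i p) \<le> D * r p powr b" by (rule bndE) blast
  have "norm (f i p * g i p) \<le> (C * D) * r p powr (a + b)" if "i \<in> I" "p \<in> K" for i p
  proof -
    have "norm (f i p) * norm (g i p) \<le> (C * r p powr a) * (D * r p powr b)"
      by (rule mult_mono[OF C(2)[OF that] D(2)[OF that]]) (use C(1) in auto)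
    then show ?thesis by (simp add: norm_mult powr_add mult_ac)
  qed
  then show "\<exists>C. \<forall>i\<in>I. \<forall>p\<in>K. norm (f i p * g i p) \<le> C * r p powr (a + b)" by blast
qed

lemma symb_mult:
  assumes "\<And>i. i \<in> I \<Longrightarrow> smooth_on S (f i)" "\<And>i. i \<in> I \<Longrightarrow> smooth_on S (g i)" "sy n a f" "sy n b g"
  shows "sy n (a + b) (\<lambda>i p. f i p * g i p)"
  using assms
proof (induction n arbitrary: a b f g)
  case 0
  then show ?case using bnd_mult by simp
next
  case (Suc n)
  have "sy n (a + b + w v) (\<lambda>i. ddir v (\<lambda>p. f i p * g i p))" if v: "v \<in> B" for v
  proof (rule symb_cong)
    have vB: "v \<in> Basis" using v B by blast
    have smd: "smooth_on S (ddir v (f i))" "smooth_on S (ddir v (g i))" if "i \<in> I" for i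
      using smooth_on_ddir[OF Suc.prems(1) vB] smooth_on_ddir[OF Suc.prems(2) vB] that by blast+
    have "sy n (a + (b + w v)) (\<lambda>i p. f i p * ddir v (g i) p)"
      by (rule Suc.IH) (use Suc.prems v smd symb_Suc_imp[OF Suc.prems(3)] in auto)
    then have 1: "sy n (a + b + w v) (\<lambda>i p. f i p * ddir v (g i) p)" by (simp add: add.assoc)
    have "sy n ((a + w v) + b) (\<lambda>i p. ddir v (f i) p * g i p)"
      by (rule Suc.IH) (use Suc.prems v smd symb_Suc_imp[OF Suc.prems(4)] in auto)
    then have 2: "sy n (a + b + w v) (\<lambda>i p. ddir v (f i) p * g i p)" by (simp add: ac_simps)
    show "sy n (a + b + w v) (\<lambda>i p. f i p * ddir v (g i) p + ddir v (f i) p * g i p)"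
      by (rule symb_add[OF _ _ 1 2]) (use Suc.prems smd smooth_on_mult[OF open_S] in blast)+
    show "f i p * ddir v (g i) p + ddir v (f i) p * g i p = ddir v (\<lambda>p. f i p * g i p) p" if "i \<in> I" "p \<in> S" for i p
      using ddir_mult[OF smooth_on_differentiable_at[OF Suc.prems(1) open_S] smooth_on_differentiable_at[OF Suc.prems(2) open_S]] that
      by simp
  qed
  then show ?case using bnd_mult[OF symb_bnd[OF Suc.prems(3)] symb_bnd[OF Suc.prems(4)]] by simp
qed

lemma symb_cmult:
  assumes "\<And>i. i \<in> I \<Longrightarrow> smooth_on S (f i)" "sy n m f"
  shows "sy n m (\<lambda>i p. c * f i p)"
  using symb_mult[OF smooth_on_const assms(1) symb_const assms(2)] by simp

lemma symb_uminus:
  assumes "\<And>i. i \<in> I \<Longrightarrow> smooth_on S (f i)" "sy n m f"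
  shows "sy n m (\<lambda>i p. - f i p)"
  using symb_cmult[OF assms, of "-1"] by simp

lemma symb_sum:
  assumes "\<And>k i. k \<in> A \<Longrightarrow> i \<in> I \<Longrightarrow> smooth_on S (f k i)" "\<And>k. k \<in> A \<Longrightarrow> sy n m (f k)"
  shows "sy n m (\<lambda>i p. \<Sum>k\<in>A. f k i p)"
  using assms
proof (induction A rule: infinite_finite_induct)
  case (insert k A)
  then show ?case by (simp add: symb_add smooth_on_sum[OF open_S])
qed (auto simp: symb_zero)

text \<open>Each derivative brings down a factor \<open>ddir v (g i)\<close> of order
  \<open>w v\<close>, which is exactly the loss that the weight permits, and a nonpositive real part
  bounds the exponential by 1.\<close>

lemma symb_exp:
  assumes sm: "\<And>i. i \<in> I \<Longrightarrow> smooth_on S (g i)" and re: "\<And>i p. i \<in> I \<Longrightarrow> p \<in> S \<Longrightarrow> Re (g i p) \<le> 0"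
    and d: "\<And>v n. v \<in> B \<Longrightarrow> sy n (w v) (\<lambda>i. ddir v (g i))"
  shows "sy n 0 (\<lambda>i p. exp (g i p))"
proof (induction n)
  case 0
  have "bnd KK r I 0 (\<lambda>i p. exp (g i p))"
  proof (intro bndI exI[of _ 1] ballI)
    fix K i p assume *: "K \<in> KK" "i \<in> I" "p \<in> K"
    have "r p \<noteq> 0" using r_ge[OF *(1,3)] by simp
    moreover have "Re (g i p) \<le> 0" by (rule re[OF *(2) subsetD[OF KK_subset[OF *(1)] *(3)]])
    ultimately show "norm (exp (g i p)) \<le> 1 * r p powr 0" by simp
  qed
  then show ?case by simp
next
  case (Suc n)
  have "sy n (0 + w v) (\<lambda>i. ddir v (\<lambda>p. exp (g i p)))" if v: "v \<in> B" for v
  proof (rule symb_cong)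
    have vB: "v \<in> Basis" using v B by blast
    have smd: "smooth_on S (\<lambda>p. exp (g i p))" "smooth_on S (ddir v (g i))" if "i \<in> I" for i
      using smooth_on_ddir[OF sm vB] smooth_on_exp[OF open_S sm] that by blast+
    show "sy n (0 + w v) (\<lambda>i p. exp (g i p) * ddir v (g i) p)"
      by (rule symb_mult[OF _ _ Suc d[OF v]]) (use smd in auto)
    show "exp (g i p) * ddir v (g i) p = ddir v (\<lambda>p. exp (g i p)) p" if "i \<in> I" "p \<in> S" for i p
      using ddir_exp[OF smooth_on_differentiable_at[OF sm open_S]] that by simp
  qed
  then show ?case using symb_bnd[OF Suc] by simp
qed

lemma symb_weight_mono:
  assumes "\<And>v. v \<in> B \<Longrightarrow> w' v \<le> w v" "symb KK r B w' I n m f"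
  shows "sy n m f"
  using assms(2)
proof (induction n arbitrary: m f)
  case (Suc n)
  have "sy n (m + w v) (\<lambda>i. ddir v (f i))" if "v \<in> B" for v
    by (rule symb_mono[OF Suc.IH[of "m + w' v"]]) (use Suc.prems assms(1)[OF that] that in auto)
  then show ?case using Suc.prems by simp
qed simp

end


section \<open>Symbols on the phase space\<close>

text \<open>The split at \<open>norm \<xi> = 1\<close> follows the excision function: on the near
  regions \<open>\<theta>\<close> is 1 and L acts as the identity, while on the far regions negative
  powers of \<open>norm \<xi>\<close> do no harm.\<close>

definition far_regions :: "(real ^ 'x::finite) set \<Rightarrow> (real ^ 'y::finite) set
    \<Rightarrow> ((real ^ 'x) \<times> (real ^ 'y) \<times> (real ^ 'z::finite)) set set" where
  "far_regions X Y = {{(x, y, \<xi>). (x, y) \<in> K \<and> 1 \<le> norm \<xi>} | K. compact K \<and> K \<subseteq> X \<times> Y}"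

definition near_regions :: "(real ^ 'x::finite) set \<Rightarrow> (real ^ 'y::finite) set
    \<Rightarrow> ((real ^ 'x) \<times> (real ^ 'y) \<times> (real ^ 'z::finite)) set set" where
  "near_regions X Y = {{(x, y, \<xi>). (x, y) \<in> K \<and> 0 < norm \<xi> \<and> norm \<xi> < 1} | K. compact K \<and> K \<subseteq> X \<times> Y}"

text \<open>Comparable to \<open>japanese\<close>, but equal to \<open>norm \<xi>\<close> on the far
  regions, so homogeneous functions obey the estimates with their own degree as exponent.\<close>

definition freq :: "'a \<times> 'b \<times> 'c::real_normed_vector \<Rightarrow> real" where
  "freq p = max 1 (norm (snd (snd p)))"

text \<open>The change of exponent caused by one derivative in a class of type
  \<open>(\<rho>, \<delta>)\<close>. Homogeneous functions have the weight \<open>wt 1 0\<close>;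
  \<open>wt 0 1\<close> is the weakest weight in use, forced by the oscillating factor.\<close>

definition wt :: "real \<Rightarrow> real \<Rightarrow> (real ^ 'x::finite) \<times> (real ^ 'y::finite) \<times> (real ^ 'z::finite) \<Rightarrow> real" where
  "wt \<rho> \<delta> v = (if v \<in> range unit_xi then - \<rho> else \<delta>)"

definition xy_units :: "((real ^ 'x::finite) \<times> (real ^ 'y::finite) \<times> (real ^ 'z::finite)) set" where
  "xy_units = range unit_x \<union> range unit_y"

lemma xy_units_Basis: "xy_units \<subseteq> Basis"
  unfolding xy_units_def by auto

lemma open_phase_space: "open X \<Longrightarrow> open Y \<Longrightarrow> open (X \<times> Y \<times> (\<Xi> :: (real ^ 'z::finite) set))"
  unfolding \<Xi>_def by (intro open_Times open_Compl) auto

lemma symbol_class_far: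
  assumes "open X" "open Y"
  shows "symbol_class (X \<times> Y \<times> \<Xi>) (far_regions X Y) freq Basis"
proof
  show "open (X \<times> Y \<times> (\<Xi> :: (real ^ 'c) set))" by (rule open_phase_space[OF assms])
  show "K \<subseteq> X \<times> Y \<times> \<Xi>" if "K \<in> far_regions X Y" for K
    using that by (force simp: far_regions_def \<Xi>_def)
qed (auto simp: freq_def)

lemma symbol_class_near:
  assumes "open X" "open Y"
  shows "symbol_class (X \<times> Y \<times> \<Xi>) (near_regions X Y) (\<lambda>_. 1) xy_units"
proof
  show "open (X \<times> Y \<times> (\<Xi> :: (real ^ 'c) set))" by (rule open_phase_space[OF assms])
  show "K \<subseteq> X \<times> Y \<times> \<Xi>" if "K \<in> near_regions X Y" for K
    using that by (force simp: near_regions_def \<Xi>_def)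
qed (auto simp: xy_units_Basis)


subsection \<open>Homogeneous functions\<close>

definition homogeneous :: "(real ^ 'x::finite) set \<Rightarrow> (real ^ 'y::finite) set \<Rightarrow> real
    \<Rightarrow> ((real ^ 'x) \<times> (real ^ 'y) \<times> (real ^ 'z::finite) \<Rightarrow> complex) \<Rightarrow> bool" where
  "homogeneous X Y \<mu> f \<longleftrightarrow> (\<forall>x\<in>X. \<forall>y\<in>Y. \<forall>\<xi>\<in>\<Xi>. \<forall>t>0. f (x, y, t *\<^sub>R \<xi>) = of_real (t powr \<mu>) * f (x, y, \<xi>))"

lemma homogeneous_mult:
  "homogeneous X Y a f \<Longrightarrow> homogeneous X Y b g \<Longrightarrow> homogeneous X Y (a + b) (\<lambda>p. f p * g p)"
  by (auto simp: homogeneous_def powr_add)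

lemma homogeneous_add:
  "homogeneous X Y a f \<Longrightarrow> homogeneous X Y a g \<Longrightarrow> homogeneous X Y a (\<lambda>p. f p + g p)"
  by (auto simp: homogeneous_def distrib_left)

lemma homogeneous_sum:
  "(\<And>i. i \<in> I \<Longrightarrow> homogeneous X Y a (f i)) \<Longrightarrow> homogeneous X Y a (\<lambda>p. \<Sum>i\<in>I. f i p)"
  by (auto simp: homogeneous_def sum_distrib_left)

lemma homogeneous_inverse:
  "homogeneous X Y a f \<Longrightarrow> homogeneous X Y (- a) (\<lambda>p. inverse (f p))"
  by (auto simp: homogeneous_def powr_minus)

lemma homogeneous_norm_sq: "homogeneous X Y 2 (\<lambda>p. of_real ((norm (snd (snd p)))\<^sup>2))"
  by (auto simp: homogeneous_def power_mult_distrib powr_numeral)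

text \<open>Differentiate the homogeneity relation, written as composition with the map
  \<open>A\<close> that scales \<xi> by \<open>t\<close>. A \<xi>-direction is scaled by
  \<open>A\<close> as well, which lowers the degree by 1; x- and y-directions are fixed.\<close>

lemma homogeneous_ddir:
  fixes f :: "(real ^ 'x::finite) \<times> (real ^ 'y::finite) \<times> (real ^ 'z::finite) \<Rightarrow> complex"
  assumes X: "open X" "open Y" and f: "smooth_on (X \<times> Y \<times> \<Xi>) f" "homogeneous X Y \<mu> f" and v: "v \<in> Basis"
  shows "homogeneous X Y (\<mu> + wt 1 0 v) (ddir v f)"
  unfolding homogeneous_def
proof (intro ballI allI impI)
  fix x y and \<xi> :: "real ^ 'z" and t :: real assume *: "x \<in> X" "y \<in> Y" "\<xi> \<in> \<Xi>" "0 < t"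
  let ?W = "X \<times> Y \<times> (\<Xi> :: (real ^ 'z) set)"
  have W: "open ?W" by (rule open_phase_space[OF X])
  define A :: "(real ^ 'x) \<times> (real ^ 'y) \<times> (real ^ 'z) \<Rightarrow> (real ^ 'x) \<times> (real ^ 'y) \<times> (real ^ 'z)"
    where "A = (\<lambda>p. (fst p, fst (snd p), t *\<^sub>R snd (snd p)))"
  have A: "bounded_linear A" unfolding A_def
    by (intro bounded_linear_Pair bounded_linear_fst bounded_linear_compose[OF bounded_linear_fst bounded_linear_snd]
        bounded_linear_compose[OF bounded_linear_scaleR_right bounded_linear_compose[OF bounded_linear_snd bounded_linear_snd]])
  have p: "(x, y, \<xi>) \<in> ?W" and Ap: "0 + A (x, y, \<xi>) \<in> ?W" using * by (auto simp: A_def \<Xi>_def)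
  note df = smooth_on_differentiable_at[OF f(1) W]
  have "ddir v (\<lambda>p. f (0 + A p)) (x, y, \<xi>) = ddir v (\<lambda>p. of_real (t powr \<mu>) * f p) (x, y, \<xi>)"
    using f(2) *(4) by (intro ddir_cong[OF W p]) (auto simp: homogeneous_def A_def)
  also have "\<dots> = of_real (t powr \<mu>) * ddir v f (x, y, \<xi>)"
    by (rule ddir_bounded_linear[OF bounded_linear_mult_right df[OF p]])
  finally have eq: "ddir (A v) f (0 + A (x, y, \<xi>)) = of_real (t powr \<mu>) * ddir v f (x, y, \<xi>)"
    unfolding differentiable_affine_compose(2)[OF A df[OF Ap]] .
  have Ap': "0 + A (x, y, \<xi>) = (x, y, t *\<^sub>R \<xi>)" by (simp add: A_def)
  show "ddir v f (x, y, t *\<^sub>R \<xi>) = of_real (t powr (\<mu> + wt 1 0 v)) * ddir v f (x, y, \<xi>)"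
  proof (cases "v \<in> range unit_xi")
    case True
    then have "A v = t *\<^sub>R v" by (auto simp: A_def unit_xi_def)
    then have "ddir (A v) f (0 + A (x, y, \<xi>)) = t *\<^sub>R ddir v f (x, y, t *\<^sub>R \<xi>)"
      using linear_cmul[OF has_derivative_linear[OF has_derivative_ddir[OF df[OF Ap]]], of t v] Ap' by simp
    then have "(1 / t) *\<^sub>R (t *\<^sub>R ddir v f (x, y, t *\<^sub>R \<xi>)) = (1 / t) *\<^sub>R (of_real (t powr \<mu>) * ddir v f (x, y, \<xi>))"
      using eq by simp
    moreover have "t powr (\<mu> + wt 1 0 v) = t powr \<mu> / t" using True *(4) by (simp add: wt_def powr_diff)
    ultimately show ?thesis using *(4) by (simp add: scaleR_conv_of_real)
  next
    case False
    then have "v \<in> range unit_x \<union> range unit_y" using v Basis_triple by blast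
    then have "A v = v" by (auto simp: A_def unit_x_def unit_y_def)
    then show ?thesis using eq Ap' False by (simp add: wt_def)
  qed
qed

lemma compact_times_sphere:
  assumes "compact K" "K \<subseteq> X \<times> Y"
  shows "compact ((\<lambda>((x, y), \<xi>). (x, y, \<xi>)) ` (K \<times> sphere (0 :: real ^ 'z::finite) 1))"
    and "(\<lambda>((x, y), \<xi>). (x, y, \<xi>)) ` (K \<times> sphere (0 :: real ^ 'z::finite) 1) \<subseteq> X \<times> Y \<times> \<Xi>"
proof -
  show "compact ((\<lambda>((x, y), \<xi>). (x, y, \<xi>)) ` (K \<times> sphere (0 :: real ^ 'z::finite) 1))"
    unfolding case_prod_unfold
    by (intro compact_continuous_image compact_Times assms compact_sphere continuous_intros)
  show "(\<lambda>((x, y), \<xi>). (x, y, \<xi>)) ` (K \<times> sphere (0 :: real ^ 'z::finite) 1) \<subseteq> X \<times> Y \<times> \<Xi>"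
    using assms by (auto simp: \<Xi>_def)
qed

text \<open>Homogeneity reduces the bound to \<xi> on the unit sphere, which together with
  \<open>K\<close> forms a compact set.\<close>

lemma homogeneous_bound:
  fixes f :: "(real ^ 'x::finite) \<times> (real ^ 'y::finite) \<times> (real ^ 'z::finite) \<Rightarrow> complex"
  assumes f: "continuous_on (X \<times> Y \<times> \<Xi>) f" "homogeneous X Y \<mu> f" and K: "compact K" "K \<subseteq> X \<times> Y"
  shows "\<exists>C\<ge>0. \<forall>x y \<xi>. (x, y) \<in> K \<longrightarrow> \<xi> \<noteq> 0 \<longrightarrow> norm (f (x, y, \<xi>)) \<le> C * norm \<xi> powr \<mu>"
proof -
  let ?L = "(\<lambda>((x, y), \<xi>). (x, y, \<xi>)) ` (K \<times> sphere (0 :: real ^ 'z::finite) 1)"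
  note L = compact_times_sphere[OF K, where 'z='z]
  have "bounded (f ` ?L)"
    by (intro compact_imp_bounded compact_continuous_image[OF continuous_on_subset[OF f(1)]] L)
  then obtain C where "\<forall>q\<in>f ` ?L. norm q \<le> C" unfolding bounded_iff by blast
  then have C: "norm (f p) \<le> C" if "p \<in> ?L" for p using that by blast
  have "norm (f (x, y, \<xi>)) \<le> \<bar>C\<bar> * norm \<xi> powr \<mu>" if "(x, y) \<in> K" "\<xi> \<noteq> 0" for x y and \<xi> :: "real ^ 'z"
  proof -
    have n: "norm \<xi> > 0" using that by simp
    have xy: "x \<in> X" "y \<in> Y" "\<xi> /\<^sub>R norm \<xi> \<in> \<Xi>" using that K by (auto simp: \<Xi>_def)
    have "f (x, y, \<xi>) = f (x, y, norm \<xi> *\<^sub>R (\<xi> /\<^sub>R norm \<xi>))" using n by simp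
    also have "\<dots> = of_real (norm \<xi> powr \<mu>) * f (x, y, \<xi> /\<^sub>R norm \<xi>)"
      using f(2) xy n unfolding homogeneous_def by blast
    finally have "norm (f (x, y, \<xi>)) = norm \<xi> powr \<mu> * norm (f (x, y, \<xi> /\<^sub>R norm \<xi>))" by (simp add: norm_mult)
    moreover have "norm (f (x, y, \<xi> /\<^sub>R norm \<xi>)) \<le> \<bar>C\<bar>"
    proof (rule order_trans[OF C abs_ge_self])
      show "(x, y, \<xi> /\<^sub>R norm \<xi>) \<in> ?L"
        using that n by (intro image_eqI[of _ _ "((x, y), \<xi> /\<^sub>R norm \<xi>)"]) auto
    qed
    ultimately show ?thesis
      using mult_right_mono[of "norm (f (x, y, \<xi> /\<^sub>R norm \<xi>))" "\<bar>C\<bar>" "norm \<xi> powr \<mu>"] by (simp add: mult.commute)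
  qed
  then show ?thesis by (intro exI[of _ "\<bar>C\<bar>"]) auto
qed

lemma symb_homogeneous_far:
  fixes f :: "(real ^ 'x::finite) \<times> (real ^ 'y::finite) \<times> (real ^ 'z::finite) \<Rightarrow> complex"
  assumes X: "open X" "open Y" and f: "smooth_on (X \<times> Y \<times> \<Xi>) f" "homogeneous X Y \<mu> f" and \<rho>: "\<rho> \<le> 1" "0 \<le> \<delta>"
  shows "symb (far_regions X Y) freq Basis (wt \<rho> \<delta>) I n \<mu> (\<lambda>i. f)"
proof -
  interpret F: symbol_class "X \<times> Y \<times> \<Xi>" "far_regions X Y" freq "Basis :: ((real ^ 'x) \<times> (real ^ 'y) \<times> (real ^ 'z)) set" "wt \<rho> \<delta>" I
    by (rule symbol_class_far[OF X])
  have base: "bnd (far_regions X Y) freq I \<mu> (\<lambda>i. f)" if f: "smooth_on (X \<times> Y \<times> \<Xi>) f" "homogeneous X Y \<mu> f"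
    for f :: "(real ^ 'x) \<times> (real ^ 'y) \<times> (real ^ 'z) \<Rightarrow> complex" and \<mu>
  proof (rule bndI)
    fix R :: "((real ^ 'x) \<times> (real ^ 'y) \<times> (real ^ 'z)) set" assume "R \<in> far_regions X Y"
    then obtain K where K: "R = {(x, y, \<xi>). (x, y) \<in> K \<and> 1 \<le> norm \<xi>}" "compact K" "K \<subseteq> X \<times> Y"
      unfolding far_regions_def by blast
    obtain C where C: "\<And>x y \<xi>. (x, y) \<in> K \<Longrightarrow> \<xi> \<noteq> 0 \<Longrightarrow> norm (f (x, y, \<xi>)) \<le> C * norm \<xi> powr \<mu>"
      using homogeneous_bound[OF smooth_on_continuous_on[OF f(1)] f(2) K(2,3)] by blast
    have "norm (f p) \<le> C * freq p powr \<mu>" if p: "p \<in> R" for p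
    proof -
      obtain x y \<xi> where "p = (x, y, \<xi>)" by (cases p)
      with p K have "p = (x, y, \<xi>)" "(x, y) \<in> K" "1 \<le> norm \<xi>" by auto
      moreover from this have "\<xi> \<noteq> 0" by auto
      ultimately show ?thesis using C[of x y \<xi>] by (simp add: freq_def)
    qed
    then show "\<exists>C. \<forall>i\<in>I. \<forall>p\<in>R. norm (f p) \<le> C * freq p powr \<mu>" by blast
  qed
  have "symb (far_regions X Y) freq Basis (wt 1 0) I n \<mu> (\<lambda>i. f)"
    using f
  proof (induction n arbitrary: \<mu> f)
    case 0
    then show ?case using base by simp
  next
    case (Suc n)
    have "symb (far_regions X Y) freq Basis (wt 1 0) I n (\<mu> + wt 1 0 v) (\<lambda>i. ddir v f)" if "v \<in> Basis" for v
      by (rule Suc.IH[OF smooth_on_ddir[OF Suc.prems(1) that] homogeneous_ddir[OF X Suc.prems that]])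
    then show ?case using base[OF Suc.prems] by simp
  qed
  then show ?thesis by (rule F.symb_weight_mono[rotated]) (use \<rho> in \<open>auto simp: wt_def\<close>)
qed

text \<open>Derivatives in x and y keep the degree, and a homogeneous function of nonnegative degree
  stays bounded for \<open>norm \<xi> < 1\<close>. Derivatives in \<xi> can push the degree below 0,
  which is why \<open>xy_units\<close> are the only directions here.\<close>

lemma symb_homogeneous_near:
  fixes f :: "(real ^ 'x::finite) \<times> (real ^ 'y::finite) \<times> (real ^ 'z::finite) \<Rightarrow> complex"
  assumes X: "open X" "open Y" and f: "smooth_on (X \<times> Y \<times> \<Xi>) f" "homogeneous X Y \<mu> f" and \<mu>: "0 \<le> \<mu>"
  shows "symb (near_regions X Y) (\<lambda>_. 1) xy_units (\<lambda>_. 0) I n 0 (\<lambda>i. f)"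
proof -
  have base: "bnd (near_regions X Y) (\<lambda>_. 1) I 0 (\<lambda>i. f)" if f: "smooth_on (X \<times> Y \<times> \<Xi>) f" "homogeneous X Y \<mu> f"
    for f :: "(real ^ 'x) \<times> (real ^ 'y) \<times> (real ^ 'z) \<Rightarrow> complex"
  proof (rule bndI)
    fix R :: "((real ^ 'x) \<times> (real ^ 'y) \<times> (real ^ 'z)) set" assume "R \<in> near_regions X Y"
    then obtain K where K: "R = {(x, y, \<xi>). (x, y) \<in> K \<and> 0 < norm \<xi> \<and> norm \<xi> < 1}" "compact K" "K \<subseteq> X \<times> Y"
      unfolding near_regions_def by blast
    obtain C where C: "C \<ge> 0" "\<And>x y \<xi>. (x, y) \<in> K \<Longrightarrow> \<xi> \<noteq> 0 \<Longrightarrow> norm (f (x, y, \<xi>)) \<le> C * norm \<xi> powr \<mu>"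
      using homogeneous_bound[OF smooth_on_continuous_on[OF f(1)] f(2) K(2,3)] by blast
    have "norm (f p) \<le> C * 1 powr 0" if p: "p \<in> R" for p
    proof -
      obtain x y \<xi> where "p = (x, y, \<xi>)" by (cases p)
      with p K have *: "p = (x, y, \<xi>)" "(x, y) \<in> K" "0 < norm \<xi>" "norm \<xi> < 1" by auto
      then have "norm (f p) \<le> C * norm \<xi> powr \<mu>" using C(2)[of x y \<xi>] by auto
      also have "\<dots> \<le> C * 1" using * \<mu> C(1) by (intro mult_left_mono powr_le1) auto
      finally show ?thesis by simp
    qed
    then show "\<exists>C. \<forall>i\<in>I. \<forall>p\<in>R. norm (f p) \<le> C * 1 powr 0" by blast
  qed
  show ?thesis
    using f
  proof (induction n arbitrary: f)
    case 0
    then show ?case using base by simp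
  next
    case (Suc n)
    have "symb (near_regions X Y) (\<lambda>_. 1) xy_units (\<lambda>_. 0) I n (0 + 0) (\<lambda>i. ddir v f)" if v: "v \<in> xy_units" for v
    proof -
      have vB: "v \<in> Basis" using v xy_units_Basis by blast
      have "wt 1 0 v = 0" using v units_disjoint by (auto simp: wt_def xy_units_def)
      then show ?thesis
        using Suc.IH[OF smooth_on_ddir[OF Suc.prems(1) vB]] homogeneous_ddir[OF X Suc.prems vB] by simp
    qed
    then show ?case using base[OF Suc.prems] by simp
  qed
qed

lemma ddir_zero: "ddir 0 f p = 0"
  by (simp add: ddir_def)

lemma bounded_linear_snd_snd: "bounded_linear (\<lambda>p. snd (snd p))"
  by (rule bounded_linear_compose[OF bounded_linear_snd bounded_linear_snd])

lemma bounded_linear_fst_snd: "bounded_linear (\<lambda>p. fst (snd p))"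
  by (rule bounded_linear_compose[OF bounded_linear_fst bounded_linear_snd])

lemma Basis_triple_cases:
  fixes v :: "(real ^ 'x::finite) \<times> (real ^ 'y::finite) \<times> (real ^ 'z::finite)"
  assumes "v \<in> Basis"
  shows "v \<in> range unit_x \<and> fst (snd v) = 0 \<and> snd (snd v) = 0 \<and> fst v \<in> Basis
    \<or> v \<in> range unit_y \<and> fst v = 0 \<and> snd (snd v) = 0 \<and> fst (snd v) \<in> Basis
    \<or> v \<in> range unit_xi \<and> fst v = 0 \<and> fst (snd v) = 0 \<and> snd (snd v) \<in> Basis"
  using assms unfolding Basis_triple
  by (auto simp: unit_x_def unit_y_def unit_xi_def Basis_vec_def)

lemma ddir_snd_snd:
  fixes p v :: "'a::euclidean_space \<times> 'b::euclidean_space \<times> 'c::euclidean_space"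
  assumes "smooth_on UNIV g"
  shows "ddir v (\<lambda>p. g (snd (snd p))) p = ddir (snd (snd v)) g (snd (snd p))"
  using differentiable_affine_compose(2)[OF bounded_linear_snd_snd, of g 0 p v]
    smooth_on_differentiable_at[OF assms open_UNIV] by simp

lemma ddir_fst_snd:
  fixes p v :: "'a::euclidean_space \<times> 'b::euclidean_space \<times> 'c::euclidean_space"
  assumes "smooth_on UNIV g"
  shows "ddir v (\<lambda>p. g (fst (snd p))) p = ddir (fst (snd v)) g (fst (snd p))"
  using differentiable_affine_compose(2)[OF bounded_linear_fst_snd, of g 0 p v]
    smooth_on_differentiable_at[OF assms open_UNIV] by simp

lemma smooth_on_snd_snd:
  fixes g :: "real ^ 'z::finite \<Rightarrow> complex"
  assumes "smooth_on UNIV g" "open S"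
  shows "smooth_on S (\<lambda>p :: (real ^ 'x::finite) \<times> (real ^ 'y::finite) \<times> (real ^ 'z). g (snd (snd p)))"
proof -
  have B: "\<exists>r. \<exists>b\<in>Basis. snd (snd v) = r *\<^sub>R b" if v: "v \<in> Basis"
    for v :: "(real ^ 'x) \<times> (real ^ 'y) \<times> (real ^ 'z)"
  proof (cases "snd (snd v) = 0")
    case True
    then show ?thesis using SOME_Basis by (intro exI[of _ 0]) auto
  next
    case False
    then show ?thesis using Basis_triple_cases[OF v] by (intro exI[of _ 1]) auto
  qed
  show ?thesis
    using smooth_on_affine_compose[OF bounded_linear_snd_snd B assms(1) open_UNIV assms(2), of 0] by simp
qed

lemma smooth_on_fst_snd:
  fixes g :: "real ^ 'y::finite \<Rightarrow> complex"
  assumes "smooth_on UNIV g" "open S"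
  shows "smooth_on S (\<lambda>p :: (real ^ 'x::finite) \<times> (real ^ 'y) \<times> (real ^ 'z::finite). g (fst (snd p)))"
proof -
  have B: "\<exists>r. \<exists>b\<in>Basis. fst (snd v) = r *\<^sub>R b" if v: "v \<in> Basis"
    for v :: "(real ^ 'x) \<times> (real ^ 'y) \<times> (real ^ 'z)"
  proof (cases "fst (snd v) = 0")
    case True
    then show ?thesis using SOME_Basis by (intro exI[of _ 0]) auto
  next
    case False
    then show ?thesis using Basis_triple_cases[OF v] by (intro exI[of _ 1]) auto
  qed
  show ?thesis
    using smooth_on_affine_compose[OF bounded_linear_fst_snd B assms(1) open_UNIV assms(2), of 0] by simp
qed

text \<open>On the support \<open>freq\<close> lies between 1 and 2, where all its powers are
  comparable up to \<open>2 powr \<bar>m\<bar>\<close>. Hence order and weight are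
  arbitrary.\<close>

lemma symb_compact_frequency:
  fixes g :: "real ^ 'z::finite \<Rightarrow> complex"
  assumes X: "open (X :: (real ^ 'x::finite) set)" "open (Y :: (real ^ 'y::finite) set)"
    and g: "smooth_on UNIV g" "\<And>\<xi>. norm \<xi> > 2 \<Longrightarrow> g \<xi> = 0"
  shows "symb (far_regions X Y) freq Basis w I n m (\<lambda>i p. g (snd (snd p)))"
proof -
  interpret F: symbol_class "X \<times> Y \<times> \<Xi>" "far_regions X Y" freq "Basis :: ((real ^ 'x) \<times> (real ^ 'y) \<times> (real ^ 'z)) set" w I
    by (rule symbol_class_far[OF X])
  have base: "bnd (far_regions X Y) freq I m (\<lambda>i p. g (snd (snd p)))"
    if g: "smooth_on UNIV g" "\<And>\<xi>. norm \<xi> > 2 \<Longrightarrow> g \<xi> = 0" for g :: "real ^ 'z \<Rightarrow> complex" and m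
  proof -
    have "bounded (g ` cball 0 2)"
      by (intro compact_imp_bounded compact_continuous_image continuous_on_subset[OF smooth_on_continuous_on[OF g(1)]]) auto
    then obtain C where C: "\<And>\<xi>. norm \<xi> \<le> 2 \<Longrightarrow> norm (g \<xi>) \<le> C" unfolding bounded_iff by fastforce
    have "norm (g (snd (snd p))) \<le> (\<bar>C\<bar> * 2 powr \<bar>m\<bar>) * freq p powr m" for p :: "(real ^ 'x) \<times> (real ^ 'y) \<times> (real ^ 'z)"
    proof (cases "norm (snd (snd p)) \<le> 2")
      case True
      have f: "1 \<le> freq p" "freq p \<le> 2" using True by (auto simp: freq_def)
      have "1 \<le> 2 powr \<bar>m\<bar> * freq p powr m"
      proof (cases "m \<ge> 0")
        case True
        then show ?thesis using f mult_mono[of 1 "2 powr \<bar>m\<bar>" 1 "freq p powr m"] by (simp add: ge_one_powr_ge_zero)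
      next
        case False
        have "freq p powr (- m) \<le> 2 powr (- m)" using f False by (intro powr_mono2) auto
        then show ?thesis using f False by (simp add: powr_minus field_simps)
      qed
      then have "\<bar>C\<bar> * 1 \<le> \<bar>C\<bar> * (2 powr \<bar>m\<bar> * freq p powr m)" by (rule mult_left_mono) simp
      moreover have "norm (g (snd (snd p))) \<le> \<bar>C\<bar>" using C[OF True] by simp
      ultimately show ?thesis by (simp add: mult.assoc)
    next
      case False
      then show ?thesis using g(2)[of "snd (snd p)"] by simp
    qed
    then show ?thesis by (intro bndI) blast
  qed
  show ?thesis using g
  proof (induction n arbitrary: g m)
    case 0
    then show ?case using base by simp
  next
    case (Suc n)
    have "F.sy n (m + w v) (\<lambda>i. ddir v (\<lambda>p. g (snd (snd p))))" if v: "v \<in> Basis" for v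
    proof (cases "snd (snd v) = 0")
      case True
      then have "ddir v (\<lambda>p :: (real ^ 'x) \<times> (real ^ 'y) \<times> (real ^ 'z). g (snd (snd p))) = (\<lambda>_. 0)"
        by (intro ext) (simp add: ddir_snd_snd[OF Suc.prems(1)] ddir_zero)
      then show ?thesis using F.symb_zero by simp
    next
      case False
      have eq: "ddir v (\<lambda>p :: (real ^ 'x) \<times> (real ^ 'y) \<times> (real ^ 'z). g (snd (snd p)))
          = (\<lambda>p. ddir (snd (snd v)) g (snd (snd p)))"
        by (intro ext) (simp add: ddir_snd_snd[OF Suc.prems(1)])
      from False have b: "snd (snd v) \<in> Basis" using Basis_triple_cases[OF v] by auto
      have "F.sy n (m + w v) (\<lambda>i p. ddir (snd (snd v)) g (snd (snd p)))"
      proof (rule Suc.IH[OF smooth_on_ddir[OF Suc.prems(1) b]])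
        fix \<xi> :: "real ^ 'z" assume \<xi>: "norm \<xi> > 2"
        have "ddir (snd (snd v)) g \<xi> = ddir (snd (snd v)) (\<lambda>_. 0) \<xi>"
          by (rule ddir_cong[of "{\<xi>. norm \<xi> > 2}"])
            (use \<xi> Suc.prems(2) in \<open>auto intro!: open_Collect_less continuous_intros\<close>)
        then show "ddir (snd (snd v)) g \<xi> = 0" by (simp add: ddir_const)
      qed
      then show ?thesis unfolding eq .
    qed
    then show ?case using base[OF Suc.prems] by simp
  qed
qed

text \<open>Derivatives in x and \<xi> annihilate the pullback, so a sign condition on the weight is
  needed in the y-directions only.\<close>

lemma symb_pullback_y:
  fixes \<psi> :: "'i \<Rightarrow> real ^ 'y::finite \<Rightarrow> complex"
    and S :: "((real ^ 'x::finite) \<times> (real ^ 'y) \<times> (real ^ 'z::finite)) set"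
  assumes S: "symbol_class S KK r B" and w: "\<And>v. v \<in> B \<Longrightarrow> v \<in> range unit_y \<Longrightarrow> 0 \<le> w v"
    and sm: "\<And>i. i \<in> I \<Longrightarrow> smooth_on UNIV (\<psi> i)"
    and bd: "\<And>vs. set vs \<subseteq> Basis \<Longrightarrow> length vs \<le> n \<Longrightarrow> \<exists>C. \<forall>i\<in>I. \<forall>y. norm (foldr ddir vs (\<psi> i) y) \<le> C"
  shows "symb KK r B w I n 0 (\<lambda>i p. \<psi> i (fst (snd p)))"
proof -
  interpret symbol_class S KK r B w I by (rule S)
  have base: "bnd KK r I 0 (\<lambda>i p. \<psi> i (fst (snd p)))" if ex: "\<exists>C. \<forall>i\<in>I. \<forall>y. norm (\<psi> i y) \<le> C"
    for \<psi> :: "'i \<Rightarrow> real ^ 'y \<Rightarrow> complex"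
  proof (rule bndI)
    fix K assume K: "K \<in> KK"
    obtain C where C: "\<And>i y. i \<in> I \<Longrightarrow> norm (\<psi> i y) \<le> C" using ex by blast
    have "norm (\<psi> i (fst (snd p))) \<le> C * r p powr 0" if "i \<in> I" "p \<in> K" for i p
    proof -
      have "r p \<noteq> 0" using r_ge[OF K that(2)] by simp
      then show ?thesis using C[OF that(1)] by simp
    qed
    then show "\<exists>C. \<forall>i\<in>I. \<forall>p\<in>K. norm (\<psi> i (fst (snd p))) \<le> C * r p powr 0" by blast
  qed
  show ?thesis using sm bd
  proof (induction n arbitrary: \<psi>)
    case 0
    then show ?case using base[of \<psi>] "0.prems"(2)[of "[]"] by simp
  next
    case (Suc n)
    have "sy n (0 + w v) (\<lambda>i. ddir v (\<lambda>p. \<psi> i (fst (snd p))))" if v: "v \<in> B" for v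
    proof (rule symb_cong)
      have vB: "v \<in> Basis" using v B by blast
      show "ddir (fst (snd v)) (\<psi> i) (fst (snd p)) = ddir v (\<lambda>p. \<psi> i (fst (snd p))) p" if "i \<in> I" for i p
        by (simp add: ddir_fst_snd[OF Suc.prems(1)[OF that]])
      show "sy n (0 + w v) (\<lambda>i p. ddir (fst (snd v)) (\<psi> i) (fst (snd p)))"
      proof (cases "fst (snd v) = 0")
        case True
        then show ?thesis using symb_zero by (simp add: ddir_zero)
      next
        case False
        then have b: "fst (snd v) \<in> Basis" "v \<in> range unit_y" using Basis_triple_cases[OF vB] by auto
        have "sy n 0 (\<lambda>i p. ddir (fst (snd v)) (\<psi> i) (fst (snd p)))"
        proof (rule Suc.IH)
          show "smooth_on UNIV (ddir (fst (snd v)) (\<psi> i))" if "i \<in> I" for i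
            by (rule smooth_on_ddir[OF Suc.prems(1)[OF that] b(1)])
          show "\<exists>C. \<forall>i\<in>I. \<forall>y. norm (foldr ddir vs (ddir (fst (snd v)) (\<psi> i)) y) \<le> C"
            if "set vs \<subseteq> Basis" "length vs \<le> n" for vs
            using Suc.prems(2)[of "vs @ [fst (snd v)]"] that b by simp
        qed
        then show ?thesis by (rule symb_mono) (use w[OF v b(2)] in simp)
      qed
    qed
    then show ?case using base[of \<psi>] Suc.prems(2)[of "[]"] by simp
  qed
qed

subsection \<open>Amplitudes\<close>

lemma order_of_count_Cons:
  assumes "inj e"
  shows "order_of (\<lambda>i. count (mset (v # vs)) (e i))
    = order_of (\<lambda>i. count (mset vs) (e i)) + (if v \<in> range e then 1 else 0)"
proof -
  have "(\<Sum>i\<in>UNIV. if v = e i then 1 else 0 :: nat) = (if v \<in> range e then 1 else 0)"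
  proof (cases "v \<in> range e")
    case True
    then obtain i0 where i0: "v = e i0" by blast
    then have "(\<Sum>i\<in>UNIV. if v = e i then 1 else 0 :: nat) = (\<Sum>i\<in>UNIV. if i = i0 then 1 else 0)"
      using assms by (intro sum.cong) (auto simp: inj_eq)
    then show ?thesis using True by simp
  next
    case False
    then show ?thesis by (auto intro!: sum.neutral)
  qed
  moreover have "order_of (\<lambda>i. count (mset (v # vs)) (e i))
      = (\<Sum>i\<in>UNIV. count (mset vs) (e i) + (if v = e i then 1 else 0))"
    unfolding order_of_def by (intro sum.cong) auto
  ultimately show ?thesis by (simp add: order_of_def sum.distrib)
qed

text \<open>Translates the accumulated weights of a list of directions into the exponent of the
  Hoermander estimate for the corresponding multi-indices.\<close>

lemma sum_list_wt:
  fixes vs :: "((real ^ 'x::finite) \<times> (real ^ 'y::finite) \<times> (real ^ 'z::finite)) list"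
  assumes "set vs \<subseteq> Basis"
  shows "sum_list (map (wt \<rho> \<delta>) vs) = - \<rho> * real (order_of (\<lambda>i. count (mset vs) (unit_xi i)))
    + \<delta> * (real (order_of (\<lambda>i. count (mset vs) (unit_x i))) + real (order_of (\<lambda>i. count (mset vs) (unit_y i))))"
  using assms
proof (induction vs)
  case Nil
  then show ?case by (simp add: order_of_def)
next
  case (Cons v vs)
  have "v \<in> range unit_x \<union> range unit_y \<union> range unit_xi" using Cons.prems Basis_triple by auto
  then have c: "(if v \<in> range unit_x then 1 else 0 :: nat) + (if v \<in> range unit_y then 1 else 0)
      = (if v \<in> range unit_xi then 0 else 1)"
    using units_disjoint by auto
  have "wt \<rho> \<delta> v = - \<rho> * real (if v \<in> range unit_xi then 1 else 0)
      + \<delta> * real ((if v \<in> range unit_x then 1 else 0) + (if v \<in> range unit_y then 1 else 0))"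
    unfolding c by (simp add: wt_def)
  then show ?case
    using Cons unfolding order_of_count_Cons[OF inj_units(2)] order_of_count_Cons[OF inj_units(3)] order_of_count_Cons[OF inj_units(4)]
    by (simp add: algebra_simps)
qed

lemma amplitude_smooth:
  assumes "open X" "open Y" "a \<in> amplitudes d \<rho> \<delta> X Y"
  shows "smooth_on (X \<times> Y \<times> \<Xi>) a"
proof -
  obtain b where b: "smooth_on (X \<times> Y \<times> UNIV) b" "a = restrict b (X \<times> Y \<times> \<Xi>)"
    using assms(3) unfolding amplitudes_def hoermander_class_def by blast
  have "smooth_on (X \<times> Y \<times> \<Xi>) b" by (rule smooth_on_subset[OF b(1)]) auto
  then show ?thesis by (rule smooth_on_cong[OF open_phase_space[OF assms(1,2)], rotated]) (simp add: b(2))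
qed

text \<open>For \<open>norm \<xi> \<ge> 1\<close> the bracket lies between \<open>norm \<xi>\<close>
  and twice that value; the absolute value in \<open>2 powr \<bar>e\<bar>\<close> covers both signs
  of the exponent.\<close>

lemma japanese_powr_le:
  fixes \<xi> :: "'a::real_normed_vector"
  assumes "1 \<le> norm \<xi>"
  shows "japanese \<xi> powr e \<le> 2 powr \<bar>e\<bar> * norm \<xi> powr e"
proof -
  have l: "norm \<xi> \<le> japanese \<xi>" unfolding japanese_def by (rule real_le_rsqrt) simp
  have "1 + (norm \<xi>)\<^sup>2 \<le> (2 * norm \<xi>)\<^sup>2"
    using power_mono[OF assms, of 2] by (simp add: power_mult_distrib)
  then have u: "japanese \<xi> \<le> 2 * norm \<xi>" unfolding japanese_def by (rule real_le_lsqrt[rotated]) auto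
  show ?thesis
  proof (cases "e \<ge> 0")
    case True
    have "japanese \<xi> powr e \<le> (2 * norm \<xi>) powr e" using u l True by (intro powr_mono2) (auto intro: order_trans[OF norm_ge_zero])
    then show ?thesis using True by (simp add: powr_mult)
  next
    case False
    have "japanese \<xi> powr e \<le> norm \<xi> powr e" using l assms False by (intro powr_mono2') auto
    also have "\<dots> \<le> 2 powr \<bar>e\<bar> * norm \<xi> powr e"
      using ge_one_powr_ge_zero[of 2 "\<bar>e\<bar>"] mult_right_mono[of 1 "2 powr \<bar>e\<bar>" "norm \<xi> powr e"] by simp
    finally show ?thesis .
  qed
qed

lemma amplitude_far:
  fixes X :: "(real ^ 'x::finite) set" and Y :: "(real ^ 'y::finite) set"
    and a :: "(real ^ 'x) \<times> (real ^ 'y) \<times> (real ^ 'z::finite) \<Rightarrow> complex"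
  assumes X: "open X" "open Y" and a: "a \<in> amplitudes d \<rho> \<delta> X Y"
  shows "symb (far_regions X Y) freq Basis (wt \<rho> \<delta>) I n d (\<lambda>i. a)"
proof (rule symb_from_derivs)
  obtain b where b: "b \<in> hoermander_class d \<rho> \<delta> X Y" "a = restrict b (X \<times> Y \<times> \<Xi>)"
    using a unfolding amplitudes_def by blast
  have sb: "smooth_on (X \<times> Y \<times> UNIV) b" using b(1) by (simp add: hoermander_class_def)
  fix vs :: "((real ^ 'x) \<times> (real ^ 'y) \<times> (real ^ 'z)) list" and R :: "((real ^ 'x) \<times> (real ^ 'y) \<times> (real ^ 'z)) set"
  assume vs: "set vs \<subseteq> Basis" and "R \<in> far_regions X Y"
  then obtain K where K: "R = {(x, y, \<xi>). (x, y) \<in> K \<and> 1 \<le> norm \<xi>}" "compact K" "K \<subseteq> X \<times> Y"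
    unfolding far_regions_def by blast
  define j where "j = (\<lambda>i. count (mset vs) (unit_x i))"
  define k where "k = (\<lambda>i. count (mset vs) (unit_y i))"
  define l where "l = (\<lambda>i. count (mset vs) (unit_xi i))"
  define e where "e = d - \<rho> * order_of l + \<delta> * (order_of j + order_of k)"
  have e: "d + sum_list (map (wt \<rho> \<delta>) vs) = e"
    unfolding e_def j_def k_def l_def sum_list_wt[OF vs] by simp
  obtain C where C: "\<forall>(x, y)\<in>K. \<forall>\<xi>. norm (mderiv3 j k l b (x, y, \<xi>)) \<le> C * japanese \<xi> powr e"
    using b(1) K(2,3) unfolding hoermander_class_def e_def by fastforce
  have "norm (foldr ddir vs a p) \<le> (\<bar>C\<bar> * 2 powr \<bar>e\<bar>) * freq p powr e" if p: "p \<in> R" for p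
  proof -
    obtain x y \<xi> where "p = (x, y, \<xi>)" by (cases p)
    with p K have *: "p = (x, y, \<xi>)" "(x, y) \<in> K" "1 \<le> norm \<xi>" by auto
    then have W: "p \<in> X \<times> Y \<times> \<Xi>" using K(3) by (auto simp: \<Xi>_def)
    have "foldr ddir vs a p = foldr ddir vs b p"
      by (rule derivs_cong[OF open_phase_space[OF X] W]) (simp add: b(2))
    also have "\<dots> = mderiv3 j k l b p"
      unfolding j_def k_def l_def using W by (intro derivs_eq_mderiv3[OF sb _ _ vs]) (auto intro!: open_Times X)
    finally have "norm (foldr ddir vs a p) \<le> C * japanese \<xi> powr e" using C * by auto
    also have "\<dots> \<le> \<bar>C\<bar> * (2 powr \<bar>e\<bar> * norm \<xi> powr e)"
      using japanese_powr_le[OF *(3), of e] by (intro mult_mono) auto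
    finally show ?thesis using * by (simp add: freq_def mult.assoc)
  qed
  then show "\<exists>C. \<forall>i\<in>I. \<forall>p\<in>R. norm (foldr ddir vs a p) \<le> C * freq p powr (d + sum_list (map (wt \<rho> \<delta>) vs))"
    unfolding e by blast
qed

text \<open>The amplitude is the restriction of a function \<open>b\<close> that is smooth across
  \<xi> = 0, so its derivatives are bounded on the product of \<open>K\<close> with the closed unit
  ball.\<close>

lemma amplitude_near:
  fixes X :: "(real ^ 'x::finite) set" and Y :: "(real ^ 'y::finite) set"
    and a :: "(real ^ 'x) \<times> (real ^ 'y) \<times> (real ^ 'z::finite) \<Rightarrow> complex"
  assumes X: "open X" "open Y" and a: "a \<in> amplitudes d \<rho> \<delta> X Y"
  shows "symb (near_regions X Y) (\<lambda>_. 1) xy_units (\<lambda>_. 0) I n 0 (\<lambda>i. a)"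
proof (rule symb_from_derivs)
  obtain b where b: "b \<in> hoermander_class d \<rho> \<delta> X Y" "a = restrict b (X \<times> Y \<times> \<Xi>)"
    using a unfolding amplitudes_def by blast
  have sb: "smooth_on (X \<times> Y \<times> UNIV) b" using b(1) by (simp add: hoermander_class_def)
  fix vs :: "((real ^ 'x) \<times> (real ^ 'y) \<times> (real ^ 'z)) list" and R :: "((real ^ 'x) \<times> (real ^ 'y) \<times> (real ^ 'z)) set"
  assume vs: "set vs \<subseteq> xy_units" and "R \<in> near_regions X Y"
  then obtain K where K: "R = {(x, y, \<xi>). (x, y) \<in> K \<and> 0 < norm \<xi> \<and> norm \<xi> < 1}" "compact K" "K \<subseteq> X \<times> Y"
    unfolding near_regions_def by blast
  let ?L = "(\<lambda>((x, y), \<xi>). (x, y, \<xi>)) ` (K \<times> cball (0 :: real ^ 'z) 1)"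
  have L: "compact ?L" unfolding case_prod_unfold
    by (intro compact_continuous_image compact_Times K compact_cball continuous_intros)
  have LW: "?L \<subseteq> X \<times> Y \<times> UNIV" using K by auto
  have "continuous_on (X \<times> Y \<times> UNIV) (foldr ddir vs b)"
    using vs xy_units_Basis by (intro smooth_on_continuous_on smooth_on_derivs[OF sb]) blast
  from compact_imp_bounded[OF compact_continuous_image[OF continuous_on_subset[OF this LW] L]]
  have "bounded (foldr ddir vs b ` ?L)" .
  then obtain C where C: "\<forall>q\<in>foldr ddir vs b ` ?L. norm q \<le> C" unfolding bounded_iff by blast
  have "norm (foldr ddir vs a p) \<le> C" if p: "p \<in> R" for p
  proof -
    obtain x y \<xi> where "p = (x, y, \<xi>)" by (cases p)
    with p K have *: "p = (x, y, \<xi>)" "(x, y) \<in> K" "0 < norm \<xi>" "norm \<xi> < 1" by auto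
    then have W: "p \<in> X \<times> Y \<times> \<Xi>" using K(3) by (auto simp: \<Xi>_def)
    have "foldr ddir vs a p = foldr ddir vs b p"
      by (rule derivs_cong[OF open_phase_space[OF X] W]) (simp add: b(2))
    moreover have "p \<in> ?L" using * by (intro image_eqI[of _ _ "((x, y), \<xi>)"]) auto
    ultimately show ?thesis using C by auto
  qed
  then show "\<exists>C. \<forall>i\<in>I. \<forall>p\<in>R. norm (foldr ddir vs a p) \<le> C * 1 powr (0 + sum_list (map (\<lambda>_. 0) vs))"
    by (intro exI[of _ C]) simp
qed


section \<open>The operator L\<close>

lemma norm_grad_sq: "(norm (grad e f p))\<^sup>2 = (\<Sum>i\<in>UNIV. (ddir (e i) f p)\<^sup>2)"
  unfolding power2_norm_eq_inner inner_vec_def grad_def by (simp add: power2_eq_square)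

lemma L_op_apply:
  "L_op \<theta> \<Phi> f p = - (\<Sum>l\<in>UNIV. ddir (unit_xi l) (\<lambda>z. L_alpha \<theta> \<Phi> l z * f z) p)
     - (\<Sum>k\<in>UNIV. ddir (unit_y k) (\<lambda>z. L_beta \<theta> \<Phi> k z * f z) p) + \<theta> (snd (snd p)) * f p"
  by (cases p) (simp add: L_op_def)

lemma L_op_cong:
  assumes "open S" "p \<in> S" "\<And>q. q \<in> S \<Longrightarrow> f q = g q"
  shows "L_op \<theta> \<Phi> f p = L_op \<theta> \<Phi> g p"
proof -
  have "ddir v (\<lambda>z. c z * f z) p = ddir v (\<lambda>z. c z * g z) p" for v and c :: "_ \<Rightarrow> complex"
    by (rule ddir_cong[OF assms(1,2)]) (simp add: assms(3))
  then show ?thesis unfolding L_op_apply using assms(2,3) by simp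
qed

lemma L_iter_cong:
  assumes "open S" "p \<in> S" "\<And>q. q \<in> S \<Longrightarrow> f q = g q"
  shows "(L_op \<theta> \<Phi> ^^ \<kappa>) f p = (L_op \<theta> \<Phi> ^^ \<kappa>) g p"
  using assms(2)
proof (induction \<kappa> arbitrary: p)
  case (Suc \<kappa>)
  then show ?case using L_op_cong[OF assms(1) Suc.prems, of "(L_op \<theta> \<Phi> ^^ \<kappa>) f" "(L_op \<theta> \<Phi> ^^ \<kappa>) g"] by simp
qed (simp add: assms(3))

lemma L_op_zero: "L_op \<theta> \<Phi> (\<lambda>_. 0) = (\<lambda>_. 0)"
  by (rule ext) (simp add: L_op_apply ddir_const)

lemma L_iter_zero:
  assumes "open S" "p \<in> S" "\<And>q. q \<in> S \<Longrightarrow> f q = 0"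
  shows "(L_op \<theta> \<Phi> ^^ \<kappa>) f p = 0"
proof -
  have "(L_op \<theta> \<Phi> ^^ \<kappa>) (\<lambda>_. 0) = (\<lambda>_. 0)" by (induction \<kappa>) (simp_all add: L_op_zero)
  then show ?thesis using L_iter_cong[OF assms(1,2), of f "\<lambda>_. 0"] assms(3) by simp
qed

locale phase_setting =
  fixes X :: "(real ^ 'x::finite) set" and Y :: "(real ^ 'y::finite) set"
    and \<alpha> :: real and \<theta> :: "real ^ 'z::finite \<Rightarrow> complex"
    and \<Phi> :: "(real ^ 'x) \<times> (real ^ 'y) \<times> (real ^ 'z) \<Rightarrow> real"
  assumes X: "open X" and Y: "open Y" and \<alpha>: "0 < \<alpha>"
    and \<theta>: "\<theta> \<in> test_functions UNIV"
    and \<theta>1: "\<And>\<xi>. norm \<xi> < 1 \<Longrightarrow> \<theta> \<xi> = 1" and \<theta>2: "\<And>\<xi>. norm \<xi> > 2 \<Longrightarrow> \<theta> \<xi> = 0"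
    and \<Phi>: "\<Phi> \<in> nondeg_phases \<alpha> X Y"
begin

abbreviation W :: "((real ^ 'x) \<times> (real ^ 'y) \<times> (real ^ 'z)) set" where "W \<equiv> X \<times> Y \<times> \<Xi>"

abbreviation "farsy \<equiv> symb (far_regions X Y :: ((real ^ 'x) \<times> (real ^ 'y) \<times> (real ^ 'z)) set set) freq Basis"
abbreviation "nearsy \<equiv> symb (near_regions X Y :: ((real ^ 'x) \<times> (real ^ 'y) \<times> (real ^ 'z)) set set) (\<lambda>_. 1) xy_units (\<lambda>_. 0)"

lemma open_W: "open W"
  by (rule open_phase_space[OF X Y])

sublocale F: symbol_class W "far_regions X Y" freq Basis w I for w I
  by (rule symbol_class_far[OF X Y])

sublocale N: symbol_class W "near_regions X Y" "\<lambda>_. 1" xy_units w I for w I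
  by (rule symbol_class_near[OF X Y])

lemma smooth_\<theta>: "smooth_on UNIV \<theta>"
  using \<theta> by (simp add: test_functions_def)

lemma smooth_\<Phi>: "smooth_on W \<Phi>"
  using \<Phi> by (simp add: nondeg_phases_def phases_def)

text \<open>The symbol calculus is set up for complex-valued functions, so the phase is carried
  along in complex form.\<close>

definition "cphi = (\<lambda>p. complex_of_real (\<Phi> p))"

lemma smooth_cphi: "smooth_on W cphi"
  unfolding cphi_def by (rule smooth_on_of_real[OF open_W smooth_\<Phi>])

lemma homogeneous_cphi: "homogeneous X Y 1 cphi"
  using \<Phi> by (simp add: nondeg_phases_def phases_def homogeneous_def cphi_def)

lemma ddir_cphi: "p \<in> W \<Longrightarrow> ddir v cphi p = of_real (ddir v \<Phi> p)"
  unfolding cphi_def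
  by (rule ddir_bounded_linear[OF bounded_linear_of_real smooth_on_differentiable_at[OF smooth_\<Phi> open_W]])

lemma smooth_norm_sq: "smooth_on W (\<lambda>p. complex_of_real ((norm (snd (snd p)))\<^sup>2))"
proof (rule smooth_on_of_real[OF open_W])
  have "smooth_on W (\<lambda>p. snd (snd p))" by (rule smooth_on_linear[OF bounded_linear_snd_snd])
  then have "smooth_on W (\<lambda>p. snd (snd p) \<bullet> snd (snd p))"
    unfolding smooth_on_diff_order by (intro allI diff_order_bounded_bilinear[OF open_W bounded_bilinear_inner]) blast+
  then show "smooth_on W (\<lambda>p. (norm (snd (snd p)))\<^sup>2)" by (simp add: power2_norm_eq_inner)
qed

text \<open>Agrees with \<open>L_denom\<close> on \<open>W\<close>, but is written as a polynomial
  in first derivatives, so that smoothness and homogeneity of degree 2 follow term by term.\<close>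

definition "den = (\<lambda>p. complex_of_real ((norm (snd (snd p)))\<^sup>2)
    * (\<Sum>l\<in>UNIV. ddir (unit_xi l) cphi p * ddir (unit_xi l) cphi p)
    + (\<Sum>k\<in>UNIV. ddir (unit_y k) cphi p * ddir (unit_y k) cphi p))"

lemma smooth_den: "smooth_on W den"
  unfolding den_def
  by (intro smooth_on_add[OF open_W] smooth_on_mult[OF open_W] smooth_on_sum[OF open_W] smooth_norm_sq
      smooth_on_ddir[OF smooth_cphi]) auto

lemma homogeneous_d_xi: "homogeneous X Y 0 (ddir (unit_xi l) cphi)"
  using homogeneous_ddir[OF X Y smooth_cphi homogeneous_cphi, of "unit_xi l"] by (simp add: wt_def)

lemma homogeneous_d_y: "homogeneous X Y 1 (ddir (unit_y k) cphi)"
proof -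
  have "(unit_y k :: (real ^ 'x) \<times> (real ^ 'y) \<times> (real ^ 'z)) \<notin> range unit_xi" using units_disjoint by blast
  then show ?thesis using homogeneous_ddir[OF X Y smooth_cphi homogeneous_cphi, of "unit_y k"] by (simp add: wt_def)
qed

lemma homogeneous_den: "homogeneous X Y 2 den"
proof -
  have 1: "homogeneous X Y (2 + (0 + 0)) (\<lambda>p. complex_of_real ((norm (snd (snd p)))\<^sup>2)
      * (\<Sum>l\<in>UNIV. ddir (unit_xi l) cphi p * ddir (unit_xi l) cphi p))"
    by (intro homogeneous_mult homogeneous_norm_sq homogeneous_sum homogeneous_d_xi)
  have 2: "homogeneous X Y (1 + 1) (\<lambda>p. \<Sum>k\<in>UNIV. ddir (unit_y k) cphi p * ddir (unit_y k) cphi p)"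
    by (intro homogeneous_sum homogeneous_mult homogeneous_d_y)
  from 1 2 show ?thesis unfolding den_def by (intro homogeneous_add) simp_all
qed

lemma den_eq:
  assumes "p \<in> W"
  shows "den p = of_real (L_denom \<Phi> p)"
proof -
  obtain x y \<xi> where p: "p = (x, y, \<xi>)" by (cases p)
  show ?thesis
    unfolding den_def L_denom_def ddir_cphi[OF assms] unfolding p prod.case norm_grad_sq
    by (simp add: power2_eq_square)
qed

text \<open>The nondegeneracy condition in y, multiplied by \<open>(norm \<xi>)\<^sup>2\<close>,
  bounds \<open>L_denom\<close> below by \<open>\<alpha> * (norm \<xi>)\<^sup>2\<close>.\<close>

lemma L_denom_pos:
  assumes "p \<in> W"
  shows "0 < L_denom \<Phi> p"
proof -
  obtain x y \<xi> where p: "p = (x, y, \<xi>)" by (cases p)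
  then have n: "norm \<xi> > 0" and W: "x \<in> X" "y \<in> Y" "\<xi> \<in> \<Xi>" using assms by (auto simp: \<Xi>_def)
  have "\<alpha> \<le> (norm (grad unit_y \<Phi> (x, y, \<xi>)))\<^sup>2 / (norm \<xi>)\<^sup>2 + (norm (grad unit_xi \<Phi> (x, y, \<xi>)))\<^sup>2"
    using \<Phi> W unfolding nondeg_phases_def by blast
  then have "\<alpha> * (norm \<xi>)\<^sup>2 \<le> L_denom \<Phi> p" using n by (simp add: p L_denom_def field_simps)
  moreover have "0 < \<alpha> * (norm \<xi>)\<^sup>2" using \<alpha> n by simp
  ultimately show ?thesis by linarith
qed

lemma den_nonzero: "p \<in> W \<Longrightarrow> den p \<noteq> 0"
  using L_denom_pos[of p] by (simp add: den_eq)

text \<open>\<open>L_alpha\<close> and \<open>L_beta\<close> split into the common factor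
  \<open>excision\<close>, which is - i (1 - \<theta>), and a homogeneous coefficient of degree 0
  and - 1 respectively. The two factors are estimated by different lemmas.\<close>

definition "acoef l = (\<lambda>p. inverse (den p) * (complex_of_real ((norm (snd (snd p)))\<^sup>2) * ddir (unit_xi l) cphi p))"
definition "bcoef k = (\<lambda>p. inverse (den p) * ddir (unit_y k) cphi p)"
definition "excision = (\<lambda>p :: (real ^ 'x) \<times> (real ^ 'y) \<times> (real ^ 'z). - \<i> + \<i> * \<theta> (snd (snd p)))"

lemma L_alpha_eq: "p \<in> W \<Longrightarrow> L_alpha \<theta> \<Phi> l p = excision p * acoef l p"
  by (cases p) (simp add: L_alpha_def acoef_def excision_def den_eq ddir_cphi divide_inverse algebra_simps)

lemma L_beta_eq: "p \<in> W \<Longrightarrow> L_beta \<theta> \<Phi> k p = excision p * bcoef k p"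
  by (cases p) (simp add: L_beta_def bcoef_def excision_def den_eq ddir_cphi divide_inverse algebra_simps)

lemma smooth_acoef: "smooth_on W (acoef l)"
  unfolding acoef_def using den_nonzero
  by (intro smooth_on_mult[OF open_W] smooth_on_inverse[OF open_W] smooth_den smooth_norm_sq smooth_on_ddir[OF smooth_cphi]) auto

lemma smooth_bcoef: "smooth_on W (bcoef k)"
  unfolding bcoef_def using den_nonzero
  by (intro smooth_on_mult[OF open_W] smooth_on_inverse[OF open_W] smooth_den smooth_on_ddir[OF smooth_cphi]) auto

lemma homogeneous_acoef: "homogeneous X Y 0 (acoef l)"
proof -
  have "homogeneous X Y (- 2 + (2 + 0)) (acoef l)" unfolding acoef_def
    by (intro homogeneous_mult homogeneous_inverse homogeneous_den homogeneous_norm_sq homogeneous_d_xi)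
  then show ?thesis by simp
qed

lemma homogeneous_bcoef: "homogeneous X Y (- 1) (bcoef k)"
proof -
  have "homogeneous X Y (- 2 + 1) (bcoef k)" unfolding bcoef_def
    by (intro homogeneous_mult homogeneous_inverse homogeneous_den homogeneous_d_y)
  then show ?thesis by simp
qed

lemma smooth_\<theta>_W: "smooth_on W (\<lambda>p. \<theta> (snd (snd p)))"
  by (rule smooth_on_snd_snd[OF smooth_\<theta> open_W])

lemma symb_\<theta>: "farsy w I n m (\<lambda>i p. \<theta> (snd (snd p)))"
  by (rule symb_compact_frequency[OF X Y smooth_\<theta> \<theta>2])

lemma smooth_excision: "smooth_on W excision"
  unfolding excision_def
  by (rule smooth_on_add[OF open_W smooth_on_const smooth_on_mult[OF open_W smooth_on_const smooth_\<theta>_W]])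

lemma symb_excision: "farsy w I n 0 (\<lambda>i. excision)"
  unfolding excision_def
  by (rule F.symb_add[OF smooth_on_const smooth_on_mult[OF open_W smooth_on_const smooth_\<theta>_W] F.symb_const
        F.symb_cmult[OF smooth_\<theta>_W symb_\<theta>]])

lemma smooth_L_alpha: "smooth_on W (L_alpha \<theta> \<Phi> l)"
  by (rule smooth_on_cong[OF open_W _ smooth_on_mult[OF open_W smooth_excision smooth_acoef[of l]]])
    (simp add: L_alpha_eq)

lemma smooth_L_beta: "smooth_on W (L_beta \<theta> \<Phi> k)"
  by (rule smooth_on_cong[OF open_W _ smooth_on_mult[OF open_W smooth_excision smooth_bcoef[of k]]])
    (simp add: L_beta_eq)

lemma symb_L_alpha:
  assumes "\<rho> \<le> 1" "0 \<le> \<delta>"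
  shows "farsy (wt \<rho> \<delta>) I n 0 (\<lambda>i. L_alpha \<theta> \<Phi> l)"
proof (rule F.symb_cong)
  have "farsy (wt \<rho> \<delta>) I n (0 + 0) (\<lambda>i p. excision p * acoef l p)"
    by (rule F.symb_mult[OF smooth_excision smooth_acoef symb_excision
          symb_homogeneous_far[OF X Y smooth_acoef homogeneous_acoef assms]])
  then show "farsy (wt \<rho> \<delta>) I n 0 (\<lambda>i p. excision p * acoef l p)" by simp
qed (simp add: L_alpha_eq)

lemma symb_L_beta:
  assumes "\<rho> \<le> 1" "0 \<le> \<delta>"
  shows "farsy (wt \<rho> \<delta>) I n (- 1) (\<lambda>i. L_beta \<theta> \<Phi> k)"
proof (rule F.symb_cong)
  have "farsy (wt \<rho> \<delta>) I n (0 + - 1) (\<lambda>i p. excision p * bcoef k p)"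
    by (rule F.symb_mult[OF smooth_excision smooth_bcoef symb_excision
          symb_homogeneous_far[OF X Y smooth_bcoef homogeneous_bcoef assms]])
  then show "farsy (wt \<rho> \<delta>) I n (- 1) (\<lambda>i p. excision p * bcoef k p)" by simp
qed (simp add: L_beta_eq)

lemma smooth_L_op:
  assumes f: "smooth_on W f"
  shows "smooth_on W (L_op \<theta> \<Phi> f)"
proof -
  have "smooth_on W (\<lambda>p. - (\<Sum>l\<in>UNIV. ddir (unit_xi l) (\<lambda>z. L_alpha \<theta> \<Phi> l z * f z) p)
     - (\<Sum>k\<in>UNIV. ddir (unit_y k) (\<lambda>z. L_beta \<theta> \<Phi> k z * f z) p) + \<theta> (snd (snd p)) * f p)"
    by (intro smooth_on_add[OF open_W] smooth_on_diff[OF open_W] smooth_on_uminus[OF open_W] smooth_on_sum[OF open_W]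
        smooth_on_ddir smooth_on_mult[OF open_W] smooth_L_alpha smooth_L_beta f smooth_\<theta>_W unit_Basis)
  then show ?thesis by (rule smooth_on_cong[OF open_W, rotated]) (simp add: L_op_apply)
qed

text \<open>The \<xi>-terms have coefficients of order 0 and one \<xi>-derivative, a gain of
  \<open>\<rho>\<close>; the y-terms have coefficients of order - 1 and one y-derivative, a gain of
  \<open>1 - \<delta>\<close>; the \<theta>-term is of any order. One order of differentiability is
  used up.\<close>

lemma symb_L_op:
  assumes \<rho>: "\<rho> \<le> 1" "0 \<le> \<delta>" and sm: "\<And>i. i \<in> I \<Longrightarrow> smooth_on W (f i)"
    and f: "farsy (wt \<rho> \<delta>) I (Suc n) m f"
  shows "farsy (wt \<rho> \<delta>) I n (m - min \<rho> (1 - \<delta>)) (\<lambda>i. L_op \<theta> \<Phi> (f i))"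
proof (rule F.symb_cong)
  let ?m = "m - min \<rho> (1 - \<delta>)"
  have sa: "smooth_on W (\<lambda>z. L_alpha \<theta> \<Phi> l z * f i z)" and sb: "smooth_on W (\<lambda>z. L_beta \<theta> \<Phi> k z * f i z)"
    if "i \<in> I" for i l k
    using smooth_on_mult[OF open_W smooth_L_alpha sm[OF that]] smooth_on_mult[OF open_W smooth_L_beta sm[OF that]] by auto
  have "farsy (wt \<rho> \<delta>) I (Suc n) (0 + m) (\<lambda>i z. L_alpha \<theta> \<Phi> l z * f i z)" for l
    by (rule F.symb_mult[OF smooth_L_alpha sm symb_L_alpha[OF \<rho>] f])
  from symb_ddir[OF this unit_Basis(4)]
  have 1: "farsy (wt \<rho> \<delta>) I n ?m (\<lambda>i. ddir (unit_xi l) (\<lambda>z. L_alpha \<theta> \<Phi> l z * f i z))" for l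
    by (rule F.symb_mono) (simp add: wt_def)
  have "farsy (wt \<rho> \<delta>) I (Suc n) (- 1 + m) (\<lambda>i z. L_beta \<theta> \<Phi> k z * f i z)" for k
    by (rule F.symb_mult[OF smooth_L_beta sm symb_L_beta[OF \<rho>] f])
  note b = symb_ddir[OF this unit_Basis(3)]
  have ny: "(unit_y k :: (real ^ 'x) \<times> (real ^ 'y) \<times> (real ^ 'z)) \<notin> range unit_xi" for k
    using units_disjoint by blast
  have 2: "farsy (wt \<rho> \<delta>) I n ?m (\<lambda>i. ddir (unit_y k) (\<lambda>z. L_beta \<theta> \<Phi> k z * f i z))" for k
    by (rule F.symb_mono[OF b]) (simp add: wt_def ny)
  have "farsy (wt \<rho> \<delta>) I n (- min \<rho> (1 - \<delta>) + m) (\<lambda>i p. \<theta> (snd (snd p)) * f i p)"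
    by (rule F.symb_mult[OF smooth_\<theta>_W sm symb_\<theta> symb_Suc_imp[OF f]])
  then have 3: "farsy (wt \<rho> \<delta>) I n ?m (\<lambda>i p. \<theta> (snd (snd p)) * f i p)" by simp
  have s1: "smooth_on W (\<lambda>p. - (\<Sum>l\<in>UNIV. ddir (unit_xi l) (\<lambda>z. L_alpha \<theta> \<Phi> l z * f i z) p))"
    and s2: "smooth_on W (\<lambda>p. - (\<Sum>k\<in>UNIV. ddir (unit_y k) (\<lambda>z. L_beta \<theta> \<Phi> k z * f i z) p))" if "i \<in> I" for i
    by (intro smooth_on_uminus[OF open_W] smooth_on_sum[OF open_W] smooth_on_ddir sa[OF that] sb[OF that] unit_Basis)+
  have s3: "smooth_on W (\<lambda>p. \<theta> (snd (snd p)) * f i p)" if "i \<in> I" for i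
    by (rule smooth_on_mult[OF open_W smooth_\<theta>_W sm[OF that]])
  have "farsy (wt \<rho> \<delta>) I n ?m (\<lambda>i p. - (\<Sum>l\<in>UNIV. ddir (unit_xi l) (\<lambda>z. L_alpha \<theta> \<Phi> l z * f i z) p))"
    by (intro F.symb_uminus F.symb_sum 1 smooth_on_sum[OF open_W] smooth_on_ddir sa unit_Basis)
  moreover have "farsy (wt \<rho> \<delta>) I n ?m (\<lambda>i p. - (\<Sum>k\<in>UNIV. ddir (unit_y k) (\<lambda>z. L_beta \<theta> \<Phi> k z * f i z) p))"
    by (intro F.symb_uminus F.symb_sum 2 smooth_on_sum[OF open_W] smooth_on_ddir sb unit_Basis)
  ultimately show "farsy (wt \<rho> \<delta>) I n ?m (\<lambda>i p. - (\<Sum>l\<in>UNIV. ddir (unit_xi l) (\<lambda>z. L_alpha \<theta> \<Phi> l z * f i z) p)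
     + - (\<Sum>k\<in>UNIV. ddir (unit_y k) (\<lambda>z. L_beta \<theta> \<Phi> k z * f i z) p) + \<theta> (snd (snd p)) * f i p)"
    by (intro F.symb_add 3 smooth_on_add[OF open_W] s1 s2 s3)
qed (simp add: L_op_apply)

lemma smooth_L_iter: "smooth_on W f \<Longrightarrow> smooth_on W ((L_op \<theta> \<Phi> ^^ \<kappa>) f)"
  by (induction \<kappa>) (auto simp: smooth_L_op)

lemma symb_L_iter:
  assumes \<rho>: "\<rho> \<le> 1" "0 \<le> \<delta>" and sm: "\<And>i. i \<in> I \<Longrightarrow> smooth_on W (f i)"
  shows "farsy (wt \<rho> \<delta>) I (n + \<kappa>) m f \<Longrightarrow>
    farsy (wt \<rho> \<delta>) I n (m - real \<kappa> * min \<rho> (1 - \<delta>)) (\<lambda>i. (L_op \<theta> \<Phi> ^^ \<kappa>) (f i))"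
proof (induction \<kappa> arbitrary: n)
  case (Suc \<kappa>)
  have "farsy (wt \<rho> \<delta>) I (Suc n + \<kappa>) m f" using Suc.prems by simp
  from symb_L_op[OF \<rho> smooth_L_iter[OF sm] Suc.IH[OF this]] show ?case
    by (simp add: algebra_simps)
qed simp

text \<open>Since 1 - \<theta> vanishes on a whole neighbourhood of \<open>p\<close>, so do both
  kinds of coefficients, and their products with \<open>f\<close> have zero derivative there; only
  the last term of L remains.\<close>

lemma L_op_near:
  assumes "p \<in> W" "norm (snd (snd p)) < 1"
  shows "L_op \<theta> \<Phi> f p = f p"
proof -
  let ?S = "{p :: (real ^ 'x) \<times> (real ^ 'y) \<times> (real ^ 'z). norm (snd (snd p)) < 1}"
  have S: "open ?S" by (intro open_Collect_less continuous_intros)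
  have "ddir v (\<lambda>z. L_alpha \<theta> \<Phi> l z * f z) p = ddir v (\<lambda>_. 0) p" for v l
    by (rule ddir_cong[OF S]) (use assms \<theta>1 in \<open>auto simp: L_alpha_def\<close>)
  moreover have "ddir v (\<lambda>z. L_beta \<theta> \<Phi> k z * f z) p = ddir v (\<lambda>_. 0) p" for v k
    by (rule ddir_cong[OF S]) (use assms \<theta>1 in \<open>auto simp: L_beta_def\<close>)
  ultimately show ?thesis using \<theta>1[OF assms(2)] by (simp add: L_op_apply ddir_const)
qed

lemma L_iter_near:
  assumes "p \<in> W" "norm (snd (snd p)) < 1"
  shows "(L_op \<theta> \<Phi> ^^ \<kappa>) f p = f p"
  using L_op_near[OF assms] by (induction \<kappa>) auto

definition "osc = (\<lambda>p. exp (\<i> * cphi p))"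

lemma smooth_osc: "smooth_on W osc"
  unfolding osc_def by (intro smooth_on_exp[OF open_W] smooth_on_mult[OF open_W] smooth_on_const smooth_cphi)

lemma ddir_osc: "p \<in> W \<Longrightarrow> ddir v osc p = osc p * (\<i> * of_real (ddir v \<Phi> p))"
proof -
  assume p: "p \<in> W"
  have d: "cphi differentiable at p" by (rule smooth_on_differentiable_at[OF smooth_cphi open_W p])
  have "(\<lambda>p. \<i> * cphi p) differentiable at p"
    by (rule smooth_on_differentiable_at[OF smooth_on_mult[OF open_W smooth_on_const smooth_cphi] open_W p])
  from ddir_exp[OF this, of v] show ?thesis
    unfolding osc_def ddir_bounded_linear[OF bounded_linear_mult_right d] by (simp add: ddir_cphi[OF p])
qed

text \<open>First derivatives of the phase have degree 0 in the \<xi>-directions and degree 1 in the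
  others. A derivative of the oscillating factor therefore costs nothing in \<xi> and one power of
  \<open>freq\<close> in x or y, which is the weight \<open>wt 0 1\<close>.\<close>

lemma symb_osc_far: "farsy (wt 0 1) I n 0 (\<lambda>i. osc)"
  unfolding osc_def
proof (rule F.symb_exp)
  show "smooth_on W (\<lambda>p. \<i> * cphi p)" by (intro smooth_on_mult[OF open_W] smooth_on_const smooth_cphi)
  show "Re (\<i> * cphi p) \<le> 0" for p by (simp add: cphi_def)
  fix v :: "(real ^ 'x) \<times> (real ^ 'y) \<times> (real ^ 'z)" and n assume v: "v \<in> Basis"
  have "homogeneous X Y (1 + wt 1 0 v) (ddir v cphi)"
    by (rule homogeneous_ddir[OF X Y smooth_cphi homogeneous_cphi v])
  then have "farsy (wt 0 1) I n (1 + wt 1 0 v) (\<lambda>i. ddir v cphi)"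
    by (intro symb_homogeneous_far[OF X Y smooth_on_ddir[OF smooth_cphi v]]) auto
  then have "farsy (wt 0 1) I n (wt 0 1 v) (\<lambda>i p. \<i> * ddir v cphi p)"
    by (intro F.symb_cmult smooth_on_ddir[OF smooth_cphi v]) (simp add: wt_def split: if_splits)
  then show "farsy (wt 0 1) I n (wt 0 1 v) (\<lambda>i. ddir v (\<lambda>p. \<i> * cphi p))"
    by (rule F.symb_cong[rotated])
      (simp add: ddir_bounded_linear[OF bounded_linear_mult_right smooth_on_differentiable_at[OF smooth_cphi open_W]])
qed

lemma symb_osc_near: "nearsy I n 0 (\<lambda>i. osc)"
  unfolding osc_def
proof (rule N.symb_exp)
  show "smooth_on W (\<lambda>p. \<i> * cphi p)" by (intro smooth_on_mult[OF open_W] smooth_on_const smooth_cphi)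
  show "Re (\<i> * cphi p) \<le> 0" for p by (simp add: cphi_def)
  fix v :: "(real ^ 'x) \<times> (real ^ 'y) \<times> (real ^ 'z)" and n assume v: "v \<in> xy_units"
  then have vB: "v \<in> Basis" using xy_units_Basis by blast
  have "v \<notin> range unit_xi" using v units_disjoint by (auto simp: xy_units_def)
  then have "homogeneous X Y 1 (ddir v cphi)"
    using homogeneous_ddir[OF X Y smooth_cphi homogeneous_cphi vB] by (simp add: wt_def)
  then have "nearsy I n 0 (\<lambda>i. ddir v cphi)"
    by (intro symb_homogeneous_near[OF X Y smooth_on_ddir[OF smooth_cphi vB]]) auto
  then have "nearsy I n 0 (\<lambda>i p. \<i> * ddir v cphi p)"
    by (intro N.symb_cmult smooth_on_ddir[OF smooth_cphi vB])
  then show "nearsy I n 0 (\<lambda>i. ddir v (\<lambda>p. \<i> * cphi p))"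
    by (rule N.symb_cong[rotated])
      (simp add: ddir_bounded_linear[OF bounded_linear_mult_right smooth_on_differentiable_at[OF smooth_cphi open_W]])
qed

text \<open>The formal transpose of \<open>L\<close> fixes \<open>e\<^bsup>i\<Phi>\<^esup>\<close>.\<close>

lemma osc_L_op:
  assumes f: "smooth_on W f" and p: "p \<in> W"
  shows "osc p * L_op \<theta> \<Phi> f p = osc p * f p
    - (\<Sum>l\<in>UNIV. ddir (unit_xi l) (\<lambda>z. osc z * (L_alpha \<theta> \<Phi> l z * f z)) p)
    - (\<Sum>k\<in>UNIV. ddir (unit_y k) (\<lambda>z. osc z * (L_beta \<theta> \<Phi> k z * f z)) p)"
proof -
  have eq: "ddir v (\<lambda>z. osc z * (c z * f z)) p
      = osc p * ddir v (\<lambda>z. c z * f z) p + osc p * f p * (\<i> * of_real (ddir v \<Phi> p) * c p)"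
    if "smooth_on W c" for c v
    using ddir_mult[OF smooth_on_differentiable_at[OF smooth_osc open_W p]
        smooth_on_differentiable_at[OF smooth_on_mult[OF open_W that f] open_W p], of v]
    by (simp add: ddir_osc[OF p] mult_ac)
  define D where "D = complex_of_real (L_denom \<Phi> p)"
  have D: "D \<noteq> 0" using L_denom_pos[OF p] by (simp add: D_def)
  obtain x y \<xi> where pp: "p = (x, y, \<xi>)" by (cases p)
  have i_cancel: "\<i> * r * (- \<i> / E * t * s) = t / E * (r * s)" for r E t s :: complex
    by (simp add: divide_inverse algebra_simps)
  have 1: "\<i> * of_real (ddir (unit_xi l) \<Phi> p) * L_alpha \<theta> \<Phi> l p
      = (1 - \<theta> \<xi>) / D * of_real ((norm \<xi>)\<^sup>2 * (ddir (unit_xi l) \<Phi> p)\<^sup>2)" for l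
    unfolding L_alpha_def pp prod.case D_def of_real_mult i_cancel by (simp add: power2_eq_square mult_ac)
  have 2: "\<i> * of_real (ddir (unit_y k) \<Phi> p) * L_beta \<theta> \<Phi> k p
      = (1 - \<theta> \<xi>) / D * of_real ((ddir (unit_y k) \<Phi> p)\<^sup>2)" for k
    unfolding L_beta_def pp prod.case D_def of_real_mult i_cancel by (simp add: power2_eq_square mult_ac)
  \<comment> \<open>Division by \<open>L_denom\<close> is chosen to make these products add up to 1
    - \<theta>; the missing \<theta> is supplied by the last term of L.\<close>
  have "(\<Sum>l\<in>UNIV. \<i> * of_real (ddir (unit_xi l) \<Phi> p) * L_alpha \<theta> \<Phi> l p)
      + (\<Sum>k\<in>UNIV. \<i> * of_real (ddir (unit_y k) \<Phi> p) * L_beta \<theta> \<Phi> k p)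
      = (1 - \<theta> \<xi>) / D * of_real (L_denom \<Phi> p)"
    unfolding 1 2 unfolding pp L_denom_def norm_grad_sq prod.case of_real_add of_real_mult of_real_sum
    by (simp only: sum_distrib_left distrib_left)
  also have "\<dots> = 1 - \<theta> \<xi>" using D by (simp add: D_def)
  finally have s: "(\<Sum>l\<in>UNIV. \<i> * of_real (ddir (unit_xi l) \<Phi> p) * L_alpha \<theta> \<Phi> l p)
      + (\<Sum>k\<in>UNIV. \<i> * of_real (ddir (unit_y k) \<Phi> p) * L_beta \<theta> \<Phi> k p) = 1 - \<theta> \<xi>" .
  define A where "A = (\<Sum>l\<in>UNIV. ddir (unit_xi l) (\<lambda>z. L_alpha \<theta> \<Phi> l z * f z) p)"
  define B where "B = (\<Sum>k\<in>UNIV. ddir (unit_y k) (\<lambda>z. L_beta \<theta> \<Phi> k z * f z) p)"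
  have "(\<Sum>l\<in>UNIV. ddir (unit_xi l) (\<lambda>z. osc z * (L_alpha \<theta> \<Phi> l z * f z)) p)
      = osc p * A + osc p * f p * (\<Sum>l\<in>UNIV. \<i> * of_real (ddir (unit_xi l) \<Phi> p) * L_alpha \<theta> \<Phi> l p)"
    unfolding eq[OF smooth_L_alpha] sum.distrib A_def sum_distrib_left ..
  moreover have "(\<Sum>k\<in>UNIV. ddir (unit_y k) (\<lambda>z. osc z * (L_beta \<theta> \<Phi> k z * f z)) p)
      = osc p * B + osc p * f p * (\<Sum>k\<in>UNIV. \<i> * of_real (ddir (unit_y k) \<Phi> p) * L_beta \<theta> \<Phi> k p)"
    unfolding eq[OF smooth_L_beta] sum.distrib B_def sum_distrib_left ..
  ultimately have "osc p * f p - (\<Sum>l\<in>UNIV. ddir (unit_xi l) (\<lambda>z. osc z * (L_alpha \<theta> \<Phi> l z * f z)) p)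
      - (\<Sum>k\<in>UNIV. ddir (unit_y k) (\<lambda>z. osc z * (L_beta \<theta> \<Phi> k z * f z)) p)
      = osc p * f p - osc p * A - osc p * B - osc p * f p * ((\<Sum>l\<in>UNIV. \<i> * of_real (ddir (unit_xi l) \<Phi> p) * L_alpha \<theta> \<Phi> l p)
      + (\<Sum>k\<in>UNIV. \<i> * of_real (ddir (unit_y k) \<Phi> p) * L_beta \<theta> \<Phi> k p))"
    by (simp only: distrib_left) (simp add: algebra_simps)
  also have "\<dots> = osc p * L_op \<theta> \<Phi> f p"
    unfolding s L_op_apply A_def[symmetric] B_def[symmetric] by (simp add: pp algebra_simps)
  finally show ?thesis by simp
qed

end

section \<open>Integration\<close>

text \<open>Dyadic comparison. If \<open>2 ^ k \<le> max 1 (norm \<xi>) < 2 ^ Suc k\<close>, the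
  function is at most \<open>2 powr (- p * real k)\<close>, and the ball of radius
  \<open>2 ^ Suc k\<close> has volume \<open>c * (2 ^ Suc k) ^ n\<close> in dimension n. The
  products form a geometric series with ratio \<open>q = 2 powr (n - p) < 1\<close>.\<close>

lemma integrable_powr_max:
  fixes p :: real
  assumes p: "real DIM('a::euclidean_space) < p"
  shows "integrable lborel (\<lambda>\<xi> :: 'a. max 1 (norm \<xi>) powr (- p))"
proof (rule integrableI_bounded)
  let ?n = "DIM('a)"
  define c where "c = unit_ball_vol (real ?n)"
  define q where "q = 2 powr (real ?n - p)"
  have c: "c \<ge> 0" by (simp add: c_def)
  have q: "0 \<le> q" "q < 1"
    using p powr_less_mono[of "real ?n - p" 0 2] by (auto simp: q_def)
  define s where "s k \<xi> = ennreal (2 powr (- p * real k)) * indicator (cball 0 (2 ^ Suc k)) \<xi>" for k and \<xi> :: 'a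
  have "ennreal (norm (max 1 (norm \<xi>) powr (- p))) \<le> (\<Sum>k. s k \<xi>)" for \<xi> :: 'a
  proof -
    define r where "r = max 1 (norm \<xi>)"
    define k where "k = nat \<lfloor>log 2 r\<rfloor>"
    have r: "r \<ge> 1" by (simp add: r_def)
    have l: "0 \<le> log 2 r" using r by simp
    have k1: "real k \<le> log 2 r" and k2: "log 2 r < real (Suc k)" using l unfolding k_def by linarith+
    have "2 powr real k \<le> 2 powr (log 2 r)" using k1 by simp
    then have a: "2 powr real k \<le> r" using r by simp
    have "2 powr (log 2 r) < 2 powr real (Suc k)" using k2 by simp
    then have b: "r < 2 ^ Suc k" using r by (simp only: powr_realpow) simp
    have "r powr (- p) \<le> (2 powr real k) powr (- p)"
      using a p by (intro powr_mono2') auto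
    also have "\<dots> = 2 powr (- p * real k)" by (simp add: powr_powr mult.commute)
    finally have le: "r powr (- p) \<le> 2 powr (- p * real k)" .
    have "norm \<xi> \<le> 2 ^ Suc k" using b unfolding r_def by linarith
    then have "\<xi> \<in> cball 0 (2 ^ Suc k)" unfolding mem_cball dist_0_norm .
    then have "s k \<xi> = ennreal (2 powr (- p * real k))" unfolding s_def by (simp only: indicator_simps mult_1_right)
    then have "ennreal (norm (r powr (- p))) \<le> s k \<xi>"
      using le by (simp only: real_norm_def abs_of_nonneg[OF powr_ge_zero] ennreal_leI)
    also have "\<dots> \<le> (\<Sum>k. s k \<xi>)"
      using sum_le_suminf[of "\<lambda>k. s k \<xi>" "{k}"] by simp
    finally show ?thesis by (simp add: r_def)
  qed
  then have "(\<integral>\<^sup>+ \<xi>. ennreal (norm (max 1 (norm (\<xi> :: 'a)) powr (- p))) \<partial>lborel) \<le> (\<integral>\<^sup>+ \<xi>. (\<Sum>k. s k \<xi>) \<partial>lborel)"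
    by (intro nn_integral_mono)
  also have "\<dots> = (\<Sum>k. \<integral>\<^sup>+ \<xi>. s k \<xi> \<partial>lborel)"
  proof (rule nn_integral_suminf)
    show "s k \<in> borel_measurable lborel" for k
      unfolding s_def by (intro borel_measurable_times_ennreal borel_measurable_const borel_measurable_indicator) simp
  qed
  also have "\<dots> = (\<Sum>k. ennreal (c * 2 ^ ?n * q ^ k))"
  proof (intro suminf_cong)
    fix k
    have "(\<integral>\<^sup>+ \<xi>. s k \<xi> \<partial>lborel) = ennreal (2 powr (- p * real k)) * emeasure lborel (cball (0 :: 'a) (2 ^ Suc k))"
      unfolding s_def by (subst nn_integral_cmult_indicator) auto
    also have "\<dots> = ennreal (2 powr (- p * real k) * (c * (2 ^ Suc k) ^ ?n))"
    proof -
      have "emeasure lborel (cball (0 :: 'a) (2 ^ Suc k)) = ennreal (c * (2 ^ Suc k) ^ ?n)"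
        unfolding c_def by (rule emeasure_cball) simp
      moreover have "0 \<le> c * (2 ^ Suc k) ^ ?n" using c by simp
      ultimately show ?thesis by (simp only: ennreal_mult[OF powr_ge_zero])
    qed
    also have "2 powr (- p * real k) * (c * (2 ^ Suc k) ^ ?n) = c * 2 ^ ?n * q ^ k"
    proof -
      have "q ^ k = 2 powr ((real ?n - p) * real k)" by (simp add: q_def powr_powr flip: powr_realpow)
      also have "\<dots> = 2 powr (- p * real k) * 2 powr (real ?n * real k)" by (simp add: algebra_simps flip: powr_add)
      also have "2 powr (real ?n * real k) = (2 ^ k) ^ ?n" by (simp add: powr_realpow mult.commute flip: power_mult of_nat_mult)
      finally show ?thesis by (simp add: power_mult_distrib mult_ac)
    qed
    finally show "(\<integral>\<^sup>+ \<xi>. s k \<xi> \<partial>lborel) = ennreal (c * 2 ^ ?n * q ^ k)" .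
  qed
  also have "\<dots> < \<infinity>"
  proof -
    have "summable (\<lambda>k. c * 2 ^ ?n * q ^ k)" using q by (intro summable_mult summable_geometric) auto
    moreover have "0 \<le> c * 2 ^ ?n * q ^ k" for k using c q by simp
    ultimately have "(\<Sum>k. ennreal (c * 2 ^ ?n * q ^ k)) = ennreal (\<Sum>k. c * 2 ^ ?n * q ^ k)"
      by (intro suminf_ennreal2) auto
    then show ?thesis by simp
  qed
  finally show "(\<integral>\<^sup>+ \<xi>. ennreal (norm (max 1 (norm (\<xi> :: 'a)) powr (- p))) \<partial>lborel) < \<infinity>" .
qed simp

lemma
  fixes f :: "'a::euclidean_space \<Rightarrow> 'b::{banach, second_countable_topology}"
  assumes f: "integrable lborel f"
  shows integrable_translation: "integrable lborel (\<lambda>x. f (x + c))"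
    and integral_translation: "(\<integral>x. f (x + c) \<partial>lborel) = (\<integral>x. f x \<partial>lborel)"
proof -
  have fm: "f \<in> borel_measurable borel" using f by simp
  have m: "(+) c \<in> measurable lborel borel" by simp
  have "integrable (distr lborel borel ((+) c)) f" using f by (simp add: lborel_distr_plus)
  then show "integrable lborel (\<lambda>x. f (x + c))" using integrable_distr_eq[OF m fm] by (simp add: add.commute)
  show "(\<integral>x. f (x + c) \<partial>lborel) = (\<integral>x. f x \<partial>lborel)"
    using integral_distr[OF m fm] by (simp add: lborel_distr_plus add.commute)
qed

text \<open>
  Integrate \<open>G (p + v) - G p = \<integral>\<^sub>0\<^sup>1 \<partial>\<^sub>v G (p + s v) ds\<close> over \<open>p\<close>: by translation invariance the left side
  vanishes and, after exchanging the integrals, the right side is the integral of \<open>\<partial>\<^sub>v G\<close>.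
\<close>

lemma integral_ddir_eq_0:
  fixes G :: "'a::euclidean_space \<Rightarrow> complex"
  assumes G: "\<And>p. G differentiable (at p)" and cont: "continuous_on UNIV (ddir v G)"
    and int: "integrable lborel G" "integrable lborel (ddir v G)"
  shows "(\<integral>p. ddir v G p \<partial>lborel) = 0"
proof -
  let ?D = "ddir v G"
  define f where "f = (\<lambda>(s :: real) p. indicator {0..1} s *\<^sub>R ?D (p + s *\<^sub>R v))"
  have FTC: "(\<integral>s. f s p \<partial>lborel) = G (p + v) - G p" for p
  proof -
    have "(\<integral>s. indicator {0..1} s *\<^sub>R ?D (p + s *\<^sub>R v) \<partial>lborel) = G (p + 1 *\<^sub>R v) - G (p + 0 *\<^sub>R v)"
    proof (rule integral_FTC_Icc)
      show "((\<lambda>s. G (p + s *\<^sub>R v)) has_vector_derivative ?D (p + x *\<^sub>R v)) (at x within {0..1})" for x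
        by (rule has_vector_derivative_at_within[OF has_vector_derivative_line[OF G]])
      show "continuous_on {0..1} (\<lambda>s. ?D (p + s *\<^sub>R v))"
        by (rule continuous_on_compose2[OF cont]) (auto intro!: continuous_intros)
    qed simp
    then show ?thesis by (simp add: f_def)
  qed
  have Dm: "?D \<in> borel_measurable borel" using int(2) by simp
  have fm: "case_prod f \<in> borel_measurable (lborel \<Otimes>\<^sub>M lborel)"
  proof -
    have "(\<lambda>x :: real \<times> 'a. ?D (snd x + fst x *\<^sub>R v)) \<in> borel_measurable (lborel \<Otimes>\<^sub>M lborel)"
      by (rule measurable_compose[OF _ Dm]) simp
    moreover have "(\<lambda>x :: real \<times> 'a. indicator {0..1} (fst x) :: real) \<in> borel_measurable (lborel \<Otimes>\<^sub>M lborel)" by simp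
    ultimately show ?thesis unfolding f_def case_prod_unfold by (intro borel_measurable_scaleR)
  qed
  have inner: "(\<integral>p. f s p \<partial>lborel) = indicator {0..1} s *\<^sub>R (\<integral>p. ?D p \<partial>lborel)" for s
    unfolding f_def by (simp add: integral_translation[OF int(2)])
  have "integrable (lborel \<Otimes>\<^sub>M lborel) (case_prod f)"
  proof (rule lborel_pair.Fubini_integrable[OF fm])
    have "(\<integral>p. norm (f s p) \<partial>lborel) = indicator {0..1} s * (\<integral>p. norm (?D p) \<partial>lborel)" for s
      unfolding f_def using integral_translation[OF integrable_norm[OF int(2)], of "s *\<^sub>R v"] by simp
    then show "integrable lborel (\<lambda>s. \<integral>p. norm (case_prod f (s, p)) \<partial>lborel)" by simp
    show "AE s in lborel. integrable lborel (\<lambda>p. case_prod f (s, p))"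
      unfolding f_def using integrable_translation[OF int(2)] by simp
  qed
  from lborel_pair.Fubini_integral[OF this]
  have "(\<integral>p. G (p + v) - G p \<partial>lborel) = (\<integral>s. indicator {0..1} s *\<^sub>R (\<integral>p. ?D p \<partial>lborel) \<partial>(lborel :: real measure))"
    unfolding FTC inner .
  moreover have "(\<integral>p. G (p + v) - G p \<partial>lborel) = 0"
    using integrable_translation[OF int(1)] integral_translation[OF int(1)] int(1) by simp
  moreover have "(\<integral>s. indicator {0..1} s *\<^sub>R (\<integral>p. ?D p \<partial>lborel) \<partial>(lborel :: real measure)) = (\<integral>p. ?D p \<partial>lborel)"
    by simp
  ultimately show ?thesis by simp
qed

lemma has_derivative_sum_ddir:
  fixes f :: "'a::euclidean_space \<Rightarrow> complex"
  assumes "f differentiable (at p)"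
  shows "(f has_derivative (\<lambda>k. \<Sum>b\<in>Basis. (k \<bullet> b) *\<^sub>R ddir b f p)) (at p)"
proof -
  have lin: "linear (\<lambda>k. ddir k f p)" using has_derivative_linear[OF has_derivative_ddir[OF assms]] .
  have "ddir k f p = (\<Sum>b\<in>Basis. (k \<bullet> b) *\<^sub>R ddir b f p)" for k
  proof -
    have "ddir k f p = ddir (\<Sum>b\<in>Basis. (k \<bullet> b) *\<^sub>R b) f p" by (simp add: euclidean_representation)
    also have "\<dots> = (\<Sum>b\<in>Basis. (k \<bullet> b) *\<^sub>R ddir b f p)"
      using linear_sum[OF lin, of "\<lambda>b. (k \<bullet> b) *\<^sub>R b" Basis] linear_cmul[OF lin] by simp
    finally show ?thesis .
  qed
  then show ?thesis by (intro has_derivative_eq_rhs[OF has_derivative_ddir[OF assms]] ext)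
qed

lemma norm_sum_ddir_le:
  fixes k :: "'a::euclidean_space" and a :: "'a \<Rightarrow> complex"
  assumes "\<And>b. b \<in> Basis \<Longrightarrow> norm (a b) \<le> g"
  shows "norm (\<Sum>b\<in>Basis. (k \<bullet> b) *\<^sub>R a b) \<le> (real DIM('a) * g) * norm k"
proof -
  have "norm (\<Sum>b\<in>Basis. (k \<bullet> b) *\<^sub>R a b) \<le> (\<Sum>b\<in>(Basis :: 'a set). norm k * g)"
  proof (rule sum_norm_le)
    fix b :: 'a assume b: "b \<in> Basis"
    then show "norm ((k \<bullet> b) *\<^sub>R a b) \<le> norm k * g"
      using Basis_le_norm[OF b, of k] assms[OF b] by (auto intro!: mult_mono)
  qed
  then show ?thesis by (simp add: mult_ac)
qed

text \<open>\<open>smooth_on\<close> asks for the total derivative, so differentiating under the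
  integral in single directions is not enough. The whole remainder quotient is dominated instead:
  the bound on the basis derivatives gives the Lipschitz constant \<open>?n * g p\<close>, the
  linear part contributes the same amount, and dominated convergence applies with
  \<open>2 * (?n * g p)\<close>.\<close>

lemma differentiable_integral:
  fixes h :: "'a::euclidean_space \<Rightarrow> 'p \<Rightarrow> complex"
  assumes e: "0 < e"
    and d: "\<And>z p. z \<in> ball x e \<Longrightarrow> p \<in> space M \<Longrightarrow> (\<lambda>z. h z p) differentiable (at z)"
    and meas: "\<And>z. z \<in> ball x e \<Longrightarrow> h z \<in> borel_measurable M"
    and measd: "\<And>b. b \<in> Basis \<Longrightarrow> (\<lambda>p. ddir b (\<lambda>z. h z p) x) \<in> borel_measurable M"
    and int: "integrable M (h x)" "integrable M g"
    and bound: "\<And>z p b. z \<in> ball x e \<Longrightarrow> p \<in> space M \<Longrightarrow> b \<in> Basis \<Longrightarrow> norm (ddir b (\<lambda>z. h z p) z) \<le> g p"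
  shows "(\<lambda>z. \<integral>p. h z p \<partial>M) differentiable (at x)"
    and "v \<in> Basis \<Longrightarrow> ddir v (\<lambda>z. \<integral>p. h z p \<partial>M) x = (\<integral>p. ddir v (\<lambda>z. h z p) x \<partial>M)"
proof -
  let ?F = "\<lambda>z. \<integral>p. h z p \<partial>M"
  let ?n = "real DIM('a)"
  define D where "D p k = (\<Sum>b\<in>Basis. (k \<bullet> b) *\<^sub>R ddir b (\<lambda>z. h z p) x)" for p k
  define L where "L k = (\<Sum>b\<in>Basis. (k \<bullet> b) *\<^sub>R (\<integral>p. ddir b (\<lambda>z. h z p) x \<partial>M))" for k
  have xb: "x \<in> ball x e" using e by simp
  have intd: "integrable M (\<lambda>p. ddir b (\<lambda>z. h z p) x)" if b: "b \<in> Basis" for b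
    by (rule Bochner_Integration.integrable_bound[OF int(2) measd[OF b]])
      (use bound[OF xb _ b] in \<open>auto intro!: AE_I2 intro: order_trans[OF _ abs_ge_self]\<close>)
  have intD: "integrable M (\<lambda>p. D p k)" for k unfolding D_def using intd by auto
  have LD: "L k = (\<integral>p. D p k \<partial>M)" for k
    unfolding L_def D_def using intd by (subst Bochner_Integration.integral_sum) auto
  have lip: "norm (h z p - h x p) \<le> (?n * g p) * norm (z - x)" if z: "z \<in> ball x e" and p: "p \<in> space M" for z p
  proof (rule differentiable_bound[of "ball x e" "\<lambda>z. h z p" "\<lambda>z k. \<Sum>b\<in>Basis. (k \<bullet> b) *\<^sub>R ddir b (\<lambda>z. h z p) z"])
    show "((\<lambda>z. h z p) has_derivative (\<lambda>k. \<Sum>b\<in>Basis. (k \<bullet> b) *\<^sub>R ddir b (\<lambda>z. h z p) z)) (at z within ball x e)"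
      if "z \<in> ball x e" for z
      by (rule has_derivative_at_withinI[OF has_derivative_sum_ddir[OF d[OF that p]]])
    show "onorm (\<lambda>k. \<Sum>b\<in>Basis. (k \<bullet> b) *\<^sub>R ddir b (\<lambda>z. h z p) z) \<le> ?n * g p" if "z \<in> ball x e" for z
      by (rule onorm_le) (rule norm_sum_ddir_le[OF bound[OF that p]])
  qed (use z xb in auto)
  have inth: "integrable M (h z)" if z: "z \<in> ball x e" for z
  proof -
    have "integrable M (\<lambda>p. h z p - h x p)"
    proof (rule Bochner_Integration.integrable_bound)
      show "integrable M (\<lambda>p. (?n * g p) * norm (z - x))" using int(2) by simp
      show "(\<lambda>p. h z p - h x p) \<in> borel_measurable M" using meas[OF z] meas[OF xb] by simp
      show "AE p in M. norm (h z p - h x p) \<le> norm ((?n * g p) * norm (z - x))"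
        using lip[OF z] by (auto intro!: AE_I2 intro: order_trans[OF _ abs_ge_self])
    qed
    from Bochner_Integration.integrable_add[OF this int(1)] show ?thesis by simp
  qed
  have der: "(?F has_derivative L) (at x)"
    unfolding has_derivative_at_within
  proof
    show "bounded_linear L" unfolding L_def
      by (intro bounded_linear_sum bounded_linear_compose[OF bounded_linear_scaleR_left bounded_linear_inner_left])
    show "((\<lambda>y. (?F y - ?F x - L (y - x)) /\<^sub>R norm (y - x)) \<longlongrightarrow> 0) (at x)"
      unfolding tendsto_at_iff_sequentially comp_def
    proof (intro allI impI)
      fix X assume X0: "\<forall>i. X i \<in> UNIV - {x}" and X: "X \<longlonglongrightarrow> x"
      have "eventually (\<lambda>i. X i \<in> ball x e) sequentially"
        by (rule topological_tendstoD[OF X]) (use e in auto)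
      then obtain N where N: "\<And>i. i \<ge> N \<Longrightarrow> X i \<in> ball x e" by (auto simp: eventually_sequentially)
      define Z where "Z i = X (i + N)" for i
      have Zb: "Z i \<in> ball x e" and Zx: "Z i \<noteq> x" for i using N X0 by (auto simp: Z_def)
      have Z: "Z \<longlonglongrightarrow> x" unfolding Z_def by (rule LIMSEQ_ignore_initial_segment[OF X])
      define q where "q i p = (h (Z i) p - h x p - D p (Z i - x)) /\<^sub>R norm (Z i - x)" for i p
      have eq: "(?F (Z i) - ?F x - L (Z i - x)) /\<^sub>R norm (Z i - x) = (\<integral>p. q i p \<partial>M)" for i
        unfolding q_def LD using inth[OF Zb] int(1) intD by simp
      have "(\<lambda>i. \<integral>p. q i p \<partial>M) \<longlonglongrightarrow> (\<integral>p. 0 \<partial>M)"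
      proof (rule integral_dominated_convergence)
        show "q i \<in> borel_measurable M" for i
          unfolding q_def using meas[OF Zb] meas[OF xb] intD by auto
        show "integrable M (\<lambda>p. 2 * (?n * g p))" using int(2) by simp
        show "AE p in M. (\<lambda>i. q i p) \<longlonglongrightarrow> 0"
        proof (rule AE_I2)
          fix p assume p: "p \<in> space M"
          have "((\<lambda>y. (h y p - h x p - D p (y - x)) /\<^sub>R norm (y - x)) \<longlongrightarrow> 0) (at x)"
            using has_derivative_sum_ddir[OF d[OF xb p]] unfolding has_derivative_at_within D_def by simp
          then show "(\<lambda>i. q i p) \<longlonglongrightarrow> 0"
            unfolding tendsto_at_iff_sequentially comp_def q_def using Zx Z by blast
        qed
        show "AE p in M. norm (q i p) \<le> 2 * (?n * g p)" for i
        proof (rule AE_I2)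
          fix p assume p: "p \<in> space M"
          have n: "norm (Z i - x) > 0" using Zx by simp
          have "norm (h (Z i) p - h x p - D p (Z i - x)) \<le> (?n * g p) * norm (Z i - x) + (?n * g p) * norm (Z i - x)"
            unfolding D_def
            by (intro order_trans[OF norm_triangle_ineq4] add_mono lip[OF Zb p] norm_sum_ddir_le bound[OF xb p])
          moreover have "norm (q i p) = norm (h (Z i) p - h x p - D p (Z i - x)) / norm (Z i - x)"
            unfolding q_def by (simp add: divide_inverse mult.commute)
          ultimately show "norm (q i p) \<le> 2 * (?n * g p)" using n by (simp add: pos_divide_le_eq mult_ac)
        qed
      qed simp
      then have "(\<lambda>i. (?F (Z i) - ?F x - L (Z i - x)) /\<^sub>R norm (Z i - x)) \<longlonglongrightarrow> 0" by (simp add: eq)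
      then show "(\<lambda>i. (?F (X i) - ?F x - L (X i - x)) /\<^sub>R norm (X i - x)) \<longlonglongrightarrow> 0"
        unfolding Z_def by (rule LIMSEQ_offset)
    qed
  qed
  then show "?F differentiable (at x)" by (auto simp: differentiable_def)
  show "ddir v ?F x = (\<integral>p. ddir v (\<lambda>z. h z p) x \<partial>M)" if v: "v \<in> Basis"
  proof -
    have "L v = (\<Sum>b\<in>Basis. (if b = v then (\<integral>p. ddir v (\<lambda>z. h z p) x \<partial>M) else 0))"
      unfolding L_def using v by (intro sum.cong) (auto simp: inner_Basis)
    then show ?thesis using ddir_has_derivative[OF der] v by simp
  qed
qed

text \<open>Replacing \<open>p\<close> by simple functions \<open>s i p\<close> that converge to it
  leaves only finitely many sections of \<open>f\<close>, each measurable in \<omega>; continuity in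
  \<open>p\<close> recovers the original function in the limit.\<close>

lemma measurable_caratheodory:
  fixes f :: "'w \<Rightarrow> 'a::euclidean_space \<Rightarrow> complex"
  assumes O: "open O'" and meas: "\<And>p. p \<in> O' \<Longrightarrow> (\<lambda>\<omega>. f \<omega> p) \<in> borel_measurable P"
    and cont: "\<And>\<omega>. \<omega> \<in> space P \<Longrightarrow> continuous_on O' (f \<omega>)"
  shows "(\<lambda>(\<omega>, p). indicator O' p *\<^sub>R f \<omega> p) \<in> borel_measurable (P \<Otimes>\<^sub>M lborel)"
proof -
  have "(\<lambda>p :: 'a. p) \<in> borel_measurable lborel" by simp
  from borel_measurable_implies_sequence_metric[OF this, of 0]
  obtain s :: "nat \<Rightarrow> 'a \<Rightarrow> 'a" where s: "\<And>i. simple_function lborel (s i)" "\<And>p. (\<lambda>i. s i p) \<longlonglongrightarrow> p" by auto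
  have O_sets: "O' \<in> sets borel" using O by simp
  \<comment> \<open>The inner indicator is needed because \<open>s i p\<close> may leave the open
    set before the limit, where nothing is known about \<open>f\<close>.\<close>
  define F where "F i x = indicator O' (snd x) *\<^sub>R (indicator O' (s i (snd x)) *\<^sub>R f (fst x) (s i (snd x)))" for i and x :: "'w \<times> 'a"
  show ?thesis
  proof (rule borel_measurable_LIMSEQ_metric)
    fix i
    have fin: "finite (range (s i))" using s(1)[of i] by (simp add: simple_function_def)
    have "s i \<in> measurable lborel (count_space (range (s i)))"
      using s(1)[of i] fin by (auto simp: simple_function_def measurable_count_space_eq2)
    then have si: "(\<lambda>x. s i (snd x)) \<in> measurable (P \<Otimes>\<^sub>M lborel) (count_space (range (s i)))"
      by (rule measurable_compose[OF measurable_snd])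
    have a: "(\<lambda>x. indicator O' (s i (snd x)) *\<^sub>R f (fst x) (s i (snd x))) \<in> borel_measurable (P \<Otimes>\<^sub>M lborel)"
    proof (rule measurable_compose_countable'[OF _ si countable_finite[OF fin]])
      fix q
      show "(\<lambda>x. indicator O' q *\<^sub>R f (fst x) q) \<in> borel_measurable (P \<Otimes>\<^sub>M lborel)"
      proof (cases "q \<in> O'")
        case True
        from measurable_compose[OF measurable_fst meas[OF this]] True show ?thesis by simp
      qed simp
    qed
    have b: "(\<lambda>x. indicator O' (snd x) :: real) \<in> borel_measurable (P \<Otimes>\<^sub>M lborel)"
      using O_sets by measurable
    show "F i \<in> borel_measurable (P \<Otimes>\<^sub>M lborel)"
      unfolding F_def by (rule borel_measurable_scaleR[OF b a])
  next
    fix x :: "'w \<times> 'a" assume x: "x \<in> space (P \<Otimes>\<^sub>M lborel)"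
    obtain \<omega> p where xp: "x = (\<omega>, p)" by (cases x)
    then have \<omega>: "\<omega> \<in> space P" using x by (simp add: space_pair_measure)
    show "(\<lambda>i. F i x) \<longlonglongrightarrow> (case x of (\<omega>, p) \<Rightarrow> indicator O' p *\<^sub>R f \<omega> p)"
    proof (cases "p \<in> O'")
      case True
      have ev: "eventually (\<lambda>i. s i p \<in> O') sequentially" by (rule topological_tendstoD[OF s(2) O True])
      have "isCont (f \<omega>) p" using cont[OF \<omega>] O True continuous_on_eq_continuous_at by blast
      then have "(\<lambda>i. f \<omega> (s i p)) \<longlonglongrightarrow> f \<omega> p" by (rule isCont_tendsto_compose[OF _ s(2)])
      then have "(\<lambda>i. F i x) \<longlonglongrightarrow> f \<omega> p"
        by (rule Lim_transform_eventually) (use ev True in \<open>auto simp: F_def xp elim!: eventually_mono\<close>)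
      then show ?thesis using True xp by simp
    next
      case False
      then show ?thesis by (simp add: F_def xp)
    qed
  qed
qed

lemma integrable_tensor:
  fixes f :: "'a::euclidean_space \<Rightarrow> real" and g :: "'b::euclidean_space \<Rightarrow> real"
  assumes f: "integrable lborel f" and g: "integrable lborel g"
  shows "integrable lborel (\<lambda>(x, y). g y * f x)"
proof -
  have m: "(\<lambda>(x, y). g y * f x) \<in> borel_measurable (lborel \<Otimes>\<^sub>M lborel)"
    using borel_measurable_integrable[OF f] borel_measurable_integrable[OF g] by measurable
  have "integrable (lborel \<Otimes>\<^sub>M lborel) (\<lambda>(x, y). g y * f x)"
  proof (rule lborel_pair.Fubini_integrable[OF m])
    have "(\<integral>y. norm (case (x, y) of (x, y) \<Rightarrow> g y * f x) \<partial>lborel) = \<bar>f x\<bar> * (\<integral>y. \<bar>g y\<bar> \<partial>lborel)" for x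
      using g by (simp add: abs_mult mult.commute)
    then show "integrable lborel (\<lambda>x. \<integral>y. norm (case (x, y) of (x, y) \<Rightarrow> g y * f x) \<partial>lborel)"
      using f by simp
    show "AE x in lborel. integrable lborel (\<lambda>y. case (x, y) of (x, y) \<Rightarrow> g y * f x)" using g by simp
  qed
  then show ?thesis by (simp add: lborel_prod)
qed

lemma integrable_dominating:
  assumes K: "compact (K :: (real ^ 'y::finite) set)" and m: "m < - real CARD('z::finite)"
  shows "integrable lborel (\<lambda>(\<xi> :: real ^ 'z, y). indicator K y * max 1 (norm \<xi>) powr m)"
proof (rule integrable_tensor)
  show "integrable lborel (\<lambda>\<xi> :: real ^ 'z. max 1 (norm \<xi>) powr m)"
    using integrable_powr_max[where 'a="real ^ 'z", of "- m"] m by simp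
  show "integrable lborel (indicator K :: real ^ 'y \<Rightarrow> real)"
    using K emeasure_bounded_finite[OF compact_imp_bounded[OF K]] by (simp add: integrable_indicator_iff borel_compact)
qed

section \<open>Slices of the integrand at fixed x, and their integrals\<close>

context phase_setting
begin

abbreviation O' :: "((real ^ 'z) \<times> (real ^ 'y)) set" where "O' \<equiv> \<Xi> \<times> Y"

lemma open_O': "open O'"
  unfolding \<Xi>_def using Y by (intro open_Times open_Compl) auto

text \<open>The integrand at fixed x, extended by 0 to all pairs (\<xi>, y), so that whole-space
  integration and translation invariance apply. The frequency comes first, as in the iterated
  integral of \<open>fio\<close>.\<close>

definition slice :: "((real ^ 'x) \<times> (real ^ 'y) \<times> (real ^ 'z) \<Rightarrow> complex) \<Rightarrow> real ^ 'x \<Rightarrow> (real ^ 'z) \<times> (real ^ 'y) \<Rightarrow> complex" where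
  "slice c x q = indicator O' q *\<^sub>R c (x, snd q, fst q)"

definition dom_fun :: "(real ^ 'y) set \<Rightarrow> real \<Rightarrow> (real ^ 'z) \<times> (real ^ 'y) \<Rightarrow> real" where
  "dom_fun K m = (\<lambda>(\<xi>, y). indicator K y * max 1 (norm \<xi>) powr m)"

lemma dom_fun_nonneg: "0 \<le> dom_fun K m q"
  by (simp add: dom_fun_def split: prod.split)

lemma integrable_dom_fun: "compact K \<Longrightarrow> m < - real CARD('z) \<Longrightarrow> integrable lborel (dom_fun K m)"
  unfolding dom_fun_def by (rule integrable_dominating)

text \<open>For y in \<open>K\<close> the function \<open>dom_fun\<close> is a power of
  \<open>freq\<close> at large frequencies and equals 1 near the origin, so the far and near
  estimates together give one integrable majorant, uniform in the index and in x.\<close>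

lemma slice_bound:
  assumes far: "bnd (far_regions X Y) freq I m f" and near: "bnd (near_regions X Y) (\<lambda>_. 1) I 0 f"
    and zero: "\<And>i p. i \<in> I \<Longrightarrow> p \<in> W \<Longrightarrow> fst (snd p) \<notin> K \<Longrightarrow> f i p = 0"
    and K: "compact K" "K \<subseteq> Y" and Kx: "compact Kx" "Kx \<subseteq> X"
  shows "\<exists>C. \<forall>i\<in>I. \<forall>x\<in>Kx. \<forall>q. norm (slice (f i) x q) \<le> C * dom_fun K m q"
proof -
  have KK: "compact (Kx \<times> K)" "Kx \<times> K \<subseteq> X \<times> Y" using K Kx by (auto intro: compact_Times)
  have "{(x, y, \<xi> :: real ^ 'z). (x, y) \<in> Kx \<times> K \<and> 1 \<le> norm \<xi>} \<in> far_regions X Y"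
    unfolding far_regions_def using KK by blast
  from far this obtain C1 where C1: "C1 \<ge> 0" "\<And>i p. i \<in> I \<Longrightarrow> p \<in> {(x, y, \<xi> :: real ^ 'z). (x, y) \<in> Kx \<times> K \<and> 1 \<le> norm \<xi>} \<Longrightarrow> norm (f i p) \<le> C1 * freq p powr m"
    by (rule bndE) blast
  have "{(x, y, \<xi> :: real ^ 'z). (x, y) \<in> Kx \<times> K \<and> 0 < norm \<xi> \<and> norm \<xi> < 1} \<in> near_regions X Y"
    unfolding near_regions_def using KK by blast
  from near this obtain C2 where C2: "C2 \<ge> 0" "\<And>i p. i \<in> I \<Longrightarrow> p \<in> {(x, y, \<xi> :: real ^ 'z). (x, y) \<in> Kx \<times> K \<and> 0 < norm \<xi> \<and> norm \<xi> < 1} \<Longrightarrow> norm (f i p) \<le> C2 * 1 powr 0"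
    by (rule bndE) blast
  have "norm (slice (f i) x q) \<le> (C1 + C2) * dom_fun K m q" if i: "i \<in> I" and x: "x \<in> Kx" for i x q
  proof -
    obtain \<xi> y where q: "q = (\<xi>, y)" by (cases q)
    consider "q \<notin> O'" | "q \<in> O'" "y \<notin> K" | "q \<in> O'" "y \<in> K" "1 \<le> norm \<xi>" | "q \<in> O'" "y \<in> K" "norm \<xi> < 1" by fastforce
    then show ?thesis
    proof cases
      case 1
      then show ?thesis using C1(1) C2(1) dom_fun_nonneg[of K m q] by (simp add: slice_def)
    next
      case 2
      then have "f i (x, y, \<xi>) = 0" using zero[OF i, of "(x, y, \<xi>)"] x Kx q by auto
      then show ?thesis using C1(1) C2(1) dom_fun_nonneg[of K m q] by (simp add: slice_def q)
    next
      case 3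
      then have "norm (f i (x, y, \<xi>)) \<le> C1 * freq (x, y, \<xi>) powr m" using C1(2)[OF i] x by auto
      moreover have "C1 * freq (x, y, \<xi>) powr m \<le> (C1 + C2) * freq (x, y, \<xi>) powr m"
        using C2(1) by (intro mult_right_mono) auto
      ultimately show ?thesis using 3 by (simp add: slice_def dom_fun_def q freq_def)
    next
      case 4
      then have "0 < norm \<xi>" using q by (auto simp: \<Xi>_def)
      then have "norm (f i (x, y, \<xi>)) \<le> C2" using C2(2)[OF i, of "(x, y, \<xi>)"] x 4 by auto
      then show ?thesis using 4 C1(1) by (simp add: slice_def dom_fun_def q max_absorb1)
    qed
  qed
  then show ?thesis by blast
qed

lemma measurable_slice:
  assumes "x \<in> X" "continuous_on W c"
  shows "slice c x \<in> borel_measurable lborel"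
proof -
  have "continuous_on O' (\<lambda>q. c (x, snd q, fst q))"
    by (rule continuous_on_compose2[OF assms(2)]) (use assms(1) in \<open>auto intro!: continuous_intros\<close>)
  then have "(\<lambda>q. indicator O' q *\<^sub>R c (x, snd q, fst q)) \<in> borel_measurable borel"
    using open_O' by (intro borel_measurable_continuous_on_indicator) auto
  then show ?thesis unfolding slice_def[abs_def] by simp
qed

lemma integrable_slice:
  assumes "x \<in> X" "continuous_on W c" "compact K" "m < - real CARD('z)"
    and "\<And>q. norm (slice c x q) \<le> C * dom_fun K m q"
  shows "integrable lborel (slice c x)"
proof (rule Bochner_Integration.integrable_bound[OF _ measurable_slice[OF assms(1,2)]])
  show "integrable lborel (\<lambda>q. C * dom_fun K m q)" using integrable_dom_fun[OF assms(3,4)] by simp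
  show "AE q in lborel. norm (slice c x q) \<le> norm (C * dom_fun K m q)"
    using assms(5) by (auto intro!: AE_I2 intro: order_trans[OF _ abs_ge_self])
qed

text \<open>Together with \<open>swap_q\<close> below, the linear part of the embedding of x,
  respectively of (\<xi>, y), into the phase space; derivatives of a slice become slices of
  derivatives along these images.\<close>

definition lift_x :: "real ^ 'x \<Rightarrow> (real ^ 'x) \<times> (real ^ 'y) \<times> (real ^ 'z)" where
  "lift_x b = (b, 0, 0)"

definition swap_q :: "(real ^ 'z) \<times> (real ^ 'y) \<Rightarrow> (real ^ 'x) \<times> (real ^ 'y) \<times> (real ^ 'z)" where
  "swap_q q = (0, snd q, fst q)"

lemma bounded_linear_lift_x: "bounded_linear lift_x"
  unfolding lift_x_def[abs_def] by (intro bounded_linear_Pair bounded_linear_ident bounded_linear_zero)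

lemma bounded_linear_swap_q: "bounded_linear swap_q"
  unfolding swap_q_def[abs_def] by (intro bounded_linear_Pair bounded_linear_fst bounded_linear_snd bounded_linear_zero)

lemma slice_x:
  assumes c: "smooth_on W c" and z: "z \<in> X"
  shows "(\<lambda>z. slice c z q) differentiable (at z)"
    and "ddir b (\<lambda>z. slice c z q) z = slice (ddir (lift_x b) c) z q"
proof -
  have "(\<lambda>z. slice c z q) differentiable (at z) \<and> ddir b (\<lambda>z. slice c z q) z = slice (ddir (lift_x b) c) z q"
  proof (cases "q \<in> O'")
    case True
    have eq: "(\<lambda>z. slice c z q) = (\<lambda>z. c ((0, snd q, fst q) + lift_x z))"
      using True by (auto simp: slice_def lift_x_def)
    have "(0, snd q, fst q) + lift_x z \<in> W" using True z by (auto simp: lift_x_def)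
    from smooth_on_differentiable_at[OF c open_W this]
    have d: "c differentiable at ((0, snd q, fst q) + lift_x z)" .
    show ?thesis unfolding eq
      using differentiable_affine_compose[OF bounded_linear_lift_x d] True
      by (auto simp: slice_def lift_x_def)
  next
    case False
    then show ?thesis by (simp add: slice_def ddir_const)
  qed
  then show "(\<lambda>z. slice c z q) differentiable (at z)"
    and "ddir b (\<lambda>z. slice c z q) z = slice (ddir (lift_x b) c) z q" by auto
qed

text \<open>Extension by 0 creates no singularity: \<open>c\<close> vanishes for y off
  \<open>K\<close> and for small \<xi>, so the slice is 0 on an open set \<open>U\<close> which
  together with the domain \<open>O'\<close> covers the whole space.\<close>

lemma slice_q:
  assumes c: "smooth_on W c" and x: "x \<in> X" and K: "compact K" "K \<subseteq> Y"
    and zero: "\<And>p. p \<in> W \<Longrightarrow> fst (snd p) \<notin> K \<or> norm (snd (snd p)) < 1 \<Longrightarrow> c p = 0"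
  shows "slice c x differentiable (at q)" and "ddir v (slice c x) q = slice (ddir (swap_q v) c) x q"
    and "continuous_on UNIV (slice c x)"
proof -
  define U where "U = (snd -` (- K) \<union> {q. norm (fst q) < 1} :: ((real ^ 'z) \<times> (real ^ 'y)) set)"
  have cK: "open (- K)" using compact_imp_closed[OF K(1)] by auto
  have "open {q :: (real ^ 'z) \<times> (real ^ 'y). norm (fst q) < 1}" by (intro open_Collect_less continuous_intros)
  then have U: "open U" unfolding U_def by (rule open_Un[OF open_vimage_snd[OF cK]])
  have cover: "q \<in> O' \<or> q \<in> U" for q using K(2) by (cases q) (auto simp: U_def \<Xi>_def)
  have zU: "slice c x q = 0" if "q \<in> U" for q
    using zero[of "(x, snd q, fst q)"] that x by (auto simp: slice_def U_def indicator_def)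
  have "slice c x differentiable (at q) \<and> ddir v (slice c x) q = slice (ddir (swap_q v) c) x q"
  proof (cases "q \<in> O'")
    case True
    have "(x, 0, 0) + swap_q q \<in> W" using True x by (auto simp: swap_q_def)
    from smooth_on_differentiable_at[OF c open_W this]
    have d: "c differentiable at ((x, 0, 0) + swap_q q)" .
    have eq: "slice c x r = c ((x, 0, 0) + swap_q r)" if "r \<in> O'" for r using that by (simp add: slice_def swap_q_def)
    have "(\<lambda>q. c ((x, 0, 0) + swap_q q)) differentiable at q"
      by (rule differentiable_affine_compose(1)[OF bounded_linear_swap_q d])
    then obtain D where "((\<lambda>q. c ((x, 0, 0) + swap_q q)) has_derivative D) (at q)" by (auto simp: differentiable_def)
    then have "(slice c x has_derivative D) (at q)"
      by (rule has_derivative_transform_within_open[OF _ open_O' True]) (simp add: eq)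
    moreover have "ddir v (slice c x) q = ddir v (\<lambda>q. c ((x, 0, 0) + swap_q q)) q"
      by (rule ddir_cong[OF open_O' True eq])
    ultimately show ?thesis
      using differentiable_affine_compose(2)[OF bounded_linear_swap_q d, of v] True
      by (auto simp: differentiable_def slice_def swap_q_def)
  next
    case False
    then have qU: "q \<in> U" using cover by blast
    have "((\<lambda>_. 0) has_derivative (\<lambda>_. 0)) (at q)" by simp
    then have "(slice c x has_derivative (\<lambda>_. 0)) (at q)"
      by (rule has_derivative_transform_within_open[OF _ U qU]) (simp add: zU)
    then have "slice c x differentiable (at q)" "ddir v (slice c x) q = 0"
      using ddir_has_derivative by (auto simp: differentiable_def)
    then show ?thesis using False by (simp add: slice_def)
  qed
  then show "slice c x differentiable (at q)" "ddir v (slice c x) q = slice (ddir (swap_q v) c) x q" by auto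
  have "continuous_on O' (\<lambda>q. c (x, snd q, fst q))"
    by (rule continuous_on_compose2[OF smooth_on_continuous_on[OF c]]) (use x in \<open>auto intro!: continuous_intros\<close>)
  then have "continuous_on O' (slice c x)" by (rule continuous_on_eq) (simp add: slice_def)
  moreover have "continuous_on U (slice c x)"
    by (rule continuous_on_eq[OF continuous_on_const[of U 0]]) (simp add: zU)
  ultimately have "continuous_on (O' \<union> U) (slice c x)"
    by (rule continuous_on_open_Un[OF open_O' U])
  moreover have "O' \<union> U = UNIV" using cover by auto
  ultimately show "continuous_on UNIV (slice c x)" by simp
qed

text \<open>The integration by parts. There is no contribution from \<xi> = 0 or from the boundary
  of \<open>Y\<close>, because \<open>c\<close> vanishes there, and the order \<open>m\<close> makes
  \<open>c\<close> and its derivative integrable at infinity.\<close>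

lemma integral_slice_ddir:
  assumes c: "smooth_on W c" and x: "x \<in> X" and K: "compact K" "K \<subseteq> Y" and v: "swap_q v \<in> Basis"
    and zero: "\<And>p. p \<in> W \<Longrightarrow> fst (snd p) \<notin> K \<or> norm (snd (snd p)) < 1 \<Longrightarrow> c p = 0"
    and m: "m < - real CARD('z)"
    and far: "bnd (far_regions X Y) freq {()} m (\<lambda>_. c)" "bnd (far_regions X Y) freq {()} m (\<lambda>_. ddir (swap_q v) c)"
  shows "integrable lborel (slice (ddir (swap_q v) c) x)" and "(\<integral>q. slice (ddir (swap_q v) c) x q \<partial>lborel) = 0"
proof -
  have dz: "ddir (swap_q v) c p = 0" if p: "p \<in> W" "fst (snd p) \<notin> K \<or> norm (snd (snd p)) < 1" for p
  proof -
    define U where "U = W \<inter> ((\<lambda>p. fst (snd p)) -` (- K) \<union> {p. norm (snd (snd p)) < 1})"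
    have "open ((\<lambda>p :: (real ^ 'x) \<times> (real ^ 'y) \<times> (real ^ 'z). fst (snd p)) -` (- K))"
      by (rule open_vimage) (use compact_imp_closed[OF K(1)] in \<open>auto intro!: continuous_intros\<close>)
    moreover have "open {p :: (real ^ 'x) \<times> (real ^ 'y) \<times> (real ^ 'z). norm (snd (snd p)) < 1}"
      by (intro open_Collect_less continuous_intros)
    ultimately have "open U" unfolding U_def by (intro open_Int[OF open_W] open_Un)
    moreover have "p \<in> U" using p by (auto simp: U_def)
    ultimately have "ddir (swap_q v) c p = ddir (swap_q v) (\<lambda>_. 0) p"
      by (rule ddir_cong) (auto simp: U_def intro!: zero)
    then show ?thesis by (simp add: ddir_const)
  qed
  have near: "bnd (near_regions X Y) (\<lambda>_. 1) {()} 0 (\<lambda>_. f)"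
    if "\<And>p. p \<in> W \<Longrightarrow> norm (snd (snd p)) < 1 \<Longrightarrow> f p = 0" for f
  proof (intro bndI exI[of _ 0] ballI)
    fix R and i :: unit and p :: "(real ^ 'x) \<times> (real ^ 'y) \<times> (real ^ 'z)" assume "R \<in> near_regions X Y" "p \<in> R"
    then have "p \<in> W" "norm (snd (snd p)) < 1" by (force simp: near_regions_def \<Xi>_def)+
    then show "norm (f p) \<le> 0 * 1 powr 0" using that[of p] by simp
  qed
  have Kx: "compact {x}" "{x} \<subseteq> X" using x by auto
  obtain C where C: "\<And>q. norm (slice c x q) \<le> C * dom_fun K m q"
    using slice_bound[OF far(1) near _ K Kx] zero by auto
  obtain C' where C': "\<And>q. norm (slice (ddir (swap_q v) c) x q) \<le> C' * dom_fun K m q"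
    using slice_bound[OF far(2) near _ K Kx] dz by auto
  have sd: "smooth_on W (ddir (swap_q v) c)" by (rule smooth_on_ddir[OF c v])
  have i1: "integrable lborel (slice c x)"
    by (rule integrable_slice[OF x smooth_on_continuous_on[OF c] K(1) m C])
  show i2: "integrable lborel (slice (ddir (swap_q v) c) x)"
    by (rule integrable_slice[OF x smooth_on_continuous_on[OF sd] K(1) m C'])
  have eq: "ddir v (slice c x) = slice (ddir (swap_q v) c) x"
    by (rule ext) (rule slice_q(2)[OF c x K zero])
  have "(\<integral>q. ddir v (slice c x) q \<partial>lborel) = 0"
  proof (rule integral_ddir_eq_0[OF slice_q(1)[OF c x K zero]])
    show "continuous_on UNIV (ddir v (slice c x))" unfolding eq
      by (rule slice_q(3)[OF sd x K dz])
  qed (use i1 i2 in \<open>simp_all add: eq\<close>)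
  then show "(\<integral>q. slice (ddir (swap_q v) c) x q \<partial>lborel) = 0" by (simp add: eq)
qed

lemma swap_q_units: "swap_q (axis l 1, 0) = unit_xi l" "swap_q (0, axis k 1) = unit_y k"
  by (simp_all add: swap_q_def unit_xi_def unit_y_def)

lemma lift_x_unit: "b \<in> Basis \<Longrightarrow> lift_x b \<in> range unit_x"
  by (auto simp: lift_x_def unit_x_def Basis_vec_def)

lemma differentiable_slice_integral:
  assumes c: "smooth_on W c" and x: "x \<in> X" and K: "compact K" and m: "m < - real CARD('z)"
    and bound: "\<And>Kx. compact Kx \<Longrightarrow> Kx \<subseteq> X \<Longrightarrow> \<exists>C. \<forall>z\<in>Kx. \<forall>q. norm (slice c z q) \<le> C * dom_fun K m q"
    and boundd: "\<And>Kx b. compact Kx \<Longrightarrow> Kx \<subseteq> X \<Longrightarrow> b \<in> Basis \<Longrightarrow>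
      \<exists>C. \<forall>z\<in>Kx. \<forall>q. norm (slice (ddir (lift_x b) c) z q) \<le> C * dom_fun K m q"
  shows "(\<lambda>z. \<integral>q. slice c z q \<partial>lborel) differentiable (at x)"
    and "v \<in> Basis \<Longrightarrow> ddir v (\<lambda>z. \<integral>q. slice c z q \<partial>lborel) x = (\<integral>q. slice (ddir (lift_x v) c) x q \<partial>lborel)"
proof -
  obtain e where e: "e > 0" "cball x e \<subseteq> X" using X x open_contains_cball by blast
  have "\<forall>b\<in>Basis. \<exists>C. \<forall>z\<in>cball x e. \<forall>q. norm (slice (ddir (lift_x b) c) z q) \<le> C * dom_fun K m q"
    using boundd[OF compact_cball e(2)] by blast
  from bchoice[OF this] obtain C where
    C: "\<And>b z q. b \<in> Basis \<Longrightarrow> z \<in> cball x e \<Longrightarrow> norm (slice (ddir (lift_x b) c) z q) \<le> C b * dom_fun K m q" by blast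
  \<comment> \<open>Summing the constants over the finite basis gives one majorant valid for all
    directions at once.\<close>
  define g where "g q = (\<Sum>b\<in>(Basis :: (real ^ 'x) set). \<bar>C b\<bar>) * dom_fun K m q" for q
  have g: "norm (slice (ddir (lift_x b) c) z q) \<le> g q" if "b \<in> Basis" "z \<in> ball x e" for b z q
  proof -
    have "norm (slice (ddir (lift_x b) c) z q) \<le> C b * dom_fun K m q" using C that by auto
    also have "\<dots> \<le> g q" unfolding g_def
    proof (rule mult_right_mono[OF _ dom_fun_nonneg])
      have "\<bar>C b\<bar> \<le> (\<Sum>b\<in>(Basis :: (real ^ 'x) set). \<bar>C b\<bar>)" using that by (intro member_le_sum) auto
      then show "C b \<le> (\<Sum>b\<in>(Basis :: (real ^ 'x) set). \<bar>C b\<bar>)" by linarith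
    qed
    finally show ?thesis .
  qed
  have gi: "integrable lborel g" unfolding g_def[abs_def] using integrable_dom_fun[OF K m] by simp
  have zX: "z \<in> X" if "z \<in> ball x e" for z using that e(2) by auto
  have sl: "smooth_on W (ddir (lift_x b) c)" if "b \<in> Basis" for b
    using smooth_on_ddir[OF c, of "lift_x b"] lift_x_unit[OF that] unit_Basis by auto
  obtain C0 where C0: "\<And>q. norm (slice c x q) \<le> C0 * dom_fun K m q"
    using bound[of "{x}"] x by auto
  have int: "integrable lborel (slice c x)"
    by (rule integrable_slice[OF x smooth_on_continuous_on[OF c] K m C0])
  have 1: "(\<lambda>z. slice c z q) differentiable (at z)" if "z \<in> ball x e" for z q
    by (rule slice_x(1)[OF c zX[OF that]])
  have 2: "slice c z \<in> borel_measurable lborel" if "z \<in> ball x e" for z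
    by (rule measurable_slice[OF zX[OF that] smooth_on_continuous_on[OF c]])
  have 3: "(\<lambda>q. ddir b (\<lambda>z. slice c z q) x) \<in> borel_measurable lborel" if "b \<in> Basis" for b
    unfolding slice_x(2)[OF c x] by (rule measurable_slice[OF x smooth_on_continuous_on[OF sl[OF that]]])
  have 4: "norm (ddir b (\<lambda>z. slice c z q) z) \<le> g q" if "z \<in> ball x e" "b \<in> Basis" for z q b
    unfolding slice_x(2)[OF c zX[OF that(1)]] by (rule g[OF that(2,1)])
  show "(\<lambda>z. \<integral>q. slice c z q \<partial>lborel) differentiable (at x)"
    by (rule differentiable_integral(1)[where g=g, OF e(1) 1 2 3 int gi 4])
  show "ddir v (\<lambda>z. \<integral>q. slice c z q \<partial>lborel) x = (\<integral>q. slice (ddir (lift_x v) c) x q \<partial>lborel)" if v: "v \<in> Basis"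
  proof -
    have "ddir v (\<lambda>z. \<integral>q. slice c z q \<partial>lborel) x = (\<integral>q. ddir v (\<lambda>z. slice c z q) x \<partial>lborel)"
      by (rule differentiable_integral(2)[where g=g, OF e(1) 1 2 3 int gi 4 v])
    then show ?thesis unfolding slice_x(2)[OF c x] .
  qed
qed

text \<open>The formula reaches order \<open>n\<close>, but differentiability only orders below
  \<open>n\<close>, because differentiating once more requires the next derivative to be
  dominated.\<close>

lemma derivs_slice_integral:
  assumes c: "smooth_on W c" and K: "compact K" and m: "m < - real CARD('z)"
    and bound: "\<And>vs Kx. set vs \<subseteq> Basis \<Longrightarrow> length vs \<le> n \<Longrightarrow> compact Kx \<Longrightarrow> Kx \<subseteq> X \<Longrightarrow>
      \<exists>C. \<forall>z\<in>Kx. \<forall>q. norm (slice (foldr ddir (map lift_x vs) c) z q) \<le> C * dom_fun K m q"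
  shows "set vs \<subseteq> Basis \<Longrightarrow> length vs \<le> n \<Longrightarrow> x \<in> X \<Longrightarrow>
      foldr ddir vs (\<lambda>z. \<integral>q. slice c z q \<partial>lborel) x = (\<integral>q. slice (foldr ddir (map lift_x vs) c) x q \<partial>lborel)"
    and "set vs \<subseteq> Basis \<Longrightarrow> length vs < n \<Longrightarrow> foldr ddir vs (\<lambda>z. \<integral>q. slice c z q \<partial>lborel) differentiable_on X"
proof -
  let ?F = "\<lambda>z. \<integral>q. slice c z q \<partial>lborel"
  have lB: "set (map lift_x vs) \<subseteq> Basis" if vsB: "set vs \<subseteq> Basis" for vs
  proof
    fix u assume "u \<in> set (map lift_x vs)"
    then obtain b where "u = lift_x b" "b \<in> Basis" using vsB by auto
    then show "u \<in> Basis" using lift_x_unit[of b] by auto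
  qed
  have sm: "smooth_on W (foldr ddir (map lift_x vs) c)" if "set vs \<subseteq> Basis" for vs
    by (rule smooth_on_derivs[OF c lB[OF that]])
  have step: "(\<lambda>z. \<integral>q. slice (foldr ddir (map lift_x vs) c) z q \<partial>lborel) differentiable (at x)
      \<and> (\<forall>v\<in>Basis. ddir v (\<lambda>z. \<integral>q. slice (foldr ddir (map lift_x vs) c) z q \<partial>lborel) x
          = (\<integral>q. slice (ddir (lift_x v) (foldr ddir (map lift_x vs) c)) x q \<partial>lborel))"
    if vs: "set vs \<subseteq> Basis" "length vs < n" and x: "x \<in> X" for vs x
  proof -
    have b1: "\<exists>C. \<forall>z\<in>Kx. \<forall>q. norm (slice (foldr ddir (map lift_x vs) c) z q) \<le> C * dom_fun K m q"
      if "compact Kx" "Kx \<subseteq> X" for Kx by (rule bound[OF vs(1) less_imp_le[OF vs(2)] that])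
    have b2: "\<exists>C. \<forall>z\<in>Kx. \<forall>q. norm (slice (ddir (lift_x b) (foldr ddir (map lift_x vs) c)) z q) \<le> C * dom_fun K m q"
      if "compact Kx" "Kx \<subseteq> X" "b \<in> Basis" for Kx b
    proof -
      have "set (b # vs) \<subseteq> Basis" "length (b # vs) \<le> n" using vs that(3) by auto
      from bound[OF this that(1,2)] show ?thesis unfolding list.map foldr_Cons o_apply .
    qed
    note * = differentiable_slice_integral[OF sm[OF vs(1)] x K m b1 b2]
    show ?thesis by (intro conjI ballI *)
  qed
  show *: "foldr ddir vs ?F x = (\<integral>q. slice (foldr ddir (map lift_x vs) c) x q \<partial>lborel)"
    if "set vs \<subseteq> Basis" "length vs \<le> n" "x \<in> X" for vs x
    using that
  proof (induction vs arbitrary: x)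
    case (Cons v vs)
    have "ddir v (foldr ddir vs ?F) x = ddir v (\<lambda>z. \<integral>q. slice (foldr ddir (map lift_x vs) c) z q \<partial>lborel) x"
      using Cons by (intro ddir_cong[OF X]) auto
    also have "\<dots> = (\<integral>q. slice (ddir (lift_x v) (foldr ddir (map lift_x vs) c)) x q \<partial>lborel)"
      using step[of vs x] Cons.prems by simp
    finally show ?case by simp
  qed simp
  show "foldr ddir vs ?F differentiable_on X" if "set vs \<subseteq> Basis" "length vs < n" for vs
  proof (rule differentiable_on_cong[OF X])
    show "(\<lambda>z. \<integral>q. slice (foldr ddir (map lift_x vs) c) z q \<partial>lborel) differentiable_on X"
      using step[OF that] by (intro differentiable_onI[OF X]) blast
    show "(\<integral>q. slice (foldr ddir (map lift_x vs) c) z q \<partial>lborel) = foldr ddir vs ?F z" if "z \<in> X" for z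
      using *[of vs z] that \<open>set vs \<subseteq> Basis\<close> \<open>length vs < n\<close> by simp
  qed
qed

end

section \<open>Fourier integral operators\<close>

context phase_setting
begin

lemma L_op_add:
  assumes f: "smooth_on W f" and g: "smooth_on W g" and p: "p \<in> W"
  shows "L_op \<theta> \<Phi> (\<lambda>q. f q + g q) p = L_op \<theta> \<Phi> f p + L_op \<theta> \<Phi> g p"
proof -
  have "ddir v (\<lambda>z. c z * (f z + g z)) p = ddir v (\<lambda>z. c z * f z) p + ddir v (\<lambda>z. c z * g z) p"
    if "smooth_on W c" for c :: "_ \<Rightarrow> complex" and v
    unfolding distrib_left
    by (rule ddir_add) (use smooth_on_differentiable_at[OF smooth_on_mult[OF open_W that] open_W p] f g in blast)+
  from this[OF smooth_L_alpha] this[OF smooth_L_beta] show ?thesis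
    unfolding L_op_apply by (simp add: sum.distrib distrib_left)
qed

lemma L_op_cmult:
  assumes f: "smooth_on W f" and p: "p \<in> W"
  shows "L_op \<theta> \<Phi> (\<lambda>q. c * f q) p = c * L_op \<theta> \<Phi> f p"
proof -
  have "ddir v (\<lambda>z. u z * (c * f z)) p = c * ddir v (\<lambda>z. u z * f z) p"
    if "smooth_on W u" for u :: "_ \<Rightarrow> complex" and v
    unfolding mult.left_commute[of _ c]
    by (rule ddir_bounded_linear[OF bounded_linear_mult_right smooth_on_differentiable_at[OF smooth_on_mult[OF open_W that f] open_W p]])
  from this[OF smooth_L_alpha] this[OF smooth_L_beta] show ?thesis
    unfolding L_op_apply by (simp add: sum_distrib_left right_diff_distrib distrib_left)
qed

lemma L_iter_add:
  assumes f: "smooth_on W f" and g: "smooth_on W g" and p: "p \<in> W"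
  shows "(L_op \<theta> \<Phi> ^^ \<kappa>) (\<lambda>q. f q + g q) p = (L_op \<theta> \<Phi> ^^ \<kappa>) f p + (L_op \<theta> \<Phi> ^^ \<kappa>) g p"
  using p
proof (induction \<kappa> arbitrary: p)
  case (Suc \<kappa>)
  have "L_op \<theta> \<Phi> ((L_op \<theta> \<Phi> ^^ \<kappa>) (\<lambda>q. f q + g q)) p
      = L_op \<theta> \<Phi> (\<lambda>q. (L_op \<theta> \<Phi> ^^ \<kappa>) f q + (L_op \<theta> \<Phi> ^^ \<kappa>) g q) p"
    by (rule L_op_cong[OF open_W Suc.prems Suc.IH])
  then show ?case using L_op_add[OF smooth_L_iter[OF f] smooth_L_iter[OF g] Suc.prems] by simp
qed simp

lemma L_iter_cmult:
  assumes f: "smooth_on W f" and p: "p \<in> W"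
  shows "(L_op \<theta> \<Phi> ^^ \<kappa>) (\<lambda>q. c * f q) p = c * (L_op \<theta> \<Phi> ^^ \<kappa>) f p"
  using p
proof (induction \<kappa> arbitrary: p)
  case (Suc \<kappa>)
  have "L_op \<theta> \<Phi> ((L_op \<theta> \<Phi> ^^ \<kappa>) (\<lambda>q. c * f q)) p = L_op \<theta> \<Phi> (\<lambda>q. c * (L_op \<theta> \<Phi> ^^ \<kappa>) f q) p"
    by (rule L_op_cong[OF open_W Suc.prems Suc.IH])
  then show ?case using L_op_cmult[OF smooth_L_iter[OF f] Suc.prems] by simp
qed simp

end

text \<open>Boundedness in the test functions, truncated at order \<open>N\<close> and with common
  support in \<open>K\<close>. It is used for a \<open>cnorm\<close> ball, which yields uniform
  constants, and for a single function, indexed by the unit type.\<close>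

definition bounded_family :: "'i set \<Rightarrow> ('i \<Rightarrow> 'v::euclidean_space \<Rightarrow> complex) \<Rightarrow> nat \<Rightarrow> 'v set \<Rightarrow> bool" where
  "bounded_family I \<psi> N K \<longleftrightarrow> (\<forall>i\<in>I. smooth_on UNIV (\<psi> i) \<and> (\<forall>y. y \<notin> K \<longrightarrow> \<psi> i y = 0))
    \<and> (\<forall>vs. set vs \<subseteq> Basis \<longrightarrow> length vs \<le> N \<longrightarrow> (\<exists>C. \<forall>i\<in>I. \<forall>y. norm (foldr ddir vs (\<psi> i) y) \<le> C))"

lemma length_eq_order_of:
  assumes "set vs \<subseteq> (Basis :: (real ^ 'n::finite) set)"
  shows "order_of (\<lambda>i. count (mset vs) (unit_vec i)) = length vs"
proof -
  have "mset vs = mset (mlist unit_vec (\<lambda>i. count (mset vs) (unit_vec i)))"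
    by (rule mset_mlist[OF inj_units(1)]) (use assms in \<open>simp add: range_unit_vec\<close>)
  then have "length vs = length (mlist unit_vec (\<lambda>i. count (mset vs) (unit_vec i)))" by (metis size_mset)
  then show ?thesis by (simp add: length_mlist)
qed

lemma norm_derivs_le_cnorm:
  assumes "\<phi> \<in> test_functions X" "set vs \<subseteq> Basis" "length vs \<le> N"
  shows "norm (foldr ddir vs \<phi> x) \<le> cnorm N \<phi>"
  using norm_mderiv_le_cnorm[OF assms(1), of "\<lambda>i. count (mset vs) (unit_vec i)" N x] assms(2,3)
    derivs_eq_mderiv[OF test_functions_smooth[OF assms(1)] open_UNIV UNIV_I assms(2)] length_eq_order_of[OF assms(2)]
  by simp

lemma bounded_family_test_functions:
  "bounded_family {\<phi> \<in> test_functions_on Y K. cnorm N \<phi> \<le> B} (\<lambda>\<phi>. \<phi>) N K"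
  unfolding bounded_family_def
proof (intro conjI ballI allI impI)
  fix \<phi> assume \<phi>: "\<phi> \<in> {\<phi> \<in> test_functions_on Y K. cnorm N \<phi> \<le> B}"
  then show "smooth_on UNIV \<phi>" by (auto simp: test_functions_on_def test_functions_smooth)
  show "\<phi> y = 0" if "y \<notin> K" for y using \<phi> that outside_fun_support[of y \<phi>] by (auto simp: test_functions_on_def)
next
  fix vs :: "(real ^ 'a) list" assume "set vs \<subseteq> Basis" "length vs \<le> N"
  then show "\<exists>C. \<forall>\<phi>\<in>{\<phi> \<in> test_functions_on Y K. cnorm N \<phi> \<le> B}. \<forall>y. norm (foldr ddir vs \<phi> y) \<le> C"
    by (intro exI[of _ B] ballI allI) (auto simp: test_functions_on_def intro: order_trans[OF norm_derivs_le_cnorm])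
qed

lemma bounded_family_single:
  assumes "\<psi> \<in> test_functions Y"
  shows "bounded_family {()} (\<lambda>_. \<psi>) N (fun_support \<psi>)"
  unfolding bounded_family_def
proof (intro conjI ballI allI impI)
  show "smooth_on UNIV \<psi>" by (rule test_functions_smooth[OF assms])
  show "\<psi> y = 0" if "y \<notin> fun_support \<psi>" for y by (rule outside_fun_support[OF that])
  show "\<exists>C. \<forall>i\<in>{()}. \<forall>y. norm (foldr ddir vs \<psi> y) \<le> C" if "set vs \<subseteq> Basis" "length vs \<le> N" for vs
    using norm_derivs_le_cnorm[OF assms that] by (intro exI[of _ "cnorm N \<psi>"]) simp
qed

locale fio_setting = phase_setting X Y \<alpha> \<theta> \<Phi>
  for X :: "(real ^ 'x::finite) set" and Y :: "(real ^ 'y::finite) set"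
    and \<alpha> and \<theta> :: "real ^ 'z::finite \<Rightarrow> complex" and \<Phi> +
  fixes d \<rho> \<delta> :: real and a :: "(real ^ 'x) \<times> (real ^ 'y) \<times> (real ^ 'z) \<Rightarrow> complex"
  assumes \<delta>: "0 \<le> \<delta>" "\<delta> < 1" and \<rho>: "0 < \<rho>" "\<rho> \<le> 1"
    and a: "a \<in> amplitudes d \<rho> \<delta> X Y"
begin

definition gain :: real where "gain = min \<rho> (1 - \<delta>)"

definition ap :: "(real ^ 'y \<Rightarrow> complex) \<Rightarrow> (real ^ 'x) \<times> (real ^ 'y) \<times> (real ^ 'z) \<Rightarrow> complex" where
  "ap \<psi> = (\<lambda>p. a p * \<psi> (fst (snd p)))"

definition hh :: "nat \<Rightarrow> (real ^ 'y \<Rightarrow> complex) \<Rightarrow> (real ^ 'x) \<times> (real ^ 'y) \<times> (real ^ 'z) \<Rightarrow> complex" where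
  "hh \<kappa> \<psi> = (\<lambda>p. osc p * (L_op \<theta> \<Phi> ^^ \<kappa>) (ap \<psi>) p)"

text \<open>The oscillatory integral without the power of 2 pi, as one integral over pairs (\<xi>,
  y).\<close>

definition Fint :: "nat \<Rightarrow> (real ^ 'y \<Rightarrow> complex) \<Rightarrow> real ^ 'x \<Rightarrow> complex" where
  "Fint \<kappa> \<psi> x = (\<integral>q. slice (hh \<kappa> \<psi>) x q \<partial>lborel)"

lemma gain_pos: "0 < gain"
  using \<delta> \<rho> by (simp add: gain_def)

lemma smooth_a: "smooth_on W a"
  by (rule amplitude_smooth[OF X Y a])

lemma smooth_ap: "smooth_on UNIV \<psi> \<Longrightarrow> smooth_on W (ap \<psi>)"
  unfolding ap_def by (intro smooth_on_mult[OF open_W smooth_a] smooth_on_fst_snd open_W)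

lemma smooth_hh: "smooth_on UNIV \<psi> \<Longrightarrow> smooth_on W (hh \<kappa> \<psi>)"
  unfolding hh_def by (intro smooth_on_mult[OF open_W smooth_osc] smooth_L_iter smooth_ap)

lemma L_iter_ap_zero:
  assumes "closed K" "\<And>y. y \<notin> K \<Longrightarrow> \<psi> y = 0" "fst (snd p) \<notin> K"
  shows "(L_op \<theta> \<Phi> ^^ \<kappa>) (ap \<psi>) p = 0"
proof (rule L_iter_zero)
  show "open ((\<lambda>p :: (real ^ 'x) \<times> (real ^ 'y) \<times> (real ^ 'z). fst (snd p)) -` (- K))"
    by (rule open_vimage) (use assms(1) in \<open>auto intro!: continuous_intros\<close>)
qed (use assms in \<open>auto simp: ap_def\<close>)

lemma hh_zero:
  assumes "closed K" "\<And>y. y \<notin> K \<Longrightarrow> \<psi> y = 0" "fst (snd p) \<notin> K"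
  shows "hh \<kappa> \<psi> p = 0"
  using L_iter_ap_zero[OF assms] by (simp add: hh_def)

text \<open>Each application of L lowers the order by \<open>gain\<close> and consumes one
  derivative, hence the family is bounded up to order \<open>n + \<kappa>\<close>.\<close>

lemma symb_L_iter_ap:
  assumes fam: "bounded_family I \<psi> (n + \<kappa>) K"
  shows "farsy (wt \<rho> \<delta>) I n (d - real \<kappa> * gain) (\<lambda>i. (L_op \<theta> \<Phi> ^^ \<kappa>) (ap (\<psi> i)))"
proof -
  have sm: "smooth_on UNIV (\<psi> i)" if "i \<in> I" for i using fam that by (simp add: bounded_family_def)
  have bd: "\<exists>C. \<forall>i\<in>I. \<forall>y. norm (foldr ddir vs (\<psi> i) y) \<le> C" if "set vs \<subseteq> Basis" "length vs \<le> n + \<kappa>" for vs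
    using fam that by (simp add: bounded_family_def)
  have "farsy (wt \<rho> \<delta>) I (n + \<kappa>) 0 (\<lambda>i p. \<psi> i (fst (snd p)))"
  proof (rule symb_pullback_y[OF symbol_class_far[OF X Y] _ sm bd])
    show "0 \<le> wt \<rho> \<delta> v" if "v \<in> range unit_y" for v :: "(real ^ 'x) \<times> (real ^ 'y) \<times> (real ^ 'z)"
      using that units_disjoint \<delta> by (auto simp: wt_def)
  qed
  from F.symb_mult[OF smooth_a smooth_on_fst_snd[OF sm open_W] amplitude_far[OF X Y a] this]
  have "farsy (wt \<rho> \<delta>) I (n + \<kappa>) d (\<lambda>i. ap (\<psi> i))" by (simp add: ap_def)
  from symb_L_iter[OF \<rho>(2) \<delta>(1) smooth_ap[OF sm] this] show ?thesis by (simp add: gain_def)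
qed

lemma symb_hh_far:
  assumes fam: "bounded_family I \<psi> (n + \<kappa>) K"
  shows "farsy (wt 0 1) I n (d - real \<kappa> * gain) (\<lambda>i. hh \<kappa> (\<psi> i))"
proof -
  have sm: "smooth_on UNIV (\<psi> i)" if "i \<in> I" for i using fam that by (simp add: bounded_family_def)
  have "farsy (wt 0 1) I n (d - real \<kappa> * gain) (\<lambda>i. (L_op \<theta> \<Phi> ^^ \<kappa>) (ap (\<psi> i)))"
    by (rule F.symb_weight_mono[OF _ symb_L_iter_ap[OF fam]]) (use \<rho> \<delta> in \<open>auto simp: wt_def\<close>)
  from F.symb_mult[OF smooth_osc smooth_L_iter[OF smooth_ap[OF sm]] symb_osc_far this]
  show ?thesis by (simp add: hh_def)
qed

lemma symb_hh_near:
  assumes fam: "bounded_family I \<psi> n K"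
  shows "nearsy I n 0 (\<lambda>i. hh \<kappa> (\<psi> i))"
proof -
  have sm: "smooth_on UNIV (\<psi> i)" if "i \<in> I" for i using fam that by (simp add: bounded_family_def)
  have bd: "\<exists>C. \<forall>i\<in>I. \<forall>y. norm (foldr ddir vs (\<psi> i) y) \<le> C" if "set vs \<subseteq> Basis" "length vs \<le> n" for vs
    using fam that by (simp add: bounded_family_def)
  have "nearsy I n 0 (\<lambda>i p. \<psi> i (fst (snd p)))"
    by (rule symb_pullback_y[OF symbol_class_near[OF X Y] _ sm bd]) auto
  from N.symb_mult[OF smooth_a smooth_on_fst_snd[OF sm open_W] amplitude_near[OF X Y a] this]
  have "nearsy I n 0 (\<lambda>i. ap (\<psi> i))" by (simp add: ap_def)
  from N.symb_mult[OF smooth_osc smooth_ap[OF sm] symb_osc_near this]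
  have 1: "nearsy I n 0 (\<lambda>i p. osc p * ap (\<psi> i) p)" by simp
  let ?S = "X \<times> Y \<times> (\<Xi> \<inter> ball (0 :: real ^ 'z) 1)"
  \<comment> \<open>Powers of L act as the identity only for \<open>norm \<xi> < 1\<close>, so the
    congruence is applied on this smaller open set, which still contains all near regions.\<close>
  interpret S: symbol_class ?S "near_regions X Y" "\<lambda>_. 1" xy_units "\<lambda>_. 0" I
  proof
    show "open ?S" using X Y by (intro open_Times open_Int) (auto simp: \<Xi>_def)
    show "K \<subseteq> ?S" if "K \<in> near_regions X Y" for K
      using that by (force simp: near_regions_def \<Xi>_def)
  qed (auto simp: xy_units_Basis)
  show ?thesis
  proof (rule S.symb_cong[OF _ 1])
    fix i p assume "p \<in> ?S"
    then have "p \<in> W" "norm (snd (snd p)) < 1" by auto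
    then show "osc p * ap (\<psi> i) p = hh \<kappa> (\<psi> i) p" by (simp add: hh_def L_iter_near)
  qed
qed

lemma bounded_family_mono: "bounded_family I \<psi> N K \<Longrightarrow> M \<le> N \<Longrightarrow> bounded_family I \<psi> M K"
  unfolding bounded_family_def by auto

lemma sum_list_lift_x: "set vs \<subseteq> Basis \<Longrightarrow> sum_list (map (wt 0 1) (map lift_x vs)) = real (length vs)"
proof (induction vs)
  case (Cons v vs)
  then have "lift_x v \<notin> range unit_xi" using lift_x_unit[of v] units_disjoint by auto
  then show ?case using Cons by (simp add: wt_def)
qed simp

lemma set_lift_x: "set vs \<subseteq> Basis \<Longrightarrow> set (map lift_x vs) \<subseteq> xy_units"
  using lift_x_unit by (auto simp: xy_units_def)

text \<open>Under \<open>wt 0 1\<close> every x-derivative costs one power of \<open>freq\<close>,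
  which accounts for the summand \<open>real n\<close> in the exponent. Near \<xi> = 0 the
  derivatives are merely bounded, which \<open>dom_fun\<close> allows.\<close>

lemma hh_bound:
  assumes fam: "bounded_family I \<psi> (n + \<kappa>) K" and K: "compact K" "K \<subseteq> Y" and Kx: "compact Kx" "Kx \<subseteq> X"
    and vs: "set vs \<subseteq> Basis" "length vs \<le> n"
  shows "\<exists>C. \<forall>i\<in>I. \<forall>z\<in>Kx. \<forall>q. norm (slice (foldr ddir (map lift_x vs) (hh \<kappa> (\<psi> i))) z q)
    \<le> C * dom_fun K (d - real \<kappa> * gain + real n) q"
proof (rule slice_bound[OF _ _ _ K Kx])
  let ?us = "map lift_x vs"
  have us: "set ?us \<subseteq> xy_units" "set ?us \<subseteq> Basis" "length ?us \<le> n"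
    using set_lift_x[OF vs(1)] xy_units_Basis vs(2) by auto
  have "bnd (far_regions X Y) freq I (d - real \<kappa> * gain + real (length vs)) (\<lambda>i. foldr ddir ?us (hh \<kappa> (\<psi> i)))"
    using symb_derivs[OF symb_hh_far[OF fam] us(2,3)] unfolding sum_list_lift_x[OF vs(1)] bnd_def by blast
  then show "bnd (far_regions X Y) freq I (d - real \<kappa> * gain + real n) (\<lambda>i. foldr ddir ?us (hh \<kappa> (\<psi> i)))"
    by (rule F.bnd_mono) (use vs(2) in simp)
  show "bnd (near_regions X Y) (\<lambda>_. 1) I 0 (\<lambda>i. foldr ddir ?us (hh \<kappa> (\<psi> i)))"
  proof (rule bndI)
    fix R :: "((real ^ 'x) \<times> (real ^ 'y) \<times> (real ^ 'z)) set" assume "R \<in> near_regions X Y"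
    from symb_derivs[OF symb_hh_near[OF bounded_family_mono[OF fam le_add1]] us(1,3) this]
    show "\<exists>C. \<forall>i\<in>I. \<forall>p\<in>R. norm (foldr ddir ?us (hh \<kappa> (\<psi> i)) p) \<le> C * 1 powr 0" by (simp only: powr_one_eq_one)
  qed
  fix i p assume i: "i \<in> I" and p: "p \<in> W" "fst (snd p) \<notin> K"
  let ?U = "(\<lambda>p :: (real ^ 'x) \<times> (real ^ 'y) \<times> (real ^ 'z). fst (snd p)) -` (- K)"
  have "open ?U"
    by (rule open_vimage) (use compact_imp_closed[OF K(1)] in \<open>auto intro!: continuous_intros\<close>)
  then have "foldr ddir ?us (hh \<kappa> (\<psi> i)) p = foldr ddir ?us (\<lambda>_. 0) p"
    by (rule derivs_cong)
      (use p hh_zero[OF compact_imp_closed[OF K(1)]] fam i in \<open>auto simp: bounded_family_def\<close>)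
  then show "foldr ddir ?us (hh \<kappa> (\<psi> i)) p = 0" by (simp add: derivs_zero)
qed

lemma integrable_hh:
  assumes \<psi>: "\<psi> \<in> test_functions Y" and x: "x \<in> X" and \<kappa>: "d - real \<kappa> * gain < - real CARD('z)"
  shows "integrable lborel (slice (hh \<kappa> \<psi>) x)"
proof -
  have K: "compact (fun_support \<psi>)" "fun_support \<psi> \<subseteq> Y" using \<psi> by (auto simp: test_functions_def)
  obtain C where "\<And>q. norm (slice (hh \<kappa> \<psi>) x q) \<le> C * dom_fun (fun_support \<psi>) (d - real \<kappa> * gain) q"
    using hh_bound[OF bounded_family_single[OF \<psi>] K, of "{x}" "[]" 0 \<kappa>] x by auto
  from integrable_slice[OF x smooth_on_continuous_on[OF smooth_hh[OF test_functions_smooth[OF \<psi>]]] K(1) \<kappa> this]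
  show ?thesis .
qed

text \<open>By \<open>osc_L_op\<close> the two integrands differ by derivatives of
  \<open>c l\<close> and \<open>e k\<close>. These are products with L's coefficients, hence vanish
  for small \<xi>, and the assumption on \<open>\<kappa>\<close> makes them integrable, so their
  derivatives integrate to 0.\<close>

lemma Fint_Suc:
  assumes \<psi>: "\<psi> \<in> test_functions Y" and x: "x \<in> X" and \<kappa>: "d - real \<kappa> * gain < - real CARD('z)"
  shows "Fint (Suc \<kappa>) \<psi> x = Fint \<kappa> \<psi> x"
proof -
  let ?f = "(L_op \<theta> \<Phi> ^^ \<kappa>) (ap \<psi>)" and ?m = "d - real \<kappa> * gain"
  have K: "compact (fun_support \<psi>)" "fun_support \<psi> \<subseteq> Y" using \<psi> by (auto simp: test_functions_def)
  have sf: "smooth_on W ?f" by (intro smooth_L_iter smooth_ap test_functions_smooth[OF \<psi>])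
  define c where "c = (\<lambda>l z. osc z * (L_alpha \<theta> \<Phi> l z * ?f z))"
  define e where "e = (\<lambda>k z. osc z * (L_beta \<theta> \<Phi> k z * ?f z))"
  have sc: "smooth_on W (c l)" for l
    unfolding c_def by (intro smooth_on_mult[OF open_W] smooth_osc smooth_L_alpha sf)
  have se: "smooth_on W (e k)" for k
    unfolding e_def by (intro smooth_on_mult[OF open_W] smooth_osc smooth_L_beta sf)
  have "farsy (wt \<rho> \<delta>) {()} 1 ?m (\<lambda>_. ?f)"
    by (rule symb_L_iter_ap[OF bounded_family_single[OF \<psi>]])
  then have f01: "farsy (wt 0 1) {()} 1 ?m (\<lambda>_. ?f)"
    by (rule F.symb_weight_mono[rotated]) (use \<rho> \<delta> in \<open>auto simp: wt_def\<close>)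
  have "farsy (wt 0 1) {()} 1 (0 + (0 + ?m)) (\<lambda>_. c l)" for l
    unfolding c_def
    by (intro F.symb_mult smooth_osc smooth_on_mult[OF open_W] smooth_L_alpha sf symb_osc_far symb_L_alpha f01) auto
  then have cs: "farsy (wt 0 1) {()} (Suc 0) ?m (\<lambda>_. c l)" for l by simp
  have "farsy (wt 0 1) {()} 1 (0 + (- 1 + ?m)) (\<lambda>_. e k)" for k
    unfolding e_def
    by (intro F.symb_mult smooth_osc smooth_on_mult[OF open_W] smooth_L_beta sf symb_osc_far symb_L_beta f01) auto
  \<comment> \<open>\<open>L_beta\<close> has order - 1 and a y-derivative costs 1 under
    \<open>wt 0 1\<close>, so differentiating \<open>e k\<close> leads back to the order
    \<open>?m\<close>.\<close>
  then have es: "farsy (wt 0 1) {()} (Suc 0) (?m - 1) (\<lambda>_. e k)" for k by simp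
  have wx: "wt 0 1 (unit_xi l :: (real ^ 'x) \<times> (real ^ 'y) \<times> (real ^ 'z)) = 0" for l by (simp add: wt_def)
  have "(unit_y k :: (real ^ 'x) \<times> (real ^ 'y) \<times> (real ^ 'z)) \<notin> range unit_xi" for k
    using units_disjoint by blast
  then have wy: "wt 0 1 (unit_y k :: (real ^ 'x) \<times> (real ^ 'y) \<times> (real ^ 'z)) = 1" for k by (simp add: wt_def)
  have c0: "c l p = 0" and e0: "e k p = 0"
    if p: "p \<in> W" "fst (snd p) \<notin> fun_support \<psi> \<or> norm (snd (snd p)) < 1" for l k p
  proof -
    have "?f p = 0" if "fst (snd p) \<notin> fun_support \<psi>"
      by (rule L_iter_ap_zero[OF compact_imp_closed[OF K(1)] _ that]) (rule outside_fun_support)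
    moreover have "L_alpha \<theta> \<Phi> l p = 0 \<and> L_beta \<theta> \<Phi> k p = 0" if "norm (snd (snd p)) < 1"
      using \<theta>1[OF that] by (simp add: L_alpha_def L_beta_def case_prod_unfold)
    ultimately show "c l p = 0" "e k p = 0" using p(2) by (auto simp: c_def e_def)
  qed
  have ci: "integrable lborel (slice (ddir (unit_xi l) (c l)) x)" "(\<integral>q. slice (ddir (unit_xi l) (c l)) x q \<partial>lborel) = 0" for l
  proof -
    have 1: "bnd (far_regions X Y) freq {()} ?m (\<lambda>_. c l)" by (rule symb_bnd[OF cs])
    have 2: "bnd (far_regions X Y) freq {()} ?m (\<lambda>_. ddir (swap_q (axis l 1, 0)) (c l))"
      using symb_bnd[OF symb_ddir[OF cs, of "unit_xi l" l]] by (simp add: wx swap_q_units)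
    have v: "swap_q (axis l 1, 0) \<in> Basis" by (simp add: swap_q_units)
    from integral_slice_ddir[OF sc x K v c0 \<kappa> 1 2]
    show "integrable lborel (slice (ddir (unit_xi l) (c l)) x)" "(\<integral>q. slice (ddir (unit_xi l) (c l)) x q \<partial>lborel) = 0"
      by (simp_all add: swap_q_units)
  qed
  have ei: "integrable lborel (slice (ddir (unit_y k) (e k)) x)" "(\<integral>q. slice (ddir (unit_y k) (e k)) x q \<partial>lborel) = 0" for k
  proof -
    have 1: "bnd (far_regions X Y) freq {()} ?m (\<lambda>_. e k)" by (rule F.bnd_mono[OF symb_bnd[OF es]]) simp
    have 2: "bnd (far_regions X Y) freq {()} ?m (\<lambda>_. ddir (swap_q (0, axis k 1)) (e k))"
      using symb_bnd[OF symb_ddir[OF es, of "unit_y k" k]] by (simp add: wy swap_q_units)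
    have v: "swap_q (0, axis k 1) \<in> Basis" by (simp add: swap_q_units)
    from integral_slice_ddir[OF se x K v e0 \<kappa> 1 2]
    show "integrable lborel (slice (ddir (unit_y k) (e k)) x)" "(\<integral>q. slice (ddir (unit_y k) (e k)) x q \<partial>lborel) = 0"
      by (simp_all add: swap_q_units)
  qed
  have eq: "slice (hh (Suc \<kappa>) \<psi>) x q = slice (hh \<kappa> \<psi>) x q - (\<Sum>l\<in>UNIV. slice (ddir (unit_xi l) (c l)) x q)
      - (\<Sum>k\<in>UNIV. slice (ddir (unit_y k) (e k)) x q)" for q
  proof (cases "q \<in> O'")
    case True
    then have "(x, snd q, fst q) \<in> W" using x by auto
    from osc_L_op[OF sf this] True show ?thesis by (simp add: slice_def hh_def c_def e_def)
  next
    case False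
    then show ?thesis by (simp add: slice_def)
  qed
  have "Fint (Suc \<kappa>) \<psi> x = (\<integral>q. slice (hh \<kappa> \<psi>) x q \<partial>lborel) - (\<integral>q. (\<Sum>l\<in>UNIV. slice (ddir (unit_xi l) (c l)) x q) \<partial>lborel)
      - (\<integral>q. (\<Sum>k\<in>UNIV. slice (ddir (unit_y k) (e k)) x q) \<partial>lborel)"
    unfolding Fint_def eq using integrable_hh[OF \<psi> x \<kappa>] ci(1) ei(1)
    by (simp add: Bochner_Integration.integral_diff Bochner_Integration.integrable_sum Bochner_Integration.integrable_diff)
  also have "\<dots> = Fint \<kappa> \<psi> x"
    unfolding Fint_def using ci ei by (simp add: Bochner_Integration.integral_sum)
  finally show ?thesis .
qed

lemma gain_mono: "\<kappa> \<le> \<kappa>' \<Longrightarrow> d - real \<kappa>' * gain \<le> d - real \<kappa> * gain"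
  using gain_pos by (simp add: mult_right_mono)

lemma Fint_mono:
  assumes "\<psi> \<in> test_functions Y" "x \<in> X" "d - real \<kappa> * gain < - real CARD('z)" "\<kappa> \<le> \<kappa>'"
  shows "Fint \<kappa>' \<psi> x = Fint \<kappa> \<psi> x"
  using assms(4)
proof (induction \<kappa>' rule: dec_induct)
  case (step n)
  have "d - real n * gain < - real CARD('z)" using gain_mono[OF step(1)] assms(3) by linarith
  then show ?case using Fint_Suc[OF assms(1,2)] step by simp
qed simp

lemma large_kappa: "\<exists>\<kappa>'\<ge>\<kappa>. d - real \<kappa>' * gain + real n < - real CARD('z)"
proof -
  obtain k :: nat where k: "d + real n + real CARD('z) < real k * gain"
    using reals_Archimedean3[OF gain_pos] by blast
  have "real k * gain \<le> real (max k \<kappa>) * gain" using gain_pos by (intro mult_right_mono) auto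
  then show ?thesis using k by (intro exI[of _ "max k \<kappa>"]) auto
qed

lemma Fint_derivs:
  assumes \<psi>: "\<psi> \<in> test_functions Y" and \<kappa>: "d - real \<kappa> * gain + real n < - real CARD('z)" and vs: "set vs \<subseteq> Basis"
  shows "length vs \<le> n \<Longrightarrow> x \<in> X \<Longrightarrow>
      foldr ddir vs (Fint \<kappa> \<psi>) x = (\<integral>q. slice (foldr ddir (map lift_x vs) (hh \<kappa> \<psi>)) x q \<partial>lborel)"
    and "length vs < n \<Longrightarrow> foldr ddir vs (Fint \<kappa> \<psi>) differentiable_on X"
proof -
  have K: "compact (fun_support \<psi>)" "fun_support \<psi> \<subseteq> Y" using \<psi> by (auto simp: test_functions_def)
  have b: "\<exists>C. \<forall>z\<in>Kx. \<forall>q. norm (slice (foldr ddir (map lift_x vs) (hh \<kappa> \<psi>)) z q)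
      \<le> C * dom_fun (fun_support \<psi>) (d - real \<kappa> * gain + real n) q"
    if "set vs \<subseteq> Basis" "length vs \<le> n" "compact Kx" "Kx \<subseteq> X" for vs Kx
    using hh_bound[OF bounded_family_single[OF \<psi>] K that(3,4,1,2), of \<kappa>]
    by (elim exE) (drule bspec[OF _ singletonI], rule exI)
  note * = derivs_slice_integral[OF smooth_hh[OF test_functions_smooth[OF \<psi>]] K(1) \<kappa> b]
  show "foldr ddir vs (Fint \<kappa> \<psi>) x = (\<integral>q. slice (foldr ddir (map lift_x vs) (hh \<kappa> \<psi>)) x q \<partial>lborel)"
    if "length vs \<le> n" "x \<in> X" unfolding Fint_def[abs_def] by (rule *(1)[OF _ _ _ _ vs that])
  show "foldr ddir vs (Fint \<kappa> \<psi>) differentiable_on X" if "length vs < n"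
    unfolding Fint_def[abs_def] by (rule *(2)[OF _ _ _ _ vs that])
qed

lemma smooth_Fint:
  assumes \<psi>: "\<psi> \<in> test_functions Y" and \<kappa>: "d - real \<kappa> * gain < - real CARD('z)"
  shows "smooth_on X (Fint \<kappa> \<psi>)"
  unfolding smooth_on_def
proof (intro allI impI)
  fix vs :: "(real ^ 'x) list" assume vs: "set vs \<subseteq> Basis"
  \<comment> \<open>\<open>Fint_derivs\<close> yields differentiability only for lists shorter than
    \<open>n\<close>, hence \<open>Suc (length vs)\<close>.\<close>
  obtain \<kappa>' where \<kappa>': "\<kappa> \<le> \<kappa>'" "d - real \<kappa>' * gain + real (Suc (length vs)) < - real CARD('z)"
    using large_kappa by blast
  have "foldr ddir vs (Fint \<kappa>' \<psi>) differentiable_on X" by (rule Fint_derivs(2)[OF \<psi> \<kappa>'(2) vs]) simp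
  then show "foldr ddir vs (Fint \<kappa> \<psi>) differentiable_on X"
    by (rule differentiable_on_cong[OF X, rotated]) (rule derivs_cong[OF X _ Fint_mono[OF \<psi> _ \<kappa> \<kappa>'(1)]])
qed

text \<open>The larger number of integrations by parts depends on \<open>n\<close> alone, so the
  order \<open>N\<close> can be fixed before the directions, the compact set and the radius
  \<open>B\<close>. This lets \<open>fio_bound\<close> normalise the test function with a single
  seminorm.\<close>

lemma Fint_bound:
  assumes \<kappa>: "d - real \<kappa> * gain < - real CARD('z)" and K: "compact K" "K \<subseteq> Y"
  shows "\<exists>N. \<forall>vs Kx B. set vs \<subseteq> Basis \<longrightarrow> length vs \<le> n \<longrightarrow> compact Kx \<longrightarrow> Kx \<subseteq> X \<longrightarrow>
    (\<exists>C. \<forall>\<psi>\<in>test_functions_on Y K. cnorm N \<psi> \<le> B \<longrightarrow> (\<forall>x\<in>Kx. norm (foldr ddir vs (Fint \<kappa> \<psi>) x) \<le> C))"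
proof -
  obtain \<kappa>' where \<kappa>': "\<kappa> \<le> \<kappa>'" "d - real \<kappa>' * gain + real n < - real CARD('z)"
    using large_kappa by blast
  let ?m = "d - real \<kappa>' * gain + real n"
  have *: "\<exists>C. \<forall>\<psi>\<in>test_functions_on Y K. cnorm (n + \<kappa>') \<psi> \<le> B \<longrightarrow> (\<forall>x\<in>Kx. norm (foldr ddir vs (Fint \<kappa> \<psi>) x) \<le> C)"
    if vs: "set vs \<subseteq> Basis" "length vs \<le> n" and Kx: "compact Kx" "Kx \<subseteq> X" for vs Kx B
  proof -
    let ?I = "{\<psi> \<in> test_functions_on Y K. cnorm (n + \<kappa>') \<psi> \<le> B}"
    obtain C where C: "\<And>\<psi> z q. \<psi> \<in> ?I \<Longrightarrow> z \<in> Kx \<Longrightarrow>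
        norm (slice (foldr ddir (map lift_x vs) (hh \<kappa>' \<psi>)) z q) \<le> C * dom_fun K ?m q"
      using hh_bound[OF bounded_family_test_functions K Kx vs] by meson
    have "norm (foldr ddir vs (Fint \<kappa> \<psi>) x) \<le> (\<integral>q. C * dom_fun K ?m q \<partial>lborel)" if \<psi>: "\<psi> \<in> ?I" and x: "x \<in> Kx" for \<psi> x
    proof -
      have \<psi>T: "\<psi> \<in> test_functions Y" using \<psi> by (simp add: test_functions_on_def)
      have xX: "x \<in> X" using x Kx by blast
      have "foldr ddir vs (Fint \<kappa> \<psi>) x = foldr ddir vs (Fint \<kappa>' \<psi>) x"
        by (rule derivs_cong[OF X xX]) (simp add: Fint_mono[OF \<psi>T _ \<kappa> \<kappa>'(1)])
      also have "\<dots> = (\<integral>q. slice (foldr ddir (map lift_x vs) (hh \<kappa>' \<psi>)) x q \<partial>lborel)"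
        by (rule Fint_derivs(1)[OF \<psi>T \<kappa>'(2) vs(1) vs(2) xX])
      finally have "norm (foldr ddir vs (Fint \<kappa> \<psi>) x) \<le> (\<integral>q. norm (slice (foldr ddir (map lift_x vs) (hh \<kappa>' \<psi>)) x q) \<partial>lborel)"
        by (simp only: integral_norm_bound)
      also have "\<dots> \<le> (\<integral>q. C * dom_fun K ?m q \<partial>lborel)"
      proof (rule integral_mono')
        show "integrable lborel (\<lambda>q. C * dom_fun K ?m q)" using integrable_dom_fun[OF K(1) \<kappa>'(2)] by simp
        show "norm (slice (foldr ddir (map lift_x vs) (hh \<kappa>' \<psi>)) x q) \<le> C * dom_fun K ?m q" for q by (rule C[OF \<psi> x])
        then show "0 \<le> C * dom_fun K ?m q" for q by (rule order_trans[OF norm_ge_zero])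
      qed
      finally show ?thesis .
    qed
    then show ?thesis by (intro exI[of _ "\<integral>q. C * dom_fun K ?m q \<partial>lborel"] ballI impI) simp
  qed
  show ?thesis by (intro exI[of _ "n + \<kappa>'"] allI impI) (rule *)
qed

end

section \<open>Scaling of test functions and products with a fixed test function\<close>

lemma finite_uniform_bound:
  assumes "finite S" "\<And>s. s \<in> S \<Longrightarrow> \<exists>C::real. \<forall>i\<in>I. f s i \<le> C * r i" "\<And>i. i \<in> I \<Longrightarrow> 0 \<le> r i"
  shows "\<exists>C\<ge>0. \<forall>s\<in>S. \<forall>i\<in>I. f s i \<le> C * r i"
proof -
  have "\<forall>s\<in>S. \<exists>C. \<forall>i\<in>I. f s i \<le> C * r i" using assms(2) by (rule ballI)
  from bchoice[OF this] obtain C where C: "\<forall>s\<in>S. \<forall>i\<in>I. f s i \<le> C s * r i" ..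
  define D where "D = (\<Sum>s\<in>S. \<bar>C s\<bar>)"
  have "f s i \<le> D * r i" if "s \<in> S" "i \<in> I" for s i
  proof -
    have "\<bar>C s\<bar> \<le> D" unfolding D_def using that assms(1) by (intro member_le_sum) auto
    then have "C s * r i \<le> D * r i" using assms(3)[OF that(2)] by (intro mult_right_mono) auto
    then show ?thesis using C that by (auto intro: order_trans)
  qed
  moreover have "D \<ge> 0" by (simp add: D_def sum_nonneg)
  ultimately show ?thesis by blast
qed

lemma mderiv_cmult:
  assumes "\<phi> \<in> test_functions X"
  shows "mderiv unit_vec j (\<lambda>x. c * \<phi> x) x = c * mderiv unit_vec j \<phi> x"
  unfolding mderiv_eq_derivs
  by (rule derivs_bounded_linear[OF bounded_linear_mult_right open_UNIV test_functions_smooth[OF assms] set_mlist_Basis(1) UNIV_I])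

lemma test_functions_on_cmult:
  assumes "\<phi> \<in> test_functions_on X K" "closed K"
  shows "(\<lambda>x. c * \<phi> x) \<in> test_functions_on X K"
proof -
  have \<phi>: "\<phi> \<in> test_functions X" "fun_support \<phi> \<subseteq> K" using assms by (auto simp: test_functions_on_def)
  have "(\<lambda>x. c * \<phi> x) \<in> test_functions_on X (fun_support \<phi>)"
    by (rule test_functionsI)
      (use \<phi> in \<open>auto simp: test_functions_def smooth_on_mult smooth_on_const outside_fun_support\<close>)
  then show ?thesis using \<phi>(2) by (auto simp: test_functions_on_def)
qed

lemma test_functions_cmult: "\<phi> \<in> test_functions X \<Longrightarrow> (\<lambda>x. c * \<phi> x) \<in> test_functions X"
  using test_functions_on_cmult[of \<phi> X UNIV c] by (simp add: test_functions_on_def)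

lemma test_functions_add:
  assumes "\<phi> \<in> test_functions X" "\<psi> \<in> test_functions X"
  shows "(\<lambda>x. \<phi> x + \<psi> x) \<in> test_functions X"
  using test_functions_diff[OF assms(1) test_functions_cmult[OF assms(2), of "- 1"]] by simp

lemma cnorm_cmult:
  assumes "\<phi> \<in> test_functions X"
  shows "cnorm N (\<lambda>x. c * \<phi> x) \<le> norm c * cnorm N \<phi>"
  unfolding cnorm_def sum_distrib_left
proof (rule sum_mono)
  fix j :: "'a multi_index"
  show "(SUP x. norm (mderiv unit_vec j (\<lambda>x. c * \<phi> x) x)) \<le> norm c * (SUP x. norm (mderiv unit_vec j \<phi> x))"
    unfolding mderiv_cmult[OF assms] norm_mult
    by (rule cSUP_least) (auto intro!: mult_left_mono cSUP_upper[OF UNIV_I bdd_above_mderiv[OF assms]])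
qed

lemma smooth_on_open_Un:
  assumes "open S" "open T" "smooth_on S f" "smooth_on T f"
  shows "smooth_on (S \<union> T) f"
  unfolding smooth_on_def
proof (intro allI impI)
  fix vs :: "'a list" assume "set vs \<subseteq> Basis"
  then have "foldr ddir vs f differentiable_on S" "foldr ddir vs f differentiable_on T"
    using assms unfolding smooth_on_def by blast+
  then show "foldr ddir vs f differentiable_on (S \<union> T)"
    using differentiable_on_at[OF assms(1)] differentiable_on_at[OF assms(2)]
    by (intro differentiable_onI) (use assms in auto)
qed

lemma test_function_mult:
  assumes Y: "open Y" and \<eta>: "\<eta> \<in> test_functions Y" and v: "smooth_on Y v"
  shows "(\<lambda>y. \<eta> y * v y) \<in> test_functions_on Y (fun_support \<eta>)"
proof (rule test_functionsI)
  let ?U = "- fun_support \<eta>"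
  have K: "compact (fun_support \<eta>)" "fun_support \<eta> \<subseteq> Y" using \<eta> by (auto simp: test_functions_def)
  have U: "open ?U" unfolding fun_support_def by (intro open_Compl closed_closure)
  have "smooth_on ?U (\<lambda>y. \<eta> y * v y)"
    by (rule smooth_on_cong[OF U _ smooth_on_const[of ?U 0]]) (simp add: outside_fun_support)
  moreover have "smooth_on Y (\<lambda>y. \<eta> y * v y)"
    by (intro smooth_on_mult[OF Y _ v] smooth_on_subset[OF test_functions_smooth[OF \<eta>]]) simp
  ultimately have "smooth_on (Y \<union> ?U) (\<lambda>y. \<eta> y * v y)" by (intro smooth_on_open_Un Y U)
  moreover have "Y \<union> ?U = UNIV" using K by blast
  ultimately show "smooth_on UNIV (\<lambda>y. \<eta> y * v y)" by simp
  show "compact (fun_support \<eta>)" "fun_support \<eta> \<subseteq> Y" by (fact K)+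
qed (simp add: outside_fun_support)

text \<open>The Leibniz rule with a constant independent of \<open>v\<close>: it is the product
  estimate for symbols, with base function 1, applied to the family of all \<open>v\<close> whose
  derivatives are bounded by 1 on the support of \<open>\<eta>\<close>. Division by \<open>B\<close>
  reduces the general case to this family.\<close>

lemma cnorm_mult_le:
  fixes Y :: "(real ^ 'y::finite) set"
  assumes Y: "open Y" and \<eta>: "\<eta> \<in> test_functions Y"
  shows "\<exists>C\<ge>0. \<forall>(v :: real ^ 'y \<Rightarrow> complex) B. smooth_on Y v \<longrightarrow> 0 < B \<longrightarrow>
    (\<forall>vs x. set vs \<subseteq> Basis \<longrightarrow> length vs \<le> N \<longrightarrow> x \<in> fun_support \<eta> \<longrightarrow> norm (foldr ddir vs v x) \<le> B) \<longrightarrow>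
    cnorm N (\<lambda>x. \<eta> x * v x) \<le> C * B"
proof -
  let ?K = "fun_support \<eta>"
  have K: "?K \<subseteq> Y" using \<eta> by (simp add: test_functions_def)
  define I where "I = {v :: real ^ 'y \<Rightarrow> complex. smooth_on Y v \<and> (\<forall>vs x. set vs \<subseteq> Basis \<longrightarrow> length vs \<le> N \<longrightarrow> x \<in> ?K \<longrightarrow> norm (foldr ddir vs v x) \<le> 1)}"
  interpret S: symbol_class Y "{?K}" "\<lambda>_. 1" Basis "\<lambda>_. 0" I
    by standard (use Y K in auto)
  have s\<eta>: "smooth_on Y \<eta>" by (rule smooth_on_subset[OF test_functions_smooth[OF \<eta>]]) simp
  have 1: "S.sy N 0 (\<lambda>v. v)"
    by (rule symb_from_derivs) (auto simp: I_def intro!: exI[of _ 1])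
  have 2: "S.sy N 0 (\<lambda>v. \<eta>)"
  proof (rule symb_from_derivs)
    fix vs :: "(real ^ 'y) list" and L assume "set vs \<subseteq> Basis" "length vs \<le> N"
    then show "\<exists>C. \<forall>i\<in>I. \<forall>p\<in>L. norm (foldr ddir vs \<eta> p) \<le> C * 1 powr (0 + sum_list (map (\<lambda>_. 0) vs))"
      using norm_derivs_le_cnorm[OF \<eta>] by (intro exI[of _ "cnorm N \<eta>"]) simp
  qed
  have "S.sy N (0 + 0) (\<lambda>v p. \<eta> p * v p)"
    by (rule S.symb_mult[OF s\<eta> _ 2 1]) (simp add: I_def)
  note prod = this
  let ?A = "{vs :: (real ^ 'y) list. set vs \<subseteq> Basis \<and> length vs \<le> N}"
  have "\<exists>C\<ge>0. \<forall>vs\<in>?A. \<forall>i\<in>I \<times> UNIV. norm (foldr ddir vs (\<lambda>p. \<eta> p * fst i p) (snd i)) \<le> C * 1"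
  proof (rule finite_uniform_bound)
    show "finite ?A" by (rule finite_lists_length_le[OF finite_Basis])
    fix vs assume vs: "vs \<in> ?A"
    from symb_derivs[OF prod _ _ singletonI, of vs] vs
    obtain C where C: "\<forall>v\<in>I. \<forall>p\<in>?K. norm (foldr ddir vs (\<lambda>p. \<eta> p * v p) p) \<le> C"
      by auto
    have "norm (foldr ddir vs (\<lambda>p. \<eta> p * v p) x) \<le> \<bar>C\<bar> * 1" if v: "v \<in> I" for v x
    proof (cases "x \<in> ?K")
      case True
      then show ?thesis using C v by force
    next
      case False
      have "fun_support (\<lambda>p. \<eta> p * v p) \<subseteq> ?K"
        using test_function_mult[OF Y \<eta>] v by (simp add: I_def test_functions_on_def)
      then have "x \<notin> fun_support (\<lambda>p. \<eta> p * v p)" using False by blast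
      from derivs_outside_fun_support[OF this] show ?thesis by simp
    qed
    then show "\<exists>C. \<forall>i\<in>I \<times> UNIV. norm (foldr ddir vs (\<lambda>p. \<eta> p * fst i p) (snd i)) \<le> C * 1"
      by (intro exI[of _ "\<bar>C\<bar>"]) auto
  qed simp
  then obtain C where C: "C \<ge> 0" "\<And>vs v x. vs \<in> ?A \<Longrightarrow> v \<in> I \<Longrightarrow> norm (foldr ddir vs (\<lambda>p. \<eta> p * v p) x) \<le> C"
    by auto
  let ?M = "real (card {j :: 'y multi_index. order_of j \<le> N})"
  have "cnorm N (\<lambda>x. \<eta> x * v x) \<le> ?M * C * B"
    if v: "smooth_on Y v" and B: "0 < B"
      and b: "\<forall>vs x. set vs \<subseteq> Basis \<longrightarrow> length vs \<le> N \<longrightarrow> x \<in> ?K \<longrightarrow> norm (foldr ddir vs v x) \<le> B" for v B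
  proof -
    define w where "w = (\<lambda>y. complex_of_real (1 / B) * v y)"
    have d: "foldr ddir vs w x = of_real (1 / B) * foldr ddir vs v x" if "set vs \<subseteq> Basis" "x \<in> ?K" for vs x
      unfolding w_def
      by (rule derivs_bounded_linear[OF bounded_linear_mult_right Y v that(1)]) (use that K in auto)
    have "smooth_on Y w" unfolding w_def by (intro smooth_on_mult[OF Y] smooth_on_const v)
    moreover have "norm (foldr ddir vs w x) \<le> 1" if "set vs \<subseteq> Basis" "length vs \<le> N" "x \<in> ?K" for vs x
      unfolding d[OF that(1,3)] using b that B by (simp add: norm_mult norm_divide field_simps)
    ultimately have w: "w \<in> I" by (simp add: I_def)
    have wT: "(\<lambda>x. \<eta> x * w x) \<in> test_functions Y"
      using test_function_mult[OF Y \<eta>] w by (simp add: I_def test_functions_on_def)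
    have "(\<lambda>x. \<eta> x * v x) = (\<lambda>x. complex_of_real B * (\<eta> x * w x))"
      using B by (simp add: w_def fun_eq_iff)
    then have "cnorm N (\<lambda>x. \<eta> x * v x) = cnorm N (\<lambda>x. complex_of_real B * (\<eta> x * w x))" by simp
    also have "\<dots> \<le> norm (complex_of_real B) * cnorm N (\<lambda>x. \<eta> x * w x)" by (rule cnorm_cmult[OF wT])
    also have "\<dots> \<le> norm (complex_of_real B) * (?M * C)"
      by (intro mult_left_mono cnorm_le)
        (simp_all add: mderiv_eq_derivs C(2)[OF _ w] set_mlist_Basis length_mlist)
    also have "\<dots> = ?M * C * B" using B by simp
    finally show ?thesis .
  qed
  then show ?thesis using C(1) by (intro exI[of _ "?M * C"]) auto
qed

text \<open>For normalising by a seminorm that may vanish: one divides by \<open>t + e\<close> and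
  lets \<open>e\<close> tend to 0. The proof uses \<open>e / (C + 1)\<close>, which also covers
  \<open>C = 0\<close>.\<close>

lemma le_mult_by_epsilon:
  fixes C :: real
  assumes "\<And>e. 0 < e \<Longrightarrow> g \<le> C * (t + e)" "0 \<le> C"
  shows "g \<le> C * t"
proof (rule field_le_epsilon)
  fix e :: real assume e: "0 < e"
  have "g \<le> C * (t + e / (C + 1))" using assms e by simp
  also have "\<dots> = C * t + C * e / (C + 1)" by (simp add: distrib_left)
  also have "C * e / (C + 1) \<le> e" using e assms(2) by (simp add: field_simps)
  finally show "g \<le> C * t + e" by simp
qed

context fio_setting
begin

lemma ap_add: "ap (\<lambda>y. \<phi> y + \<psi> y) = (\<lambda>p. ap \<phi> p + ap \<psi> p)"
  by (simp add: ap_def fun_eq_iff distrib_left)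

lemma ap_cmult: "ap (\<lambda>y. c * \<psi> y) = (\<lambda>p. c * ap \<psi> p)"
  by (simp add: ap_def fun_eq_iff)

lemma slice_hh_add:
  assumes "\<phi> \<in> test_functions Y" "\<psi> \<in> test_functions Y" "x \<in> X"
  shows "slice (hh \<kappa> (\<lambda>y. \<phi> y + \<psi> y)) x q = slice (hh \<kappa> \<phi>) x q + slice (hh \<kappa> \<psi>) x q"
proof (cases "q \<in> O'")
  case True
  then have "(x, snd q, fst q) \<in> W" using assms(3) by auto
  from L_iter_add[OF smooth_ap smooth_ap this, OF assms(1,2)[THEN test_functions_smooth]]
  show ?thesis by (simp add: slice_def hh_def ap_add distrib_left scaleR_add_right)
qed (simp add: slice_def)

lemma slice_hh_cmult:
  assumes "\<psi> \<in> test_functions Y" "x \<in> X"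
  shows "slice (hh \<kappa> (\<lambda>y. c * \<psi> y)) x q = c * slice (hh \<kappa> \<psi>) x q"
proof (cases "q \<in> O'")
  case True
  then have "(x, snd q, fst q) \<in> W" using assms(2) by auto
  from L_iter_cmult[OF smooth_ap[OF test_functions_smooth[OF assms(1)]] this]
  show ?thesis by (simp add: slice_def hh_def ap_cmult)
qed (simp add: slice_def)

end

locale fio_setting_kappa = fio_setting X Y \<alpha> \<theta> \<Phi> d \<rho> \<delta> a
  for X :: "(real ^ 'x::finite) set" and Y :: "(real ^ 'y::finite) set"
    and \<alpha> and \<theta> :: "real ^ 'z::finite \<Rightarrow> complex" and \<Phi> d \<rho> \<delta> a +
  fixes \<kappa> :: nat
  assumes \<kappa>: "d - real \<kappa> * min \<rho> (1 - \<delta>) < - real CARD('z)"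
begin

lemma \<kappa>': "d - real \<kappa> * gain < - real CARD('z)"
  using \<kappa> by (simp add: gain_def)

text \<open>Absolute integrability over pairs, from \<open>integrable_hh\<close>, turns the iterated
  integral into a single one; the two set integrals become the indicator in
  \<open>slice\<close>.\<close>

lemma fio_eq:
  assumes \<psi>: "\<psi> \<in> test_functions Y" and x: "x \<in> X"
  shows "fio \<kappa> \<theta> X Y \<Phi> a \<psi> x = 1 / of_real ((2 * pi) ^ CARD('z)) * Fint \<kappa> \<psi> x"
proof -
  have ap: "(\<lambda>(x, y, \<xi>). a (x, y, \<xi>) * \<psi> y) = ap \<psi>" by (auto simp: ap_def)
  have sl: "slice (hh \<kappa> \<psi>) x (\<xi>, y) = indicator \<Xi> \<xi> *\<^sub>R (indicator Y y *\<^sub>R (exp (\<i> * of_real (\<Phi> (x, y, \<xi>))) *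
        (L_op \<theta> \<Phi> ^^ \<kappa>) (\<lambda>(x, y, \<xi>). a (x, y, \<xi>) * \<psi> y) (x, y, \<xi>)))" for \<xi> y
    unfolding ap by (simp add: slice_def hh_def osc_def cphi_def indicator_times)
  have "integrable (lborel \<Otimes>\<^sub>M lborel) (\<lambda>(\<xi>, y). slice (hh \<kappa> \<psi>) x (\<xi>, y))"
    using integrable_hh[OF \<psi> x \<kappa>'] by (simp add: lborel_prod case_prod_beta')
  from lborel_pair.integral_fst'[OF this]
  have "Fint \<kappa> \<psi> x = (\<integral>\<xi>. \<integral>y. slice (hh \<kappa> \<psi>) x (\<xi>, y) \<partial>lborel \<partial>lborel)"
    unfolding Fint_def by (simp add: lborel_prod)
  also have "\<dots> = (LINT \<xi>:\<Xi>|lborel. LINT y:Y|lborel. exp (\<i> * of_real (\<Phi> (x, y, \<xi>))) *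
        (L_op \<theta> \<Phi> ^^ \<kappa>) (\<lambda>(x, y, \<xi>). a (x, y, \<xi>) * \<psi> y) (x, y, \<xi>))"
    unfolding sl set_lebesgue_integral_def integral_scaleR_right ..
  finally show ?thesis using x by (simp add: fio_def)
qed

lemma smooth_fio:
  assumes \<psi>: "\<psi> \<in> test_functions Y"
  shows "fio \<kappa> \<theta> X Y \<Phi> a \<psi> \<in> smooth_functions X"
proof -
  have "smooth_on X (\<lambda>x. 1 / of_real ((2 * pi) ^ CARD('z)) * Fint \<kappa> \<psi> x)"
    by (intro smooth_on_mult[OF X] smooth_on_const smooth_Fint[OF \<psi> \<kappa>'])
  then have "smooth_on X (fio \<kappa> \<theta> X Y \<Phi> a \<psi>)"
    by (rule smooth_on_cong[OF X, rotated]) (simp add: fio_eq[OF \<psi>])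
  then show ?thesis by (simp add: smooth_functions_def fio_def)
qed

lemma fio_add:
  assumes "\<phi> \<in> test_functions Y" "\<psi> \<in> test_functions Y" "x \<in> X"
  shows "fio \<kappa> \<theta> X Y \<Phi> a (\<lambda>y. \<phi> y + \<psi> y) x = fio \<kappa> \<theta> X Y \<Phi> a \<phi> x + fio \<kappa> \<theta> X Y \<Phi> a \<psi> x"
proof -
  have "Fint \<kappa> (\<lambda>y. \<phi> y + \<psi> y) x = Fint \<kappa> \<phi> x + Fint \<kappa> \<psi> x"
    unfolding Fint_def slice_hh_add[OF assms]
    by (rule Bochner_Integration.integral_add) (use integrable_hh[OF _ assms(3) \<kappa>'] assms in blast)+
  then show ?thesis using assms by (simp add: fio_eq test_functions_add distrib_left)
qed

lemma fio_cmult: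
  assumes "\<psi> \<in> test_functions Y" "x \<in> X"
  shows "fio \<kappa> \<theta> X Y \<Phi> a (\<lambda>y. c * \<psi> y) x = c * fio \<kappa> \<theta> X Y \<Phi> a \<psi> x"
  using assms fio_eq[OF test_functions_cmult]
  by (simp add: fio_eq Fint_def slice_hh_cmult)

text \<open>\<open>Fint_bound\<close> gives a constant on the unit ball of \<open>cnorm N\<close>;
  dividing the test function by \<open>cnorm N \<psi> + e\<close> turns this into an estimate
  proportional to the seminorm.\<close>

lemma fio_bound:
  assumes K: "compact K" "K \<subseteq> Y" and Kx: "compact Kx" "Kx \<subseteq> X"
  shows "\<exists>N C. 0 \<le> C \<and> (\<forall>\<psi>\<in>test_functions_on Y K. \<forall>vs x. set vs \<subseteq> Basis \<longrightarrow> length vs \<le> n \<longrightarrow> x \<in> Kx \<longrightarrow>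
    norm (foldr ddir vs (fio \<kappa> \<theta> X Y \<Phi> a \<psi>) x) \<le> C * cnorm N \<psi>)"
proof -
  let ?c = "1 / of_real ((2 * pi) ^ CARD('z)) :: complex"
  let ?F = "fio \<kappa> \<theta> X Y \<Phi> a" and ?A = "{vs :: (real ^ 'x) list. set vs \<subseteq> Basis \<and> length vs \<le> n}"
  from Fint_bound[OF \<kappa>' K, of n] obtain N where "\<forall>vs Kx B. set vs \<subseteq> Basis \<longrightarrow> length vs \<le> n \<longrightarrow> compact Kx \<longrightarrow> Kx \<subseteq> X \<longrightarrow>
      (\<exists>C. \<forall>\<psi>\<in>test_functions_on Y K. cnorm N \<psi> \<le> B \<longrightarrow> (\<forall>x\<in>Kx. norm (foldr ddir vs (Fint \<kappa> \<psi>) x) \<le> C))" ..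
  note N = this[rule_format, OF _ _ Kx]
  let ?I = "{\<psi> \<in> test_functions_on Y K. cnorm N \<psi> \<le> 1} \<times> Kx"
  have "\<exists>C\<ge>0. \<forall>vs\<in>?A. \<forall>i\<in>?I. norm (foldr ddir vs (Fint \<kappa> (fst i)) (snd i)) \<le> C * 1"
  proof (rule finite_uniform_bound)
    show "finite ?A" by (rule finite_lists_length_le[OF finite_Basis])
    show "\<exists>C. \<forall>i\<in>?I. norm (foldr ddir vs (Fint \<kappa> (fst i)) (snd i)) \<le> C * 1" if "vs \<in> ?A" for vs
      using N[of vs 1] that by auto
  qed simp
  then obtain C where C: "0 \<le> C" "\<And>vs \<psi> x. vs \<in> ?A \<Longrightarrow> \<psi> \<in> test_functions_on Y K \<Longrightarrow> cnorm N \<psi> \<le> 1 \<Longrightarrow> x \<in> Kx \<Longrightarrow>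
      norm (foldr ddir vs (Fint \<kappa> \<psi>) x) \<le> C" by auto
  have "norm (foldr ddir vs (?F \<psi>) x) \<le> norm ?c * C * cnorm N \<psi>"
    if \<psi>: "\<psi> \<in> test_functions_on Y K" and vs: "vs \<in> ?A" and x: "x \<in> Kx" for \<psi> vs x
  proof (rule le_mult_by_epsilon)
    fix e :: real assume e: "0 < e"
    have \<psi>T: "\<psi> \<in> test_functions Y" using \<psi> by (simp add: test_functions_on_def)
    have xX: "x \<in> X" and vsB: "set vs \<subseteq> Basis" using x Kx vs by auto
    define t where "t = cnorm N \<psi> + e"
    have t: "0 < t" using cnorm_nonneg[OF \<psi>T, of N] e by (simp add: t_def)
    define \<phi> where "\<phi> = (\<lambda>y. complex_of_real (1 / t) * \<psi> y)"
    have \<phi>: "\<phi> \<in> test_functions_on Y K"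
      unfolding \<phi>_def by (rule test_functions_on_cmult[OF \<psi> compact_imp_closed[OF K(1)]])
    then have \<phi>T: "\<phi> \<in> test_functions Y" by (simp add: test_functions_on_def)
    have "cnorm N \<phi> \<le> norm (complex_of_real (1 / t)) * cnorm N \<psi>"
      unfolding \<phi>_def by (rule cnorm_cmult[OF \<psi>T])
    also have "\<dots> = cnorm N \<psi> / t" using t by (simp add: norm_divide)
    also have "\<dots> \<le> 1" using e t by (simp add: t_def)
    finally have n1: "norm (foldr ddir vs (Fint \<kappa> \<phi>) x) \<le> C" by (rule C(2)[OF vs \<phi> _ x])
    have "?F \<psi> z = (?c * of_real t) * Fint \<kappa> \<phi> z" if "z \<in> X" for z
    proof -
      have "\<psi> = (\<lambda>y. of_real t * \<phi> y)" using t by (simp add: \<phi>_def fun_eq_iff)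
      then have "?F \<psi> z = of_real t * ?F \<phi> z" using fio_cmult[OF \<phi>T that, of "of_real t"] by simp
      then show ?thesis by (simp add: fio_eq[OF \<phi>T that])
    qed
    then have "foldr ddir vs (?F \<psi>) x = foldr ddir vs (\<lambda>z. (?c * of_real t) * Fint \<kappa> \<phi> z) x"
      by (rule derivs_cong[OF X xX])
    also have "\<dots> = (?c * of_real t) * foldr ddir vs (Fint \<kappa> \<phi>) x"
      by (rule derivs_bounded_linear[OF bounded_linear_mult_right X smooth_Fint[OF \<phi>T \<kappa>'] vsB xX])
    finally have "norm (foldr ddir vs (?F \<psi>) x) = norm ?c * t * norm (foldr ddir vs (Fint \<kappa> \<phi>) x)"
      using t by (simp only: norm_mult norm_of_real abs_of_pos)
    also have "\<dots> \<le> norm ?c * t * C" by (intro mult_left_mono n1) (use t in simp)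
    finally show "norm (foldr ddir vs (?F \<psi>) x) \<le> norm ?c * C * (cnorm N \<psi> + e)"
      by (simp only: t_def mult.commute mult.left_commute)
  qed (use C(1) in simp)
  then show ?thesis using C(1) by (intro exI[of _ N] exI[of _ "norm ?c * C"]) auto
qed

end

section \<open>Measurable dependence on the parameter\<close>

context fio_setting_kappa
begin

lemma fio_eq_integral:
  assumes \<psi>: "\<psi> \<in> test_functions Y" and x: "x \<in> X"
  shows "fio \<kappa> \<theta> X Y \<Phi> a \<psi> x = 1 / of_real ((2 * pi) ^ CARD('z)) *
    (\<integral>q. indicator (\<Xi> \<times> Y) q *\<^sub>R (exp (\<i> * of_real (\<Phi> (x, snd q, fst q))) *
        (L_op \<theta> \<Phi> ^^ \<kappa>) (\<lambda>p. a p * \<psi> (fst (snd p))) (x, snd q, fst q)) \<partial>lborel)"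
  unfolding fio_eq[OF \<psi> x] Fint_def slice_def hh_def osc_def cphi_def ap_def ..

lemma continuous_integrand:
  assumes \<psi>: "\<psi> \<in> test_functions Y" and x: "x \<in> X"
  shows "continuous_on (\<Xi> \<times> Y) (\<lambda>q. exp (\<i> * of_real (\<Phi> (x, snd q, fst q))) *
        (L_op \<theta> \<Phi> ^^ \<kappa>) (\<lambda>p. a p * \<psi> (fst (snd p))) (x, snd q, fst q))"
proof -
  have "continuous_on W (hh \<kappa> \<psi>)"
    by (rule smooth_on_continuous_on[OF smooth_hh[OF test_functions_smooth[OF \<psi>]]])
  then have "continuous_on (\<Xi> \<times> Y) (\<lambda>q. hh \<kappa> \<psi> (x, snd q, fst q))"
    by (rule continuous_on_compose2) (use x in \<open>auto intro!: continuous_intros\<close>)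
  then show ?thesis unfolding hh_def osc_def cphi_def ap_def .
qed

end

context
  fixes X :: "(real ^ 'x::finite) set" and Y :: "(real ^ 'y::finite) set" and P :: "'w measure"
    and \<alpha> d \<rho> \<delta> :: real and \<kappa> :: nat and \<theta> :: "real ^ 'z::finite \<Rightarrow> complex"
    and a :: "'w \<Rightarrow> (real ^ 'x) \<times> (real ^ 'y) \<times> (real ^ 'z) \<Rightarrow> complex"
    and \<Phi> :: "'w \<Rightarrow> (real ^ 'x) \<times> (real ^ 'y) \<times> (real ^ 'z) \<Rightarrow> real"
  assumes X: "open X" and Y: "open Y"
    and setting: "\<And>\<omega>. \<omega> \<in> space P \<Longrightarrow> fio_setting_kappa X Y \<alpha> \<theta> (\<Phi> \<omega>) d \<rho> \<delta> (a \<omega>) \<kappa>"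
    and measurable_phase: "\<And>p. p \<in> X \<times> Y \<times> \<Xi> \<Longrightarrow> (\<lambda>\<omega>. \<Phi> \<omega> p) \<in> borel_measurable P"
    and measurable_amplitude: "\<And>p. p \<in> X \<times> Y \<times> \<Xi> \<Longrightarrow> (\<lambda>\<omega>. a \<omega> p) \<in> borel_measurable P"
begin

lemma phase: "\<omega> \<in> space P \<Longrightarrow> phase_setting X Y \<alpha> \<theta> (\<Phi> \<omega>)"
  using setting by (simp add: fio_setting_kappa_def fio_setting_def)

lemma measurable_ddir_phase:
  assumes p: "p \<in> X \<times> Y \<times> \<Xi>"
  shows "(\<lambda>\<omega>. ddir v (\<Phi> \<omega>) p) \<in> borel_measurable P"
  by (rule measurable_ddir[OF open_phase_space[OF X Y] p measurable_phase
    smooth_on_differentiable_at[OF phase_setting.smooth_\<Phi>[OF phase] open_phase_space[OF X Y] p]])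

lemma measurable_L_coeffs:
  assumes p: "p \<in> X \<times> Y \<times> \<Xi>"
  shows "(\<lambda>\<omega>. L_alpha \<theta> (\<Phi> \<omega>) l p) \<in> borel_measurable P" "(\<lambda>\<omega>. L_beta \<theta> (\<Phi> \<omega>) k p) \<in> borel_measurable P"
proof -
  obtain x y \<xi> where xyz: "p = (x, y, \<xi>)" by (cases p)
  have [measurable]: "(\<lambda>\<omega>. ddir v (\<Phi> \<omega>) (x, y, \<xi>)) \<in> borel_measurable P" for v
    using measurable_ddir_phase[OF p] by (simp add: xyz)
  have [measurable]: "(\<lambda>\<omega>. L_denom (\<Phi> \<omega>) (x, y, \<xi>)) \<in> borel_measurable P"
    unfolding L_denom_def prod.case norm_grad_sq by measurable
  show "(\<lambda>\<omega>. L_alpha \<theta> (\<Phi> \<omega>) l p) \<in> borel_measurable P" "(\<lambda>\<omega>. L_beta \<theta> (\<Phi> \<omega>) k p) \<in> borel_measurable P"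
    unfolding L_alpha_def L_beta_def xyz prod.case by measurable
qed

lemma measurable_L_op:
  assumes g: "\<And>p. p \<in> X \<times> Y \<times> \<Xi> \<Longrightarrow> (\<lambda>\<omega>. g \<omega> p) \<in> borel_measurable P"
    and sg: "\<And>\<omega>. \<omega> \<in> space P \<Longrightarrow> smooth_on (X \<times> Y \<times> \<Xi>) (g \<omega>)" and p: "p \<in> X \<times> Y \<times> \<Xi>"
  shows "(\<lambda>\<omega>. L_op \<theta> (\<Phi> \<omega>) (g \<omega>) p) \<in> borel_measurable P"
proof -
  note O = open_phase_space[OF X Y]
  have [measurable]: "(\<lambda>\<omega>. ddir v (\<lambda>z. L_alpha \<theta> (\<Phi> \<omega>) l z * g \<omega> z) p) \<in> borel_measurable P" for v l
    by (rule measurable_ddir[OF O p borel_measurable_times[OF measurable_L_coeffs(1) g]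
      smooth_on_differentiable_at[OF smooth_on_mult[OF O phase_setting.smooth_L_alpha[OF phase] sg] O p]])
  have [measurable]: "(\<lambda>\<omega>. ddir v (\<lambda>z. L_beta \<theta> (\<Phi> \<omega>) k z * g \<omega> z) p) \<in> borel_measurable P" for v k
    by (rule measurable_ddir[OF O p borel_measurable_times[OF measurable_L_coeffs(2) g]
      smooth_on_differentiable_at[OF smooth_on_mult[OF O phase_setting.smooth_L_beta[OF phase] sg] O p]])
  note [measurable] = g[OF p]
  show ?thesis unfolding L_op_apply by measurable
qed

lemma measurable_L_iter:
  assumes g: "\<And>p. p \<in> X \<times> Y \<times> \<Xi> \<Longrightarrow> (\<lambda>\<omega>. g \<omega> p) \<in> borel_measurable P"
    and sg: "\<And>\<omega>. \<omega> \<in> space P \<Longrightarrow> smooth_on (X \<times> Y \<times> \<Xi>) (g \<omega>)" and p: "p \<in> X \<times> Y \<times> \<Xi>"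
  shows "(\<lambda>\<omega>. (L_op \<theta> (\<Phi> \<omega>) ^^ n) (g \<omega>) p) \<in> borel_measurable P"
  using p
proof (induction n arbitrary: p)
  case 0
  then show ?case using g by simp
next
  case (Suc n)
  show ?case unfolding funpow.simps o_apply
    by (rule measurable_L_op[OF Suc.IH phase_setting.smooth_L_iter[OF phase sg] Suc.prems])
qed

lemma measurable_fio:
  assumes \<psi>: "\<psi> \<in> test_functions Y" and x: "x \<in> X"
  shows "(\<lambda>\<omega>. fio \<kappa> \<theta> X Y (\<Phi> \<omega>) (a \<omega>) \<psi> x) \<in> borel_measurable P"
proof -
  let ?g = "\<lambda>\<omega> p. a \<omega> p * \<psi> (fst (snd p))"
  let ?f = "\<lambda>\<omega> q. exp (\<i> * of_real (\<Phi> \<omega> (x, snd q, fst q))) * (L_op \<theta> (\<Phi> \<omega>) ^^ \<kappa>) (?g \<omega>) (x, snd q, fst q)"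
  let ?O = "\<Xi> \<times> Y :: ((real ^ 'z) \<times> (real ^ 'y)) set"
  have sg: "smooth_on (X \<times> Y \<times> \<Xi>) (?g \<omega>)" if "\<omega> \<in> space P" for \<omega>
  proof -
    interpret fio_setting_kappa X Y \<alpha> \<theta> "\<Phi> \<omega>" d \<rho> \<delta> "a \<omega>" \<kappa> by (rule setting[OF that])
    show ?thesis using smooth_ap[OF test_functions_smooth[OF \<psi>]] unfolding ap_def .
  qed
  have gm: "(\<lambda>\<omega>. ?g \<omega> p) \<in> borel_measurable P" if "p \<in> X \<times> Y \<times> \<Xi>" for p
    using measurable_amplitude[OF that] by measurable
  have "(\<lambda>\<omega>. ?f \<omega> q) \<in> borel_measurable P" if "q \<in> ?O" for q
  proof -
    have q: "(x, snd q, fst q) \<in> X \<times> Y \<times> \<Xi>" using that x by auto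
    note [measurable] = measurable_phase[OF q] measurable_L_iter[OF gm sg q]
    show ?thesis by measurable
  qed
  moreover have "continuous_on ?O (?f \<omega>)" if "\<omega> \<in> space P" for \<omega>
    by (rule fio_setting_kappa.continuous_integrand[OF setting[OF that] \<psi> x])
  moreover have "open ?O" using open_phase_space[OF X Y] Y by (intro open_Times) (auto simp: \<Xi>_def)
  ultimately have "(\<lambda>(\<omega>, q). indicator ?O q *\<^sub>R ?f \<omega> q) \<in> borel_measurable (P \<Otimes>\<^sub>M lborel)"
    by (intro measurable_caratheodory)
  from sigma_finite_measure.borel_measurable_lebesgue_integral[OF sigma_finite_lborel this]
  have "(\<lambda>\<omega>. 1 / of_real ((2 * pi) ^ CARD('z)) * (\<integral>q. indicator ?O q *\<^sub>R ?f \<omega> q \<partial>lborel)) \<in> borel_measurable P"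
    by (rule borel_measurable_times[OF borel_measurable_const])
  then show ?thesis
    by (rule measurable_cong[THEN iffD1, rotated])
      (rule fio_setting_kappa.fio_eq_integral[OF setting \<psi> x, symmetric])
qed

end

section \<open>Interchanging the variables\<close>

definition swap3 :: "'a \<times> 'b \<times> 'c \<Rightarrow> 'b \<times> 'a \<times> 'c" where
  "swap3 p = (fst (snd p), fst p, snd (snd p))"

lemma swap3_simps [simp]:
  "swap3 (x, y, z) = (y, x, z)" "swap3 (swap3 p) = p"
  "swap3 p \<in> A \<times> B \<times> C \<longleftrightarrow> p \<in> B \<times> A \<times> C"
  "swap3 (unit_x i) = unit_y i" "swap3 (unit_y j) = unit_x j" "swap3 (unit_xi l) = unit_xi l"
  by (cases p; auto simp: swap3_def unit_x_def unit_y_def unit_xi_def)+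

lemma interchange_eq: "interchange f = (\<lambda>p. f (swap3 p))"
  by (simp add: interchange_def swap3_def case_prod_unfold)

lemma bounded_linear_swap3: "bounded_linear swap3"
  unfolding swap3_def
  by (intro bounded_linear_Pair bounded_linear_compose[OF bounded_linear_fst bounded_linear_snd]
      bounded_linear_compose[OF bounded_linear_snd bounded_linear_snd] bounded_linear_fst)

lemma ddir_interchange: "ddir v (interchange f) = interchange (ddir (swap3 v) f)"
  by (rule ext) (simp add: interchange_eq ddir_def swap3_def)

lemma derivs_interchange: "foldr ddir vs (interchange f) = interchange (foldr ddir (map swap3 vs) f)"
  by (induction vs) (simp_all add: ddir_interchange)

lemma smooth_interchange:
  fixes f :: "(real ^ 'x::finite) \<times> (real ^ 'y::finite) \<times> (real ^ 'z::finite) \<Rightarrow> 'b::real_normed_vector"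
  assumes "smooth_on (X \<times> Y \<times> Z) f" "open X" "open Y" "open Z"
  shows "smooth_on (Y \<times> X \<times> Z) (interchange f)"
proof -
  have "smooth_on (Y \<times> X \<times> Z) (\<lambda>p. f (0 + swap3 p))"
  proof (rule smooth_on_affine_compose[OF bounded_linear_swap3 _ assms(1)])
    fix v :: "(real ^ 'y) \<times> (real ^ 'x) \<times> (real ^ 'z)" assume "v \<in> Basis"
    then have "swap3 v \<in> Basis" by (auto simp: Basis_triple)
    then show "\<exists>r. \<exists>b\<in>Basis. swap3 v = r *\<^sub>R b" by (intro exI[of _ 1] bexI[of _ "swap3 v"]) auto
  qed (use assms in \<open>auto intro!: open_Times simp: swap3_def\<close>)
  then show ?thesis by (simp add: interchange_eq)
qed

text \<open>Interchanging x and y exchanges the two nondegeneracy inequalities, so the transposed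
  operator satisfies the same hypotheses and every result about \<open>fio\<close> applies to
  it.\<close>

lemma interchange_nondeg_phases:
  assumes \<Phi>: "\<Phi> \<in> nondeg_phases \<alpha> X Y" and X: "open X" and Y: "open Y"
  shows "interchange \<Phi> \<in> nondeg_phases \<alpha> Y X"
proof -
  have [simp]: "grad unit_x (interchange \<Phi>) (y, x, \<xi>) = grad unit_y \<Phi> (x, y, \<xi>)"
    "grad unit_y (interchange \<Phi>) (y, x, \<xi>) = grad unit_x \<Phi> (x, y, \<xi>)"
    "grad unit_xi (interchange \<Phi>) (y, x, \<xi>) = grad unit_xi \<Phi> (x, y, \<xi>)" for x y \<xi>
    by (simp_all add: grad_def ddir_interchange) (simp_all add: interchange_eq)
  have "smooth_on (Y \<times> X \<times> \<Xi>) (interchange \<Phi>)"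
    by (rule smooth_interchange[OF _ X Y]) (use \<Phi> in \<open>auto simp: nondeg_phases_def phases_def \<Xi>_def\<close>)
  moreover have "interchange \<Phi> \<in> extensional (Y \<times> X \<times> \<Xi>)"
    using \<Phi> by (auto simp: nondeg_phases_def phases_def extensional_def interchange_eq)
  moreover have "\<forall>y\<in>Y. \<forall>x\<in>X. \<forall>\<xi>\<in>\<Xi>. \<forall>t>0. interchange \<Phi> (y, x, t *\<^sub>R \<xi>) = t * interchange \<Phi> (y, x, \<xi>)"
    using \<Phi> by (simp add: nondeg_phases_def phases_def interchange_eq)
  ultimately show ?thesis using \<Phi> unfolding nondeg_phases_def phases_def by simp
qed

lemma map_swap3_mlist: "map swap3 (mlist e j) = mlist (\<lambda>i. swap3 (e i)) j"
  by (simp add: mlist_def map_concat o_def)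

text \<open>\<open>mderiv3\<close> takes y-derivatives before x-derivatives, so the interchange
  alone produces them in the opposite order; smoothness allows putting them back.\<close>

lemma mderiv3_interchange:
  assumes f: "smooth_on (X \<times> Y \<times> Z) f" "open X" "open Y" "open Z" and p: "x \<in> X" "y \<in> Y" "z \<in> Z"
  shows "mderiv3 j k l (interchange f) (y, x, z) = mderiv3 k j l f (x, y, z)"
proof -
  have "mderiv3 j k l (interchange f) (y, x, z)
      = foldr ddir (mlist unit_y j @ mlist unit_x k @ mlist unit_xi l) f (x, y, z)"
    unfolding mderiv3_eq_derivs derivs_interchange map_append map_swap3_mlist swap3_simps
    unfolding interchange_eq swap3_simps ..
  also have "foldr ddir (mlist unit_y j @ mlist unit_x k @ mlist unit_xi l) f (x, y, z)
      = foldr ddir (mlist unit_x k @ mlist unit_y j @ mlist unit_xi l) f (x, y, z)"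
  proof (rule derivs_perm[OF f(1)])
    show "open (X \<times> Y \<times> Z)" by (intro open_Times f)
    show "set (mlist unit_y j @ mlist unit_x k @ mlist unit_xi l) \<subseteq> Basis"
      unfolding set_append by (intro Un_least set_mlist_Basis)
  qed (use p in simp_all)
  finally show ?thesis unfolding mderiv3_eq_derivs .
qed

lemma interchange_amplitudes:
  fixes X :: "(real ^ 'x::finite) set" and Y :: "(real ^ 'y::finite) set"
    and a :: "(real ^ 'x) \<times> (real ^ 'y) \<times> (real ^ 'z::finite) \<Rightarrow> complex"
  assumes a: "a \<in> amplitudes d \<rho> \<delta> X Y" and X: "open X" and Y: "open Y"
  shows "interchange a \<in> amplitudes d \<rho> \<delta> Y X"
proof -
  obtain b where b: "b \<in> hoermander_class d \<rho> \<delta> X Y" "a = restrict b (X \<times> Y \<times> \<Xi>)"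
    using a unfolding amplitudes_def by blast
  have sb: "smooth_on (X \<times> Y \<times> UNIV) b" using b(1) by (simp add: hoermander_class_def)
  have "interchange b \<in> hoermander_class d \<rho> \<delta> Y X"
    unfolding hoermander_class_def
  proof (intro CollectI conjI allI impI)
    show "interchange b \<in> extensional (Y \<times> X \<times> UNIV)"
      using b(1) by (auto simp: hoermander_class_def extensional_def interchange_eq)
    show "smooth_on (Y \<times> X \<times> UNIV) (interchange b)" by (rule smooth_interchange[OF sb X Y open_UNIV])
    fix j :: "'y multi_index" and k :: "'x multi_index" and l :: "'z multi_index" and K :: "((real ^ 'y) \<times> (real ^ 'x)) set"
    assume K: "compact K" "K \<subseteq> Y \<times> X"
    have "compact (prod.swap ` K)"
      by (rule compact_continuous_image[OF _ K(1)]) (auto simp: prod.swap_def intro!: continuous_intros)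
    moreover have "prod.swap ` K \<subseteq> X \<times> Y" using K(2) by auto
    ultimately obtain C where C: "\<forall>(x, y)\<in>prod.swap ` K. \<forall>\<xi>. norm (mderiv3 k j l b (x, y, \<xi>)) \<le>
          C * japanese \<xi> powr (d - \<rho> * order_of l + \<delta> * (order_of k + order_of j))"
      using b(1) unfolding hoermander_class_def by blast
    have "norm (mderiv3 j k l (interchange b) (y, x, \<xi>)) \<le>
          C * japanese \<xi> powr (d - \<rho> * order_of l + \<delta> * (order_of j + order_of k))" if "(y, x) \<in> K" for x y \<xi>
    proof -
      have "x \<in> X" "y \<in> Y" using that K(2) by auto
      from mderiv3_interchange[OF sb X Y open_UNIV this UNIV_I]
      have "mderiv3 j k l (interchange b) (y, x, \<xi>) = mderiv3 k j l b (x, y, \<xi>)" .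
      then show ?thesis using C that by (force simp: add.commute)
    qed
    then show "\<exists>C. \<forall>(x, y)\<in>K. \<forall>\<xi>. norm (mderiv3 j k l (interchange b) (x, y, \<xi>)) \<le>
          C * japanese \<xi> powr (d - \<rho> * order_of l + \<delta> * (order_of j + order_of k))" by (intro exI[of _ C]) auto
  qed
  moreover have "interchange a = restrict (interchange b) (Y \<times> X \<times> \<Xi>)"
    by (rule ext) (auto simp: b(2) interchange_eq restrict_def)
  ultimately show ?thesis unfolding amplitudes_def by blast
qed

lemma (in fio_setting_kappa) fio_setting_interchange:
  "fio_setting_kappa Y X \<alpha> \<theta> (interchange \<Phi>) d \<rho> \<delta> (interchange a) \<kappa>"
  by unfold_locales
    (use X Y \<alpha> \<theta> \<theta>1 \<theta>2 \<delta> \<rho> \<kappa> interchange_nondeg_phases[OF \<Phi> X Y] interchange_amplitudes[OF a X Y] in auto)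

section \<open>Cutoff functions and the pairing\<close>

context
  fixes \<theta> :: "real ^ 'z::finite \<Rightarrow> complex"
  assumes \<theta>: "\<theta> \<in> test_functions UNIV"
    and \<theta>1: "\<And>\<xi>. norm \<xi> < 1 \<Longrightarrow> \<theta> \<xi> = 1" and \<theta>2: "\<And>\<xi>. norm \<xi> > 2 \<Longrightarrow> \<theta> \<xi> = 0"
begin

text \<open>
  The bump is a product of copies of \<open>\<theta>\<close>, restricted to a line and composed with the coordinates.
\<close>

lemma bump_exists:
  fixes Y :: "(real ^ 'y::finite) set"
  assumes Y: "open Y" and x0: "x0 \<in> Y"
  shows "\<exists>b\<in>test_functions Y. \<exists>e>0. \<forall>y\<in>ball x0 e. b y = 1"
proof -
  obtain r where r: "0 < r" "cball x0 r \<subseteq> Y" using Y x0 open_contains_cball by blast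
  \<comment> \<open>Outside the ball of radius r the coordinate differences add up to more than r,
    so one of them exceeds \<open>r / CARD('y) = 2 / s\<close>, and the corresponding factor of the
    bump has an argument of norm above 2.\<close>
  define s where "s = 2 * real CARD('y) / r"
  have s: "0 < s" using r by (simp add: s_def)
  define w :: "real ^ 'z" where "w = axis undefined 1"
  have w: "norm w = 1" "w \<in> Basis" by (auto simp: w_def)
  have nw: "norm ((s * t) *\<^sub>R w) = s * \<bar>t\<bar>" for t using s w(1) by (simp add: abs_mult)
  define b where "b = (\<lambda>y :: real ^ 'y. \<Prod>i\<in>UNIV. \<theta> ((s * (y $ i - x0 $ i)) *\<^sub>R w))"
  have "b \<in> test_functions_on Y (cball x0 r)"
  proof (rule test_functionsI)
    have "smooth_on UNIV (\<lambda>y. \<theta> ((- s * x0 $ i) *\<^sub>R w + (s * y $ i) *\<^sub>R w))" for i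
    proof (rule smooth_on_affine_compose)
      have "bounded_linear (\<lambda>y :: real ^ 'y. s * y $ i)"
        by (rule bounded_linear_compose[OF bounded_linear_mult_right bounded_linear_vec_nth])
      then show "bounded_linear (\<lambda>y :: real ^ 'y. (s * y $ i) *\<^sub>R w)"
        by (rule bounded_linear_compose[OF bounded_linear_scaleR_left])
      show "\<exists>r. \<exists>b\<in>Basis. (s * v $ i) *\<^sub>R w = r *\<^sub>R b" for v using w(2) by blast
    qed (use test_functions_smooth[OF \<theta>] in auto)
    then show "smooth_on UNIV b"
      unfolding b_def by (intro smooth_on_prod) (simp_all add: algebra_simps)
    show "b y = 0" if "y \<notin> cball x0 r" for y
    proof -
      have "\<exists>i. 2 / s < \<bar>y $ i - x0 $ i\<bar>"
      proof (rule ccontr)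
        assume "\<not> ?thesis"
        then have "\<bar>(y - x0) $ i\<bar> \<le> 2 / s" for i by (simp add: not_less)
        then have "norm (y - x0) \<le> (\<Sum>i\<in>(UNIV :: 'y set). 2 / s)"
          by (intro order_trans[OF norm_le_l1_cart] sum_mono)
        also have "\<dots> = r" using r by (simp add: s_def)
        finally show False using that by (simp add: dist_norm norm_minus_commute)
      qed
      then obtain i where "2 / s < \<bar>y $ i - x0 $ i\<bar>" ..
      then have "2 < norm ((s * (y $ i - x0 $ i)) *\<^sub>R w)" using s unfolding nw by (simp add: field_simps)
      then show ?thesis unfolding b_def by (intro prod_zero) (auto intro!: bexI[of _ i] \<theta>2)
    qed
  qed (use r in auto)
  moreover have "b y = 1" if "y \<in> ball x0 (1 / s)" for y
  proof -
    have "norm ((s * (y $ i - x0 $ i)) *\<^sub>R w) < 1" for i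
    proof -
      have "\<bar>(y - x0) $ i\<bar> \<le> norm (y - x0)" by (rule component_le_norm_cart)
      also have "\<dots> < 1 / s" using that by (simp add: dist_norm norm_minus_commute)
      finally show ?thesis using s unfolding nw by (simp add: field_simps)
    qed
    then show ?thesis unfolding b_def by (intro prod.neutral) (simp add: \<theta>1)
  qed
  ultimately show ?thesis using s by (intro bexI[of _ b] exI[of _ "1 / s"]) (auto simp: test_functions_on_def)
qed

lemma cutoff_exists:
  fixes Y :: "(real ^ 'y::finite) set"
  assumes Y: "open Y" and K: "compact K" "K \<subseteq> Y"
  shows "\<exists>\<eta>. \<eta> \<in> test_functions Y \<and> (\<exists>U. open U \<and> K \<subseteq> U \<and> (\<forall>y\<in>U. \<eta> y = 1))"
proof -
  have "\<forall>x\<in>K. \<exists>b. b \<in> test_functions Y \<and> (\<exists>e>0. \<forall>y\<in>ball x e. b y = 1)" using bump_exists[OF Y] K(2) by blast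
  from bchoice[OF this] obtain b where "\<forall>x\<in>K. b x \<in> test_functions Y \<and> (\<exists>e>0. \<forall>y\<in>ball x e. b x y = 1)" ..
  then have b: "\<And>x. x \<in> K \<Longrightarrow> b x \<in> test_functions Y" and "\<forall>x\<in>K. \<exists>e>0. \<forall>y\<in>ball x e. b x y = 1" by auto
  from bchoice[OF this(2)] obtain e where "\<forall>x\<in>K. 0 < e x \<and> (\<forall>y\<in>ball x (e x). b x y = 1)" ..
  then have e: "\<And>x. x \<in> K \<Longrightarrow> 0 < e x" "\<And>x y. x \<in> K \<Longrightarrow> y \<in> ball x (e x) \<Longrightarrow> b x y = 1" by blast+
  have "K \<subseteq> (\<Union>x\<in>K. ball x (e x))" using e(1) by auto
  then obtain C where C: "C \<subseteq> K" "finite C" "K \<subseteq> (\<Union>x\<in>C. ball x (e x))"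
    by (rule compactE_image[OF K(1), rotated]) auto
  \<comment> \<open>This combination is 1 as soon as a single bump is 1 and 0 off all supports;
    overlaps need no renormalisation.\<close>
  define \<eta> where "\<eta> = (\<lambda>y. 1 - (\<Prod>x\<in>C. 1 - b x y))"
  have "\<eta> \<in> test_functions_on Y (\<Union>x\<in>C. fun_support (b x))"
  proof (rule test_functionsI)
    show "smooth_on UNIV \<eta>"
      unfolding \<eta>_def
      by (intro smooth_on_diff smooth_on_prod smooth_on_const open_UNIV test_functions_smooth[OF b]) (use C in auto)
    show "compact (\<Union>x\<in>C. fun_support (b x))" "(\<Union>x\<in>C. fun_support (b x)) \<subseteq> Y"
      using C b by (auto simp: test_functions_def intro!: compact_UN)
    show "\<eta> y = 0" if "y \<notin> (\<Union>x\<in>C. fun_support (b x))" for y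
      using that by (simp add: \<eta>_def outside_fun_support)
  qed
  moreover have "\<eta> y = 1" if y: "y \<in> (\<Union>x\<in>C. ball x (e x))" for y
  proof -
    obtain x where "x \<in> C" "y \<in> ball x (e x)" using y by blast
    then have "(\<Prod>x\<in>C. 1 - b x y) = 0" using C e(2)[of x y] by (intro prod_zero) auto
    then show ?thesis by (simp add: \<eta>_def)
  qed
  ultimately show ?thesis using C(3)
    by (intro exI[of _ \<eta>] conjI exI[of _ "\<Union>x\<in>C. ball x (e x)"]) (auto simp: test_functions_on_def)
qed

lemma cutoff_test_function:
  fixes Y :: "(real ^ 'y::finite) set"
  assumes "open Y" "compact K" "K \<subseteq> Y"
  shows "cutoff Y K \<in> test_functions Y"
  unfolding cutoff_def using someI_ex[OF cutoff_exists[OF assms]] by blast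

end

locale pairing_setting =
  fixes Y :: "(real ^ 'y::finite) set" and u :: "(real ^ 'y \<Rightarrow> complex) \<Rightarrow> complex"
    and \<theta> :: "real ^ 'z::finite \<Rightarrow> complex"
  assumes open_Y: "open Y" and u: "u \<in> compact_distributions Y"
    and \<theta>: "\<theta> \<in> test_functions UNIV"
    and \<theta>1: "\<And>\<xi>. norm \<xi> < 1 \<Longrightarrow> \<theta> \<xi> = 1" and \<theta>2: "\<And>\<xi>. norm \<xi> > 2 \<Longrightarrow> \<theta> \<xi> = 0"
begin

definition \<eta> :: "real ^ 'y \<Rightarrow> complex" where "\<eta> = cutoff Y (dist_support Y u)"

lemma pairing_eq: "pairing Y u v = u (\<lambda>y. \<eta> y * v y)"
  by (simp add: pairing_def \<eta>_def)

lemma u_distribution: "u \<in> distributions Y"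
  using u by (simp add: compact_distributions_def)

lemma \<eta>: "\<eta> \<in> test_functions Y"
  unfolding \<eta>_def
  by (rule cutoff_test_function[OF \<theta> \<theta>1 \<theta>2 open_Y]) (use u in \<open>auto simp: compact_distributions_def dist_support_def\<close>)

lemma \<eta>_mult: "smooth_on Y v \<Longrightarrow> (\<lambda>y. \<eta> y * v y) \<in> test_functions Y"
  using test_function_mult[OF open_Y \<eta>] by (simp add: test_functions_on_def)

text \<open>The cutoff is supported in \<open>Y\<close>. This is used because linearity of
  \<open>fio\<close> holds only at points of its set, as its values elsewhere are
  \<open>undefined\<close>.\<close>

lemma pairing_cong:
  assumes "\<And>y. y \<in> Y \<Longrightarrow> v y = w y"
  shows "pairing Y u v = pairing Y u w"
proof -
  have "fun_support \<eta> \<subseteq> Y" using \<eta> by (simp add: test_functions_def)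
  then have "(\<lambda>y. \<eta> y * v y) = (\<lambda>y. \<eta> y * w y)" using assms outside_fun_support[of _ \<eta>] by fastforce
  then show ?thesis by (simp only: pairing_eq)
qed

lemma pairing_add:
  assumes "smooth_on Y v" "smooth_on Y w"
  shows "pairing Y u (\<lambda>y. v y + w y) = pairing Y u v + pairing Y u w"
  using u_distribution \<eta>_mult[OF assms(1)] \<eta>_mult[OF assms(2)]
  by (simp add: pairing_eq distrib_left distributions_def)

lemma pairing_cmult:
  assumes "smooth_on Y v"
  shows "pairing Y u (\<lambda>y. c * v y) = c * pairing Y u v"
  using u_distribution \<eta>_mult[OF assms]
  by (simp add: pairing_eq mult.left_commute[of _ c] distributions_def)

lemma pairing_diff:
  assumes "smooth_on Y v" "smooth_on Y w"
  shows "pairing Y u (\<lambda>y. v y - w y) = pairing Y u v - pairing Y u w"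
  using distribution_diff[OF u_distribution \<eta>_mult[OF assms(1)] \<eta>_mult[OF assms(2)]]
  by (simp add: pairing_eq right_diff_distrib)

text \<open>Formulated with an arbitrary positive bound \<open>B\<close> for the derivatives on the
  support of the cutoff. In this form it serves both continuity for the smooth topology and the
  estimate that makes \<open>fio_dist\<close> a distribution.\<close>

lemma pairing_bound:
  "\<exists>N C. 0 \<le> C \<and> (\<forall>v B. smooth_on Y v \<longrightarrow> 0 < B \<longrightarrow>
    (\<forall>vs x. set vs \<subseteq> Basis \<longrightarrow> length vs \<le> N \<longrightarrow> x \<in> fun_support \<eta> \<longrightarrow> norm (foldr ddir vs v x) \<le> B) \<longrightarrow>
    norm (pairing Y u v) \<le> C * B)"
proof -
  have "compact (fun_support \<eta>)" "fun_support \<eta> \<subseteq> Y" using \<eta> by (auto simp: test_functions_def)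
  moreover have "\<forall>K. compact K \<longrightarrow> K \<subseteq> Y \<longrightarrow>
      (\<exists>C N. \<forall>\<phi>\<in>test_functions Y. fun_support \<phi> \<subseteq> K \<longrightarrow> norm (u \<phi>) \<le> C * cnorm N \<phi>)"
    using u_distribution unfolding distributions_def cnorm_def by (elim CollectE conjE)
  ultimately have "\<exists>C N. \<forall>\<phi>\<in>test_functions Y. fun_support \<phi> \<subseteq> fun_support \<eta> \<longrightarrow> norm (u \<phi>) \<le> C * cnorm N \<phi>"
    by simp
  then obtain C N where C: "\<And>\<phi>. \<phi> \<in> test_functions_on Y (fun_support \<eta>) \<Longrightarrow> norm (u \<phi>) \<le> C * cnorm N \<phi>"
    unfolding test_functions_on_def by auto
  from cnorm_mult_le[OF open_Y \<eta>, of N] obtain D where D: "0 \<le> D"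
    "\<forall>v B. smooth_on Y v \<longrightarrow> 0 < B \<longrightarrow>
    (\<forall>vs x. set vs \<subseteq> Basis \<longrightarrow> length vs \<le> N \<longrightarrow> x \<in> fun_support \<eta> \<longrightarrow> norm (foldr ddir vs v x) \<le> B) \<longrightarrow>
    cnorm N (\<lambda>x. \<eta> x * v x) \<le> D * B" by (elim exE conjE) (rule that)
  have "norm (pairing Y u v) \<le> \<bar>C\<bar> * D * B"
    if v: "smooth_on Y v" and "0 < B"
      "\<forall>vs x. set vs \<subseteq> Basis \<longrightarrow> length vs \<le> N \<longrightarrow> x \<in> fun_support \<eta> \<longrightarrow> norm (foldr ddir vs v x) \<le> B" for v B
  proof -
    note le = D(2)[rule_format, OF that(1,2) that(3)[rule_format]]
    have nn: "0 \<le> cnorm N (\<lambda>x. \<eta> x * v x)" by (rule cnorm_nonneg[OF \<eta>_mult[OF v]])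
    have "norm (pairing Y u v) \<le> C * cnorm N (\<lambda>x. \<eta> x * v x)"
      unfolding pairing_eq by (rule C[OF test_function_mult[OF open_Y \<eta> v]])
    also have "\<dots> \<le> \<bar>C\<bar> * cnorm N (\<lambda>x. \<eta> x * v x)" by (rule mult_right_mono[OF abs_ge_self nn])
    also have "\<dots> \<le> \<bar>C\<bar> * (D * B)" by (rule mult_left_mono[OF le]) auto
    finally show ?thesis by simp
  qed
  then show ?thesis using D(1) by (intro exI[of _ N] exI[of _ "\<bar>C\<bar> * D"]) simp
qed

lemma measurable_pairing:
  assumes F: "F \<in> measurable P (borel_of (smooth_topology Y))"
  shows "(\<lambda>\<omega>. pairing Y u (F \<omega>)) \<in> borel_measurable P"
proof (rule measurable_seminorm_functional[OF F[unfolded smooth_topology_def] smooth_seminorm_zero])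
  fix f :: "real ^ 'y \<Rightarrow> complex" and e :: real assume f: "f \<in> smooth_functions Y" and e: "0 < e"
  obtain N C where C: "0 \<le> C" and bound: "\<forall>v B. smooth_on Y v \<longrightarrow> 0 < B \<longrightarrow>
    (\<forall>vs x. set vs \<subseteq> Basis \<longrightarrow> length vs \<le> N \<longrightarrow> x \<in> fun_support \<eta> \<longrightarrow> norm (foldr ddir vs v x) \<le> B) \<longrightarrow>
    norm (pairing Y u v) \<le> C * B"
    using pairing_bound by (elim exE conjE) (rule that)
  have "compact (fun_support \<eta>)" "fun_support \<eta> \<subseteq> Y" using \<eta> by (auto simp: test_functions_def)
  \<comment> \<open>One index has to cover the support of the cutoff and the order \<open>N\<close>;
    then smallness of the seminorm \<open>m\<close> controls all derivatives that the pairing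
    sees.\<close>
  from compact_subset_exhaust[OF open_Y this, of N]
  obtain m where m: "N \<le> m" "1 \<le> m" "fun_support \<eta> \<subseteq> exhaust Y m" by blast
  let ?B = "e / (C + 1)"
  have B: "0 < ?B" "C * ?B < e" using C e by (auto simp: field_simps)
  have "dist (pairing Y u g) (pairing Y u f) < e"
    if g: "g \<in> smooth_functions Y" and gf: "smooth_seminorm Y m (\<lambda>z. g z - f z) < ennreal ?B" for g
  proof -
    have sm: "smooth_on Y g" "smooth_on Y f" using f g by (auto simp: smooth_functions_def)
    have smd: "smooth_on Y (\<lambda>z. g z - f z)" by (rule smooth_on_diff[OF open_Y sm])
    have "norm (foldr ddir vs (\<lambda>z. g z - f z) x) \<le> ?B"
      if "set vs \<subseteq> Basis" "length vs \<le> N" "x \<in> fun_support \<eta>" for vs x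
    proof -
      have x: "x \<in> exhaust Y m" "x \<in> Y" using m(3) that(3) exhaust_subset by blast+
      have "order_of (\<lambda>i. count (mset vs) (unit_vec i)) \<le> m"
        using length_eq_order_of[OF that(1)] that(2) m(1) by simp
      from smooth_seminorm_less[OF gf x(1) this] show ?thesis
        unfolding derivs_eq_mderiv[OF smd open_Y x(2) that(1)] by simp
    qed
    then have "norm (pairing Y u (\<lambda>z. g z - f z)) \<le> C * ?B" by (intro bound[rule_format, OF smd B(1)])
    then show ?thesis using B(2) by (simp add: dist_norm pairing_diff[OF sm])
  qed
  then show "\<exists>m\<ge>1. \<exists>\<delta>>0. \<forall>g\<in>smooth_functions Y. smooth_seminorm Y m (\<lambda>z. g z - f z) < ennreal \<delta> \<longrightarrow>
      dist (pairing Y u g) (pairing Y u f) < e"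
    using m(2) B(1) by blast
qed

end

lemma (in fio_setting_kappa) fio_dist_distribution:
  assumes u: "u \<in> compact_distributions Y"
  shows "fio_dist \<kappa> \<theta> X Y \<Phi> a u \<in> distributions X"
proof -
  interpret T: fio_setting_kappa Y X \<alpha> \<theta> "interchange \<Phi>" d \<rho> \<delta> "interchange a" \<kappa>
    by (rule fio_setting_interchange)
  interpret U: pairing_setting Y u \<theta> by unfold_locales (use Y u \<theta> \<theta>1 \<theta>2 in auto)
  let ?A = "fio \<kappa> \<theta> Y X (interchange \<Phi>) (interchange a)"
  have sA: "smooth_on Y (?A \<phi>)" if "\<phi> \<in> test_functions X" for \<phi>
    using T.smooth_fio[OF that] by (simp add: smooth_functions_def)
  have eq: "fio_dist \<kappa> \<theta> X Y \<Phi> a u \<phi> = pairing Y u (?A \<phi>)" if "\<phi> \<in> test_functions X" for \<phi>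
    using that by (simp add: fio_dist_def fio_transpose_def)
  have "fio_dist \<kappa> \<theta> X Y \<Phi> a u \<in> extensional (test_functions X)" by (simp add: fio_dist_def)
  moreover have "fio_dist \<kappa> \<theta> X Y \<Phi> a u (\<lambda>x. \<phi> x + \<psi> x) = fio_dist \<kappa> \<theta> X Y \<Phi> a u \<phi> + fio_dist \<kappa> \<theta> X Y \<Phi> a u \<psi>"
    if "\<phi> \<in> test_functions X" "\<psi> \<in> test_functions X" for \<phi> \<psi>
    unfolding eq[OF that(1)] eq[OF that(2)] eq[OF test_functions_add[OF that]] U.pairing_add[OF sA sA, OF that, symmetric]
    by (rule U.pairing_cong[OF T.fio_add[OF that]])
  moreover have "fio_dist \<kappa> \<theta> X Y \<Phi> a u (\<lambda>x. c * \<phi> x) = c * fio_dist \<kappa> \<theta> X Y \<Phi> a u \<phi>"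
    if "\<phi> \<in> test_functions X" for c \<phi>
    unfolding eq[OF that] eq[OF test_functions_cmult[OF that]] U.pairing_cmult[OF sA[OF that], symmetric]
    by (rule U.pairing_cong[OF T.fio_cmult[OF that]])
  moreover have "\<exists>C N. \<forall>\<phi>\<in>test_functions X. fun_support \<phi> \<subseteq> K \<longrightarrow>
        norm (fio_dist \<kappa> \<theta> X Y \<Phi> a u \<phi>) \<le> C * cnorm N \<phi>" if K: "compact K" "K \<subseteq> X" for K
  proof -
    obtain N C where C: "0 \<le> C" and bound: "\<forall>v B. smooth_on Y v \<longrightarrow> 0 < B \<longrightarrow>
      (\<forall>vs x. set vs \<subseteq> Basis \<longrightarrow> length vs \<le> N \<longrightarrow> x \<in> fun_support U.\<eta> \<longrightarrow> norm (foldr ddir vs v x) \<le> B) \<longrightarrow>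
      norm (pairing Y u v) \<le> C * B"
      using U.pairing_bound by (elim exE conjE) (rule that)
    have "compact (fun_support U.\<eta>)" "fun_support U.\<eta> \<subseteq> Y" using U.\<eta> by (auto simp: test_functions_def)
    from T.fio_bound[OF K this, of N] obtain M D where D: "0 \<le> D" "\<And>\<phi> vs y. \<phi> \<in> test_functions_on X K \<Longrightarrow>
        set vs \<subseteq> Basis \<Longrightarrow> length vs \<le> N \<Longrightarrow> y \<in> fun_support U.\<eta> \<Longrightarrow> norm (foldr ddir vs (?A \<phi>) y) \<le> D * cnorm M \<phi>"
      by blast
    have "norm (fio_dist \<kappa> \<theta> X Y \<Phi> a u \<phi>) \<le> C * (D * cnorm M \<phi>)"
      if \<phi>: "\<phi> \<in> test_functions X" "fun_support \<phi> \<subseteq> K" for \<phi>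
    \<comment> \<open>\<open>pairing_bound\<close> needs a positive bound, whereas
      \<open>D * cnorm M \<phi>\<close> may be 0; the additional \<open>e\<close> disappears in the
      limit.\<close>
    proof (rule le_mult_by_epsilon[OF _ C])
      fix e :: real assume e: "0 < e"
      have \<phi>K: "\<phi> \<in> test_functions_on X K" using \<phi> by (simp add: test_functions_on_def)
      have p: "0 < D * cnorm M \<phi> + e" using D(1) cnorm_nonneg[OF \<phi>(1), of M] e by (simp add: add_nonneg_pos)
      show "norm (fio_dist \<kappa> \<theta> X Y \<Phi> a u \<phi>) \<le> C * (D * cnorm M \<phi> + e)"
        unfolding eq[OF \<phi>(1)]
        by (rule bound[rule_format, OF sA[OF \<phi>(1)] p]) (use D(2)[OF \<phi>K] e in \<open>force intro: add_increasing2\<close>)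
    qed
    then show ?thesis by (intro exI[of _ "C * D"] exI[of _ M] ballI impI) (simp only: mult.assoc)
  qed
  ultimately show ?thesis unfolding distributions_def cnorm_def by simp
qed

section \<open>Evaluation of amplitudes and phases\<close>

lemma mlist_0: "mlist e (\<lambda>_. 0) = []"
  by (simp add: mlist_def)

lemma mderiv3_0: "mderiv3 (\<lambda>_. 0) (\<lambda>_. 0) (\<lambda>_. 0) f = f"
  by (simp add: mderiv3_eq_derivs mlist_0)

lemma mderiv3_zero: "mderiv3 j k l (\<lambda>_. 0) = (\<lambda>_. 0)"
  unfolding mderiv3_eq_derivs by (rule derivs_zero)

lemma common_exhaust:
  assumes "open X" "open Y" "x \<in> X" "y \<in> Y"
  shows "\<exists>m\<ge>1. x \<in> exhaust X m \<and> y \<in> exhaust Y m"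
proof -
  obtain m n where "1 \<le> m" "x \<in> exhaust X m" "1 \<le> n" "y \<in> exhaust Y n"
    using finite_subset_exhaust[OF assms(1,3)] finite_subset_exhaust[OF assms(2,4)] by auto
  then have "x \<in> exhaust X (max m n)" "y \<in> exhaust Y (max m n)"
    using exhaust_mono[of m "max m n" X] exhaust_mono[of n "max m n" Y] by auto
  then show ?thesis using \<open>1 \<le> m\<close> by (intro exI[of _ "max m n"]) auto
qed

lemma amplitude_seminorm_zero: "amplitude_seminorm d \<rho> \<delta> X Y m (\<lambda>_. 0) = 0"
proof -
  have "amplitude_seminorm d \<rho> \<delta> X Y m (\<lambda>_. 0) \<le> 0"
    unfolding amplitude_seminorm_def mderiv3_zero by (rule Sup_least) auto
  then show ?thesis by simp
qed

lemma phase_seminorm_zero: "phase_seminorm X Y m (\<lambda>_. 0) = 0"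
proof -
  have "phase_seminorm X Y m (\<lambda>_. 0) \<le> 0"
    unfolding phase_seminorm_def mderiv3_zero by (rule Sup_least) auto
  then show ?thesis by simp
qed

lemma amplitude_seminorm_upper:
  assumes "x \<in> exhaust X m" "y \<in> exhaust Y m" "\<xi> \<in> \<Xi>"
  shows "ennreal (japanese \<xi> powr (- d) * norm (a (x, y, \<xi>))) \<le> amplitude_seminorm d \<rho> \<delta> X Y m a"
  unfolding amplitude_seminorm_def
proof (intro Sup_upper CollectI exI conjI)
  show "ennreal (japanese \<xi> powr (- d) * norm (a (x, y, \<xi>)))
      = ennreal (japanese \<xi> powr (- d + \<rho> * order_of (\<lambda>_. 0) - \<delta> * (order_of (\<lambda>_. 0) + order_of (\<lambda>_. 0)))
        * norm (mderiv3 (\<lambda>_. 0) (\<lambda>_. 0) (\<lambda>_. 0) a (x, y, \<xi>)))"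
    by (simp add: mderiv3_0 order_of_def)
qed (use assms in \<open>simp_all add: order_of_def\<close>)

lemma phase_seminorm_upper:
  assumes "x \<in> exhaust X m" "y \<in> exhaust Y m" "\<xi> \<in> \<Xi>"
  shows "ennreal (inverse (norm \<xi>) * \<bar>\<Phi> (x, y, \<xi>)\<bar>) \<le> phase_seminorm X Y m \<Phi>"
  unfolding phase_seminorm_def
proof (intro Sup_upper CollectI exI conjI)
  show "ennreal (inverse (norm \<xi>) * \<bar>\<Phi> (x, y, \<xi>)\<bar>)
      = ennreal (norm \<xi> powi (int (order_of (\<lambda>_. 0)) - 1) * \<bar>mderiv3 (\<lambda>_. 0) (\<lambda>_. 0) (\<lambda>_. 0) \<Phi> (x, y, \<xi>)\<bar>)"
    by (simp add: mderiv3_0 order_of_def)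
qed (use assms in \<open>simp_all add: order_of_def\<close>)

text \<open>A seminorm that dominates a positive multiple of the value at \<open>z\<close> makes the
  evaluation at \<open>z\<close> continuous. For amplitudes and phases the multi-indices 0 provide
  such a bound, with the frequency weight as factor \<open>c\<close>.\<close>

lemma measurable_seminorm_evaluation:
  fixes F :: "'w \<Rightarrow> 'a \<Rightarrow> 'b::real_normed_vector"
  assumes F: "F \<in> measurable P (borel_of (seminorm_topology V p))" and p0: "\<And>m. p m (\<lambda>_. 0) = 0"
    and m: "1 \<le> m" and c: "0 < c" and upper: "\<And>f. ennreal (c * norm (f z)) \<le> p m f"
  shows "(\<lambda>\<omega>. F \<omega> z) \<in> borel_measurable P"
proof (rule measurable_seminorm_functional[OF F p0, where l = "\<lambda>f. f z"])
  fix f :: "'a \<Rightarrow> 'b" and e :: real assume e: "0 < e"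
  have "dist (g z) (f z) < e" if "p m (\<lambda>z. g z - f z) < ennreal (c * e)" for g
  proof -
    have "ennreal (c * norm (g z - f z)) < ennreal (c * e)" using upper[of "\<lambda>z. g z - f z"] that by simp
    then show ?thesis using c by (simp add: ennreal_less_iff dist_norm)
  qed
  then show "\<exists>m\<ge>1. \<exists>\<delta>>0. \<forall>g\<in>V. p m (\<lambda>z. g z - f z) < ennreal \<delta> \<longrightarrow> dist (g z) (f z) < e"
    using m c e by (intro exI[of _ m] conjI exI[of _ "c * e"]) auto
qed

theorem theorem3p13:
  fixes X :: "(real ^ 'x::finite) set" and Y :: "(real ^ 'y::finite) set"
    and \<alpha> d \<rho> \<delta> :: real and \<kappa> :: nat
    and \<theta> :: "real ^ 'z::finite \<Rightarrow> complex"
    and P :: "'w measure"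
    and a :: "'w \<Rightarrow> (real ^ 'x) \<times> (real ^ 'y) \<times> (real ^ 'z) \<Rightarrow> complex"
    and \<Phi> :: "'w \<Rightarrow> (real ^ 'x) \<times> (real ^ 'y) \<times> (real ^ 'z) \<Rightarrow> real"
  assumes "open X" and "open Y"
    and "0 < \<alpha>" and "0 \<le> \<delta>" and "\<delta> < 1" and "0 < \<rho>" and "\<rho> \<le> 1"
    and "\<theta> \<in> test_functions UNIV"
    and "\<And>\<xi>. norm \<xi> < 1 \<Longrightarrow> \<theta> \<xi> = 1" and "\<And>\<xi>. norm \<xi> > 2 \<Longrightarrow> \<theta> \<xi> = 0"
    and "d - real \<kappa> * min \<rho> (1 - \<delta>) < - real CARD('z)"
    and "prob_space P"
    and "a \<in> measurable P (borel_of (amplitude_topology d \<rho> \<delta> X Y))"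
    and "\<Phi> \<in> measurable P (borel_of (nondeg_phase_topology \<alpha> X Y))"
  shows "(\<forall>\<psi>\<in>test_functions Y.
            (\<lambda>\<omega>. fio \<kappa> \<theta> X Y (\<Phi> \<omega>) (a \<omega>) \<psi>) \<in> measurable P (borel_of (smooth_topology X))) \<and>
         (\<forall>u\<in>compact_distributions Y.
            (\<lambda>\<omega>. fio_dist \<kappa> \<theta> X Y (\<Phi> \<omega>) (a \<omega>) u) \<in> measurable P (borel_of (weak_star_topology X)))"
proof -
  \<comment> \<open>Membership in the function classes comes from measurability itself, because the
    underlying space of each Borel algebra is the carrier of the topology.\<close>
  have setting: "fio_setting_kappa X Y \<alpha> \<theta> (\<Phi> \<omega>) d \<rho> \<delta> (a \<omega>) \<kappa>" if "\<omega> \<in> space P" for \<omega>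
  proof -
    have "a \<omega> \<in> amplitudes d \<rho> \<delta> X Y"
      using measurable_space[OF assms(13) that]
      by (simp add: amplitude_topology_def topspace_seminorm_topology amplitude_seminorm_zero)
    moreover have "\<Phi> \<omega> \<in> nondeg_phases \<alpha> X Y"
      using measurable_space[OF assms(14) that] by (simp add: nondeg_phase_topology_def)
    ultimately show ?thesis by unfold_locales (use assms in auto)
  qed
  have ma: "(\<lambda>\<omega>. a \<omega> p) \<in> borel_measurable P" and m\<Phi>: "(\<lambda>\<omega>. \<Phi> \<omega> p) \<in> borel_measurable P" if pW: "p \<in> X \<times> Y \<times> \<Xi>" for p
  proof -
    obtain x y \<xi> where p: "p = (x, y, \<xi>)" "x \<in> X" "y \<in> Y" "\<xi> \<in> \<Xi>" using pW by (cases p) auto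
    obtain m where m: "1 \<le> m" "x \<in> exhaust X m" "y \<in> exhaust Y m"
      using common_exhaust[OF assms(1,2) p(2,3)] by auto
    have "0 < japanese \<xi>" by (simp add: japanese_def add_pos_nonneg)
    then show "(\<lambda>\<omega>. a \<omega> p) \<in> borel_measurable P"
      unfolding p(1)
      by (intro measurable_seminorm_evaluation[OF assms(13)[unfolded amplitude_topology_def] amplitude_seminorm_zero m(1)
          _ amplitude_seminorm_upper[OF m(2,3) p(4)]]) simp
    have "0 < inverse (norm \<xi>)" using p(4) by (simp add: \<Xi>_def)
    moreover have "ennreal (inverse (norm \<xi>) * norm (\<Phi> (x, y, \<xi>))) \<le> phase_seminorm X Y m \<Phi>"
      for \<Phi> :: "(real ^ 'x) \<times> (real ^ 'y) \<times> (real ^ 'z) \<Rightarrow> real"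
      using phase_seminorm_upper[OF m(2,3) p(4)] by simp
    \<comment> \<open>The phase is measurable into a subspace topology, while its evaluations are
      continuous for the full seminorm topology; \<open>measurable_borel_of_subtopology\<close>
      provides the passage.\<close>
    ultimately show "(\<lambda>\<omega>. \<Phi> \<omega> p) \<in> borel_measurable P"
      unfolding p(1)
      by (rule measurable_seminorm_evaluation[OF measurable_borel_of_subtopology[OF assms(14)[unfolded nondeg_phase_topology_def]]
          phase_seminorm_zero m(1)])
  qed
  have fio: "(\<lambda>\<omega>. fio \<kappa> \<theta> X Y (\<Phi> \<omega>) (a \<omega>) \<psi>) \<in> measurable P (borel_of (smooth_topology X))"
    if "\<psi> \<in> test_functions Y" for \<psi>
    by (rule measurable_smooth_topology[OF assms(1) fio_setting_kappa.smooth_fio[OF setting that]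
      measurable_fio[OF assms(1,2) setting m\<Phi> ma that]])
  have fioT: "(\<lambda>\<omega>. fio \<kappa> \<theta> Y X (interchange (\<Phi> \<omega>)) (interchange (a \<omega>)) \<phi>) \<in> measurable P (borel_of (smooth_topology Y))"
    if \<phi>: "\<phi> \<in> test_functions X" for \<phi>
  proof -
    note settingT = fio_setting_kappa.fio_setting_interchange[OF setting]
    have "(\<lambda>\<omega>. interchange (a \<omega>) p) \<in> borel_measurable P" "(\<lambda>\<omega>. interchange (\<Phi> \<omega>) p) \<in> borel_measurable P"
      if "p \<in> Y \<times> X \<times> \<Xi>" for p
      unfolding interchange_eq using that by (auto intro!: ma m\<Phi>)
    then show ?thesis
      by (intro measurable_smooth_topology[OF assms(2) fio_setting_kappa.smooth_fio[OF settingT \<phi>]]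
          measurable_fio[OF assms(2,1) settingT _ _ \<phi>])
  qed
  have "(\<lambda>\<omega>. fio_dist \<kappa> \<theta> X Y (\<Phi> \<omega>) (a \<omega>) u) \<in> measurable P (borel_of (weak_star_topology X))"
    if u: "u \<in> compact_distributions Y" for u
  proof (rule measurable_weak_star_topology[OF assms(1) fio_setting_kappa.fio_dist_distribution[OF setting u]])
    interpret pairing_setting Y u \<theta> by unfold_locales (use assms u in auto)
    show "(\<lambda>\<omega>. fio_dist \<kappa> \<theta> X Y (\<Phi> \<omega>) (a \<omega>) u \<phi>) \<in> borel_measurable P" if \<phi>: "\<phi> \<in> test_functions X" for \<phi>
      using measurable_pairing[OF fioT[OF \<phi>]] \<phi> by (simp add: fio_dist_def fio_transpose_def)
  qed
  with fio show ?thesis by blast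
qed

end
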